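(* Let $R$ be a complete discrete valuation ring with field of fractions $K$, and let $\mathfrak{g}$ be an $R$-Lie algebra which is finite and free as an $R$-module. Put $\mathfrak{g}_K=\mathfrak{g}\otimes_RK$. Then the natural homomorphism $U(\mathfrak{g}_K)\to\hat{U}(\mathfrak{g}_K)$ from the universal enveloping algebra of $\mathfrak{g}_K$ to its Arens–Michael envelope is faithfully flat.
   Context: $\hat{U}(\mathfrak{g}_K)$ denotes the Arens–Michael envelope of $U(\mathfrak{g}_K)$, i.e. the Hausdorff completion of the abstract $K$-algebra $U(\mathfrak{g}_K)$ with respect to the family of all submultiplicative seminorms on $U(\mathfrak{g}_K)$ (seminorms being nonarchimedean $K$-vector space seminorms). *)

theory Defs
  imports Complex_Main "HOL-Algebra.Algebra"
begin

section \<open>Complete discrete valuation rings, fraction fields, absolute values\<close>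

locale discrete_valuation_ring = principal_domain R for R (structure) +
  assumes local: "\<exists>!M. maximalideal M R"
    and not_field: "\<not> field R"

definition adically_complete :: "('r, 'z) ring_scheme \<Rightarrow> 'r set \<Rightarrow> bool" where
  "adically_complete R I \<longleftrightarrow>
     (\<Inter>n. I [^]\<^bsub>ideals_set R\<^esub> (n::nat)) = {\<zero>\<^bsub>R\<^esub>} \<and>
     (\<forall>s \<in> UNIV \<rightarrow> carrier R.
        (\<forall>n::nat. \<exists>N::nat. \<forall>i\<ge>N. \<forall>j\<ge>N. s i \<ominus>\<^bsub>R\<^esub> s j \<in> I [^]\<^bsub>ideals_set R\<^esub> n) \<longrightarrow>
        (\<exists>x \<in> carrier R. \<forall>n::nat. \<exists>N::nat. \<forall>i\<ge>N. s i \<ominus>\<^bsub>R\<^esub> x \<in> I [^]\<^bsub>ideals_set R\<^esub> n))"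

locale complete_discrete_valuation_ring = discrete_valuation_ring +
  assumes complete: "maximalideal M R \<Longrightarrow> adically_complete R M"

locale fraction_field = R?: domain R + K?: field K
  for R (structure) and K (structure) and \<iota> +
  assumes embed_hom: "\<iota> \<in> ring_hom R K"
    and embed_inj: "inj_on \<iota> (carrier R)"
    and fraction: "x \<in> carrier K \<Longrightarrow>
      \<exists>a \<in> carrier R. \<exists>b \<in> carrier R - {\<zero>\<^bsub>R\<^esub>}. x = \<iota> a \<otimes>\<^bsub>K\<^esub> inv\<^bsub>K\<^esub> (\<iota> b)"

locale nonarch_absolute_value = field K
  for K :: "('k, 'z) ring_scheme" (structure) and abs_K :: "'k \<Rightarrow> real" +
  assumes nonneg: "x \<in> carrier K \<Longrightarrow> 0 \<le> abs_K x"
    and eq_zero_iff: "x \<in> carrier K \<Longrightarrow> abs_K x = 0 \<longleftrightarrow> x = \<zero>"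
    and multiplicative:
      "x \<in> carrier K \<Longrightarrow> y \<in> carrier K \<Longrightarrow> abs_K (x \<otimes> y) = abs_K x * abs_K y"
    and ultrametric:
      "x \<in> carrier K \<Longrightarrow> y \<in> carrier K \<Longrightarrow> abs_K (x \<oplus> y) \<le> max (abs_K x) (abs_K y)"

text \<open>
  The absolute values with valuation ring \<open>R\<close> are the functions \<open>x \<mapsto> \<rho> ^ v x\<close> with \<open>0 < \<rho> < 1\<close>,
  where \<open>v\<close> is the discrete valuation of \<open>R\<close>; the choice of \<open>\<rho>\<close> is left open.
\<close>

locale valued_fraction_field =
  fraction_field R K \<iota> + nonarch_absolute_value K abs_K
  for R (structure) and K :: "('k, 'z) ring_scheme" (structure) and \<iota>
    and abs_K :: "'k \<Rightarrow> real" +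
  assumes valuation_ring: "{x \<in> carrier K. abs_K x \<le> 1} = \<iota> ` carrier R"


section \<open>Modules and tensor products over a noncommutative ring\<close>

definition with_smult :: "('b, 'z) ring_scheme \<Rightarrow> ('a \<Rightarrow> 'b \<Rightarrow> 'b) \<Rightarrow> ('a, 'b) module" where
  "with_smult B s = \<lparr>carrier = carrier B, monoid.mult = monoid.mult B, monoid.one = monoid.one B,
                     ring.zero = ring.zero B, ring.add = ring.add B, smult = s\<rparr>"

text \<open>
  As for the library's \<open>module\<close>, the components \<open>mult\<close> and \<open>one\<close> of the record of a module are
  irrelevant.  For a right module \<open>M\<close>, \<open>a \<odot>\<^bsub>M\<^esub> x\<close> stands for \<open>x \<cdot> a\<close>.
\<close>

locale one_sided_module = A?: ring A + M?: abelian_group M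
  for A :: "('a, 'y) ring_scheme" (structure) and M :: "('a, 'm, 'z) module_scheme" (structure) +
  assumes smult_closed: "\<lbrakk>a \<in> carrier A; x \<in> carrier M\<rbrakk> \<Longrightarrow> a \<odot>\<^bsub>M\<^esub> x \<in> carrier M"
    and smult_add_scalar: "\<lbrakk>a \<in> carrier A; b \<in> carrier A; x \<in> carrier M\<rbrakk> \<Longrightarrow>
      (a \<oplus>\<^bsub>A\<^esub> b) \<odot>\<^bsub>M\<^esub> x = a \<odot>\<^bsub>M\<^esub> x \<oplus>\<^bsub>M\<^esub> b \<odot>\<^bsub>M\<^esub> x"
    and smult_add_vector: "\<lbrakk>a \<in> carrier A; x \<in> carrier M; y \<in> carrier M\<rbrakk> \<Longrightarrow>
      a \<odot>\<^bsub>M\<^esub> (x \<oplus>\<^bsub>M\<^esub> y) = a \<odot>\<^bsub>M\<^esub> x \<oplus>\<^bsub>M\<^esub> a \<odot>\<^bsub>M\<^esub> y"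
    and smult_one: "x \<in> carrier M \<Longrightarrow> \<one>\<^bsub>A\<^esub> \<odot>\<^bsub>M\<^esub> x = x"

locale left_module = one_sided_module +
  assumes smult_assoc: "\<lbrakk>a \<in> carrier A; b \<in> carrier A; x \<in> carrier M\<rbrakk> \<Longrightarrow>
    (a \<otimes>\<^bsub>A\<^esub> b) \<odot>\<^bsub>M\<^esub> x = a \<odot>\<^bsub>M\<^esub> (b \<odot>\<^bsub>M\<^esub> x)"

locale right_module = one_sided_module +
  assumes smult_assoc: "\<lbrakk>a \<in> carrier A; b \<in> carrier A; x \<in> carrier M\<rbrakk> \<Longrightarrow>
    (a \<otimes>\<^bsub>A\<^esub> b) \<odot>\<^bsub>M\<^esub> x = b \<odot>\<^bsub>M\<^esub> (a \<odot>\<^bsub>M\<^esub> x)"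

definition linear_maps ::
  "('a, 'y) ring_scheme \<Rightarrow> ('a, 'm) module \<Rightarrow> ('a, 'n) module \<Rightarrow> ('m \<Rightarrow> 'n) set" where
  "linear_maps A M N = {f \<in> carrier M \<rightarrow> carrier N.
     (\<forall>x \<in> carrier M. \<forall>y \<in> carrier M. f (x \<oplus>\<^bsub>M\<^esub> y) = f x \<oplus>\<^bsub>N\<^esub> f y) \<and>
     (\<forall>a \<in> carrier A. \<forall>x \<in> carrier M. f (a \<odot>\<^bsub>M\<^esub> x) = a \<odot>\<^bsub>N\<^esub> f x)}"

definition finite_free :: "('r, 'y) ring_scheme \<Rightarrow> ('r, 'm) module \<Rightarrow> bool" where
  "finite_free R M \<longleftrightarrow> (\<exists>B. finite B \<and> B \<subseteq> carrier M \<and>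
     (\<forall>x \<in> carrier M. \<exists>!c. c \<in> B \<rightarrow>\<^sub>E carrier R \<and> x = (\<Oplus>\<^bsub>M\<^esub>b\<in>B. c b \<odot>\<^bsub>M\<^esub> b)))"

text \<open>
  \<open>M \<otimes>\<^sub>A N\<close> for a right module \<open>M\<close> and a left module \<open>N\<close>: the free abelian group on
  \<open>M \<times> N\<close> modulo the subgroup \<open>tensor_null A M N\<close>.
\<close>

abbreviation free_on_pairs :: "('a, 'm) module \<Rightarrow> ('a, 'n) module \<Rightarrow> ('m \<times> 'n \<Rightarrow>\<^sub>0 int) monoid" where
  "free_on_pairs M N \<equiv> free_Abelian_group (carrier M \<times> carrier N)"

definition tensor_null ::
  "('a, 'y) ring_scheme \<Rightarrow> ('a, 'm) module \<Rightarrow> ('a, 'n) module \<Rightarrow> ('m \<times> 'n \<Rightarrow>\<^sub>0 int) set" where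
  "tensor_null A M N = generate (free_on_pairs M N)
     ({frag_of (x \<oplus>\<^bsub>M\<^esub> x', y) - frag_of (x, y) - frag_of (x', y) | x x' y.
         x \<in> carrier M \<and> x' \<in> carrier M \<and> y \<in> carrier N} \<union>
      {frag_of (x, y \<oplus>\<^bsub>N\<^esub> y') - frag_of (x, y) - frag_of (x, y') | x y y'.
         x \<in> carrier M \<and> y \<in> carrier N \<and> y' \<in> carrier N} \<union>
      {frag_of (a \<odot>\<^bsub>M\<^esub> x, y) - frag_of (x, a \<odot>\<^bsub>N\<^esub> y) | a x y.
         a \<in> carrier A \<and> x \<in> carrier M \<and> y \<in> carrier N})"

definition tensor_product ::
  "('a, 'y) ring_scheme \<Rightarrow> ('a, 'm) module \<Rightarrow> ('a, 'n) module \<Rightarrow>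
   ('m \<times> 'n \<Rightarrow>\<^sub>0 int) set monoid" where
  "tensor_product A M N = free_on_pairs M N Mod tensor_null A M N"

text \<open>\<open>f \<otimes> g : M \<otimes>\<^sub>A N \<rightarrow> M' \<otimes>\<^sub>A N'\<close>, computed on representatives\<close>

definition tensor_map ::
  "('a, 'y) ring_scheme \<Rightarrow> ('a, 'm1) module \<Rightarrow> ('a, 'n1) module \<Rightarrow> ('m \<Rightarrow> 'm1) \<Rightarrow> ('n \<Rightarrow> 'n1) \<Rightarrow>
   ('m \<times> 'n \<Rightarrow>\<^sub>0 int) set \<Rightarrow> ('m1 \<times> 'n1 \<Rightarrow>\<^sub>0 int) set" where
  "tensor_map A M' N' f g C =
     (\<Union>P\<in>C. tensor_null A M' N' #>\<^bsub>free_on_pairs M' N'\<^esub>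
             frag_extend (\<lambda>(x, y). frag_of (f x, g y)) P)"


section \<open>Faithful flatness\<close>

definition exact_at ::
  "('x, 'p) monoid_scheme \<Rightarrow> ('y, 'q) monoid_scheme \<Rightarrow> ('z, 's) monoid_scheme \<Rightarrow>
   ('x \<Rightarrow> 'y) \<Rightarrow> ('y \<Rightarrow> 'z) \<Rightarrow> bool" where
  "exact_at G' G G'' f g \<longleftrightarrow> f ` carrier G' = kernel G G'' g"

text \<open>
  A module is faithfully flat iff a sequence \<open>N' \<rightarrow> N \<rightarrow> N''\<close> is exact precisely when its tensor
  product with the module is exact.  The modules \<open>N', N, N''\<close> range over all modules
  with carrier in the type \<open>'n\<close>.  Any three modules can be realised in one common type, so the full
  notion is obtained by letting \<open>'n\<close> be an arbitrary type variable.
\<close>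

definition faithfully_flat_right ::
  "'n itself \<Rightarrow> ('a, 'y) ring_scheme \<Rightarrow> ('a, 'e) module \<Rightarrow> bool" where
  "faithfully_flat_right (_ :: 'n itself) A E \<longleftrightarrow> right_module A E \<and>
     (\<forall>(N' :: ('a, 'n) module) (N :: ('a, 'n) module) (N'' :: ('a, 'n) module). \<forall>f g.
        left_module A N' \<and> left_module A N \<and> left_module A N'' \<and>
        f \<in> linear_maps A N' N \<and> g \<in> linear_maps A N N'' \<longrightarrow>
        (exact_at (add_monoid N') (add_monoid N) (add_monoid N'') f g \<longleftrightarrow>
         exact_at (tensor_product A E N') (tensor_product A E N) (tensor_product A E N'')
           (tensor_map A E N id f) (tensor_map A E N'' id g)))"

definition faithfully_flat_left ::
  "'n itself \<Rightarrow> ('a, 'y) ring_scheme \<Rightarrow> ('a, 'e) module \<Rightarrow> bool" where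
  "faithfully_flat_left (_ :: 'n itself) A E \<longleftrightarrow> left_module A E \<and>
     (\<forall>(N' :: ('a, 'n) module) (N :: ('a, 'n) module) (N'' :: ('a, 'n) module). \<forall>f g.
        right_module A N' \<and> right_module A N \<and> right_module A N'' \<and>
        f \<in> linear_maps A N' N \<and> g \<in> linear_maps A N N'' \<longrightarrow>
        (exact_at (add_monoid N') (add_monoid N) (add_monoid N'') f g \<longleftrightarrow>
         exact_at (tensor_product A N' E) (tensor_product A N E) (tensor_product A N'' E)
           (tensor_map A N E f id) (tensor_map A N'' E g id)))"

definition faithfully_flat_hom ::
  "'n itself \<Rightarrow> ('a, 'y) ring_scheme \<Rightarrow> ('b, 'z) ring_scheme \<Rightarrow> ('a \<Rightarrow> 'b) \<Rightarrow> bool" where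
  "faithfully_flat_hom T A B h \<longleftrightarrow> ring_hom_ring A B h \<and>
     faithfully_flat_left T A (with_smult B (\<lambda>a x. h a \<otimes>\<^bsub>B\<^esub> x)) \<and>
     faithfully_flat_right T A (with_smult B (\<lambda>a x. x \<otimes>\<^bsub>B\<^esub> h a))"


section \<open>Lie algebras\<close>

text \<open>
  As a nonassociative algebra, a Lie algebra \<open>L\<close> has its bracket in the component \<open>mult\<close>:
  \<open>x \<otimes>\<^bsub>L\<^esub> y\<close> is \<open>[x, y]\<close>.  The component \<open>one\<close> is irrelevant.
\<close>

locale lie_algebra = module R L for R (structure) and L (structure) +
  assumes bracket_closed:
      "\<lbrakk>x \<in> carrier L; y \<in> carrier L\<rbrakk> \<Longrightarrow> x \<otimes>\<^bsub>L\<^esub> y \<in> carrier L"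
    and bracket_add_left: "\<lbrakk>x \<in> carrier L; y \<in> carrier L; z \<in> carrier L\<rbrakk> \<Longrightarrow>
      (x \<oplus>\<^bsub>L\<^esub> y) \<otimes>\<^bsub>L\<^esub> z = x \<otimes>\<^bsub>L\<^esub> z \<oplus>\<^bsub>L\<^esub> y \<otimes>\<^bsub>L\<^esub> z"
    and bracket_add_right: "\<lbrakk>x \<in> carrier L; y \<in> carrier L; z \<in> carrier L\<rbrakk> \<Longrightarrow>
      x \<otimes>\<^bsub>L\<^esub> (y \<oplus>\<^bsub>L\<^esub> z) = x \<otimes>\<^bsub>L\<^esub> y \<oplus>\<^bsub>L\<^esub> x \<otimes>\<^bsub>L\<^esub> z"
    and bracket_smult_left: "\<lbrakk>a \<in> carrier R; x \<in> carrier L; y \<in> carrier L\<rbrakk> \<Longrightarrow>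
      (a \<odot>\<^bsub>L\<^esub> x) \<otimes>\<^bsub>L\<^esub> y = a \<odot>\<^bsub>L\<^esub> (x \<otimes>\<^bsub>L\<^esub> y)"
    and bracket_smult_right: "\<lbrakk>a \<in> carrier R; x \<in> carrier L; y \<in> carrier L\<rbrakk> \<Longrightarrow>
      x \<otimes>\<^bsub>L\<^esub> (a \<odot>\<^bsub>L\<^esub> y) = a \<odot>\<^bsub>L\<^esub> (x \<otimes>\<^bsub>L\<^esub> y)"
    and bracket_self: "x \<in> carrier L \<Longrightarrow> x \<otimes>\<^bsub>L\<^esub> x = \<zero>\<^bsub>L\<^esub>"
    and jacobi: "\<lbrakk>x \<in> carrier L; y \<in> carrier L; z \<in> carrier L\<rbrakk> \<Longrightarrow>
      x \<otimes>\<^bsub>L\<^esub> (y \<otimes>\<^bsub>L\<^esub> z) \<oplus>\<^bsub>L\<^esub> y \<otimes>\<^bsub>L\<^esub> (z \<otimes>\<^bsub>L\<^esub> x) \<oplus>\<^bsub>L\<^esub> z \<otimes>\<^bsub>L\<^esub> (x \<otimes>\<^bsub>L\<^esub> y) = \<zero>\<^bsub>L\<^esub>"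

abbreviation scalars_module ::
  "('k, 'z) ring_scheme \<Rightarrow> ('r \<Rightarrow> 'k) \<Rightarrow> ('r, 'k) module" where
  "scalars_module K \<iota> \<equiv> with_smult K (\<lambda>r x. \<iota> r \<otimes>\<^bsub>K\<^esub> x)"

text \<open>
  \<open>L \<otimes>\<^sub>R K\<close> as a \<open>K\<close>-Lie algebra: \<open>c (x \<otimes> a) = x \<otimes> c a\<close> and
  \<open>[x \<otimes> a, y \<otimes> b] = [x, y] \<otimes> a b\<close>, computed on representatives.
\<close>

definition base_change ::
  "('r, 'y) ring_scheme \<Rightarrow> ('k, 'z) ring_scheme \<Rightarrow> ('r \<Rightarrow> 'k) \<Rightarrow> ('r, 'g) module \<Rightarrow>
   ('k, ('g \<times> 'k \<Rightarrow>\<^sub>0 int) set) module" where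
  "base_change R K \<iota> L =
     (let K' = scalars_module K \<iota>; T = tensor_product R L K' in
      \<lparr>carrier = carrier T,
       monoid.mult = (\<lambda>C D. \<Union>P\<in>C. \<Union>Q\<in>D. tensor_null R L K' #>\<^bsub>free_on_pairs L K'\<^esub>
         frag_extend (\<lambda>(x, a). frag_extend (\<lambda>(y, b). frag_of (x \<otimes>\<^bsub>L\<^esub> y, a \<otimes>\<^bsub>K\<^esub> b)) Q) P),
       monoid.one = monoid.one T,
       ring.zero = monoid.one T,
       ring.add = monoid.mult T,
       smult = (\<lambda>c. tensor_map R L K' id (\<lambda>a. c \<otimes>\<^bsub>K\<^esub> a))\<rparr>)"


section \<open>Tensor algebra and universal enveloping algebra\<close>

text \<open>The free associative \<open>K\<close>-algebra on a set \<open>S\<close>: functions on words with finite support\<close>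

definition free_algebra ::
  "('k, 'z) ring_scheme \<Rightarrow> 's set \<Rightarrow> ('k, 's list \<Rightarrow> 'k) module" where
  "free_algebra K S =
     \<lparr>carrier = {f \<in> UNIV \<rightarrow> carrier K.
                  finite {w. f w \<noteq> \<zero>\<^bsub>K\<^esub>} \<and> {w. f w \<noteq> \<zero>\<^bsub>K\<^esub>} \<subseteq> lists S},
      monoid.mult = (\<lambda>f g w. \<Oplus>\<^bsub>K\<^esub>i\<in>{..length w}. f (take i w) \<otimes>\<^bsub>K\<^esub> g (drop i w)),
      monoid.one = (\<lambda>w. if w = [] then \<one>\<^bsub>K\<^esub> else \<zero>\<^bsub>K\<^esub>),
      ring.zero = (\<lambda>w. \<zero>\<^bsub>K\<^esub>),
      ring.add = (\<lambda>f g w. f w \<oplus>\<^bsub>K\<^esub> g w),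
      smult = (\<lambda>c f w. c \<otimes>\<^bsub>K\<^esub> f w)\<rparr>"

definition free_generator :: "('k, 'z) ring_scheme \<Rightarrow> 's \<Rightarrow> 's list \<Rightarrow> 'k" where
  "free_generator K s = (\<lambda>w. if w = [s] then \<one>\<^bsub>K\<^esub> else \<zero>\<^bsub>K\<^esub>)"

definition quotient_algebra :: "('k, 'a) module \<Rightarrow> 'a set \<Rightarrow> ('k, 'a set) module" where
  "quotient_algebra A I = with_smult (A Quot I) (\<lambda>c C. \<Union>x\<in>C. I +>\<^bsub>A\<^esub> (c \<odot>\<^bsub>A\<^esub> x))"

text \<open>
  The tensor algebra is the free algebra on the set \<open>V\<close> modulo the relations making
  \<open>v \<mapsto> free_generator K v\<close> linear.
\<close>

definition tensor_algebra_ideal ::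
  "('k, 'z) ring_scheme \<Rightarrow> ('k, 'v) module \<Rightarrow> ('v list \<Rightarrow> 'k) set" where
  "tensor_algebra_ideal K V =
     (let F = free_algebra K (carrier V) in
      Idl\<^bsub>F\<^esub>
       ({free_generator K (x \<oplus>\<^bsub>V\<^esub> y) \<ominus>\<^bsub>F\<^esub> (free_generator K x \<oplus>\<^bsub>F\<^esub> free_generator K y) | x y.
           x \<in> carrier V \<and> y \<in> carrier V} \<union>
        {free_generator K (c \<odot>\<^bsub>V\<^esub> x) \<ominus>\<^bsub>F\<^esub> c \<odot>\<^bsub>F\<^esub> free_generator K x | c x.
           c \<in> carrier K \<and> x \<in> carrier V}))"

definition tensor_algebra ::
  "('k, 'z) ring_scheme \<Rightarrow> ('k, 'v) module \<Rightarrow> ('k, ('v list \<Rightarrow> 'k) set) module" where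
  "tensor_algebra K V =
     quotient_algebra (free_algebra K (carrier V)) (tensor_algebra_ideal K V)"

definition tensor_generator ::
  "('k, 'z) ring_scheme \<Rightarrow> ('k, 'v) module \<Rightarrow> 'v \<Rightarrow> ('v list \<Rightarrow> 'k) set" where
  "tensor_generator K V x =
     tensor_algebra_ideal K V +>\<^bsub>free_algebra K (carrier V)\<^esub> free_generator K x"

definition universal_enveloping_algebra ::
  "('k, 'z) ring_scheme \<Rightarrow> ('k, 'v) module \<Rightarrow> ('k, ('v list \<Rightarrow> 'k) set set) module" where
  "universal_enveloping_algebra K L =
     (let T = tensor_algebra K L; t = tensor_generator K L in
      quotient_algebra T
        (Idl\<^bsub>T\<^esub> {(t x \<otimes>\<^bsub>T\<^esub> t y \<ominus>\<^bsub>T\<^esub> t y \<otimes>\<^bsub>T\<^esub> t x) \<ominus>\<^bsub>T\<^esub> t (x \<otimes>\<^bsub>L\<^esub> y) | x y.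
                  x \<in> carrier L \<and> y \<in> carrier L}))"


section \<open>The Arens--Michael envelope\<close>

text \<open>Only the values of a seminorm on the carrier of \<open>A\<close> matter.\<close>

definition submultiplicative_seminorms ::
  "('k, 'z) ring_scheme \<Rightarrow> ('k \<Rightarrow> real) \<Rightarrow> ('k, 'a) module \<Rightarrow> ('a \<Rightarrow> real) set" where
  "submultiplicative_seminorms K abs_K A = {q.
     (\<forall>x \<in> carrier A. 0 \<le> q x) \<and>
     (\<forall>x \<in> carrier A. \<forall>y \<in> carrier A. q (x \<oplus>\<^bsub>A\<^esub> y) \<le> max (q x) (q y)) \<and>
     (\<forall>c \<in> carrier K. \<forall>x \<in> carrier A. q (c \<odot>\<^bsub>A\<^esub> x) = abs_K c * q x) \<and>
     (\<forall>x \<in> carrier A. \<forall>y \<in> carrier A. q (x \<otimes>\<^bsub>A\<^esub> y) \<le> q x * q y)}"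

text \<open>
  The Hausdorff completion of an algebra \<open>A\<close> with respect to a family \<open>Q\<close> of seminorms consists of
  the Cauchy filters on \<open>A\<close>, where two of them are identified if their difference tends to \<open>0\<close>.
\<close>

definition small_difference ::
  "('k, 'a) module \<Rightarrow> ('a \<Rightarrow> real) set \<Rightarrow> 'a filter \<Rightarrow> 'a filter \<Rightarrow> bool" where
  "small_difference A Q F G \<longleftrightarrow>
     (\<forall>q\<in>Q. \<forall>\<epsilon>>0. eventually (\<lambda>(x, y). q (x \<ominus>\<^bsub>A\<^esub> y) < \<epsilon>) (F \<times>\<^sub>F G))"

definition cauchy_filters :: "('k, 'a) module \<Rightarrow> ('a \<Rightarrow> real) set \<Rightarrow> 'a filter set" where
  "cauchy_filters A Q = {F. F \<noteq> bot \<and> F \<le> principal (carrier A) \<and> small_difference A Q F F}"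

definition completion_class ::
  "('k, 'a) module \<Rightarrow> ('a \<Rightarrow> real) set \<Rightarrow> 'a filter \<Rightarrow> 'a filter set" where
  "completion_class A Q F = {G \<in> cauchy_filters A Q. small_difference A Q F G}"

definition completion_map :: "('k, 'a) module \<Rightarrow> ('a \<Rightarrow> real) set \<Rightarrow> 'a \<Rightarrow> 'a filter set" where
  "completion_map A Q x = completion_class A Q (principal {x})"

definition hausdorff_completion ::
  "('k, 'a) module \<Rightarrow> ('a \<Rightarrow> real) set \<Rightarrow> ('k, 'a filter set) module" where
  "hausdorff_completion A Q =
     \<lparr>carrier = completion_class A Q ` cauchy_filters A Q,
      monoid.mult = (\<lambda>C D. \<Union>F\<in>C. \<Union>G\<in>D.
        completion_class A Q (filtermap (\<lambda>(x, y). x \<otimes>\<^bsub>A\<^esub> y) (F \<times>\<^sub>F G))),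
      monoid.one = completion_map A Q \<one>\<^bsub>A\<^esub>,
      ring.zero = completion_map A Q \<zero>\<^bsub>A\<^esub>,
      ring.add = (\<lambda>C D. \<Union>F\<in>C. \<Union>G\<in>D.
        completion_class A Q (filtermap (\<lambda>(x, y). x \<oplus>\<^bsub>A\<^esub> y) (F \<times>\<^sub>F G))),
      smult = (\<lambda>c C. \<Union>F\<in>C. completion_class A Q (filtermap (\<lambda>x. c \<odot>\<^bsub>A\<^esub> x) F))\<rparr>"

definition arens_michael ::
  "('k, 'z) ring_scheme \<Rightarrow> ('k \<Rightarrow> real) \<Rightarrow> ('k, 'a) module \<Rightarrow> ('k, 'a filter set) module" where
  "arens_michael K abs_K A = hausdorff_completion A (submultiplicative_seminorms K abs_K A)"

definition arens_michael_map ::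
  "('k, 'z) ring_scheme \<Rightarrow> ('k \<Rightarrow> real) \<Rightarrow> ('k, 'a) module \<Rightarrow> 'a \<Rightarrow> 'a filter set" where
  "arens_michael_map K abs_K A = completion_map A (submultiplicative_seminorms K abs_K A)"

end

theory Submission
  imports Defs "HOL-Computational_Algebra.Polynomial" "HOL-Library.Multiset"
begin

text \<open>
  Let \<open>U\<close> be the universal enveloping algebra of \<open>\<gg> \<otimes>\<^sub>R K\<close>. An \<open>R\<close>-basis of \<open>\<gg>\<close> gives generators
  \<open>x 0, ..., x (d - 1)\<close> of \<open>U\<close> whose commutators are \<open>K\<close>-linear combinations of the generators, and
  \<open>U\<close> is spanned over \<open>K\<close> by the words in them. The locale \<open>commutator_algebra\<close> records exactly
  this, and the flatness argument is carried out there.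

  \<^emph>\<open>Topology.\<close> Give the letter \<open>k\<close> the weight \<open>B ^ Suc d + B ^ Suc k\<close>. For \<open>R \<ge> 1\<close>, taking the
  infimum of \<open>max \<bar>c\<bar> * R ^ weight\<close> over all ways of writing an element as a combination of words
  defines a submultiplicative seminorm, and every submultiplicative seminorm is dominated by a
  multiple of one of these. Hence \<open>R \<rightarrow> \<infinity>\<close> along the integers defines the topology of the
  Arens--Michael envelope \<open>\<AA>\<close>, and the elements of \<open>\<AA>\<close> are the classes of Cauchy sequences modulo
  null sequences.

  \<^emph>\<open>Division.\<close> Let \<open>J\<close> be a submodule of a free module \<open>U\<^sup>p\<close>. Order the words by their weight, read
  as a polynomial in \<open>B\<close>; two words have the same weight polynomial only if they are permutations of
  each other, and then they differ by words of smaller weight. By Dickson's lemma \<open>J\<close> has a finite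
  Groebner basis for this order. It involves finitely many inequalities between polynomials in \<open>B\<close>;
  these hold for the values at one large \<open>B\<close>, and then, for every sufficiently large \<open>R\<close>, no term of
  a basis element has a larger norm than its leading monomial, and the same is true for commutators.
  So one and the same division algorithm writes an element of \<open>J\<close> of norm at most \<open>\<rho>\<close> with quotients
  of norm at most \<open>\<rho>\<close> (\<open>groebner_division\<close>), for all large \<open>R\<close> with the same basis. Two things
  follow. A null sequence in \<open>J\<close> is a combination of the basis with null sequences as coefficients
  (\<open>null_generators_exist\<close>). And if the first basis vector \<open>e\<close> is not in \<open>J\<close>, then no element of \<open>J\<close>
  has distance less than \<open>1\<close> from \<open>e\<close>, because the division algorithm would otherwise produce a
  nonzero multiple of \<open>e\<close> in \<open>J\<close> (\<open>generator_not_close\<close>).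

  \<^emph>\<open>Flatness.\<close> Let \<open>\<Sum>i. b i * u i l = 0\<close> in \<open>\<AA>\<close> with \<open>u i l \<in> U\<close>, and represent the \<open>b i\<close> by Cauchy
  sequences. Their values on the relation form a null sequence in the image of the matrix \<open>u\<close>, so a
  null sequence can be subtracted from the representatives to make them satisfy the relation
  exactly. The differences of consecutive members are then a null sequence of syzygies of \<open>u\<close>, hence
  combinations of finitely many syzygies with null coefficients, and summing up expresses \<open>b\<close>
  through syzygies with coefficients in \<open>\<AA>\<close> (\<open>equational_flatness\<close>). If \<open>1\<close> lies in \<open>\<AA> I\<close> for a left
  ideal \<open>I\<close> of \<open>U\<close>, it is a limit of elements of \<open>I\<close>, so \<open>1 \<in> I\<close> (\<open>faithfulness\<close>).

  \<^emph>\<open>Tensor products.\<close> These two properties of a module imply that tensoring with it preserves and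
  reflects exactness (\<open>faithfully_flat_rightI\<close>), by the description of the vanishing of a tensor in
  \<open>vanishing_tensors\<close>. The statement for the other side is the same statement for the opposite
  algebra, which has the same generators, words up to reversal, null sequences and completion.
\<close>

section \<open>Weights of words and Dickson's lemma\<close>

lemma mono_subseq_nat:
  fixes s :: "nat \<Rightarrow> nat"
  shows "\<exists>r::nat \<Rightarrow> nat. strict_mono r \<and> mono (\<lambda>n. s (r n))"
proof -
  have "\<exists>p\<ge>k. \<forall>y\<ge>k. s p \<le> s y" for k
    using ex_has_least_nat[of "\<lambda>y. y \<ge> k" k s] by auto
  then obtain p where p: "\<And>k. p k \<ge> k" "\<And>k y. y \<ge> k \<Longrightarrow> s (p k) \<le> s y" by metis
  define r where "r = rec_nat (p 0) (\<lambda>_ l. p (Suc l))"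
  have r0: "r 0 = p 0" and rS: "r (Suc n) = p (Suc (r n))" for n by (simp_all add: r_def)
  have lt: "r n < r (Suc n)" for n using p(1)[of "Suc (r n)"] rS[of n] by simp
  have img: "\<exists>k. r n = p k \<and> k \<le> r n" for n by (cases n) (use r0 rS p(1) in auto)
  have "s (r n) \<le> s (r (Suc n))" for n
    using img[of n] p(2) lt[of n] by (metis less_imp_le order.trans)
  then show ?thesis using lt by (intro exI[of _ r] conjI) (auto simp: strict_mono_Suc_iff mono_iff_le_Suc)
qed

lemma mono_subseq_coords:
  fixes g :: "nat \<Rightarrow> nat \<Rightarrow> nat"
  shows "\<exists>r::nat \<Rightarrow> nat. strict_mono r \<and> (\<forall>k<D. mono (\<lambda>n. g (r n) k))"
proof (induction D)
  case 0 show ?case by (intro exI[of _ id] conjI) (auto simp: strict_mono_def)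
next
  case (Suc D)
  then obtain r :: "nat \<Rightarrow> nat" where r: "strict_mono r" "\<forall>k<D. mono (\<lambda>n. g (r n) k)" by blast
  obtain t :: "nat \<Rightarrow> nat" where t: "strict_mono t" "mono (\<lambda>n. g (r (t n)) D)"
    using mono_subseq_nat[of "\<lambda>n. g (r n) D"] by blast
  have "strict_mono (r \<circ> t)" using r(1) t(1) by (simp add: strict_mono_o)
  moreover have "mono (\<lambda>n. g ((r \<circ> t) n) k)" if "k < Suc D" for k
  proof (cases "k = D")
    case False
    then have "mono (\<lambda>n. g (r n) k)" using r(2) that by simp
    then show ?thesis using strict_mono_mono[OF t(1)] by (auto simp: mono_def)
  qed (use t in simp)
  ultimately show ?case by blast
qed

text \<open>
  A word with a position is a point of a lattice of dimension \<open>d + 2\<close>: the multiplicities of the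
  letters, and the position together with its complement in \<open>m\<close>, so that monotonicity in both
  coordinates makes the position constant along a subsequence.
\<close>

lemma dickson:
  fixes w :: "nat \<Rightarrow> nat list" and i :: "nat \<Rightarrow> nat"
  assumes "\<And>n. w n \<in> lists {..<d}" "\<And>n. i n < m"
  shows "\<exists>a b. a < b \<and> mset (w a) \<subseteq># mset (w b) \<and> i a = i b"
proof -
  define g where "g n k = (if k < d then count (mset (w n)) k else if k = d then i n else m - i n)" for n k
  obtain r :: "nat \<Rightarrow> nat" where r: "strict_mono r" "\<forall>k<d+2. mono (\<lambda>n. g (r n) k)"
    using mono_subseq_coords by blast
  have le: "g (r 0) k \<le> g (r 1) k" if "k < d + 2" for k
    using r(2) that by (auto simp: mono_def)
  have "count (mset (w (r 0))) k \<le> count (mset (w (r 1))) k" for k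
  proof (cases "k < d")
    case True then show ?thesis using le[of k] by (simp add: g_def)
  next
    case False
    then have "k \<notin> set (w (r 0))" using assms(1)[of "r 0"] by auto
    then show ?thesis by (metis count_eq_zero_iff set_mset_mset zero_le)
  qed
  moreover have "i (r 0) = i (r 1)"
    using le[of d] le[of "Suc d"] assms(2)[of "r 0"] assms(2)[of "r 1"] by (simp add: g_def)
  moreover have "r 0 < r 1" using r(1) by (simp add: strict_mono_def)
  ultimately show ?thesis by (auto simp: subseteq_mset_def)
qed

text \<open>
  The weight of a letter is a polynomial in a parameter \<open>B\<close>. The common leading term \<open>B ^ Suc d\<close>
  makes longer words heavier than all shorter ones; the powers \<open>B ^ Suc k\<close> separate the letters. The
  constant term of a weight is left free for the position of a basis vector in a free module.
\<close>

definition letter_poly :: "nat \<Rightarrow> nat \<Rightarrow> real poly" where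
  "letter_poly d k = Polynomial.monom 1 (Suc d) + Polynomial.monom 1 (Suc k)"

definition wpoly :: "nat \<Rightarrow> nat list \<Rightarrow> nat \<Rightarrow> real poly" where
  "wpoly d w i = sum_list (map (letter_poly d) w) + [:real i:]"

text \<open>
  The value of the weight polynomial at \<open>B\<close>, as a natural number, so that it can serve as an
  exponent.
\<close>

definition wt :: "nat \<Rightarrow> nat \<Rightarrow> nat list \<Rightarrow> nat \<Rightarrow> nat" where
  "wt d B w i = sum_list (map (\<lambda>k. B ^ Suc d + B ^ Suc k) w) + i"

lemma poly_wpoly: "poly (wpoly d w i) (real B) = real (wt d B w i)"
  by (induction w) (auto simp: wpoly_def wt_def letter_poly_def poly_monom)

lemma wpoly_Cons: "wpoly d (k # w) i = letter_poly d k + wpoly d w i"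
  by (simp add: wpoly_def)

lemma wpoly_append: "wpoly d (u @ w) i = wpoly d u 0 + wpoly d w i"
  by (simp add: wpoly_def)

lemma wt_Cons: "wt d B (k # w) i = (B ^ Suc d + B ^ Suc k) + wt d B w i"
  by (simp add: wt_def)

lemma wt_append: "wt d B (u @ w) i = wt d B u 0 + wt d B w i"
  by (simp add: wt_def)

lemma wpoly_cong: "mset w = mset w' \<Longrightarrow> wpoly d w i = wpoly d w' i"
  by (metis mset_map sum_mset_sum_list wpoly_def)

lemma wt_cong: "mset w = mset w' \<Longrightarrow> wt d B w i = wt d B w' i"
  unfolding wt_def by (metis (no_types) mset_map sum_mset_sum_list)

lemma coeff_wpoly_0: "Polynomial.coeff (wpoly d w i) 0 = real i"
  by (induction w) (auto simp: wpoly_def letter_poly_def)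

lemma coeff_wpoly_Suc: "k < d \<Longrightarrow> Polynomial.coeff (wpoly d w i) (Suc k) = real (count (mset w) k)"
  by (induction w) (auto simp: wpoly_def letter_poly_def)

lemma coeff_wpoly_top: "w \<in> lists {..<d} \<Longrightarrow> Polynomial.coeff (wpoly d w i) (Suc d) = real (length w)"
  by (induction w) (auto simp: wpoly_def letter_poly_def)

lemma degree_wpoly: "w \<in> lists {..<d} \<Longrightarrow> Polynomial.degree (wpoly d w i) \<le> Suc d"
  by (induction w) (auto simp: wpoly_def letter_poly_def add.assoc intro!: degree_add_le degree_monom_le[THEN order.trans])

lemma wpoly_inj:
  assumes "w \<in> lists {..<d}" "w' \<in> lists {..<d}" "wpoly d w i = wpoly d w' i'"
  shows "mset w = mset w' \<and> i = i'"
proof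
  show "i = i'" using coeff_wpoly_0[of d w i] coeff_wpoly_0[of d w' i'] assms(3) by simp
  show "mset w = mset w'"
  proof (rule multiset_eqI)
    fix k show "count (mset w) k = count (mset w') k"
    proof (cases "k < d")
      case True then show ?thesis
        using coeff_wpoly_Suc[of k d w i] coeff_wpoly_Suc[of k d w' i'] assms(3) by simp
    next
      case False
      then have "k \<notin> set w" "k \<notin> set w'" using assms(1,2) by auto
      then show ?thesis by (metis count_eq_zero_iff set_mset_mset)
    qed
  qed
qed

text \<open>
  A linear combination of letters has smaller weight than any product of two letters. This is why
  rewriting \<open>x i * x j\<close> as \<open>x j * x i\<close> plus the commutator lowers the weight of the error.
\<close>

lemma wpoly_less_length:
  assumes "w \<in> lists {..<d}" "w' \<in> lists {..<d}" "length w < length w'"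
  shows "wpoly d w i < wpoly d w' i'"
proof -
  let ?p = "wpoly d w' i' - wpoly d w i"
  have c: "Polynomial.coeff ?p (Suc d) > 0" using assms by (simp add: coeff_wpoly_top)
  have "Polynomial.degree ?p \<le> Suc d" using assms by (intro degree_diff_le degree_wpoly)
  moreover have "Suc d \<le> Polynomial.degree ?p" using c by (intro le_degree) simp
  ultimately have "Polynomial.degree ?p = Suc d" by simp
  then show ?thesis using c by (simp add: less_poly_def pos_poly_def)
qed

lemma letter_poly_pos: "0 < letter_poly d k"
proof -
  have "pos_poly (Polynomial.monom (1::real) n)" for n by (simp add: pos_poly_def degree_monom_eq)
  then show ?thesis by (simp add: letter_poly_def less_poly_def pos_poly_add)
qed

lemma wpoly_nonneg: "0 \<le> wpoly d w 0"
  by (induction w) (auto simp: wpoly_def intro: add_nonneg_nonneg less_imp_le[OF letter_poly_pos])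

lemma mset_subset_word:
  assumes "mset w \<subseteq># mset w'" shows "\<exists>u. mset w' = mset (u @ w) \<and> set u \<subseteq> set w'"
proof -
  obtain u where u: "mset u = mset w' - mset w" using ex_mset by blast
  then have "mset w' = mset (u @ w)" using assms by simp
  then show ?thesis by (metis set_mset_mset set_append Un_upper1)
qed

lemma wpoly_mono:
  assumes "mset w \<subseteq># mset w'" shows "wpoly d w i \<le> wpoly d w' i"
proof -
  obtain u where "mset w' = mset (u @ w)" using mset_subset_word[OF assms] by blast
  then have "wpoly d w' i = wpoly d u 0 + wpoly d w i" using wpoly_cong wpoly_append by metis
  then show ?thesis using wpoly_nonneg[of d u] by simp
qed

text \<open>
  Polynomials are ordered by their values at large arguments, so finitely many comparisons of weight
  polynomials can be realised by comparing numbers at one value of \<open>B\<close>.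
\<close>

lemma eventually_poly_less:
  fixes p q :: "real poly"
  assumes "p < q" shows "\<forall>\<^sub>F B in sequentially. poly p (real B) < poly q (real B)"
proof -
  have "pos_poly (q - p)" using assms by (simp add: less_poly_def)
  then have pos: "0 < Polynomial.lead_coeff (q - p)" by (simp add: pos_poly_def)
  then obtain n where n: "\<And>x. x \<ge> n \<Longrightarrow> poly (q - p) x \<ge> Polynomial.lead_coeff (q - p)"
    using poly_pinfty_gt_lc by blast
  have "poly p (real B) < poly q (real B)" if "B \<ge> nat \<lceil>n\<rceil>" for B
    using n[of "real B"] that pos by (simp add: nat_ceiling_le_eq)
  then show ?thesis unfolding eventually_sequentially by blast
qed

lemma eventually_wt_less:
  "wpoly d w i < wpoly d w' i' \<Longrightarrow> \<forall>\<^sub>F B in sequentially. wt d B w i < wt d B w' i'"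
  by (drule eventually_poly_less) (simp add: poly_wpoly)

text \<open>
  By Dickson's lemma an infinite descending chain contains a word that divides a later one up to the
  order of the letters, and a divisor is not heavier.
\<close>

lemma wpoly_wf:
  assumes "\<And>n. w n \<in> lists {..<d}" "\<And>n. i n < m" "\<And>n. wpoly d (w (Suc n)) (i (Suc n)) < wpoly d (w n) (i n)"
  shows False
proof -
  obtain a b where ab: "a < b" "mset (w a) \<subseteq># mset (w b)" "i a = i b" using dickson[of w d i m] assms(1,2) by blast
  have "wpoly d (w b) (i b) < wpoly d (w a) (i a)"
    by (rule lift_Suc_mono_less[where f = "\<lambda>n. - wpoly d (w n) (i n)", simplified, OF _ ab(1)]) (use assms(3) in auto)
  then show False using wpoly_mono[OF ab(2), of d "i b"] ab(3) by simp
qed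

lemma wf_wpoly:
  "wf {((w, i), (w', i')). w \<in> lists {..<d} \<and> w' \<in> lists {..<d} \<and> i < m \<and> i' < m \<and> wpoly d w i < wpoly d w' i'}"
proof (subst wf_iff_no_infinite_down_chain, safe)
  fix f assume f: "\<forall>n. (f (Suc n), f n) \<in> {((w, i), (w', i')). w \<in> lists {..<d} \<and> w' \<in> lists {..<d} \<and> i < m \<and> i' < m \<and> wpoly d w i < wpoly d w' i'}"
  show False
    by (rule wpoly_wf[of "\<lambda>n. fst (f n)" d "\<lambda>n. snd (f n)" m]) (use f in \<open>auto simp: split_beta\<close>)
qed

section \<open>Additive spans and additive maps\<close>

text \<open>
  The subgroup generated by a set. Scalars are kept in the generators, where bounds on their
  absolute values can be imposed.
\<close>

inductive_set add_span :: "('a, 'z) ring_scheme \<Rightarrow> 'a set \<Rightarrow> 'a set"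
  for G :: "('a, 'z) ring_scheme" and S :: "'a set" where
  zero: "\<zero>\<^bsub>G\<^esub> \<in> add_span G S"
| incl: "s \<in> S \<Longrightarrow> s \<in> add_span G S"
| add: "a \<in> add_span G S \<Longrightarrow> b \<in> add_span G S \<Longrightarrow> a \<oplus>\<^bsub>G\<^esub> b \<in> add_span G S"
| neg: "a \<in> add_span G S \<Longrightarrow> \<ominus>\<^bsub>G\<^esub> a \<in> add_span G S"

lemma add_span_subset:
  assumes "S \<subseteq> add_span G T" shows "add_span G S \<subseteq> add_span G T"
proof
  fix a assume "a \<in> add_span G S" then show "a \<in> add_span G T"
    by induction (use assms in \<open>auto intro: add_span.intros\<close>)
qed

lemma add_span_mono: "S \<subseteq> T \<Longrightarrow> add_span G S \<subseteq> add_span G T"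
  by (intro add_span_subset) (auto intro: add_span.incl)

lemma add_span_diff: "a \<in> add_span G S \<Longrightarrow> b \<in> add_span G S \<Longrightarrow> a \<ominus>\<^bsub>G\<^esub> b \<in> add_span G S"
  by (simp add: a_minus_def add_span.intros)

context abelian_group
begin

lemma add_span_closed: "S \<subseteq> carrier G \<Longrightarrow> a \<in> add_span G S \<Longrightarrow> a \<in> carrier G"
  by (erule add_span.induct) auto

lemma diff_chain: "p \<in> carrier G \<Longrightarrow> q \<in> carrier G \<Longrightarrow> r \<in> carrier G \<Longrightarrow> (p \<ominus> q) \<oplus> (q \<ominus> r) = p \<ominus> r"
  by (simp add: minus_eq a_assoc r_neg1)

lemma diff_add_cancel: "p \<in> carrier G \<Longrightarrow> q \<in> carrier G \<Longrightarrow> (p \<ominus> q) \<oplus> q = p"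
  by (simp add: minus_eq a_assoc l_neg)

lemma diff_zero: "p \<in> carrier G \<Longrightarrow> p \<ominus> \<zero> = p"
  by (simp add: minus_eq)

lemma minus_diff: "p \<in> carrier G \<Longrightarrow> q \<in> carrier G \<Longrightarrow> \<ominus> (p \<ominus> q) = q \<ominus> p"
  by (simp add: minus_eq minus_add a_comm)

lemma diff_eq_zero: "p \<in> carrier G \<Longrightarrow> q \<in> carrier G \<Longrightarrow> p \<ominus> q = \<zero> \<Longrightarrow> p = q"
  by (metis diff_add_cancel l_zero)

lemma add_diff_add: "\<lbrakk>a \<in> carrier G; b \<in> carrier G; c \<in> carrier G; e \<in> carrier G\<rbrakk> \<Longrightarrow>
   (a \<oplus> b) \<ominus> (c \<oplus> e) = (a \<ominus> c) \<oplus> (b \<ominus> e)"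
  by (simp add: minus_eq minus_add a_ac)

end

text \<open>
  Proved without a bundled homomorphism so that it can be applied to partial applications such as
  \<open>\<lambda>v. a \<odot> v\<close> and to maps into other record types.
\<close>

lemma additive_map_facts:
  assumes "abelian_group M" "abelian_group M'" "f \<in> carrier M \<rightarrow> carrier M'"
    and "\<And>a b. a \<in> carrier M \<Longrightarrow> b \<in> carrier M \<Longrightarrow> f (a \<oplus>\<^bsub>M\<^esub> b) = f a \<oplus>\<^bsub>M'\<^esub> f b"
  shows "f \<zero>\<^bsub>M\<^esub> = \<zero>\<^bsub>M'\<^esub>" "a \<in> carrier M \<Longrightarrow> f (\<ominus>\<^bsub>M\<^esub> a) = \<ominus>\<^bsub>M'\<^esub> f a"
    "a \<in> carrier M \<Longrightarrow> b \<in> carrier M \<Longrightarrow> f (a \<ominus>\<^bsub>M\<^esub> b) = f a \<ominus>\<^bsub>M'\<^esub> f b"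
proof -
  interpret M: abelian_group M by fact
  interpret M': abelian_group M' by fact
  interpret h: group_hom "add_monoid M" "add_monoid M'" f
    using assms by (auto simp: group_hom_def group_hom_axioms_def hom_def M.a_group M'.a_group)
  show z: "f \<zero>\<^bsub>M\<^esub> = \<zero>\<^bsub>M'\<^esub>" using h.hom_one by simp
  show n: "f (\<ominus>\<^bsub>M\<^esub> a) = \<ominus>\<^bsub>M'\<^esub> f a" if "a \<in> carrier M" for a
    using h.hom_inv[of a] that by (simp add: a_inv_def)
  show "a \<in> carrier M \<Longrightarrow> b \<in> carrier M \<Longrightarrow> f (a \<ominus>\<^bsub>M\<^esub> b) = f a \<ominus>\<^bsub>M'\<^esub> f b"
    by (simp add: a_minus_def assms(4) n)
qed

lemma additive_map_finsum:
  assumes "abelian_group M" "abelian_group M'" "f \<in> carrier M \<rightarrow> carrier M'"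
    and "\<And>a b. a \<in> carrier M \<Longrightarrow> b \<in> carrier M \<Longrightarrow> f (a \<oplus>\<^bsub>M\<^esub> b) = f a \<oplus>\<^bsub>M'\<^esub> f b"
    and "finite S" "\<And>i. i \<in> S \<Longrightarrow> g i \<in> carrier M"
  shows "f (\<Oplus>\<^bsub>M\<^esub>i\<in>S. g i) = (\<Oplus>\<^bsub>M'\<^esub>i\<in>S. f (g i))"
  using assms(5,6)
proof (induction S rule: finite_induct)
  interpret M: abelian_group M by fact
  interpret M': abelian_group M' by fact
  case empty then show ?case using additive_map_facts(1)[OF assms(1-4)] by simp
next
  interpret M: abelian_group M by fact
  interpret M': abelian_group M' by fact
  case (insert a S)
  then show ?case using assms(3,4) by (simp add: Pi_iff M.finsum_closed)
qed

lemma (in abelian_group) finsum_minus: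
  assumes "finite S" "\<And>i. i \<in> S \<Longrightarrow> f i \<in> carrier G"
  shows "(\<Oplus>i\<in>S. \<ominus> f i) = \<ominus> (\<Oplus>i\<in>S. f i)"
  using additive_map_finsum[of G G "\<lambda>a. \<ominus> a" S f] assms abelian_group_axioms by (simp add: minus_add)

lemma add_span_image:
  assumes "abelian_group M" "abelian_group M'" "f \<in> carrier M \<rightarrow> carrier M'"
    and "\<And>a b. a \<in> carrier M \<Longrightarrow> b \<in> carrier M \<Longrightarrow> f (a \<oplus>\<^bsub>M\<^esub> b) = f a \<oplus>\<^bsub>M'\<^esub> f b"
    and S: "S \<subseteq> carrier M" "\<And>s. s \<in> S \<Longrightarrow> f s \<in> add_span M' T"
    and "a \<in> add_span M S"
  shows "f a \<in> add_span M' T"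
  using assms(7)
proof induction
  case (add a b)
  then show ?case
    using assms(4)[of a b] abelian_group.add_span_closed[OF assms(1) S(1)] by (auto intro: add_span.intros)
next
  case (neg a)
  then show ?case
    using additive_map_facts(2)[OF assms(1-4)] abelian_group.add_span_closed[OF assms(1) S(1)] by (auto intro: add_span.intros)
qed (use additive_map_facts(1)[OF assms(1-4)] S in \<open>auto intro: add_span.intros\<close>)

context one_sided_module
begin

lemma smult_zero_right: "a \<in> carrier A \<Longrightarrow> a \<odot>\<^bsub>M\<^esub> \<zero>\<^bsub>M\<^esub> = \<zero>\<^bsub>M\<^esub>"
  by (rule additive_map_facts(1)[of M M "\<lambda>v. a \<odot>\<^bsub>M\<^esub> v"]) (auto simp: smult_closed smult_add_vector M.abelian_group_axioms)

lemma smult_minus_right: "a \<in> carrier A \<Longrightarrow> v \<in> carrier M \<Longrightarrow> a \<odot>\<^bsub>M\<^esub> (\<ominus>\<^bsub>M\<^esub> v) = \<ominus>\<^bsub>M\<^esub> (a \<odot>\<^bsub>M\<^esub> v)"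
  by (rule additive_map_facts(2)[of M M "\<lambda>v. a \<odot>\<^bsub>M\<^esub> v"]) (auto simp: smult_closed smult_add_vector M.abelian_group_axioms)

lemma smult_diff_right: "a \<in> carrier A \<Longrightarrow> v \<in> carrier M \<Longrightarrow> w \<in> carrier M \<Longrightarrow>
    a \<odot>\<^bsub>M\<^esub> (v \<ominus>\<^bsub>M\<^esub> w) = a \<odot>\<^bsub>M\<^esub> v \<ominus>\<^bsub>M\<^esub> a \<odot>\<^bsub>M\<^esub> w"
  by (rule additive_map_facts(3)[of M M "\<lambda>v. a \<odot>\<^bsub>M\<^esub> v"]) (auto simp: smult_closed smult_add_vector M.abelian_group_axioms)

lemma smult_zero_left: "v \<in> carrier M \<Longrightarrow> \<zero>\<^bsub>A\<^esub> \<odot>\<^bsub>M\<^esub> v = \<zero>\<^bsub>M\<^esub>"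
  by (rule additive_map_facts(1)[of A M "\<lambda>a. a \<odot>\<^bsub>M\<^esub> v"])
    (auto simp: smult_closed smult_add_scalar M.abelian_group_axioms A.abelian_group_axioms)

lemma smult_minus_left: "a \<in> carrier A \<Longrightarrow> v \<in> carrier M \<Longrightarrow> (\<ominus>\<^bsub>A\<^esub> a) \<odot>\<^bsub>M\<^esub> v = \<ominus>\<^bsub>M\<^esub> (a \<odot>\<^bsub>M\<^esub> v)"
  by (rule additive_map_facts(2)[of A M "\<lambda>a. a \<odot>\<^bsub>M\<^esub> v"])
    (auto simp: smult_closed smult_add_scalar M.abelian_group_axioms A.abelian_group_axioms)

lemma smult_diff_left: "a \<in> carrier A \<Longrightarrow> b \<in> carrier A \<Longrightarrow> v \<in> carrier M \<Longrightarrow>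
    (a \<ominus>\<^bsub>A\<^esub> b) \<odot>\<^bsub>M\<^esub> v = a \<odot>\<^bsub>M\<^esub> v \<ominus>\<^bsub>M\<^esub> b \<odot>\<^bsub>M\<^esub> v"
  by (rule additive_map_facts(3)[of A M "\<lambda>a. a \<odot>\<^bsub>M\<^esub> v"])
    (auto simp: smult_closed smult_add_scalar M.abelian_group_axioms A.abelian_group_axioms)

end

definition left_submodule :: "('a, 'y) ring_scheme \<Rightarrow> ('a, 'm, 'z) module_scheme \<Rightarrow> 'm set \<Rightarrow> bool" where
  "left_submodule A M J \<longleftrightarrow> J \<subseteq> carrier M \<and> \<zero>\<^bsub>M\<^esub> \<in> J \<and> (\<forall>u\<in>J. \<forall>v\<in>J. u \<oplus>\<^bsub>M\<^esub> v \<in> J) \<and>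
     (\<forall>a\<in>carrier A. \<forall>v\<in>J. a \<odot>\<^bsub>M\<^esub> v \<in> J)"

lemma (in one_sided_module) left_submodule_neg:
  assumes "left_submodule A M J" "v \<in> J" shows "\<ominus>\<^bsub>M\<^esub> v \<in> J"
proof -
  have "(\<ominus>\<^bsub>A\<^esub> \<one>\<^bsub>A\<^esub>) \<odot>\<^bsub>M\<^esub> v \<in> J" using assms by (simp add: left_submodule_def)
  moreover have "v \<in> carrier M" using assms by (auto simp: left_submodule_def)
  ultimately show ?thesis using smult_minus_left[of "\<one>\<^bsub>A\<^esub>" v] smult_one[of v] by simp
qed

lemma (in one_sided_module) left_submodule_diff:
  assumes "left_submodule A M J" "u \<in> J" "v \<in> J" shows "u \<ominus>\<^bsub>M\<^esub> v \<in> J"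
  using left_submodule_neg[OF assms(1,3)] assms by (simp add: left_submodule_def a_minus_def)

section \<open>Algebras whose generators have linear commutators\<close>

text \<open>
  These are the properties of an enveloping algebra from which the flatness of its completion is
  derived. The scalars enter through a central ring homomorphism \<open>\<kappa>\<close>, which keeps the locale
  applicable to an algebra and to its opposite alike.
\<close>

locale commutator_algebra = K: nonarch_absolute_value K abs_K + A?: ring A
  for K :: "('k, 'z) ring_scheme" and abs_K :: "'k \<Rightarrow> real" and A :: "('a, 'y) ring_scheme" (structure) +
  fixes d :: nat and \<kappa> :: "'k \<Rightarrow> 'a" and x :: "nat \<Rightarrow> 'a"
  assumes \<kappa>_hom: "\<kappa> \<in> ring_hom K A"
    and \<kappa>_central: "c \<in> carrier K \<Longrightarrow> a \<in> carrier A \<Longrightarrow> \<kappa> c \<otimes> a = a \<otimes> \<kappa> c"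
    and x_closed: "k < d \<Longrightarrow> x k \<in> carrier A"
    and commutator: "i < d \<Longrightarrow> j < d \<Longrightarrow>
      x i \<otimes> x j \<ominus> x j \<otimes> x i \<in> add_span A {\<kappa> c \<otimes> x k | c k. c \<in> carrier K \<and> k < d}"
    and spanning: "carrier A \<subseteq>
      add_span A {\<kappa> c \<otimes> foldr (\<lambda>k a. x k \<otimes> a) w \<one> | c w. c \<in> carrier K \<and> w \<in> lists {..<d}}"
begin

lemma \<kappa>_closed [simp]: "c \<in> carrier K \<Longrightarrow> \<kappa> c \<in> carrier A"
  using ring_hom_closed[OF \<kappa>_hom] .
lemma \<kappa>_one: "\<kappa> \<one>\<^bsub>K\<^esub> = \<one>" using ring_hom_one[OF \<kappa>_hom] .
lemma \<kappa>_mult: "a \<in> carrier K \<Longrightarrow> b \<in> carrier K \<Longrightarrow> \<kappa> (a \<otimes>\<^bsub>K\<^esub> b) = \<kappa> a \<otimes> \<kappa> b"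
  using ring_hom_mult[OF \<kappa>_hom] .
lemma \<kappa>_add: "a \<in> carrier K \<Longrightarrow> b \<in> carrier K \<Longrightarrow> \<kappa> (a \<oplus>\<^bsub>K\<^esub> b) = \<kappa> a \<oplus> \<kappa> b"
  using ring_hom_add[OF \<kappa>_hom] .
lemma \<kappa>_zero: "\<kappa> \<zero>\<^bsub>K\<^esub> = \<zero>"
  by (rule additive_map_facts(1)[of K A]) (auto simp: K.abelian_group_axioms A.abelian_group_axioms \<kappa>_add)
lemma \<kappa>_neg: "c \<in> carrier K \<Longrightarrow> \<kappa> (\<ominus>\<^bsub>K\<^esub> c) = \<ominus> \<kappa> c"
  by (rule additive_map_facts(2)[of K A]) (auto simp: K.abelian_group_axioms A.abelian_group_axioms \<kappa>_add)

lemma abs_one: "abs_K \<one>\<^bsub>K\<^esub> = 1"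
proof -
  have "abs_K \<one>\<^bsub>K\<^esub> = abs_K \<one>\<^bsub>K\<^esub> * abs_K \<one>\<^bsub>K\<^esub>" using K.multiplicative[of "\<one>\<^bsub>K\<^esub>" "\<one>\<^bsub>K\<^esub>"] by simp
  moreover have "abs_K \<one>\<^bsub>K\<^esub> \<noteq> 0" using K.eq_zero_iff[of "\<one>\<^bsub>K\<^esub>"] K.one_not_zero by simp
  ultimately show ?thesis by simp
qed

lemma abs_zero: "abs_K \<zero>\<^bsub>K\<^esub> = 0" using K.eq_zero_iff[of "\<zero>\<^bsub>K\<^esub>"] by simp

lemma abs_neg_one: "abs_K (\<ominus>\<^bsub>K\<^esub> \<one>\<^bsub>K\<^esub>) = 1"
proof -
  have "(\<ominus>\<^bsub>K\<^esub> \<one>\<^bsub>K\<^esub>) \<otimes>\<^bsub>K\<^esub> (\<ominus>\<^bsub>K\<^esub> \<one>\<^bsub>K\<^esub>) = \<one>\<^bsub>K\<^esub>" by (simp add: K.l_minus K.r_minus)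
  then have "abs_K (\<ominus>\<^bsub>K\<^esub> \<one>\<^bsub>K\<^esub>) * abs_K (\<ominus>\<^bsub>K\<^esub> \<one>\<^bsub>K\<^esub>) = 1"
    using K.multiplicative[of "\<ominus>\<^bsub>K\<^esub> \<one>\<^bsub>K\<^esub>" "\<ominus>\<^bsub>K\<^esub> \<one>\<^bsub>K\<^esub>"] abs_one by simp
  then show ?thesis using K.nonneg[of "\<ominus>\<^bsub>K\<^esub> \<one>\<^bsub>K\<^esub>"]
    by (metis K.add.inv_closed K.one_closed abs_mult_self_eq abs_of_nonneg abs_one mult_cancel_left1 power2_eq_1_iff power2_eq_square neg_0_le_iff_le not_one_le_zero)
qed

lemma abs_neg: "c \<in> carrier K \<Longrightarrow> abs_K (\<ominus>\<^bsub>K\<^esub> c) = abs_K c"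
  using K.multiplicative[of "\<ominus>\<^bsub>K\<^esub> \<one>\<^bsub>K\<^esub>" c] abs_neg_one by (simp add: K.l_minus)

definition word :: "nat list \<Rightarrow> 'a" where
  "word w = foldr (\<lambda>k a. x k \<otimes> a) w \<one>"

lemma word_simps [simp]: "word [] = \<one>" "word (k # w) = x k \<otimes> word w"
  by (simp_all add: word_def)

lemma word_closed [simp]: "w \<in> lists {..<d} \<Longrightarrow> word w \<in> carrier A"
  by (induction w) (auto simp: x_closed)

lemma word_append: "u \<in> lists {..<d} \<Longrightarrow> w \<in> lists {..<d} \<Longrightarrow> word (u @ w) = word u \<otimes> word w"
  by (induction u) (auto simp: x_closed m_assoc)

lemma scaled_word_mult:
  assumes "a \<in> carrier K" "c \<in> carrier K" "u \<in> lists {..<d}" "w \<in> lists {..<d}"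
  shows "(\<kappa> a \<otimes> word u) \<otimes> (\<kappa> c \<otimes> word w) = \<kappa> (a \<otimes>\<^bsub>K\<^esub> c) \<otimes> word (u @ w)"
proof -
  have "(\<kappa> a \<otimes> word u) \<otimes> (\<kappa> c \<otimes> word w) = \<kappa> a \<otimes> (word u \<otimes> \<kappa> c) \<otimes> word w"
    using assms by (simp add: m_assoc)
  also have "\<dots> = \<kappa> a \<otimes> (\<kappa> c \<otimes> word u) \<otimes> word w" using \<kappa>_central[of c "word u"] assms by simp
  also have "\<dots> = \<kappa> (a \<otimes>\<^bsub>K\<^esub> c) \<otimes> word (u @ w)" using assms by (simp add: m_assoc \<kappa>_mult word_append)
  finally show ?thesis .
qed

text \<open>
  The structure constants are bounded by \<open>R\<close>. A commutator has length one where the product it comes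
  from has length two, and this difference in weight absorbs a factor \<open>R\<close>.
\<close>

definition commutators_bounded :: "real \<Rightarrow> bool" where
  "commutators_bounded R \<longleftrightarrow> (\<forall>a<d. \<forall>b<d. x a \<otimes> x b \<ominus> x b \<otimes> x a \<in>
      add_span A {\<kappa> c \<otimes> x k | c k. c \<in> carrier K \<and> k < d \<and> abs_K c \<le> R})"

lemma eventually_commutators_bounded: "\<forall>\<^sub>F R in at_top. commutators_bounded R"
proof -
  have ev: "\<forall>\<^sub>F R in at_top. s \<in> add_span A {\<kappa> c \<otimes> x k | c k. c \<in> carrier K \<and> k < d \<and> abs_K c \<le> R}"
    if "s \<in> add_span A {\<kappa> c \<otimes> x k | c k. c \<in> carrier K \<and> k < d}" for s
    using that
  proof induction
    case (incl s)
    then obtain c k where ck: "s = \<kappa> c \<otimes> x k" "c \<in> carrier K" "k < d" by blast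
    show ?case using eventually_ge_at_top[of "abs_K c"]
      by eventually_elim (use ck in \<open>auto intro!: add_span.incl\<close>)
  next
    case (add a b)
    show ?case using add.IH by eventually_elim (rule add_span.add)
  next
    case (neg a)
    show ?case using neg.IH by eventually_elim (rule add_span.neg)
  qed (simp add: add_span.zero)
  have "\<forall>\<^sub>F R in at_top. \<forall>a\<in>{..<d}. \<forall>b\<in>{..<d}. x a \<otimes> x b \<ominus> x b \<otimes> x a \<in>
      add_span A {\<kappa> c \<otimes> x k | c k. c \<in> carrier K \<and> k < d \<and> abs_K c \<le> R}"
    by (intro eventually_ball_finite ballI finite_lessThan ev commutator) auto
  then show ?thesis by (simp add: commutators_bounded_def Ball_def)
qed

end

section \<open>Leading terms in modules over such an algebra\<close>

text \<open>
  A left module with chosen elements \<open>e 0, ..., e (m - 1)\<close>; the application is a free module with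
  its standard basis.
\<close>

locale generated_module = commutator_algebra K abs_K A d \<kappa> x + M: left_module A M
  for K :: "('k, 'z) ring_scheme" and abs_K :: "'k \<Rightarrow> real" and A :: "('a, 'y) ring_scheme" (structure)
    and d \<kappa> x and M :: "('a, 'm, 'w) module_scheme" +
  fixes m :: nat and e :: "nat \<Rightarrow> 'm"
  assumes e_closed: "i < m \<Longrightarrow> e i \<in> carrier M"
begin

definition mon :: "nat list \<Rightarrow> nat \<Rightarrow> 'm" where
  "mon w i = word w \<odot>\<^bsub>M\<^esub> e i"

lemma mon_closed [simp]: "w \<in> lists {..<d} \<Longrightarrow> i < m \<Longrightarrow> mon w i \<in> carrier M"
  by (simp add: mon_def M.smult_closed e_closed)

definition terms :: "('k \<Rightarrow> nat list \<Rightarrow> nat \<Rightarrow> bool) \<Rightarrow> 'm set" where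
  "terms Q = {\<kappa> c \<odot>\<^bsub>M\<^esub> mon w i | c w i. c \<in> carrier K \<and> w \<in> lists {..<d} \<and> i < m \<and> Q c w i}"

text \<open>
  An element of the module may have several expressions through the elements \<open>mon w i\<close>, so bounds
  are stated as membership in the span of the terms satisfying the bound.
\<close>

definition combs :: "('k \<Rightarrow> nat list \<Rightarrow> nat \<Rightarrow> bool) \<Rightarrow> 'm set" where
  "combs Q = add_span M (terms Q)"

lemma terms_closed: "terms Q \<subseteq> carrier M"
  unfolding terms_def using M.smult_closed mon_closed \<kappa>_closed by blast

lemma combs_closed: "v \<in> combs Q \<Longrightarrow> v \<in> carrier M"
  unfolding combs_def using M.add_span_closed[OF terms_closed] .

lemma term_in_combs: "c \<in> carrier K \<Longrightarrow> w \<in> lists {..<d} \<Longrightarrow> i < m \<Longrightarrow> Q c w i \<Longrightarrow> \<kappa> c \<odot>\<^bsub>M\<^esub> mon w i \<in> combs Q"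
  unfolding combs_def terms_def by (rule add_span.incl) blast

lemma combs_add: "u \<in> combs Q \<Longrightarrow> v \<in> combs Q \<Longrightarrow> u \<oplus>\<^bsub>M\<^esub> v \<in> combs Q"
  and combs_neg: "u \<in> combs Q \<Longrightarrow> \<ominus>\<^bsub>M\<^esub> u \<in> combs Q"
  and combs_zero: "\<zero>\<^bsub>M\<^esub> \<in> combs Q"
  unfolding combs_def by (auto intro: add_span.intros add_span_diff)

lemma combs_mono:
  assumes "\<And>c w i. c \<in> carrier K \<Longrightarrow> w \<in> lists {..<d} \<Longrightarrow> i < m \<Longrightarrow> Q c w i \<Longrightarrow> Q' c w i"
    and "v \<in> combs Q" shows "v \<in> combs Q'"
proof -
  have "terms Q \<subseteq> terms Q'" unfolding terms_def using assms(1) by blast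
  then show ?thesis using assms(2) add_span_mono unfolding combs_def by blast
qed

lemma combs_induct [consumes 1, case_names zero single add neg]:
  assumes "v \<in> combs Q" "P \<zero>\<^bsub>M\<^esub>"
    and "\<And>c w i. c \<in> carrier K \<Longrightarrow> w \<in> lists {..<d} \<Longrightarrow> i < m \<Longrightarrow> Q c w i \<Longrightarrow> P (\<kappa> c \<odot>\<^bsub>M\<^esub> mon w i)"
    and "\<And>u v. u \<in> combs Q \<Longrightarrow> v \<in> combs Q \<Longrightarrow> P u \<Longrightarrow> P v \<Longrightarrow> P (u \<oplus>\<^bsub>M\<^esub> v)"
    and "\<And>u. u \<in> combs Q \<Longrightarrow> P u \<Longrightarrow> P (\<ominus>\<^bsub>M\<^esub> u)"
  shows "P v"
  using assms(1) unfolding combs_def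
  by (induction rule: add_span.induct) (use assms(2-) in \<open>auto simp: combs_def terms_def\<close>)

lemma combs_act:
  assumes a: "a \<in> carrier K" and u: "u \<in> lists {..<d}"
    and "\<And>c w i. c \<in> carrier K \<Longrightarrow> w \<in> lists {..<d} \<Longrightarrow> i < m \<Longrightarrow> Q c w i \<Longrightarrow> Q' (a \<otimes>\<^bsub>K\<^esub> c) (u @ w) i"
    and v: "v \<in> combs Q"
  shows "(\<kappa> a \<otimes> word u) \<odot>\<^bsub>M\<^esub> v \<in> combs Q'"
  unfolding combs_def
proof (rule add_span_image[where f = "\<lambda>v. (\<kappa> a \<otimes> word u) \<odot>\<^bsub>M\<^esub> v", OF M.abelian_group_axioms M.abelian_group_axioms _ _ terms_closed])
  fix s assume "s \<in> terms Q"
  then obtain c w i where s: "s = \<kappa> c \<odot>\<^bsub>M\<^esub> mon w i" "c \<in> carrier K" "w \<in> lists {..<d}" "i < m" "Q c w i"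
    unfolding terms_def by blast
  have "(\<kappa> a \<otimes> word u) \<odot>\<^bsub>M\<^esub> s = ((\<kappa> a \<otimes> word u) \<otimes> (\<kappa> c \<otimes> word w)) \<odot>\<^bsub>M\<^esub> e i"
    using s a u by (simp add: mon_def M.smult_assoc e_closed M.smult_closed)
  also have "\<dots> = \<kappa> (a \<otimes>\<^bsub>K\<^esub> c) \<odot>\<^bsub>M\<^esub> mon (u @ w) i"
    using s a u scaled_word_mult[of a c u w] by (simp add: mon_def M.smult_assoc e_closed M.smult_closed)
  finally show "(\<kappa> a \<otimes> word u) \<odot>\<^bsub>M\<^esub> s \<in> add_span M (terms Q')"
    using term_in_combs[of "a \<otimes>\<^bsub>K\<^esub> c" "u @ w" i Q'] assms(3)[of c w i] s a u by (simp add: combs_def)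
qed (use a u v in \<open>auto simp: M.smult_closed M.smult_add_vector combs_def\<close>)

lemma combs_scale:
  assumes a: "a \<in> carrier K"
    and "\<And>c w i. c \<in> carrier K \<Longrightarrow> w \<in> lists {..<d} \<Longrightarrow> i < m \<Longrightarrow> Q c w i \<Longrightarrow> Q' (a \<otimes>\<^bsub>K\<^esub> c) w i"
    and v: "v \<in> combs Q"
  shows "\<kappa> a \<odot>\<^bsub>M\<^esub> v \<in> combs Q'"
  using combs_act[of a "[]" Q Q' v] assms by simp

lemma combs_letter:
  assumes k: "k < d"
    and "\<And>c w i. c \<in> carrier K \<Longrightarrow> w \<in> lists {..<d} \<Longrightarrow> i < m \<Longrightarrow> Q c w i \<Longrightarrow> Q' c (k # w) i"
    and v: "v \<in> combs Q"
  shows "x k \<odot>\<^bsub>M\<^esub> v \<in> combs Q'"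
  using combs_act[of "\<one>\<^bsub>K\<^esub>" "[k]" Q Q' v] assms by (simp add: \<kappa>_one x_closed)

lemma act_mon:
  assumes "c \<in> carrier K" "u \<in> lists {..<d}" "w \<in> lists {..<d}" "i < m"
  shows "(\<kappa> c \<otimes> word u) \<odot>\<^bsub>M\<^esub> mon w i = \<kappa> c \<odot>\<^bsub>M\<^esub> mon (u @ w) i"
  using assms by (simp add: mon_def M.smult_assoc[symmetric] m_assoc e_closed word_append)

lemma mon_Cons: "k < d \<Longrightarrow> w \<in> lists {..<d} \<Longrightarrow> i < m \<Longrightarrow> x k \<odot>\<^bsub>M\<^esub> mon w i = mon (k # w) i"
  by (simp add: mon_def M.smult_assoc e_closed x_closed)

abbreviation bounded :: "nat \<Rightarrow> real \<Rightarrow> real \<Rightarrow> 'm set" where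
  "bounded B R \<rho> \<equiv> combs (\<lambda>c w i. abs_K c * R ^ wt d B w i \<le> \<rho>)"
abbreviation bounded_below :: "real poly \<Rightarrow> nat \<Rightarrow> real \<Rightarrow> real \<Rightarrow> 'm set" where
  "bounded_below t B R \<rho> \<equiv> combs (\<lambda>c w i. wpoly d w i < t \<and> abs_K c * R ^ wt d B w i \<le> \<rho>)"
abbreviation bounded_upto :: "real poly \<Rightarrow> nat \<Rightarrow> real \<Rightarrow> real \<Rightarrow> 'm set" where
  "bounded_upto t B R \<rho> \<equiv> combs (\<lambda>c w i. wpoly d w i \<le> t \<and> abs_K c * R ^ wt d B w i \<le> \<rho>)"
abbreviation below :: "real poly \<Rightarrow> 'm set" where
  "below t \<equiv> combs (\<lambda>c w i. wpoly d w i < t)"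

text \<open>
  One transposition at the front of a word costs a commutator. Its word is shorter by one letter,
  which lowers the weight polynomial, and lowers the numerical weight by at least one, which
  compensates the bound \<open>R\<close> on the structure constants.
\<close>

lemma mon_swap:
  assumes cb: "commutators_bounded R" and R: "1 \<le> R" and B: "1 \<le> B"
    and ab: "a < d" "b < d" and v: "v \<in> lists {..<d}" "i < m"
  shows "mon (a # b # v) i \<ominus>\<^bsub>M\<^esub> mon (b # a # v) i \<in>
         bounded_below (wpoly d (a # b # v) i) B R (R ^ wt d B (a # b # v) i)" (is "_ \<in> combs ?Q")
proof -
  let ?f = "\<lambda>t. t \<odot>\<^bsub>M\<^esub> mon v i"
  let ?S = "{\<kappa> c \<otimes> x k | c k. c \<in> carrier K \<and> k < d \<and> abs_K c \<le> R}"
  have "?f (x a \<otimes> x b \<ominus> x b \<otimes> x a) \<in> add_span M (terms ?Q)"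
  proof (rule add_span_image[where f = ?f, OF A.abelian_group_axioms M.abelian_group_axioms])
    show "x a \<otimes> x b \<ominus> x b \<otimes> x a \<in> add_span A ?S" using cb ab by (simp add: commutators_bounded_def)
    fix s assume "s \<in> ?S"
    then obtain c k where s: "s = \<kappa> c \<otimes> x k" "c \<in> carrier K" "k < d" "abs_K c \<le> R" by blast
    have fs: "?f s = \<kappa> c \<odot>\<^bsub>M\<^esub> mon (k # v) i"
      using s v by (simp add: M.smult_assoc x_closed mon_Cons)
    have "B ^ Suc k \<le> B ^ Suc d" using B s by (intro power_increasing) auto
    moreover have "1 \<le> B ^ Suc a" using B by (simp only: one_le_power)
    ultimately have le: "Suc (wt d B (k # v) i) \<le> wt d B (a # b # v) i" unfolding wt_Cons by linarith
    have "abs_K c * R ^ wt d B (k # v) i \<le> R ^ Suc (wt d B (k # v) i)"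
      using s R by (simp add: mult_right_mono)
    also have "\<dots> \<le> R ^ wt d B (a # b # v) i" using R le by (intro power_increasing)
    finally have "abs_K c * R ^ wt d B (k # v) i \<le> R ^ wt d B (a # b # v) i" .
    moreover have "wpoly d (k # v) i < wpoly d (a # b # v) i"
      using s ab v by (intro wpoly_less_length) auto
    ultimately show "?f s \<in> add_span M (terms ?Q)"
      using fs term_in_combs[of c "k # v" i ?Q] s v by (simp add: combs_def)
  qed (use v in \<open>auto simp: M.smult_closed M.smult_add_scalar x_closed\<close>)
  moreover have "?f (x a \<otimes> x b \<ominus> x b \<otimes> x a) = mon (a # b # v) i \<ominus>\<^bsub>M\<^esub> mon (b # a # v) i"
    using ab v by (simp add: M.smult_diff_left x_closed M.smult_assoc mon_Cons)
  ultimately show ?thesis by (simp add: combs_def)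
qed

lemma mon_move_front:
  assumes cb: "commutators_bounded R" and R: "1 \<le> R" and B: "1 \<le> B"
    and a: "a < d" and u: "u \<in> lists {..<d}" and v: "v \<in> lists {..<d}" "i < m"
  shows "mon (u @ a # v) i \<ominus>\<^bsub>M\<^esub> mon (a # u @ v) i \<in>
         bounded_below (wpoly d (u @ a # v) i) B R (R ^ wt d B (u @ a # v) i)"
  using u
proof (induction u rule: list.induct)
  case Nil
  have "mon (a # v) i \<ominus>\<^bsub>M\<^esub> mon (a # v) i = \<zero>\<^bsub>M\<^esub>" using a v by (simp add: M.minus_eq M.r_neg)
  then show ?case by (simp add: combs_zero)
next
  case (Cons k u)
  have k: "k < d" and u: "u \<in> lists {..<d}" using Cons.prems by auto
  let ?w = "k # u @ a # v"
  have eqs: "wpoly d (k # a # u @ v) i = wpoly d ?w i" "wt d B (k # a # u @ v) i = wt d B ?w i"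
    by (rule wpoly_cong, simp) (rule wt_cong, simp)
  have "x k \<odot>\<^bsub>M\<^esub> (mon (u @ a # v) i \<ominus>\<^bsub>M\<^esub> mon (a # u @ v) i) \<in> bounded_below (wpoly d ?w i) B R (R ^ wt d B ?w i)"
  proof (rule combs_letter[OF k _ Cons.IH[OF u]])
    fix c w i' assume "wpoly d w i' < wpoly d (u @ a # v) i \<and> abs_K c * R ^ wt d B w i' \<le> R ^ wt d B (u @ a # v) i"
    then show "wpoly d (k # w) i' < wpoly d ?w i \<and> abs_K c * R ^ wt d B (k # w) i' \<le> R ^ wt d B ?w i"
      using R mult_left_mono[of "abs_K c * R ^ wt d B w i'" "R ^ wt d B (u @ a # v) i" "R ^ (B ^ Suc d + B ^ Suc k)"]
      by (simp add: wpoly_Cons wt_Cons power_add mult_ac)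
  qed
  moreover have "x k \<odot>\<^bsub>M\<^esub> (mon (u @ a # v) i \<ominus>\<^bsub>M\<^esub> mon (a # u @ v) i) = mon ?w i \<ominus>\<^bsub>M\<^esub> mon (k # a # u @ v) i"
    using k a u v by (simp add: M.smult_diff_right x_closed mon_Cons)
  moreover have "mon (k # a # u @ v) i \<ominus>\<^bsub>M\<^esub> mon (a # k # u @ v) i \<in> bounded_below (wpoly d ?w i) B R (R ^ wt d B ?w i)"
    using mon_swap[OF cb R B k a, of "u @ v" i] u v unfolding eqs by simp
  ultimately have "(mon ?w i \<ominus>\<^bsub>M\<^esub> mon (k # a # u @ v) i) \<oplus>\<^bsub>M\<^esub> (mon (k # a # u @ v) i \<ominus>\<^bsub>M\<^esub> mon (a # k # u @ v) i)
     \<in> bounded_below (wpoly d ?w i) B R (R ^ wt d B ?w i)" using combs_add by simp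
  then show ?case using k a u v by (simp add: M.diff_chain)
qed

text \<open>
  Permutations of a word agree up to terms of smaller weight and of no larger norm. So, up to
  smaller terms, only the multiset of letters of a leading word matters.
\<close>

lemma mon_permute:
  assumes cb: "commutators_bounded R" and R: "1 \<le> R" and B: "1 \<le> B"
    and "w \<in> lists {..<d}" "i < m" "mset w = mset w'"
  shows "mon w' i \<ominus>\<^bsub>M\<^esub> mon w i \<in> bounded_below (wpoly d w i) B R (R ^ wt d B w i)"
  using assms(4-)
proof (induction w arbitrary: w' rule: list.induct)
  case Nil
  then show ?case by (simp add: M.minus_eq M.r_neg combs_zero)
next
  case (Cons a w)
  have a: "a < d" and w: "w \<in> lists {..<d}" using Cons.prems by auto
  have "a \<in> set w'" using Cons.prems(3) by (metis list.set_intros(1) set_mset_mset)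
  then obtain u v where w': "w' = u @ a # v" by (metis split_list)
  have ms: "mset w = mset (u @ v)" using Cons.prems(3) w' by simp
  have "set w = set (u @ v)" using ms by (metis set_mset_mset)
  then have uv: "u \<in> lists {..<d}" "v \<in> lists {..<d}" using w by (auto simp: in_lists_conv_set)
  have eqs: "wpoly d (u @ a # v) i = wpoly d (a # w) i" "wt d B (u @ a # v) i = wt d B (a # w) i"
    using Cons.prems(3) w' wpoly_cong wt_cong by metis+
  have "x a \<odot>\<^bsub>M\<^esub> (mon (u @ v) i \<ominus>\<^bsub>M\<^esub> mon w i) \<in> bounded_below (wpoly d (a # w) i) B R (R ^ wt d B (a # w) i)"
  proof (rule combs_letter[OF a _ Cons.IH[OF w Cons.prems(2) ms]])
    fix c w1 i' assume "wpoly d w1 i' < wpoly d w i \<and> abs_K c * R ^ wt d B w1 i' \<le> R ^ wt d B w i"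
    then show "wpoly d (a # w1) i' < wpoly d (a # w) i \<and> abs_K c * R ^ wt d B (a # w1) i' \<le> R ^ wt d B (a # w) i"
      using R mult_left_mono[of "abs_K c * R ^ wt d B w1 i'" "R ^ wt d B w i" "R ^ (B ^ Suc d + B ^ Suc a)"]
      by (simp add: wpoly_Cons wt_Cons power_add mult_ac)
  qed
  then have "mon (a # u @ v) i \<ominus>\<^bsub>M\<^esub> mon (a # w) i \<in> bounded_below (wpoly d (a # w) i) B R (R ^ wt d B (a # w) i)"
    using a w uv Cons.prems by (simp add: M.smult_diff_right x_closed mon_Cons)
  moreover have "mon (u @ a # v) i \<ominus>\<^bsub>M\<^esub> mon (a # u @ v) i \<in> bounded_below (wpoly d (a # w) i) B R (R ^ wt d B (a # w) i)"
    using mon_move_front[OF cb R B a uv, of i] Cons.prems unfolding eqs by simp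
  ultimately have "(mon (u @ a # v) i \<ominus>\<^bsub>M\<^esub> mon (a # u @ v) i) \<oplus>\<^bsub>M\<^esub> (mon (a # u @ v) i \<ominus>\<^bsub>M\<^esub> mon (a # w) i)
     \<in> bounded_below (wpoly d (a # w) i) B R (R ^ wt d B (a # w) i)" using combs_add by simp
  then show ?case using a w uv w' Cons.prems by (simp add: M.diff_chain)
qed

lemma scale_bound:
  assumes "c \<in> carrier K" "abs_K c * R ^ n \<le> \<rho>" "0 \<le> R" "a \<in> carrier K" "abs_K a * s \<le> R ^ n"
  shows "abs_K (c \<otimes>\<^bsub>K\<^esub> a) * s \<le> \<rho>"
proof -
  have "abs_K (c \<otimes>\<^bsub>K\<^esub> a) * s = abs_K c * (abs_K a * s)" using assms by (simp add: K.multiplicative)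
  also have "\<dots> \<le> abs_K c * R ^ n" using assms K.nonneg by (intro mult_left_mono) auto
  finally show ?thesis using assms by simp
qed

text \<open>
  All terms whose weight is the maximal one can be collected in a single coefficient, because their
  words are permutations of each other; by the ultrametric inequality collecting them does not
  increase the norm.
\<close>

lemma leading_term:
  assumes cb: "commutators_bounded R" and R: "1 \<le> R" and B: "1 \<le> B"
    and w0: "w0 \<in> lists {..<d}" "i0 < m" and \<rho>: "0 \<le> \<rho>"
    and v: "v \<in> bounded_upto (wpoly d w0 i0) B R \<rho>"
  shows "\<exists>c\<in>carrier K. abs_K c * R ^ wt d B w0 i0 \<le> \<rho> \<and>
     v \<ominus>\<^bsub>M\<^esub> \<kappa> c \<odot>\<^bsub>M\<^esub> mon w0 i0 \<in> bounded_below (wpoly d w0 i0) B R \<rho>" (is "\<exists>c\<in>carrier K. ?b c \<and> ?l v c")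
  using v
proof (induction rule: combs_induct)
  case zero
  have "\<zero>\<^bsub>M\<^esub> \<ominus>\<^bsub>M\<^esub> \<kappa> \<zero>\<^bsub>K\<^esub> \<odot>\<^bsub>M\<^esub> mon w0 i0 = \<zero>\<^bsub>M\<^esub>" using w0 by (simp add: \<kappa>_zero M.smult_zero_left M.minus_eq)
  then show ?case using combs_zero \<rho> by (intro bexI[of _ "\<zero>\<^bsub>K\<^esub>"]) (auto simp: abs_zero)
next
  case (single c w i)
  show ?case
  proof (cases "wpoly d w i = wpoly d w0 i0")
    case True
    then have ms: "mset w0 = mset w" "i = i0" using wpoly_inj[OF single(2) w0(1) True] by auto
    have wte: "wt d B w i = wt d B w0 i0" using wt_cong[OF ms(1)] ms by simp
    have "\<kappa> c \<odot>\<^bsub>M\<^esub> (mon w i \<ominus>\<^bsub>M\<^esub> mon w0 i0) \<in> bounded_below (wpoly d w0 i0) B R \<rho>"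
      unfolding ms(2)
      by (rule combs_scale[OF single(1) _ mon_permute[OF cb R B w0 ms(1)]])
        (use single wte R scale_bound[of c R "wt d B w i" \<rho>] in auto)
    then have "?l (\<kappa> c \<odot>\<^bsub>M\<^esub> mon w i) c" using single w0 by (simp add: M.smult_diff_right)
    then show ?thesis using single wte by auto
  next
    case False
    then have "wpoly d w i < wpoly d w0 i0" using single by simp
    moreover have "\<kappa> c \<odot>\<^bsub>M\<^esub> mon w i \<ominus>\<^bsub>M\<^esub> \<kappa> \<zero>\<^bsub>K\<^esub> \<odot>\<^bsub>M\<^esub> mon w0 i0 = \<kappa> c \<odot>\<^bsub>M\<^esub> mon w i"
      using w0 single by (simp add: \<kappa>_zero M.smult_zero_left M.diff_zero M.smult_closed)
    ultimately have "?l (\<kappa> c \<odot>\<^bsub>M\<^esub> mon w i) \<zero>\<^bsub>K\<^esub>"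
      using single term_in_combs[of c w i] by simp
    then show ?thesis using \<rho> by (intro bexI[of _ "\<zero>\<^bsub>K\<^esub>"]) (auto simp: abs_zero)
  qed
next
  case (add u v)
  then obtain a b where ab: "a \<in> carrier K" "b \<in> carrier K" "?b a" "?b b" "?l u a" "?l v b" by blast
  have "?b (a \<oplus>\<^bsub>K\<^esub> b)"
  proof -
    have "abs_K (a \<oplus>\<^bsub>K\<^esub> b) * R ^ wt d B w0 i0 \<le> max (abs_K a) (abs_K b) * R ^ wt d B w0 i0"
      using K.ultrametric[OF ab(1,2)] R by (intro mult_right_mono) auto
    then show ?thesis using ab(3,4) by (auto simp: max_def split: if_splits)
  qed
  moreover have "(u \<oplus>\<^bsub>M\<^esub> v) \<ominus>\<^bsub>M\<^esub> \<kappa> (a \<oplus>\<^bsub>K\<^esub> b) \<odot>\<^bsub>M\<^esub> mon w0 i0 =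
      (u \<ominus>\<^bsub>M\<^esub> \<kappa> a \<odot>\<^bsub>M\<^esub> mon w0 i0) \<oplus>\<^bsub>M\<^esub> (v \<ominus>\<^bsub>M\<^esub> \<kappa> b \<odot>\<^bsub>M\<^esub> mon w0 i0)"
    using ab w0 add.hyps combs_closed by (simp add: \<kappa>_add M.smult_add_scalar M.add_diff_add M.smult_closed)
  ultimately show ?case using ab(1,2) combs_add[OF ab(5,6)] by (intro bexI[of _ "a \<oplus>\<^bsub>K\<^esub> b"]) auto
next
  case (neg u)
  then obtain a where a: "a \<in> carrier K" "?b a" "?l u a" by blast
  have "(\<ominus>\<^bsub>M\<^esub> u) \<ominus>\<^bsub>M\<^esub> \<kappa> (\<ominus>\<^bsub>K\<^esub> a) \<odot>\<^bsub>M\<^esub> mon w0 i0 = \<ominus>\<^bsub>M\<^esub> (u \<ominus>\<^bsub>M\<^esub> \<kappa> a \<odot>\<^bsub>M\<^esub> mon w0 i0)"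
    using a w0 combs_closed[OF neg(1)] by (simp add: \<kappa>_neg M.smult_minus_left M.minus_eq M.minus_add M.smult_closed)
  then show ?case using a combs_neg[OF a(3)] by (intro bexI[of _ "\<ominus>\<^bsub>K\<^esub> a"]) (auto simp: abs_neg)
qed

text \<open>
  Among the finitely many terms of an expression there is one of maximal weight; this starts the
  inductions over weights.
\<close>

lemma combs_max_weight:
  assumes "v \<in> combs (\<lambda>c w i. P (wpoly d w i) \<and> Q c w i)"
  shows "v = \<zero>\<^bsub>M\<^esub> \<or> (\<exists>w' i'. w' \<in> lists {..<d} \<and> i' < m \<and> P (wpoly d w' i') \<and>
     v \<in> combs (\<lambda>c w i. wpoly d w i \<le> wpoly d w' i' \<and> Q c w i))"
  using assms
proof (induction rule: combs_induct)
  case (single c w i)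
  then show ?case using term_in_combs[of c w i "\<lambda>c w' i'. wpoly d w' i' \<le> wpoly d w i \<and> Q c w' i'"] by blast
next
  case (add u v)
  show ?case
  proof (cases "u = \<zero>\<^bsub>M\<^esub> \<or> v = \<zero>\<^bsub>M\<^esub>")
    case True
    then have "u \<oplus>\<^bsub>M\<^esub> v = v \<or> u \<oplus>\<^bsub>M\<^esub> v = u"
      using combs_closed[OF add.hyps(1)] combs_closed[OF add.hyps(2)] by auto
    then show ?thesis
    proof
      assume eq: "u \<oplus>\<^bsub>M\<^esub> v = v" show ?thesis unfolding eq by (rule add.IH(2))
    next
      assume eq: "u \<oplus>\<^bsub>M\<^esub> v = u" show ?thesis unfolding eq by (rule add.IH(1))
    qed
  next
    case False
    then obtain w1 i1 w2 i2 where 1: "w1 \<in> lists {..<d} \<and> i1 < m \<and> P (wpoly d w1 i1)"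
        "u \<in> combs (\<lambda>c w i. wpoly d w i \<le> wpoly d w1 i1 \<and> Q c w i)"
      and 2: "w2 \<in> lists {..<d} \<and> i2 < m \<and> P (wpoly d w2 i2)"
        "v \<in> combs (\<lambda>c w i. wpoly d w i \<le> wpoly d w2 i2 \<and> Q c w i)"
      using add.IH by auto
    show ?thesis
    proof (cases "wpoly d w1 i1 \<le> wpoly d w2 i2")
      case True
      then have "u \<in> combs (\<lambda>c w i. wpoly d w i \<le> wpoly d w2 i2 \<and> Q c w i)"
        by (intro combs_mono[OF _ 1(2)]) auto
      then show ?thesis using 2 combs_add by blast
    next
      case False
      then have "v \<in> combs (\<lambda>c w i. wpoly d w i \<le> wpoly d w1 i1 \<and> Q c w i)"
        by (intro combs_mono[OF _ 2(2)]) auto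
      then show ?thesis using 1 combs_add by blast
    qed
  qed
next
  case (neg u)
  then show ?case using combs_neg by auto
qed simp

text \<open>
  The order of the two quantifiers is essential: a fixed \<open>B\<close> has to turn the comparison of weight
  polynomials into one of numbers before a power of \<open>R\<close> can absorb the coefficients.
\<close>

lemma eventually_bounded_below:
  assumes w: "w \<in> lists {..<d}" "i < m" and g: "g \<in> below (wpoly d w i)"
  shows "\<forall>\<^sub>F B in sequentially. \<forall>\<^sub>F R in at_top. g \<in> bounded_below (wpoly d w i) B R (R ^ wt d B w i)"
  using g
proof (induction rule: combs_induct)
  case (single c w' i')
  show ?case using eventually_wt_less[OF single(4)]
  proof eventually_elim
    case (elim B)
    show ?case using eventually_ge_at_top[of "max 1 (abs_K c)"]
    proof eventually_elim
      case (elim R)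
      have "abs_K c * R ^ wt d B w' i' \<le> R ^ Suc (wt d B w' i')" using elim by (simp add: mult_right_mono)
      also have "\<dots> \<le> R ^ wt d B w i" using elim \<open>wt d B w' i' < wt d B w i\<close> by (intro power_increasing) auto
      finally show ?case using single by (intro term_in_combs) auto
    qed
  qed
next
  case (add u v)
  show ?case using add.IH
  proof eventually_elim
    case (elim B)
    show ?case using elim by eventually_elim (rule combs_add)
  qed
next
  case (neg u)
  show ?case using neg.IH
  proof eventually_elim
    case (elim B)
    show ?case using elim by eventually_elim (rule combs_neg)
  qed
qed (simp add: combs_zero)

end

section \<open>Groebner bases and division with control of the norm\<close>

lemma wpoly_min: "wpoly d [] 0 \<le> wpoly d w i"
proof -
  have "(0::real poly) \<le> [:real i:]" by (cases i) (auto simp: less_eq_poly_def pos_poly_def)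
  moreover have "wpoly d w i = wpoly d w 0 + [:real i:]" "wpoly d [] 0 = 0" by (simp_all add: wpoly_def)
  ultimately show ?thesis using wpoly_nonneg[of d w] by simp
qed

context generated_module
begin

text \<open>
  \<open>f\<close> is a monic element of \<open>J\<close> with leading monomial \<open>mon w i\<close>. The leading monomial is not
  determined by \<open>f\<close>, since the words may be linearly dependent; therefore leading monomials are
  recorded together with the elements.
\<close>

definition leading_in :: "'m set \<Rightarrow> 'm \<Rightarrow> nat list \<Rightarrow> nat \<Rightarrow> bool" where
  "leading_in J f w i \<longleftrightarrow> f \<in> J \<and> w \<in> lists {..<d} \<and> i < m \<and> f \<ominus>\<^bsub>M\<^esub> mon w i \<in> below (wpoly d w i)"

definition groebner_basis :: "'m set \<Rightarrow> ('m \<times> nat list \<times> nat) set \<Rightarrow> bool" where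
  "groebner_basis J \<G> \<longleftrightarrow> finite \<G> \<and> (\<forall>(f, w, i)\<in>\<G>. leading_in J f w i) \<and>
     (\<forall>f' w' i'. leading_in J f' w' i' \<longrightarrow> (\<exists>(f, w, i)\<in>\<G>. i = i' \<and> mset w \<subseteq># mset w'))"

text \<open>
  Otherwise elements with new leading monomials, divisible by none of the previous ones, could be
  chosen one after the other, against Dickson's lemma.
\<close>

lemma groebner_basis_exists: "\<exists>\<G>. groebner_basis J \<G>"
proof (rule ccontr)
  assume neg: "\<nexists>\<G>. groebner_basis J \<G>"
  define P where "P f n r \<longleftrightarrow> (case r of (g, w, i) \<Rightarrow> leading_in J g w i) \<and>
     (\<forall>y<n. \<not> (snd (snd (f y)) = snd (snd r) \<and> mset (fst (snd (f y))) \<subseteq># mset (fst (snd r))))"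
    for f :: "nat \<Rightarrow> 'm \<times> nat list \<times> nat" and n :: nat and r :: "'m \<times> nat list \<times> nat"
  have "\<exists>f. \<forall>n. P f n (f n)"
  proof (rule dependent_wellorder_choice)
    fix r n and f g :: "nat \<Rightarrow> 'm \<times> nat list \<times> nat" assume "\<And>y. y < n \<Longrightarrow> f y = g y"
    then show "P f n r = P g n r" unfolding P_def by simp
  next
    fix n and f :: "nat \<Rightarrow> 'm \<times> nat list \<times> nat"
    assume prev: "\<And>y. y < n \<Longrightarrow> P f y (f y)"
    have "\<not> groebner_basis J (f ` {..<n})" using neg by blast
    moreover have "\<forall>(g, w, i)\<in>f ` {..<n}. leading_in J g w i" using prev by (auto simp: P_def)
    ultimately obtain g w i where "leading_in J g w i" "\<not> (\<exists>(f', w', i')\<in>f ` {..<n}. i' = i \<and> mset w' \<subseteq># mset w)"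
      unfolding groebner_basis_def by blast
    then have "P f n (g, w, i)" unfolding P_def by (fastforce simp: split_beta)
    then show "\<exists>r. P f n r" by blast
  qed
  then obtain f where f: "\<And>n. P f n (f n)" by blast
  have "\<exists>a b. a < b \<and> mset (fst (snd (f a))) \<subseteq># mset (fst (snd (f b))) \<and> snd (snd (f a)) = snd (snd (f b))"
    by (rule dickson[of _ d _ m]) (use f in \<open>auto simp: P_def leading_in_def split_beta\<close>)
  then show False using f unfolding P_def by blast
qed

text \<open>
  At such a radius each element of the basis is dominated in norm by its leading monomial, and each
  commutator by the product from which it comes. It holds for all large \<open>R\<close> once \<open>B\<close> is large.
\<close>

definition good_radius :: "('m \<times> nat list \<times> nat) set \<Rightarrow> nat \<Rightarrow> real \<Rightarrow> bool" where
  "good_radius \<G> B R \<longleftrightarrow> 1 \<le> B \<and> 1 \<le> R \<and> commutators_bounded R \<and>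
     (\<forall>(f, w, i)\<in>\<G>. f \<ominus>\<^bsub>M\<^esub> mon w i \<in> bounded_below (wpoly d w i) B R (R ^ wt d B w i))"

lemma eventually_good_radius:
  assumes "groebner_basis J \<G>"
  shows "\<forall>\<^sub>F B in sequentially. \<forall>\<^sub>F R in at_top. good_radius \<G> B R"
proof -
  have "\<forall>\<^sub>F B in sequentially. \<forall>t\<in>\<G>. \<forall>\<^sub>F R in at_top.
     fst t \<ominus>\<^bsub>M\<^esub> mon (fst (snd t)) (snd (snd t)) \<in> bounded_below (wpoly d (fst (snd t)) (snd (snd t))) B R (R ^ wt d B (fst (snd t)) (snd (snd t)))"
    using assms by (intro eventually_ball_finite ballI eventually_bounded_below)
      (auto simp: groebner_basis_def leading_in_def)
  moreover have "\<forall>\<^sub>F B in sequentially. 1 \<le> (B::nat)" by (rule eventually_ge_at_top)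
  ultimately show ?thesis
  proof eventually_elim
    case (elim B)
    have "finite \<G>" using assms by (simp add: groebner_basis_def)
    then have "\<forall>\<^sub>F R in at_top. \<forall>t\<in>\<G>.
     fst t \<ominus>\<^bsub>M\<^esub> mon (fst (snd t)) (snd (snd t)) \<in> bounded_below (wpoly d (fst (snd t)) (snd (snd t))) B R (R ^ wt d B (fst (snd t)) (snd (snd t)))"
      using elim by (intro eventually_ball_finite) auto
    then show ?case using eventually_commutators_bounded eventually_ge_at_top[of 1]
      by eventually_elim (use elim in \<open>auto simp: good_radius_def\<close>)
  qed
qed

text \<open>
  Dividing the leading term of an element of \<open>J\<close> by a basis element leaves only terms of smaller
  weight, and the norm bound \<open>\<rho>\<close> is kept.
\<close>

lemma reduction_step:
  assumes J: "left_submodule A M J" and gb: "groebner_basis J \<G>" and good: "good_radius \<G> B R"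
    and lead: "leading_in J f0 w0 i0" and c: "c \<in> carrier K" "abs_K c * R ^ wt d B w0 i0 \<le> \<rho>"
  shows "\<exists>(f, w, i)\<in>\<G>. \<exists>u\<in>lists {..<d}. abs_K c * R ^ (wt d B u 0 + wt d B w i) \<le> \<rho> \<and>
     \<kappa> c \<odot>\<^bsub>M\<^esub> mon w0 i0 \<ominus>\<^bsub>M\<^esub> (\<kappa> c \<otimes> word u) \<odot>\<^bsub>M\<^esub> f \<in> bounded_below (wpoly d w0 i0) B R \<rho>"
proof -
  have w0: "w0 \<in> lists {..<d}" "i0 < m" using lead by (auto simp: leading_in_def)
  obtain f w where fw: "(f, w, i0) \<in> \<G>" "mset w \<subseteq># mset w0"
    using gb lead unfolding groebner_basis_def by fast
  have fw': "f \<in> J" "w \<in> lists {..<d}" "f \<ominus>\<^bsub>M\<^esub> mon w i0 \<in> bounded_below (wpoly d w i0) B R (R ^ wt d B w i0)"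
    "leading_in J f w i0" and R: "1 \<le> R" "1 \<le> B" "commutators_bounded R"
    using gb good fw unfolding groebner_basis_def leading_in_def good_radius_def by fast+
  have f: "f \<in> carrier M" using J fw'(1) by (auto simp: left_submodule_def)
  obtain u where u: "mset w0 = mset (u @ w)" "set u \<subseteq> set w0" using mset_subset_word[OF fw(2)] by blast
  have ul: "u \<in> lists {..<d}" using u(2) w0 by auto
  have eqs: "wpoly d w0 i0 = wpoly d u 0 + wpoly d w i0" "wt d B w0 i0 = wt d B u 0 + wt d B w i0"
    using wpoly_cong[OF u(1)] wt_cong[OF u(1)] by (simp_all add: wpoly_append wt_append)
  have "\<kappa> c \<odot>\<^bsub>M\<^esub> (mon (u @ w) i0 \<ominus>\<^bsub>M\<^esub> mon w0 i0) \<in> bounded_below (wpoly d w0 i0) B R \<rho>"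
    by (rule combs_scale[OF c(1) _ mon_permute[OF R(3,1,2) w0 u(1)]])
       (use R c scale_bound[of c R "wt d B w0 i0" \<rho>] in auto)
  then have 1: "\<kappa> c \<odot>\<^bsub>M\<^esub> mon (u @ w) i0 \<ominus>\<^bsub>M\<^esub> \<kappa> c \<odot>\<^bsub>M\<^esub> mon w0 i0 \<in> bounded_below (wpoly d w0 i0) B R \<rho>"
    using w0 ul fw' c by (simp add: M.smult_diff_right)
  have "(\<kappa> c \<otimes> word u) \<odot>\<^bsub>M\<^esub> (f \<ominus>\<^bsub>M\<^esub> mon w i0) \<in> bounded_below (wpoly d w0 i0) B R \<rho>"
  proof (rule combs_act[OF c(1) ul _ fw'(3)])
    fix a v i assume a: "a \<in> carrier K" and *: "wpoly d v i < wpoly d w i0 \<and> abs_K a * R ^ wt d B v i \<le> R ^ wt d B w i0"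
    then have "abs_K a * R ^ wt d B (u @ v) i \<le> R ^ wt d B w0 i0"
      using R mult_left_mono[of "abs_K a * R ^ wt d B v i" "R ^ wt d B w i0" "R ^ wt d B u 0"]
      by (simp add: eqs wt_append power_add mult_ac)
    then show "wpoly d (u @ v) i < wpoly d w0 i0 \<and> abs_K (c \<otimes>\<^bsub>K\<^esub> a) * R ^ wt d B (u @ v) i \<le> \<rho>"
      using * scale_bound[OF c _ a] R by (simp add: eqs wpoly_append[of d u v])
  qed
  then have 2: "(\<kappa> c \<otimes> word u) \<odot>\<^bsub>M\<^esub> f \<ominus>\<^bsub>M\<^esub> \<kappa> c \<odot>\<^bsub>M\<^esub> mon (u @ w) i0 \<in> bounded_below (wpoly d w0 i0) B R \<rho>"
    using w0 ul fw' c f by (simp add: M.smult_diff_right act_mon)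
  have "((\<kappa> c \<otimes> word u) \<odot>\<^bsub>M\<^esub> f \<ominus>\<^bsub>M\<^esub> \<kappa> c \<odot>\<^bsub>M\<^esub> mon (u @ w) i0) \<oplus>\<^bsub>M\<^esub>
     (\<kappa> c \<odot>\<^bsub>M\<^esub> mon (u @ w) i0 \<ominus>\<^bsub>M\<^esub> \<kappa> c \<odot>\<^bsub>M\<^esub> mon w0 i0) \<in> bounded_below (wpoly d w0 i0) B R \<rho>"
    using combs_add[OF 2 1] .
  then have "(\<kappa> c \<otimes> word u) \<odot>\<^bsub>M\<^esub> f \<ominus>\<^bsub>M\<^esub> \<kappa> c \<odot>\<^bsub>M\<^esub> mon w0 i0 \<in> bounded_below (wpoly d w0 i0) B R \<rho>"
    using w0 ul fw' c f by (subst (asm) M.diff_chain) (auto simp: M.smult_closed)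
  from combs_neg[OF this] have "\<kappa> c \<odot>\<^bsub>M\<^esub> mon w0 i0 \<ominus>\<^bsub>M\<^esub> (\<kappa> c \<otimes> word u) \<odot>\<^bsub>M\<^esub> f \<in> bounded_below (wpoly d w0 i0) B R \<rho>"
    using w0 ul fw' c f by (simp add: M.minus_diff M.smult_closed)
  then show ?thesis using fw(1) ul c(2) eqs(2) by auto
qed

lemma leading_inI:
  assumes J: "left_submodule A M J" and v: "v \<in> J" and c: "c \<in> carrier K" "c \<noteq> \<zero>\<^bsub>K\<^esub>"
    and w: "w \<in> lists {..<d}" "i < m" and l: "v \<ominus>\<^bsub>M\<^esub> \<kappa> c \<odot>\<^bsub>M\<^esub> mon w i \<in> below (wpoly d w i)"
  shows "leading_in J (\<kappa> (inv\<^bsub>K\<^esub> c) \<odot>\<^bsub>M\<^esub> v) w i"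
proof -
  have inv: "inv\<^bsub>K\<^esub> c \<in> carrier K" "inv\<^bsub>K\<^esub> c \<otimes>\<^bsub>K\<^esub> c = \<one>\<^bsub>K\<^esub>"
    using K.field_Units c by auto
  have vM: "v \<in> carrier M" using J v by (auto simp: left_submodule_def)
  have "\<kappa> (inv\<^bsub>K\<^esub> c) \<odot>\<^bsub>M\<^esub> (v \<ominus>\<^bsub>M\<^esub> \<kappa> c \<odot>\<^bsub>M\<^esub> mon w i) \<in> below (wpoly d w i)"
    by (rule combs_scale[OF inv(1) _ l])
  moreover have "\<kappa> (inv\<^bsub>K\<^esub> c) \<odot>\<^bsub>M\<^esub> (\<kappa> c \<odot>\<^bsub>M\<^esub> mon w i) = mon w i"
    using inv c w by (simp add: M.smult_assoc[symmetric] \<kappa>_mult[symmetric] \<kappa>_one M.smult_one)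
  ultimately show ?thesis using inv(1) c(1) w v J vM
    by (simp add: leading_in_def M.smult_diff_right M.smult_closed left_submodule_def)
qed

lemma weight_induct [consumes 2, case_names less]:
  assumes "w \<in> lists {..<d}" "i < m"
    and "\<And>w i. w \<in> lists {..<d} \<Longrightarrow> i < m \<Longrightarrow>
      (\<And>w' i'. w' \<in> lists {..<d} \<Longrightarrow> i' < m \<Longrightarrow> wpoly d w' i' < wpoly d w i \<Longrightarrow> P w' i') \<Longrightarrow> P w i"
  shows "P w i"
proof -
  let ?r = "{((w, i), (w', i')). w \<in> lists {..<d} \<and> w' \<in> lists {..<d} \<and> i < m \<and> i' < m \<and> wpoly d w i < wpoly d w' i'}"
  have "P (fst p) (snd p)" if "fst p \<in> lists {..<d}" "snd p < m" for p
    using wf_wpoly[of d m] that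
  proof (induction p rule: wf_induct_rule)
    case (less p)
    show ?case
    proof (rule assms(3)[OF less.prems])
      fix w' i' assume w': "w' \<in> lists {..<d}" "i' < m" "wpoly d w' i' < wpoly d (fst p) (snd p)"
      obtain w i where p: "p = (w, i)" by (cases p)
      have "((w', i'), p) \<in> ?r" unfolding p using w' less.prems unfolding p fst_conv snd_conv by blast
      from less.IH[OF this] show "P w' i'" using w' by simp
    qed
  qed
  from this[of "(w, i)"] show ?thesis using assms(1,2) by simp
qed

text \<open>
  The bound is imposed on the norm of the multiplier times that of the leading monomial, which at a
  good radius is the norm that the product contributes.
\<close>

definition multiples :: "('m \<times> nat list \<times> nat) set \<Rightarrow> nat \<Rightarrow> real \<Rightarrow> real \<Rightarrow> 'm set" where
  "multiples \<G> B R \<rho> = {(\<kappa> c \<otimes> word u) \<odot>\<^bsub>M\<^esub> f | c u f w i. c \<in> carrier K \<and> u \<in> lists {..<d} \<and>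
      (f, w, i) \<in> \<G> \<and> abs_K c * R ^ (wt d B u 0 + wt d B w i) \<le> \<rho>}"

text \<open>
  Induction over the maximal weight: the leading term is removed by \<open>reduction_step\<close>, and the bound
  \<open>\<rho>\<close> does not deteriorate. The basis is the same for all good radii.
\<close>

lemma groebner_division:
  assumes J: "left_submodule A M J" and gb: "groebner_basis J \<G>" and good: "good_radius \<G> B R"
    and \<rho>: "0 \<le> \<rho>" and v: "v \<in> J" "v \<in> bounded B R \<rho>"
  shows "v \<in> add_span M (multiples \<G> B R \<rho>)"
proof -
  have R: "1 \<le> R" "1 \<le> B" "commutators_bounded R" using good by (auto simp: good_radius_def)
  have *: "\<forall>v\<in>J. v \<in> bounded_upto (wpoly d w0 i0) B R \<rho> \<longrightarrow> v \<in> add_span M (multiples \<G> B R \<rho>)"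
    if "w0 \<in> lists {..<d}" "i0 < m" for w0 i0
    using that
  proof (induction w0 i0 rule: weight_induct)
    case (less w0 i0)
    have below: "v \<in> add_span M (multiples \<G> B R \<rho>)" if "v \<in> J" "v \<in> bounded_below (wpoly d w0 i0) B R \<rho>" for v
      using combs_max_weight[where P = "\<lambda>t. t < wpoly d w0 i0", OF that(2)] less.IH that(1) add_span.zero by blast
    show ?case
    proof (intro ballI impI)
      fix v assume v: "v \<in> J" "v \<in> bounded_upto (wpoly d w0 i0) B R \<rho>"
      obtain c where c: "c \<in> carrier K" "abs_K c * R ^ wt d B w0 i0 \<le> \<rho>"
        and l: "v \<ominus>\<^bsub>M\<^esub> \<kappa> c \<odot>\<^bsub>M\<^esub> mon w0 i0 \<in> bounded_below (wpoly d w0 i0) B R \<rho>"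
        using leading_term[OF R(3,1,2) less.hyps \<rho> v(2)] by blast
      have vM: "v \<in> carrier M" using combs_closed v by blast
      show "v \<in> add_span M (multiples \<G> B R \<rho>)"
      proof (cases "c = \<zero>\<^bsub>K\<^esub>")
        case True
        then have "v \<in> bounded_below (wpoly d w0 i0) B R \<rho>"
          using l less.hyps vM by (simp add: \<kappa>_zero M.smult_zero_left M.diff_zero)
        then show ?thesis using below v by blast
      next
        case False
        have "leading_in J (\<kappa> (inv\<^bsub>K\<^esub> c) \<odot>\<^bsub>M\<^esub> v) w0 i0"
          by (rule leading_inI[OF J v(1) c(1) False less.hyps combs_mono[OF _ l]]) auto
        from reduction_step[OF J gb good this c] obtain f w i u where
          g: "(f, w, i) \<in> \<G>" "u \<in> lists {..<d}" "abs_K c * R ^ (wt d B u 0 + wt d B w i) \<le> \<rho>"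
          and r: "\<kappa> c \<odot>\<^bsub>M\<^esub> mon w0 i0 \<ominus>\<^bsub>M\<^esub> (\<kappa> c \<otimes> word u) \<odot>\<^bsub>M\<^esub> f \<in> bounded_below (wpoly d w0 i0) B R \<rho>"
          by blast
        let ?g = "(\<kappa> c \<otimes> word u) \<odot>\<^bsub>M\<^esub> f"
        have f: "f \<in> J" using gb g(1) by (auto simp: groebner_basis_def leading_in_def)
        then have gJ1: "?g \<in> J" using J c g by (simp add: left_submodule_def)
        then have gJ: "?g \<in> J" "?g \<in> carrier M" using J by (auto simp: left_submodule_def)
        have "(v \<ominus>\<^bsub>M\<^esub> \<kappa> c \<odot>\<^bsub>M\<^esub> mon w0 i0) \<oplus>\<^bsub>M\<^esub> (\<kappa> c \<odot>\<^bsub>M\<^esub> mon w0 i0 \<ominus>\<^bsub>M\<^esub> ?g) = v \<ominus>\<^bsub>M\<^esub> ?g"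
          using vM gJ c less.hyps by (intro M.diff_chain) (auto simp: M.smult_closed)
        then have "v \<ominus>\<^bsub>M\<^esub> ?g \<in> bounded_below (wpoly d w0 i0) B R \<rho>" using combs_add[OF l r] by simp
        then have "v \<ominus>\<^bsub>M\<^esub> ?g \<in> add_span M (multiples \<G> B R \<rho>)"
          using below M.left_submodule_diff[OF J v(1) gJ(1)] by blast
        moreover have "?g \<in> add_span M (multiples \<G> B R \<rho>)"
          unfolding multiples_def by (rule add_span.incl) (use g c in blast)
        ultimately have "(v \<ominus>\<^bsub>M\<^esub> ?g) \<oplus>\<^bsub>M\<^esub> ?g \<in> add_span M (multiples \<G> B R \<rho>)" by (rule add_span.add)
        then show ?thesis using M.diff_add_cancel vM gJ by simp
      qed
    qed
  qed
  have "v \<in> combs (\<lambda>c w i. True \<and> abs_K c * R ^ wt d B w i \<le> \<rho>)" using v by simp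
  from combs_max_weight[where P = "\<lambda>_. True", OF this] show ?thesis using * v(1) add_span.zero by blast
qed

text \<open>
  The monomial \<open>e 0\<close> is the smallest of all. Reducing \<open>v \<ominus> e 0\<close> by elements of \<open>J\<close> keeps its form
  and its norm bound while lowering its weight, until it is a multiple \<open>c\<close> of \<open>e 0\<close> with \<open>\<bar>c\<bar> < 1\<close>.
  Then \<open>1 + c\<close> is invertible, and \<open>e 0\<close> would be in \<open>J\<close>.
\<close>

lemma generator_not_close:
  assumes J: "left_submodule A M J" and gb: "groebner_basis J \<G>" and good: "good_radius \<G> B R"
    and m: "0 < m" and e: "e 0 \<notin> J" and \<rho>: "0 \<le> \<rho>" "\<rho> < 1" and v: "v \<in> J"
  shows "v \<ominus>\<^bsub>M\<^esub> e 0 \<notin> bounded B R \<rho>"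
proof
  assume vb: "v \<ominus>\<^bsub>M\<^esub> e 0 \<in> bounded B R \<rho>"
  have R: "1 \<le> R" "1 \<le> B" "commutators_bounded R" using good by (auto simp: good_radius_def)
  have e0: "mon [] 0 = e 0" "e 0 \<in> carrier M" using e_closed m by (auto simp: mon_def M.smult_one)
  have nz: "v \<ominus>\<^bsub>M\<^esub> e 0 \<noteq> \<zero>\<^bsub>M\<^esub>" if "v \<in> J" for v
    using that e e0 M.diff_eq_zero[of v "e 0"] J by (auto simp: left_submodule_def)
  have *: "\<forall>v\<in>J. v \<ominus>\<^bsub>M\<^esub> e 0 \<notin> bounded_upto (wpoly d w0 i0) B R \<rho>"
    if "w0 \<in> lists {..<d}" "i0 < m" for w0 i0
    using that
  proof (induction w0 i0 rule: weight_induct)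
    case (less w0 i0)
    have below: "v \<ominus>\<^bsub>M\<^esub> e 0 \<notin> bounded_below (wpoly d w0 i0) B R \<rho>" if "v \<in> J" for v
    proof
      assume "v \<ominus>\<^bsub>M\<^esub> e 0 \<in> bounded_below (wpoly d w0 i0) B R \<rho>"
      from combs_max_weight[where P = "\<lambda>t. t < wpoly d w0 i0", OF this] show False
        using less.IH that nz[OF that] by blast
    qed
    show ?case
    proof (intro ballI notI)
      fix v assume v: "v \<in> J" "v \<ominus>\<^bsub>M\<^esub> e 0 \<in> bounded_upto (wpoly d w0 i0) B R \<rho>"
      obtain c where c: "c \<in> carrier K" "abs_K c * R ^ wt d B w0 i0 \<le> \<rho>"
        and l: "(v \<ominus>\<^bsub>M\<^esub> e 0) \<ominus>\<^bsub>M\<^esub> \<kappa> c \<odot>\<^bsub>M\<^esub> mon w0 i0 \<in> bounded_below (wpoly d w0 i0) B R \<rho>"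
        using leading_term[OF R(3,1,2) less.hyps \<rho>(1) v(2)] by blast
      have vM: "v \<in> carrier M" using J v by (auto simp: left_submodule_def)
      have c0: "c \<noteq> \<zero>\<^bsub>K\<^esub>"
      proof
        assume "c = \<zero>\<^bsub>K\<^esub>"
        then have "\<kappa> c \<odot>\<^bsub>M\<^esub> mon w0 i0 = \<zero>\<^bsub>M\<^esub>" using less.hyps by (simp add: \<kappa>_zero M.smult_zero_left)
        then show False using l below[OF v(1)] vM e0 by (simp add: M.diff_zero)
      qed
      show False
      proof (cases "wpoly d w0 i0 = wpoly d [] 0")
        case True
        have "mset w0 = mset []" "i0 = 0" using wpoly_inj[OF less.hyps(1) _ True] by auto
        then have w0: "w0 = []" "i0 = 0" by auto
        have "\<not> wpoly d w' i' < wpoly d [] 0" for w' i' using wpoly_min[of d w' i'] by simp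
        then have "(v \<ominus>\<^bsub>M\<^esub> e 0) \<ominus>\<^bsub>M\<^esub> \<kappa> c \<odot>\<^bsub>M\<^esub> e 0 = \<zero>\<^bsub>M\<^esub>"
          using combs_max_weight[where P = "\<lambda>t. t < wpoly d w0 i0", OF l] unfolding w0 e0 by blast
        then have "v = e 0 \<oplus>\<^bsub>M\<^esub> \<kappa> c \<odot>\<^bsub>M\<^esub> e 0"
          using M.diff_eq_zero[of "v \<ominus>\<^bsub>M\<^esub> e 0" "\<kappa> c \<odot>\<^bsub>M\<^esub> e 0"] vM e0 c M.diff_add_cancel[of v "e 0"]
          by (simp add: M.smult_closed M.a_comm)
        then have ve: "v = \<kappa> (\<one>\<^bsub>K\<^esub> \<oplus>\<^bsub>K\<^esub> c) \<odot>\<^bsub>M\<^esub> e 0"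
          using c e0 by (simp add: \<kappa>_add \<kappa>_one M.smult_add_scalar M.smult_one)
        have "abs_K c < 1" using c(2) \<rho>(2) w0 by (simp add: wt_def)
        then have "\<one>\<^bsub>K\<^esub> \<oplus>\<^bsub>K\<^esub> c \<noteq> \<zero>\<^bsub>K\<^esub>"
          using abs_neg[of c] abs_one c(1) K.minus_equality[of "\<one>\<^bsub>K\<^esub>" c] by (metis K.one_closed less_irrefl)
        then have inv: "inv\<^bsub>K\<^esub> (\<one>\<^bsub>K\<^esub> \<oplus>\<^bsub>K\<^esub> c) \<in> carrier K"
            "inv\<^bsub>K\<^esub> (\<one>\<^bsub>K\<^esub> \<oplus>\<^bsub>K\<^esub> c) \<otimes>\<^bsub>K\<^esub> (\<one>\<^bsub>K\<^esub> \<oplus>\<^bsub>K\<^esub> c) = \<one>\<^bsub>K\<^esub>"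
          using K.field_Units c by auto
        have "\<kappa> (inv\<^bsub>K\<^esub> (\<one>\<^bsub>K\<^esub> \<oplus>\<^bsub>K\<^esub> c)) \<odot>\<^bsub>M\<^esub> v = e 0"
          using inv c e0 ve by (simp add: M.smult_assoc[symmetric] \<kappa>_mult[symmetric] \<kappa>_one M.smult_one)
        moreover have "\<kappa> (inv\<^bsub>K\<^esub> (\<one>\<^bsub>K\<^esub> \<oplus>\<^bsub>K\<^esub> c)) \<odot>\<^bsub>M\<^esub> v \<in> J"
          using J v(1) inv(1) by (simp add: left_submodule_def)
        ultimately show False using e by simp
      next
        case False
        have "wpoly d [] 0 \<le> wpoly d w0 i0" by (rule wpoly_min)
        then have lt: "wpoly d [] 0 < wpoly d w0 i0" using False by simp
        have "\<kappa> \<one>\<^bsub>K\<^esub> \<odot>\<^bsub>M\<^esub> mon [] 0 \<in> below (wpoly d w0 i0)"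
          by (rule term_in_combs) (use lt m in auto)
        then have "e 0 \<in> below (wpoly d w0 i0)" using e0 by (simp add: \<kappa>_one M.smult_one)
        moreover have "(v \<ominus>\<^bsub>M\<^esub> e 0) \<ominus>\<^bsub>M\<^esub> \<kappa> c \<odot>\<^bsub>M\<^esub> mon w0 i0 \<in> below (wpoly d w0 i0)"
          by (rule combs_mono[OF _ l]) auto
        ultimately have "((v \<ominus>\<^bsub>M\<^esub> e 0) \<ominus>\<^bsub>M\<^esub> \<kappa> c \<odot>\<^bsub>M\<^esub> mon w0 i0) \<oplus>\<^bsub>M\<^esub> e 0 \<in> below (wpoly d w0 i0)"
          by (rule combs_add[rotated])
        moreover have "((v \<ominus>\<^bsub>M\<^esub> e 0) \<ominus>\<^bsub>M\<^esub> \<kappa> c \<odot>\<^bsub>M\<^esub> mon w0 i0) \<oplus>\<^bsub>M\<^esub> e 0 = v \<ominus>\<^bsub>M\<^esub> \<kappa> c \<odot>\<^bsub>M\<^esub> mon w0 i0"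
          using vM e0 c less.hyps by (simp add: M.minus_eq M.a_ac M.smult_closed M.r_neg2 M.r_neg1 M.l_neg M.r_neg)
        ultimately have "leading_in J (\<kappa> (inv\<^bsub>K\<^esub> c) \<odot>\<^bsub>M\<^esub> v) w0 i0"
          using leading_inI[OF J v(1) c(1) c0 less.hyps] by simp
        from reduction_step[OF J gb good this c] obtain f w i u where
          g: "(f, w, i) \<in> \<G>" "u \<in> lists {..<d}"
          and r: "\<kappa> c \<odot>\<^bsub>M\<^esub> mon w0 i0 \<ominus>\<^bsub>M\<^esub> (\<kappa> c \<otimes> word u) \<odot>\<^bsub>M\<^esub> f \<in> bounded_below (wpoly d w0 i0) B R \<rho>"
          by blast
        let ?g = "(\<kappa> c \<otimes> word u) \<odot>\<^bsub>M\<^esub> f"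
        have "f \<in> J" using gb g(1) by (auto simp: groebner_basis_def leading_in_def)
        then have gJ1: "?g \<in> J" using J c g by (simp add: left_submodule_def)
        then have gJ: "?g \<in> J" "?g \<in> carrier M" using J by (auto simp: left_submodule_def)
        have "((v \<ominus>\<^bsub>M\<^esub> e 0) \<ominus>\<^bsub>M\<^esub> \<kappa> c \<odot>\<^bsub>M\<^esub> mon w0 i0) \<oplus>\<^bsub>M\<^esub> (\<kappa> c \<odot>\<^bsub>M\<^esub> mon w0 i0 \<ominus>\<^bsub>M\<^esub> ?g) = (v \<ominus>\<^bsub>M\<^esub> e 0) \<ominus>\<^bsub>M\<^esub> ?g"
          using vM gJ c less.hyps e0 by (intro M.diff_chain) (auto simp: M.smult_closed)
        moreover have "(v \<ominus>\<^bsub>M\<^esub> e 0) \<ominus>\<^bsub>M\<^esub> ?g = (v \<ominus>\<^bsub>M\<^esub> ?g) \<ominus>\<^bsub>M\<^esub> e 0"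
          using vM gJ e0 by (simp add: M.minus_eq M.a_ac)
        ultimately have "(v \<ominus>\<^bsub>M\<^esub> ?g) \<ominus>\<^bsub>M\<^esub> e 0 \<in> bounded_below (wpoly d w0 i0) B R \<rho>" using combs_add[OF l r] by simp
        then show False using below M.left_submodule_diff[OF J v(1) gJ(1)] by blast
      qed
    qed
  qed
  have "v \<ominus>\<^bsub>M\<^esub> e 0 \<in> combs (\<lambda>c w i. True \<and> abs_K c * R ^ wt d B w i \<le> \<rho>)" using vb by simp
  from combs_max_weight[where P = "\<lambda>_. True", OF this] show False using * v nz[OF v] by blast
qed

end

section \<open>Null sequences\<close>

text \<open>
  For each index the deepest neighbourhood among the first ones that still contains a solution is
  used. So solutions that exist for each neighbourhood separately can be combined into one sequence
  tending to \<open>0\<close>.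
\<close>

lemma diagonal_choice:
  assumes ex: "\<And>n::nat. \<exists>s. \<Phi> n s" and ev: "\<And>k::nat. \<exists>N. \<forall>n\<ge>N. \<exists>s. \<Phi> n s \<and> s \<in> U k"
    and dec: "\<And>k. U (Suc k) \<subseteq> U k"
  shows "\<exists>s. (\<forall>n. \<Phi> n (s n)) \<and> (\<forall>k. \<exists>N. \<forall>n\<ge>N. s n \<in> U k)"
proof -
  have U: "U m \<subseteq> U k" if "k \<le> m" for k m using dec that by (rule lift_Suc_antimono_le)
  have "\<exists>s. \<Phi> n s \<and> (\<forall>k\<le>n. (\<exists>s'. \<Phi> n s' \<and> s' \<in> U k) \<longrightarrow> s \<in> U k)" for n
  proof -
    let ?S = "{k. k \<le> n \<and> (\<exists>s'. \<Phi> n s' \<and> s' \<in> U k)}"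
    show ?thesis
    proof (cases "?S = {}")
      case True then show ?thesis using ex[of n] by blast
    next
      case False
      have fin: "finite ?S" by (rule finite_subset[of _ "{..n}"]) auto
      then have "Max ?S \<in> ?S" using False by (rule Max_in)
      then obtain s where s: "\<Phi> n s" "s \<in> U (Max ?S)" by blast
      have "k \<le> Max ?S" if "k \<in> ?S" for k using fin that by simp
      then have "s \<in> U k" if "k \<in> ?S" for k using s(2) U that by blast
      then show ?thesis using s(1) by blast
    qed
  qed
  then obtain s where s: "\<And>n. \<Phi> n (s n)" "\<And>n k. k \<le> n \<Longrightarrow> \<exists>s'. \<Phi> n s' \<and> s' \<in> U k \<Longrightarrow> s n \<in> U k"
    by metis
  have "\<exists>N. \<forall>n\<ge>N. s n \<in> U k" for k
  proof -
    obtain N where N: "\<forall>n\<ge>N. \<exists>s. \<Phi> n s \<and> s \<in> U k" using ev by blast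
    have "\<forall>n\<ge>max N k. s n \<in> U k" using N s(2) by simp
    then show ?thesis by blast
  qed
  then show ?thesis using s(1) by blast
qed

definition free_module :: "('a, 'y) ring_scheme \<Rightarrow> nat \<Rightarrow> ('a, nat \<Rightarrow> 'a) module" where
  "free_module A p = \<lparr>carrier = {v. (\<forall>l<p. v l \<in> carrier A) \<and> (\<forall>l\<ge>p. v l = \<zero>\<^bsub>A\<^esub>)},
     monoid.mult = (\<lambda>_ v. v), monoid.one = (\<lambda>_. \<zero>\<^bsub>A\<^esub>), ring.zero = (\<lambda>_. \<zero>\<^bsub>A\<^esub>),
     ring.add = (\<lambda>v w l. v l \<oplus>\<^bsub>A\<^esub> w l), module.smult = (\<lambda>a v l. a \<otimes>\<^bsub>A\<^esub> v l)\<rparr>"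

definition unit_vector :: "('a, 'y) ring_scheme \<Rightarrow> nat \<Rightarrow> nat \<Rightarrow> 'a" where
  "unit_vector A i = (\<lambda>l. if l = i then \<one>\<^bsub>A\<^esub> else \<zero>\<^bsub>A\<^esub>)"

lemma free_module_simps [simp]:
  "v \<in> carrier (free_module A p) \<longleftrightarrow> (\<forall>l<p. v l \<in> carrier A) \<and> (\<forall>l\<ge>p. v l = \<zero>\<^bsub>A\<^esub>)"
  "\<zero>\<^bsub>free_module A p\<^esub> = (\<lambda>_. \<zero>\<^bsub>A\<^esub>)"
  "v \<oplus>\<^bsub>free_module A p\<^esub> w = (\<lambda>l. v l \<oplus>\<^bsub>A\<^esub> w l)"
  "a \<odot>\<^bsub>free_module A p\<^esub> v = (\<lambda>l. a \<otimes>\<^bsub>A\<^esub> v l)"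
  by (simp_all add: free_module_def)

lemma (in ring) free_module_coord:
  "v \<in> carrier (free_module R p) \<Longrightarrow> v l \<in> carrier R"
  by (cases "l < p") auto

lemma (in ring) free_module_is_left_module: "left_module R (free_module R p)"
proof -
  have grp: "abelian_group (free_module R p)"
  proof (rule abelian_groupI)
    fix v assume "v \<in> carrier (free_module R p)"
    then show "\<exists>w\<in>carrier (free_module R p). w \<oplus>\<^bsub>free_module R p\<^esub> v = \<zero>\<^bsub>free_module R p\<^esub>"
      using free_module_coord by (intro bexI[of _ "\<lambda>l. \<ominus> v l"]) (auto simp: l_neg)
  next
    fix u v w assume "u \<in> carrier (free_module R p)" "v \<in> carrier (free_module R p)" "w \<in> carrier (free_module R p)"
    then have "u l \<in> carrier R \<and> v l \<in> carrier R \<and> w l \<in> carrier R" for l using free_module_coord by blast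
    then show "u \<oplus>\<^bsub>free_module R p\<^esub> v \<oplus>\<^bsub>free_module R p\<^esub> w = u \<oplus>\<^bsub>free_module R p\<^esub> (v \<oplus>\<^bsub>free_module R p\<^esub> w)"
      by (simp add: a_assoc)
  next
    fix u v assume "u \<in> carrier (free_module R p)" "v \<in> carrier (free_module R p)"
    then have "u l \<in> carrier R \<and> v l \<in> carrier R" for l using free_module_coord by blast
    then show "u \<oplus>\<^bsub>free_module R p\<^esub> v = v \<oplus>\<^bsub>free_module R p\<^esub> u"
      by (simp add: a_comm)
  next
    fix u assume "u \<in> carrier (free_module R p)"
    then have "u l \<in> carrier R" for l using free_module_coord by blast
    then show "\<zero>\<^bsub>free_module R p\<^esub> \<oplus>\<^bsub>free_module R p\<^esub> u = u" by simp
  qed auto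
  show ?thesis
    unfolding left_module_def left_module_axioms_def one_sided_module_def one_sided_module_axioms_def
  proof (intro conjI allI impI ring_axioms grp)
    fix a b v assume a: "a \<in> carrier R" "b \<in> carrier R" and v: "v \<in> carrier (free_module R p)"
    have vl: "v l \<in> carrier R" for l using free_module_coord[OF v] .
    show "(a \<oplus> b) \<odot>\<^bsub>free_module R p\<^esub> v = a \<odot>\<^bsub>free_module R p\<^esub> v \<oplus>\<^bsub>free_module R p\<^esub> b \<odot>\<^bsub>free_module R p\<^esub> v"
      using a vl by (simp add: l_distr)
    show "(a \<otimes> b) \<odot>\<^bsub>free_module R p\<^esub> v = a \<odot>\<^bsub>free_module R p\<^esub> (b \<odot>\<^bsub>free_module R p\<^esub> v)"
      using a vl by (simp add: m_assoc)
  next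
    fix a v w assume a: "a \<in> carrier R" and v: "v \<in> carrier (free_module R p)" "w \<in> carrier (free_module R p)"
    have vl: "v l \<in> carrier R \<and> w l \<in> carrier R" for l using free_module_coord v by blast
    show "a \<odot>\<^bsub>free_module R p\<^esub> (v \<oplus>\<^bsub>free_module R p\<^esub> w) = a \<odot>\<^bsub>free_module R p\<^esub> v \<oplus>\<^bsub>free_module R p\<^esub> a \<odot>\<^bsub>free_module R p\<^esub> w"
      using a vl by (simp add: r_distr)
  next
    fix v assume v: "v \<in> carrier (free_module R p)"
    have vl: "v l \<in> carrier R" for l using free_module_coord[OF v] .
    show "\<one> \<odot>\<^bsub>free_module R p\<^esub> v = v" using vl by simp
  qed auto
qed

lemma (in ring) free_module_minus:
  assumes "v \<in> carrier (free_module R p)" "w \<in> carrier (free_module R p)"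
  shows "(v \<ominus>\<^bsub>free_module R p\<^esub> w) l = v l \<ominus> w l"
proof -
  interpret F: left_module R "free_module R p" by (rule free_module_is_left_module)
  show ?thesis
    by (rule additive_map_facts(3)[of "free_module R p" R "\<lambda>v. v l"])
      (use assms in \<open>auto simp: F.M.abelian_group_axioms abelian_group_axioms free_module_coord simp del: free_module_simps(1)\<close>)
qed

context commutator_algebra
begin

text \<open>
  Up to its boundary, the ball of radius \<open>\<rho>\<close> of the gauge seminorm with parameters \<open>B\<close> and \<open>R\<close>.
\<close>

definition nbhd :: "nat \<Rightarrow> real \<Rightarrow> real \<Rightarrow> 'a set" where
  "nbhd B R \<rho> = add_span A {\<kappa> c \<otimes> word w | c w. c \<in> carrier K \<and> w \<in> lists {..<d} \<and> abs_K c * R ^ wt d B w 0 \<le> \<rho>}"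

lemma nbhd_closed: "a \<in> nbhd B R \<rho> \<Longrightarrow> a \<in> carrier A"
  unfolding nbhd_def by (erule A.add_span_closed[rotated]) (use A.m_closed word_closed \<kappa>_closed in blast)

lemma nbhd_zero: "\<zero> \<in> nbhd B R \<rho>"
  and nbhd_add: "a \<in> nbhd B R \<rho> \<Longrightarrow> b \<in> nbhd B R \<rho> \<Longrightarrow> a \<oplus> b \<in> nbhd B R \<rho>"
  and nbhd_neg: "a \<in> nbhd B R \<rho> \<Longrightarrow> \<ominus> a \<in> nbhd B R \<rho>"
  unfolding nbhd_def by (auto intro: add_span.intros add_span_diff)

lemma word_nbhd: "c \<in> carrier K \<Longrightarrow> w \<in> lists {..<d} \<Longrightarrow> abs_K c * R ^ wt d B w 0 \<le> \<rho> \<Longrightarrow> \<kappa> c \<otimes> word w \<in> nbhd B R \<rho>"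
  unfolding nbhd_def by (rule add_span.incl) blast

lemma nbhd_subset:
  assumes "\<And>c w. c \<in> carrier K \<Longrightarrow> w \<in> lists {..<d} \<Longrightarrow> abs_K c * R ^ wt d B w 0 \<le> \<rho> \<Longrightarrow> abs_K c * R' ^ wt d B' w 0 \<le> \<rho>'"
  shows "nbhd B R \<rho> \<subseteq> nbhd B' R' \<rho>'"
  unfolding nbhd_def by (rule add_span_mono) (use assms in blast)

lemma nbhd_mono:
  assumes "0 \<le> R'" "R' \<le> R" "\<rho> \<le> \<rho>'" shows "nbhd B R \<rho> \<subseteq> nbhd B R' \<rho>'"
proof (rule nbhd_subset)
  fix c w assume c: "c \<in> carrier K" "abs_K c * R ^ wt d B w 0 \<le> \<rho>"
  have "abs_K c * R' ^ wt d B w 0 \<le> abs_K c * R ^ wt d B w 0"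
    using assms c K.nonneg by (intro mult_left_mono power_mono) auto
  then show "abs_K c * R' ^ wt d B w 0 \<le> \<rho>'" using c assms by simp
qed

lemma nbhd_mult:
  assumes R: "0 \<le> R" and \<rho>: "0 \<le> \<rho>" and ab: "a \<in> nbhd B R \<rho>" "b \<in> nbhd B R \<tau>"
  shows "a \<otimes> b \<in> nbhd B R (\<rho> * \<tau>)"
proof -
  have 1: "(\<kappa> c \<otimes> word w) \<otimes> b \<in> nbhd B R (\<rho> * \<tau>)"
    if c: "c \<in> carrier K" "w \<in> lists {..<d}" "abs_K c * R ^ wt d B w 0 \<le> \<rho>" for c w
    unfolding nbhd_def
  proof (rule add_span_image[OF A.abelian_group_axioms A.abelian_group_axioms, where f = "\<lambda>b. \<kappa> c \<otimes> word w \<otimes> b"])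
    show "b \<in> add_span A {\<kappa> c \<otimes> word w | c w. c \<in> carrier K \<and> w \<in> lists {..<d} \<and> abs_K c * R ^ wt d B w 0 \<le> \<tau>}"
      using ab(2) by (simp add: nbhd_def)
    fix s assume "s \<in> {\<kappa> c \<otimes> word w | c w. c \<in> carrier K \<and> w \<in> lists {..<d} \<and> abs_K c * R ^ wt d B w 0 \<le> \<tau>}"
    then obtain c' w' where s: "s = \<kappa> c' \<otimes> word w'" "c' \<in> carrier K" "w' \<in> lists {..<d}" "abs_K c' * R ^ wt d B w' 0 \<le> \<tau>"
      by blast
    have "abs_K (c \<otimes>\<^bsub>K\<^esub> c') * R ^ wt d B (w @ w') 0 = (abs_K c * R ^ wt d B w 0) * (abs_K c' * R ^ wt d B w' 0)"
      using c s by (simp add: K.multiplicative wt_append power_add mult_ac)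
    also have "\<dots> \<le> \<rho> * \<tau>" using c s \<rho> R K.nonneg[of c'] by (intro mult_mono) auto
    finally have "\<kappa> (c \<otimes>\<^bsub>K\<^esub> c') \<otimes> word (w @ w') \<in> nbhd B R (\<rho> * \<tau>)" using c s by (intro word_nbhd) auto
    then show "(\<kappa> c \<otimes> word w) \<otimes> s \<in> add_span A {\<kappa> c \<otimes> word w | c w. c \<in> carrier K \<and> w \<in> lists {..<d} \<and> abs_K c * R ^ wt d B w 0 \<le> \<rho> * \<tau>}"
      using c s by (simp add: scaled_word_mult nbhd_def)
  next
    show "{\<kappa> c \<otimes> word w | c w. c \<in> carrier K \<and> w \<in> lists {..<d} \<and> abs_K c * R ^ wt d B w 0 \<le> \<tau>} \<subseteq> carrier A"
      using A.m_closed word_closed \<kappa>_closed by blast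
  qed (use c in \<open>simp_all add: r_distr\<close>)
  show ?thesis unfolding nbhd_def
  proof (rule add_span_image[OF A.abelian_group_axioms A.abelian_group_axioms, where f = "\<lambda>a. a \<otimes> b"])
    show "a \<in> add_span A {\<kappa> c \<otimes> word w | c w. c \<in> carrier K \<and> w \<in> lists {..<d} \<and> abs_K c * R ^ wt d B w 0 \<le> \<rho>}"
      using ab(1) by (simp add: nbhd_def)
    fix s assume "s \<in> {\<kappa> c \<otimes> word w | c w. c \<in> carrier K \<and> w \<in> lists {..<d} \<and> abs_K c * R ^ wt d B w 0 \<le> \<rho>}"
    then show "s \<otimes> b \<in> add_span A {\<kappa> c \<otimes> word w | c w. c \<in> carrier K \<and> w \<in> lists {..<d} \<and> abs_K c * R ^ wt d B w 0 \<le> \<rho> * \<tau>}"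
      using 1 unfolding nbhd_def by blast
  next
    show "{\<kappa> c \<otimes> word w | c w. c \<in> carrier K \<and> w \<in> lists {..<d} \<and> abs_K c * R ^ wt d B w 0 \<le> \<rho>} \<subseteq> carrier A"
      using A.m_closed word_closed \<kappa>_closed by blast
  qed (use nbhd_closed[OF ab(2)] in \<open>simp_all add: l_distr\<close>)
qed

lemma nbhd_exists:
  assumes "a \<in> carrier A" shows "\<exists>\<rho>>0. a \<in> nbhd B R \<rho>"
proof -
  have "a \<in> add_span A {\<kappa> c \<otimes> word w | c w. c \<in> carrier K \<and> w \<in> lists {..<d}}"
    using spanning assms by (auto simp: word_def)
  then have "\<forall>\<^sub>F \<rho> in at_top. a \<in> nbhd B R \<rho>"
  proof induction
    case (incl s)
    then obtain c w where s: "s = \<kappa> c \<otimes> word w" "c \<in> carrier K" "w \<in> lists {..<d}" by blast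
    show ?case using eventually_ge_at_top[of "abs_K c * R ^ wt d B w 0"]
      by eventually_elim (use s in \<open>auto intro: word_nbhd\<close>)
  next
    case (add a b)
    show ?case using add.IH by eventually_elim (rule nbhd_add)
  next
    case (neg a)
    show ?case using neg.IH by eventually_elim (rule nbhd_neg)
  qed (simp add: nbhd_zero)
  then have "\<forall>\<^sub>F \<rho> in at_top. a \<in> nbhd B R \<rho> \<and> \<rho> > 0" using eventually_gt_at_top[of 0] by eventually_elim simp
  then show ?thesis using eventually_happens'[OF trivial_limit_at_top_linorder] by blast
qed

text \<open>
  Weights for different values of \<open>B\<close> are comparable up to a factor, so a change of \<open>B\<close> amounts to a
  change of \<open>R\<close> and all values of \<open>B\<close> define the same topology.
\<close>

lemma wt_compare: "1 \<le> B \<Longrightarrow> wt d B' w 0 \<le> (B' ^ Suc d + (\<Sum>k\<in>{..<d}. B' ^ Suc k)) * wt d B w 0" if "w \<in> lists {..<d}"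
  using that
proof (induction w rule: list.induct)
  case (Cons k w)
  have "B' ^ Suc k \<le> (\<Sum>k\<in>{..<d}. B' ^ Suc k)" using Cons.prems by (intro member_le_sum) auto
  then have a: "B' ^ Suc d + B' ^ Suc k \<le> B' ^ Suc d + (\<Sum>k\<in>{..<d}. B' ^ Suc k)" by simp
  have "1 \<le> B ^ Suc d" using Cons.prems(1) by (simp only: one_le_power)
  then have b: "1 \<le> B ^ Suc d + B ^ Suc k" by linarith
  have "B' ^ Suc d + B' ^ Suc k \<le> (B' ^ Suc d + (\<Sum>k\<in>{..<d}. B' ^ Suc k)) * (B ^ Suc d + B ^ Suc k)"
    using mult_le_mono[OF a b] by simp
  then show ?case using Cons by (simp add: wt_Cons distrib_left del: power_Suc)
qed (simp add: wt_def)

text \<open>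
  Quantifying over all \<open>B\<close> makes the notion independent of the \<open>B\<close> that the Groebner basis at hand
  requires.
\<close>

definition null :: "(nat \<Rightarrow> 'a) \<Rightarrow> bool" where
  "null \<gamma> \<longleftrightarrow> (\<forall>B\<ge>1. \<forall>R\<ge>1. \<forall>\<epsilon>>0. \<forall>\<^sub>F n in sequentially. \<gamma> n \<in> nbhd B R \<epsilon>)"

lemma nullD: "null \<gamma> \<Longrightarrow> 1 \<le> B \<Longrightarrow> 1 \<le> R \<Longrightarrow> 0 < \<epsilon> \<Longrightarrow> \<forall>\<^sub>F n in sequentially. \<gamma> n \<in> nbhd B R \<epsilon>"
  by (simp add: null_def)

lemma nullI_one_weight:
  assumes B: "1 \<le> B" and "\<And>k. \<exists>N. \<forall>n\<ge>N. \<gamma> n \<in> nbhd B (R0 + real k) (1 / (real k + 1))"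
  shows "null \<gamma>"
  unfolding null_def
proof (intro allI impI)
  fix B' :: nat and R \<epsilon> :: real assume R: "1 \<le> R" and e: "0 < \<epsilon>"
  let ?C = "B' ^ Suc d + (\<Sum>k\<in>{..<d}. B' ^ Suc k)"
  obtain k :: nat where k: "real k \<ge> max (R ^ ?C - R0) (1 / \<epsilon>)" using real_arch_simple by blast
  have "nbhd B (R0 + real k) (1 / (real k + 1)) \<subseteq> nbhd B (R ^ ?C) \<epsilon>"
  proof (rule nbhd_mono)
    have "1 / \<epsilon> \<le> real k + 1" using k by simp
    then have "1 \<le> \<epsilon> * (real k + 1)" using e by (simp add: divide_le_eq mult.commute)
    then show "1 / (real k + 1) \<le> \<epsilon>" by (simp add: divide_le_eq)
  qed (use k R in auto)
  also have "\<dots> \<subseteq> nbhd B' R \<epsilon>"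
  proof (rule nbhd_subset)
    fix c w assume c: "c \<in> carrier K" "w \<in> lists {..<d}" "abs_K c * (R ^ ?C) ^ wt d B w 0 \<le> \<epsilon>"
    have "R ^ wt d B' w 0 \<le> R ^ (?C * wt d B w 0)" using R wt_compare[OF c(2) B] by (intro power_increasing)
    then have "abs_K c * R ^ wt d B' w 0 \<le> abs_K c * (R ^ ?C) ^ wt d B w 0"
      using c K.nonneg by (simp add: power_mult mult_left_mono del: power_Suc)
    then show "abs_K c * R ^ wt d B' w 0 \<le> \<epsilon>" using c by simp
  qed
  finally show "\<forall>\<^sub>F n in sequentially. \<gamma> n \<in> nbhd B' R \<epsilon>"
    using assms(2)[of k] unfolding eventually_sequentially by blast
qed

end

section \<open>Finite generation compatible with null sequences\<close>

lemma (in ring) finsum_unit_vector: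
  fixes j0 k :: nat assumes "j0 < k" "a \<in> carrier R" "\<And>j. j < k \<Longrightarrow> g j \<in> carrier R"
  shows "(\<Oplus>j\<in>{..<k}. (if j = j0 then a else \<zero>) \<otimes> g j) = a \<otimes> g j0"
proof -
  have "(\<Oplus>j\<in>{..<k}. (if j = j0 then a else \<zero>) \<otimes> g j) = (\<Oplus>j\<in>{..<k}. (if j0 = j then a \<otimes> g j else \<zero>))"
    using assms by (intro finsum_cong') auto
  also have "\<dots> = a \<otimes> g j0" using assms by (intro finsum_singleton) auto
  finally show ?thesis .
qed

context commutator_algebra
begin

lemma free_module_generated: "generated_module K abs_K A d \<kappa> x (free_module A p) p (unit_vector A)"
  unfolding generated_module_def generated_module_axioms_def
  using commutator_algebra_axioms free_module_is_left_module by (auto simp: unit_vector_def)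

text \<open>
  The weight of a monomial in the free module is shifted by the position of its basis vector, at
  most by \<open>p\<close>.
\<close>

lemma bounded_from_coords:
  assumes R: "1 \<le> R" and \<epsilon>: "0 \<le> \<epsilon>" and v: "v \<in> carrier (free_module A p)" "\<And>l. l < p \<Longrightarrow> v l \<in> nbhd B R \<epsilon>"
  shows "v \<in> generated_module.bounded K abs_K A d \<kappa> x (free_module A p) p (unit_vector A) B R (\<epsilon> * R ^ p)"
proof -
  interpret F: generated_module K abs_K A d \<kappa> x "free_module A p" p "unit_vector A"
    by (rule free_module_generated)
  have 1: "a \<odot>\<^bsub>free_module A p\<^esub> unit_vector A l \<in> F.bounded B R (\<epsilon> * R ^ p)" if a: "a \<in> nbhd B R \<epsilon>" and l: "l < p" for a l
    unfolding F.combs_def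
  proof (rule add_span_image[OF A.abelian_group_axioms F.M.abelian_group_axioms, where f = "\<lambda>a. a \<odot>\<^bsub>free_module A p\<^esub> unit_vector A l"])
    show "a \<in> add_span A {\<kappa> c \<otimes> word w | c w. c \<in> carrier K \<and> w \<in> lists {..<d} \<and> abs_K c * R ^ wt d B w 0 \<le> \<epsilon>}"
      using a by (simp add: nbhd_def)
    fix s assume "s \<in> {\<kappa> c \<otimes> word w | c w. c \<in> carrier K \<and> w \<in> lists {..<d} \<and> abs_K c * R ^ wt d B w 0 \<le> \<epsilon>}"
    then obtain c w where s: "s = \<kappa> c \<otimes> word w" "c \<in> carrier K" "w \<in> lists {..<d}" "abs_K c * R ^ wt d B w 0 \<le> \<epsilon>" by blast
    have "wt d B w l = wt d B w 0 + l" by (simp add: wt_def)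
    then have "abs_K c * R ^ wt d B w l = (abs_K c * R ^ wt d B w 0) * R ^ l" by (simp add: power_add)
    also have "\<dots> \<le> \<epsilon> * R ^ p" using s l R \<epsilon> by (intro mult_mono power_increasing) auto
    finally have "\<kappa> c \<odot>\<^bsub>free_module A p\<^esub> F.mon w l \<in> F.bounded B R (\<epsilon> * R ^ p)"
      using s l by (intro F.term_in_combs) auto
    moreover have "s \<odot>\<^bsub>free_module A p\<^esub> unit_vector A l = \<kappa> c \<odot>\<^bsub>free_module A p\<^esub> F.mon w l"
      unfolding F.mon_def s(1) using s l by (intro F.M.smult_assoc F.e_closed) auto
    ultimately show "s \<odot>\<^bsub>free_module A p\<^esub> unit_vector A l \<in> add_span (free_module A p) (F.terms (\<lambda>c w i. abs_K c * R ^ wt d B w i \<le> \<epsilon> * R ^ p))"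
      by (simp add: F.combs_def)
  next
    show "{\<kappa> c \<otimes> word w | c w. c \<in> carrier K \<and> w \<in> lists {..<d} \<and> abs_K c * R ^ wt d B w 0 \<le> \<epsilon>} \<subseteq> carrier A"
      using A.m_closed word_closed \<kappa>_closed by blast
  next
    show "(\<lambda>a. a \<odot>\<^bsub>free_module A p\<^esub> unit_vector A l) \<in> carrier A \<rightarrow> carrier (free_module A p)"
      using F.M.smult_closed F.e_closed[OF l] by blast
  next
    fix a b assume "a \<in> carrier A" "b \<in> carrier A"
    then show "(a \<oplus> b) \<odot>\<^bsub>free_module A p\<^esub> unit_vector A l =
      a \<odot>\<^bsub>free_module A p\<^esub> unit_vector A l \<oplus>\<^bsub>free_module A p\<^esub> b \<odot>\<^bsub>free_module A p\<^esub> unit_vector A l"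
      by (rule F.M.smult_add_scalar) (rule F.e_closed[OF l])
  qed
  have "q \<le> p \<Longrightarrow> (\<lambda>l. if l < q then v l else \<zero>) \<in> F.bounded B R (\<epsilon> * R ^ p)" for q
  proof (induction q)
    case 0 show ?case using F.combs_zero by simp
  next
    case (Suc q)
    have vq: "v q \<in> carrier A" using v(1) Suc.prems by simp
    have "(\<lambda>l. if l < Suc q then v l else \<zero>) =
       (\<lambda>l. if l < q then v l else \<zero>) \<oplus>\<^bsub>free_module A p\<^esub> (v q \<odot>\<^bsub>free_module A p\<^esub> unit_vector A q)"
      using v(1) Suc.prems vq by (auto simp: unit_vector_def less_Suc_eq)
    then show ?case using F.combs_add[OF Suc.IH 1[OF v(2)]] Suc.prems by simp
  qed
  from this[of p] have "(\<lambda>l. if l < p then v l else \<zero>) \<in> F.bounded B R (\<epsilon> * R ^ p)" by simp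
  moreover have "(\<lambda>l. if l < p then v l else \<zero>) = v" using v(1) by auto
  ultimately show ?thesis by simp
qed

text \<open>
  The elements \<open>f j\<close> generate \<open>I\<close>, even on the level of null sequences. This is the open mapping
  property of the map defined by \<open>f\<close> onto \<open>I\<close>.
\<close>

definition null_generators :: "nat \<Rightarrow> (nat \<Rightarrow> 'a) set \<Rightarrow> nat \<Rightarrow> (nat \<Rightarrow> nat \<Rightarrow> 'a) \<Rightarrow> bool" where
  "null_generators p I k f \<longleftrightarrow> (\<forall>j<k. f j \<in> I) \<and>
     (\<forall>\<gamma>. (\<forall>n. \<gamma> n \<in> I) \<and> (\<forall>l<p. null (\<lambda>n. \<gamma> n l)) \<longrightarrow>
        (\<exists>q. (\<forall>n. \<forall>j<k. q n j \<in> carrier A) \<and> (\<forall>j<k. null (\<lambda>n. q n j)) \<and>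
             (\<forall>n. \<forall>l<p. \<gamma> n l = (\<Oplus>j\<in>{..<k}. q n j \<otimes> f j l))))"

lemma null_generatorsD:
  assumes "null_generators p I k f"
  shows "j < k \<Longrightarrow> f j \<in> I"
    and "\<forall>n. \<gamma> n \<in> I \<Longrightarrow> \<forall>l<p. null (\<lambda>n. \<gamma> n l) \<Longrightarrow>
        \<exists>q. (\<forall>n. \<forall>j<k. q n j \<in> carrier A) \<and> (\<forall>j<k. null (\<lambda>n. q n j)) \<and>
             (\<forall>n. \<forall>l<p. \<gamma> n l = (\<Oplus>j\<in>{..<k}. q n j \<otimes> f j l))"
  using assms unfolding null_generators_def by simp_all

text \<open>
  Groebner division bounds the quotients by the norm of the element for every large \<open>R\<close>. The
  quotients depend on \<open>R\<close>; \<open>diagonal_choice\<close> selects for each member of the sequence one that is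
  good enough for larger and larger \<open>R\<close>.
\<close>

lemma null_generators_exist:
  assumes I: "left_submodule A (free_module A p) I"
  shows "\<exists>k f. null_generators p I k f"
proof -
  interpret F: generated_module K abs_K A d \<kappa> x "free_module A p" p "unit_vector A"
    by (rule free_module_generated)
  obtain \<G> where gb: "F.groebner_basis I \<G>" using F.groebner_basis_exists by blast
  then have "finite \<G>" unfolding F.groebner_basis_def by blast
  then obtain gs where gs: "set gs = \<G>" using finite_list by blast
  define k where "k = length gs"
  define f where "f j = fst (gs ! j)" for j
  have fI: "f j \<in> I" if "j < k" for j
  proof -
    have "gs ! j \<in> \<G>" using that gs by (auto simp: k_def)
    then show ?thesis using gb by (auto simp: F.groebner_basis_def F.leading_in_def f_def split_beta)
  qed
  have f: "f j l \<in> carrier A" if "j < k" for j l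
    using fI[OF that] I free_module_coord[of "f j" p l] by (auto simp: left_submodule_def simp del: free_module_simps(1))
  have "\<forall>\<^sub>F B in sequentially. (\<forall>\<^sub>F R in at_top. F.good_radius \<G> B R) \<and> 1 \<le> B"
    using F.eventually_good_radius[OF gb] eventually_ge_at_top[of 1] by eventually_elim simp
  then obtain B where B: "1 \<le> B" "\<forall>\<^sub>F R in at_top. F.good_radius \<G> B R"
    using eventually_happens'[OF sequentially_bot] by blast
  from B(2) eventually_ge_at_top[of 1] have "\<forall>\<^sub>F R in at_top. F.good_radius \<G> B R \<and> 1 \<le> R" by eventually_elim simp
  then obtain R0 where R0: "\<And>R. R \<ge> R0 \<Longrightarrow> F.good_radius \<G> B R \<and> 1 \<le> R" unfolding eventually_at_top_linorder by blast
  have quot: "\<exists>q. (\<forall>j<k. q j \<in> nbhd B R \<rho>) \<and> (\<forall>l<p. \<gamma> l = (\<Oplus>j\<in>{..<k}. q j \<otimes> f j l))"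
    if "\<gamma> \<in> add_span (free_module A p) (F.multiples \<G> B R \<rho>)" and R: "1 \<le> R" for \<gamma> R \<rho>
    using that(1)
  proof induction
    case zero
    have "(\<Oplus>j\<in>{..<k}. \<zero> \<otimes> f j l) = \<zero>" for l using f by (intro add.finprod_one_eqI) auto
    then show ?case by (intro exI[of _ "\<lambda>_. \<zero>"]) (simp add: nbhd_zero)
  next
    case (incl s)
    then obtain c u g w i where s: "s = (\<kappa> c \<otimes> word u) \<odot>\<^bsub>free_module A p\<^esub> g" "c \<in> carrier K" "u \<in> lists {..<d}"
      "(g, w, i) \<in> \<G>" "abs_K c * R ^ (wt d B u 0 + wt d B w i) \<le> \<rho>" unfolding F.multiples_def by blast
    obtain j0 where j0: "j0 < k" "f j0 = g" using s(4) gs unfolding f_def k_def by (metis fst_conv in_set_conv_nth)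
    have "abs_K c * R ^ wt d B u 0 \<le> abs_K c * R ^ (wt d B u 0 + wt d B w i)"
      using R K.nonneg[OF s(2)] by (intro mult_left_mono power_increasing) auto
    then have nb: "\<kappa> c \<otimes> word u \<in> nbhd B R \<rho>" using s by (intro word_nbhd) auto
    show ?case
    proof (intro exI[of _ "\<lambda>j. if j = j0 then \<kappa> c \<otimes> word u else \<zero>"] conjI allI impI)
      fix l assume "l < p"
      show "s l = (\<Oplus>j\<in>{..<k}. (if j = j0 then \<kappa> c \<otimes> word u else \<zero>) \<otimes> f j l)"
        using finsum_unit_vector[of j0 k "\<kappa> c \<otimes> word u" "\<lambda>j. f j l"] s j0 f by simp
    qed (use nb nbhd_zero in auto)
  next
    case (add a b)
    then obtain q r where q: "\<forall>j<k. q j \<in> nbhd B R \<rho>" "\<forall>l<p. a l = (\<Oplus>j\<in>{..<k}. q j \<otimes> f j l)"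
      and r: "\<forall>j<k. r j \<in> nbhd B R \<rho>" "\<forall>l<p. b l = (\<Oplus>j\<in>{..<k}. r j \<otimes> f j l)" by blast
    have c: "q j \<in> carrier A" "r j \<in> carrier A" if "j < k" for j using q(1) r(1) nbhd_closed that by blast+
    show ?case
    proof (intro exI[of _ "\<lambda>j. q j \<oplus> r j"] conjI allI impI)
      fix l assume l: "l < p"
      have "(\<Oplus>j\<in>{..<k}. (q j \<oplus> r j) \<otimes> f j l) = (\<Oplus>j\<in>{..<k}. q j \<otimes> f j l \<oplus> r j \<otimes> f j l)"
        using c f by (intro finsum_cong') (auto simp: l_distr)
      also have "\<dots> = a l \<oplus> b l" using c f q r l by (subst finsum_addf) auto
      finally show "(a \<oplus>\<^bsub>free_module A p\<^esub> b) l = (\<Oplus>j\<in>{..<k}. (q j \<oplus> r j) \<otimes> f j l)" by simp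
    qed (use q r nbhd_add in auto)
  next
    case (neg a)
    then obtain q where q: "\<forall>j<k. q j \<in> nbhd B R \<rho>" "\<forall>l<p. a l = (\<Oplus>j\<in>{..<k}. q j \<otimes> f j l)" by blast
    have c: "q j \<in> carrier A" if "j < k" for j using q(1) nbhd_closed that by blast
    have "F.multiples \<G> B R \<rho> \<subseteq> carrier (free_module A p)"
    proof
      fix s assume "s \<in> F.multiples \<G> B R \<rho>"
      then obtain c u g w i where s: "s = (\<kappa> c \<otimes> word u) \<odot>\<^bsub>free_module A p\<^esub> g" "c \<in> carrier K" "u \<in> lists {..<d}"
        "(g, w, i) \<in> \<G>" unfolding F.multiples_def by blast
      have "g \<in> carrier (free_module A p)"
        using s(4) gb I unfolding F.groebner_basis_def F.leading_in_def left_submodule_def by blast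
      then show "s \<in> carrier (free_module A p)" unfolding s(1) using s by (intro F.M.smult_closed) auto
    qed
    then have a: "a \<in> carrier (free_module A p)" using neg.hyps F.M.add_span_closed by blast
    show ?case
    proof (intro exI[of _ "\<lambda>j. \<ominus> q j"] conjI allI impI)
      fix l assume l: "l < p"
      have "(\<ominus>\<^bsub>free_module A p\<^esub> a) l = \<ominus> (a l)"
        by (rule additive_map_facts(2)[of "free_module A p" A "\<lambda>v. v l"])
          (use a free_module_coord in \<open>auto simp: F.M.abelian_group_axioms A.abelian_group_axioms simp del: free_module_simps(1)\<close>)
      also have "\<dots> = (\<Oplus>j\<in>{..<k}. \<ominus> (q j \<otimes> f j l))" using q l c f by (subst finsum_minus) auto
      also have "\<dots> = (\<Oplus>j\<in>{..<k}. (\<ominus> q j) \<otimes> f j l)" using c f by (intro finsum_cong') (auto simp: l_minus)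
      finally show "(\<ominus>\<^bsub>free_module A p\<^esub> a) l = (\<Oplus>j\<in>{..<k}. (\<ominus> q j) \<otimes> f j l)" .
    qed (use q nbhd_neg in auto)
  qed
  have div: "\<exists>q. (\<forall>j<k. q j \<in> nbhd B R \<rho>) \<and> (\<forall>l<p. \<gamma> l = (\<Oplus>j\<in>{..<k}. q j \<otimes> f j l))"
    if "\<gamma> \<in> I" and R: "R \<ge> R0" and "\<And>l. l < p \<Longrightarrow> \<gamma> l \<in> nbhd B R (\<rho> / R ^ p)" "0 \<le> \<rho>" for \<gamma> R \<rho>
  proof (rule quot)
    have R1: "1 \<le> R" "F.good_radius \<G> B R" using R0[OF R] by auto
    have "\<gamma> \<in> F.bounded B R (\<rho> / R ^ p * R ^ p)"
      using that R1 I by (intro bounded_from_coords) (auto simp: left_submodule_def simp del: free_module_simps(1))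
    then have "\<gamma> \<in> F.bounded B R \<rho>" using R1 by simp
    then show "\<gamma> \<in> add_span (free_module A p) (F.multiples \<G> B R \<rho>)"
      using F.groebner_division[OF I gb R1(2) that(4) that(1)] by simp
  qed (use R0[OF R] in simp)
  show ?thesis
    unfolding null_generators_def
  proof (rule exI[of _ k], rule exI[of _ f], rule conjI, use fI in blast, rule allI, rule impI, erule conjE)
    fix \<gamma> assume \<gamma>: "\<forall>n. \<gamma> n \<in> I" "\<forall>l<p. null (\<lambda>n. \<gamma> n l)"
    define \<Phi> where "\<Phi> n q \<longleftrightarrow> (\<forall>j<k. q j \<in> carrier A) \<and> (\<forall>l<p. \<gamma> n l = (\<Oplus>j\<in>{..<k}. q j \<otimes> f j l))" for n q
    define U where "U t = {q. \<forall>j<k. q j \<in> nbhd B (R0 + real t) (1 / (real t + 1))}" for t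
    have "\<exists>q. (\<forall>n. \<Phi> n (q n)) \<and> (\<forall>t. \<exists>N. \<forall>n\<ge>N. q n \<in> U t)"
    proof (rule diagonal_choice)
      fix n
      have gc: "\<gamma> n l \<in> carrier A" for l
        using \<gamma>(1) I free_module_coord[of "\<gamma> n" p l] by (auto simp: left_submodule_def simp del: free_module_simps(1))
      have R: "1 \<le> R0" using R0[of R0] by simp
      have "\<forall>\<^sub>F \<rho> in at_top. \<forall>l\<in>{..<p}. \<gamma> n l \<in> nbhd B R0 (\<rho> / R0 ^ p)"
      proof (intro eventually_ball_finite ballI finite_lessThan)
        fix l
        obtain \<rho> where r: "\<gamma> n l \<in> nbhd B R0 \<rho>" using nbhd_exists[OF gc] by blast
        show "\<forall>\<^sub>F \<rho> in at_top. \<gamma> n l \<in> nbhd B R0 (\<rho> / R0 ^ p)"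
          using eventually_ge_at_top[of "\<rho> * R0 ^ p"]
        proof eventually_elim
          case (elim \<rho>')
          then have "\<rho> \<le> \<rho>' / R0 ^ p" using R by (simp add: le_divide_eq)
          then show ?case using r nbhd_mono[of R0 R0 \<rho> "\<rho>' / R0 ^ p" B] R by auto
        qed
      qed
      then have "\<forall>\<^sub>F \<rho> in at_top. (\<forall>l\<in>{..<p}. \<gamma> n l \<in> nbhd B R0 (\<rho> / R0 ^ p)) \<and> 0 \<le> \<rho>"
        using eventually_ge_at_top[of 0] by eventually_elim simp
      then obtain \<rho> where "(\<forall>l\<in>{..<p}. \<gamma> n l \<in> nbhd B R0 (\<rho> / R0 ^ p)) \<and> 0 \<le> \<rho>"
        using eventually_happens'[OF trivial_limit_at_top_linorder] by blast
      then have r: "\<forall>l<p. \<gamma> n l \<in> nbhd B R0 (\<rho> / R0 ^ p)" "0 \<le> \<rho>" by auto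
      then obtain q where "\<forall>j<k. q j \<in> nbhd B R0 \<rho>" "\<forall>l<p. \<gamma> n l = (\<Oplus>j\<in>{..<k}. q j \<otimes> f j l)"
        using div[of "\<gamma> n" R0 \<rho>] \<gamma>(1) by blast
      then show "\<exists>q. \<Phi> n q" unfolding \<Phi>_def using nbhd_closed by blast
    next
      fix t
      let ?R = "R0 + real t" and ?\<rho> = "1 / (real t + 1)"
      have R: "1 \<le> ?R" using R0[of R0] by simp
      have "\<forall>\<^sub>F n in sequentially. \<forall>l\<in>{..<p}. \<gamma> n l \<in> nbhd B ?R (?\<rho> / ?R ^ p)"
        using \<gamma>(2) R by (intro eventually_ball_finite ballI finite_lessThan nullD B) auto
      then obtain N where N: "\<And>n. n \<ge> N \<Longrightarrow> \<forall>l<p. \<gamma> n l \<in> nbhd B ?R (?\<rho> / ?R ^ p)"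
        unfolding eventually_sequentially by blast
      have "\<exists>q. \<Phi> n q \<and> q \<in> U t" if nN: "n \<ge> N" for n
      proof -
        obtain q where "\<forall>j<k. q j \<in> nbhd B ?R ?\<rho>" "\<forall>l<p. \<gamma> n l = (\<Oplus>j\<in>{..<k}. q j \<otimes> f j l)"
          using div[of "\<gamma> n" ?R ?\<rho>] \<gamma>(1) N[OF nN] by auto
        then show ?thesis unfolding \<Phi>_def U_def using nbhd_closed by blast
      qed
      then show "\<exists>N. \<forall>n\<ge>N. \<exists>q. \<Phi> n q \<and> q \<in> U t" by blast
    next
      fix t
      have "nbhd B (R0 + real (Suc t)) (1 / (real (Suc t) + 1)) \<subseteq> nbhd B (R0 + real t) (1 / (real t + 1))"
        using R0[of R0] by (intro nbhd_mono) (auto simp: field_simps)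
      then show "U (Suc t) \<subseteq> U t" unfolding U_def by blast
    qed
    then obtain q where q: "\<And>n. \<Phi> n (q n)" "\<And>t. \<exists>N. \<forall>n\<ge>N. q n \<in> U t" by blast
    have "null (\<lambda>n. q n j)" if "j < k" for j
    proof (rule nullI_one_weight[OF B(1), of _ R0])
      fix t show "\<exists>N. \<forall>n\<ge>N. q n j \<in> nbhd B (R0 + real t) (1 / (real t + 1))"
        using q(2)[of t] that unfolding U_def by blast
    qed
    then show "\<exists>q. (\<forall>n. \<forall>j<k. q n j \<in> carrier A) \<and> (\<forall>j<k. null (\<lambda>n. q n j)) \<and>
             (\<forall>n. \<forall>l<p. \<gamma> n l = (\<Oplus>j\<in>{..<k}. q n j \<otimes> f j l))"
      using q(1) unfolding \<Phi>_def by blast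
  qed
qed

text \<open>
  The case of a free module of rank one in \<open>generator_not_close\<close>.
\<close>

lemma one_not_limit:
  assumes I: "I \<subseteq> carrier A" "\<zero> \<in> I" "\<And>u v. u \<in> I \<Longrightarrow> v \<in> I \<Longrightarrow> u \<oplus> v \<in> I"
      "\<And>a v. a \<in> carrier A \<Longrightarrow> v \<in> I \<Longrightarrow> a \<otimes> v \<in> I"
    and \<gamma>: "\<And>n. \<gamma> n \<in> I" "null (\<lambda>n. \<gamma> n \<ominus> \<one>)"
  shows "\<one> \<in> I"
proof (rule ccontr)
  assume one: "\<one> \<notin> I"
  interpret F: generated_module K abs_K A d \<kappa> x "free_module A 1" 1 "unit_vector A"
    by (rule free_module_generated)
  define J where "J = {v \<in> carrier (free_module A 1). v 0 \<in> I}"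
  have J: "left_submodule A (free_module A 1) J"
    using I by (auto simp: left_submodule_def J_def)
  have e: "unit_vector A 0 \<notin> J" using one by (simp add: J_def unit_vector_def)
  obtain \<G> where gb: "F.groebner_basis J \<G>" using F.groebner_basis_exists by blast
  have "\<forall>\<^sub>F B in sequentially. (\<forall>\<^sub>F R in at_top. F.good_radius \<G> B R) \<and> 1 \<le> B"
    using F.eventually_good_radius[OF gb] eventually_ge_at_top[of 1] by eventually_elim simp
  then obtain B where B: "1 \<le> B" "\<forall>\<^sub>F R in at_top. F.good_radius \<G> B R"
    using eventually_happens'[OF sequentially_bot] by blast
  then obtain R where R: "F.good_radius \<G> B R" using eventually_happens'[OF trivial_limit_at_top_linorder] by blast
  then have R1: "1 \<le> R" unfolding F.good_radius_def by blast
  \<comment> \<open>The radius allows for the factor \<open>R\<close> lost in passing to the free module of rank one.\<close>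
  have "\<forall>\<^sub>F n in sequentially. \<gamma> n \<ominus> \<one> \<in> nbhd B R (1 / (2 * R))" using R1 by (intro nullD[OF \<gamma>(2) B(1)]) auto
  then obtain n where n: "\<gamma> n \<ominus> \<one> \<in> nbhd B R (1 / (2 * R))" using eventually_happens'[OF sequentially_bot] by blast
  define v where "v = (\<lambda>l::nat. if l = 0 then \<gamma> n else \<zero>)"
  have gA: "\<gamma> n \<in> carrier A" using \<gamma>(1) I(1) by blast
  have v: "v \<in> J" "v \<in> carrier (free_module A 1)" using \<gamma>(1) gA by (auto simp: J_def v_def)
  have ec: "unit_vector A 0 \<in> carrier (free_module A 1)" by (simp add: unit_vector_def)
  let ?w = "v \<ominus>\<^bsub>free_module A 1\<^esub> unit_vector A 0"
  have "?w 0 = \<gamma> n \<ominus> \<one>" using free_module_minus[OF v(2) ec] by (simp add: v_def unit_vector_def)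
  then have "?w l \<in> nbhd B R (1 / (2 * R))" if "l < 1" for l using n that by simp
  then have "?w \<in> F.bounded B R (1 / (2 * R) * R ^ 1)"
    using R1 F.M.minus_closed[OF v(2) ec] by (intro bounded_from_coords) (auto simp del: free_module_simps(1))
  then have "?w \<in> F.bounded B R (1 / 2)" using R1 by simp
  then show False using F.generator_not_close[OF J gb R _ e, of "1/2" v] v by simp
qed

end

section \<open>The completion is flat and faithful\<close>

lemma (in abelian_group) finsum_exchange:
  assumes "finite S" "finite T" "\<And>i j. i \<in> S \<Longrightarrow> j \<in> T \<Longrightarrow> f i j \<in> carrier G"
  shows "(\<Oplus>i\<in>S. \<Oplus>j\<in>T. f i j) = (\<Oplus>j\<in>T. \<Oplus>i\<in>S. f i j)"
  using assms(1,3)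
proof (induction S rule: finite_induct)
  case empty
  then show ?case using assms(2) by simp
next
  case (insert a S)
  have c: "(\<Oplus>i\<in>S. f i j) \<in> carrier G" if "j \<in> T" for j using insert.prems that by (intro finsum_closed) auto
  have "(\<Oplus>i\<in>insert a S. \<Oplus>j\<in>T. f i j) = (\<Oplus>j\<in>T. f a j) \<oplus> (\<Oplus>i\<in>S. \<Oplus>j\<in>T. f i j)"
    using insert by (intro finsum_insert) (auto intro!: finsum_closed)
  also have "\<dots> = (\<Oplus>j\<in>T. f a j) \<oplus> (\<Oplus>j\<in>T. \<Oplus>i\<in>S. f i j)" using insert by simp
  also have "\<dots> = (\<Oplus>j\<in>T. f a j \<oplus> (\<Oplus>i\<in>S. f i j))" using insert.prems c by (subst finsum_addf) auto
  also have "\<dots> = (\<Oplus>j\<in>T. \<Oplus>i\<in>insert a S. f i j)"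
  proof (intro finsum_cong')
    fix j assume j: "j \<in> T"
    show "f a j \<oplus> (\<Oplus>i\<in>S. f i j) = (\<Oplus>i\<in>insert a S. f i j)"
      using insert j by (subst finsum_insert) auto
  qed (use insert.prems insert.hyps in \<open>auto intro!: finsum_closed\<close>)
  finally show ?case .
qed

context commutator_algebra
begin

lemma null_add: assumes "null \<gamma>" "null \<delta>" shows "null (\<lambda>n. \<gamma> n \<oplus> \<delta> n)"
  unfolding null_def
proof (intro allI impI)
  fix B :: nat and R \<epsilon> :: real assume *: "1 \<le> B" "1 \<le> R" "0 < \<epsilon>"
  show "\<forall>\<^sub>F n in sequentially. \<gamma> n \<oplus> \<delta> n \<in> nbhd B R \<epsilon>"
    using nullD[OF assms(1) *] nullD[OF assms(2) *] by eventually_elim (rule nbhd_add)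
qed

lemma null_neg: assumes "null \<gamma>" shows "null (\<lambda>n. \<ominus> \<gamma> n)"
  unfolding null_def
proof (intro allI impI)
  fix B :: nat and R \<epsilon> :: real assume *: "1 \<le> B" "1 \<le> R" "0 < \<epsilon>"
  show "\<forall>\<^sub>F n in sequentially. \<ominus> \<gamma> n \<in> nbhd B R \<epsilon>"
    using nullD[OF assms *] by eventually_elim (rule nbhd_neg)
qed

lemma null_diff: "null \<gamma> \<Longrightarrow> null \<delta> \<Longrightarrow> null (\<lambda>n. \<gamma> n \<ominus> \<delta> n)"
  unfolding a_minus_def by (intro null_add null_neg)

lemma null_zero: "null (\<lambda>_. \<zero>)"
  by (simp add: null_def nbhd_zero)

lemma null_Suc: "null (\<lambda>n. \<gamma> (Suc n)) \<longleftrightarrow> null \<gamma>"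
  unfolding null_def by (subst eventually_sequentially_Suc) simp

lemma null_mult_right:
  assumes "null \<gamma>" "a \<in> carrier A" shows "null (\<lambda>n. \<gamma> n \<otimes> a)"
  unfolding null_def
proof (intro allI impI)
  fix B :: nat and R \<epsilon> :: real assume B: "1 \<le> B" and R: "1 \<le> R" and e: "0 < \<epsilon>"
  obtain \<rho> where r: "\<rho> > 0" "a \<in> nbhd B R \<rho>" using nbhd_exists[OF assms(2)] by blast
  have "\<forall>\<^sub>F n in sequentially. \<gamma> n \<in> nbhd B R (\<epsilon> / \<rho>)" using nullD[OF assms(1) B R] e r by simp
  then show "\<forall>\<^sub>F n in sequentially. \<gamma> n \<otimes> a \<in> nbhd B R \<epsilon>"
  proof eventually_elim
    case (elim n)
    show ?case using nbhd_mult[OF _ _ elim r(2)] R e r by simp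
  qed
qed

lemma null_finsum:
  assumes "finite S" "\<And>i. i \<in> S \<Longrightarrow> null (\<gamma> i)" "\<And>i n. i \<in> S \<Longrightarrow> \<gamma> i n \<in> carrier A"
  shows "null (\<lambda>n. \<Oplus>i\<in>S. \<gamma> i n)"
  using assms
proof (induction S rule: finite_induct)
  case empty then show ?case by (simp add: null_zero)
next
  case (insert a S)
  have "(\<Oplus>i\<in>insert a S. \<gamma> i n) = \<gamma> a n \<oplus> (\<Oplus>i\<in>S. \<gamma> i n)" for n
    using insert by (intro finsum_insert) auto
  then show ?case using insert by (simp add: null_add)
qed

text \<open>
  In an ultrametric setting it suffices that consecutive differences tend to \<open>0\<close>.
\<close>

definition cauchy :: "(nat \<Rightarrow> 'a) \<Rightarrow> bool" where
  "cauchy u \<longleftrightarrow> (\<forall>n. u n \<in> carrier A) \<and> null (\<lambda>n. u (Suc n) \<ominus> u n)"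

lemma cauchy_closed: "cauchy u \<Longrightarrow> u n \<in> carrier A"
  by (simp add: cauchy_def)

lemma cauchy_const: "a \<in> carrier A \<Longrightarrow> cauchy (\<lambda>_. a)"
  by (simp add: cauchy_def minus_eq r_neg null_zero)

lemma cauchy_add:
  assumes "cauchy u" "cauchy v" shows "cauchy (\<lambda>n. u n \<oplus> v n)"
proof -
  have "null (\<lambda>n. (u (Suc n) \<ominus> u n) \<oplus> (v (Suc n) \<ominus> v n))" using assms by (intro null_add) (auto simp: cauchy_def)
  then show ?thesis using assms cauchy_closed by (simp add: cauchy_def add_diff_add)
qed

lemma cauchy_mult_right:
  assumes "cauchy u" "a \<in> carrier A" shows "cauchy (\<lambda>n. u n \<otimes> a)"
proof -
  have "null (\<lambda>n. (u (Suc n) \<ominus> u n) \<otimes> a)" using assms by (intro null_mult_right) (auto simp: cauchy_def)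
  then show ?thesis using assms cauchy_closed by (simp add: cauchy_def minus_eq l_distr l_minus)
qed

lemma cauchy_diff_null:
  assumes "cauchy u" "null \<gamma>" "\<And>n. \<gamma> n \<in> carrier A" shows "cauchy (\<lambda>n. u n \<ominus> \<gamma> n)"
proof -
  have u: "u n \<in> carrier A" for n using assms(1) cauchy_closed by blast
  have "null (\<lambda>n. (u (Suc n) \<ominus> u n) \<ominus> (\<gamma> (Suc n) \<ominus> \<gamma> n))"
    using assms null_Suc[of \<gamma>] null_diff[of "\<lambda>n. u (Suc n) \<ominus> u n" "\<lambda>n. \<gamma> (Suc n) \<ominus> \<gamma> n"] null_diff[of "\<lambda>n. \<gamma> (Suc n)" \<gamma>]
    by (simp add: cauchy_def)
  moreover have "(u (Suc n) \<ominus> u n) \<ominus> (\<gamma> (Suc n) \<ominus> \<gamma> n) = (u (Suc n) \<ominus> \<gamma> (Suc n)) \<ominus> (u n \<ominus> \<gamma> n)" for n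
    using u assms(3) by (simp add: minus_eq minus_add a_ac)
  ultimately show ?thesis using u assms(3) by (simp add: cauchy_def)
qed

end

text \<open>
  The ring of Cauchy sequences modulo null sequences, up to isomorphism.
\<close>

locale completed_algebra = commutator_algebra K abs_K A d \<kappa> x + B: ring B
  for K :: "('k, 'z) ring_scheme" and abs_K :: "'k \<Rightarrow> real" and A :: "('a, 'y) ring_scheme" (structure)
    and d \<kappa> x and B :: "('b, 'v) ring_scheme" +
  fixes cls :: "(nat \<Rightarrow> 'a) \<Rightarrow> 'b"
  assumes cls_surj: "b \<in> carrier B \<Longrightarrow> \<exists>u. cauchy u \<and> b = cls u"
    and cls_closed: "cauchy u \<Longrightarrow> cls u \<in> carrier B"
    and cls_eq: "cauchy u \<Longrightarrow> cauchy v \<Longrightarrow> cls u = cls v \<longleftrightarrow> null (\<lambda>n. u n \<ominus> v n)"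
    and cls_add: "cauchy u \<Longrightarrow> cauchy v \<Longrightarrow> cls u \<oplus>\<^bsub>B\<^esub> cls v = cls (\<lambda>n. u n \<oplus> v n)"
    and cls_mult: "cauchy u \<Longrightarrow> cauchy v \<Longrightarrow> cls u \<otimes>\<^bsub>B\<^esub> cls v = cls (\<lambda>n. u n \<otimes> v n)"
    and cls_zero: "cls (\<lambda>_. \<zero>) = \<zero>\<^bsub>B\<^esub>"
    and cls_one: "cls (\<lambda>_. \<one>) = \<one>\<^bsub>B\<^esub>"
begin

abbreviation \<iota>\<^sub>B :: "'a \<Rightarrow> 'b" where "\<iota>\<^sub>B a \<equiv> cls (\<lambda>_. a)"

lemma cls_finsum_aux:
  assumes "finite S" "\<forall>i\<in>S. cauchy (\<beta> i) \<and> a i \<in> carrier A"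
  shows "cauchy (\<lambda>n. \<Oplus>i\<in>S. \<beta> i n \<otimes> a i) \<and>
    (\<Oplus>\<^bsub>B\<^esub>i\<in>S. cls (\<beta> i) \<otimes>\<^bsub>B\<^esub> \<iota>\<^sub>B (a i)) = cls (\<lambda>n. \<Oplus>i\<in>S. \<beta> i n \<otimes> a i)"
  using assms
proof (induction S rule: finite_induct)
  case empty
  show ?case by (simp add: cauchy_const cls_zero)
next
  case (insert s S)
  have e: "(\<Oplus>i\<in>insert s S. \<beta> i n \<otimes> a i) = \<beta> s n \<otimes> a s \<oplus> (\<Oplus>i\<in>S. \<beta> i n \<otimes> a i)" for n
    using insert.hyps insert.prems cauchy_closed by (intro finsum_insert) auto
  have c: "cauchy (\<lambda>n. \<beta> s n \<otimes> a s)" "cauchy (\<lambda>n. \<Oplus>i\<in>S. \<beta> i n \<otimes> a i)"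
    using insert.prems insert.IH cauchy_mult_right by auto
  have "(\<Oplus>\<^bsub>B\<^esub>i\<in>insert s S. cls (\<beta> i) \<otimes>\<^bsub>B\<^esub> \<iota>\<^sub>B (a i)) =
      cls (\<beta> s) \<otimes>\<^bsub>B\<^esub> \<iota>\<^sub>B (a s) \<oplus>\<^bsub>B\<^esub> (\<Oplus>\<^bsub>B\<^esub>i\<in>S. cls (\<beta> i) \<otimes>\<^bsub>B\<^esub> \<iota>\<^sub>B (a i))"
    using insert.hyps insert.prems cls_closed cauchy_const by (intro B.finsum_insert) auto
  also have "\<dots> = cls (\<lambda>n. \<beta> s n \<otimes> a s) \<oplus>\<^bsub>B\<^esub> cls (\<lambda>n. \<Oplus>i\<in>S. \<beta> i n \<otimes> a i)"
    using insert.IH insert.prems cls_mult[of "\<beta> s" "\<lambda>_. a s"] cauchy_const by simp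
  also have "\<dots> = cls (\<lambda>n. \<Oplus>i\<in>insert s S. \<beta> i n \<otimes> a i)"
    unfolding e by (rule cls_add[OF c])
  finally show ?case unfolding e using cauchy_add[OF c] by simp
qed

lemma cls_finsum:
  assumes "finite S" "\<And>i. i \<in> S \<Longrightarrow> cauchy (\<beta> i)" "\<And>i. i \<in> S \<Longrightarrow> a i \<in> carrier A"
  shows "cauchy (\<lambda>n. \<Oplus>i\<in>S. \<beta> i n \<otimes> a i)"
    "(\<Oplus>\<^bsub>B\<^esub>i\<in>S. cls (\<beta> i) \<otimes>\<^bsub>B\<^esub> \<iota>\<^sub>B (a i)) = cls (\<lambda>n. \<Oplus>i\<in>S. \<beta> i n \<otimes> a i)"
  using cls_finsum_aux[of S \<beta> a] assms by auto

text \<open>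
  The equational criterion for flatness: a linear relation over the completion with coefficients in
  \<open>A\<close> comes from relations in \<open>A\<close>. \<open>null_generators_exist\<close> is used twice: for the submodule
  generated by the rows of the matrix \<open>u\<close>, to correct the representing Cauchy sequences so that they
  are themselves relations, and for the module of relations, to expand their differences.
\<close>

lemma equational_flatness:
  fixes m p :: nat and b :: "nat \<Rightarrow> 'b" and u :: "nat \<Rightarrow> nat \<Rightarrow> 'a"
  assumes b: "\<And>i. i < m \<Longrightarrow> b i \<in> carrier B" and u: "\<And>i l. i < m \<Longrightarrow> l < p \<Longrightarrow> u i l \<in> carrier A"
    and rel: "\<And>l. l < p \<Longrightarrow> (\<Oplus>\<^bsub>B\<^esub>i\<in>{..<m}. b i \<otimes>\<^bsub>B\<^esub> \<iota>\<^sub>B (u i l)) = \<zero>\<^bsub>B\<^esub>"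
  shows "\<exists>(k::nat) c v. (\<forall>j<k. c j \<in> carrier B) \<and> (\<forall>j<k. \<forall>i<m. v j i \<in> carrier A) \<and>
    (\<forall>j<k. \<forall>l<p. (\<Oplus>i\<in>{..<m}. v j i \<otimes> u i l) = \<zero>) \<and>
    (\<forall>i<m. b i = (\<Oplus>\<^bsub>B\<^esub>j\<in>{..<k}. c j \<otimes>\<^bsub>B\<^esub> \<iota>\<^sub>B (v j i)))"
proof -
  obtain \<beta> where \<beta>: "\<And>i. i < m \<Longrightarrow> cauchy (\<beta> i)" "\<And>i. i < m \<Longrightarrow> b i = cls (\<beta> i)"
    using choice[of "\<lambda>i u. i < m \<longrightarrow> cauchy u \<and> b i = cls u"] cls_surj b by blast
  have \<beta>c: "\<beta> i n \<in> carrier A" if "i < m" for i n using \<beta>(1)[OF that] cauchy_closed by blast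
  define L where "L a l = (\<Oplus>i\<in>{..<m}. a i \<otimes> u i l)" for a l
  have Lc: "L a l \<in> carrier A" if "\<And>i. i < m \<Longrightarrow> a i \<in> carrier A" "l < p" for a l
    unfolding L_def using that u by (intro finsum_closed) auto
  have Ladd: "L (\<lambda>i. a i \<oplus> a' i) l = L a l \<oplus> L a' l"
    if "\<And>i. i < m \<Longrightarrow> a i \<in> carrier A" "\<And>i. i < m \<Longrightarrow> a' i \<in> carrier A" "l < p" for a a' l
  proof -
    have "L (\<lambda>i. a i \<oplus> a' i) l = (\<Oplus>i\<in>{..<m}. a i \<otimes> u i l \<oplus> a' i \<otimes> u i l)"
      unfolding L_def using that u by (intro finsum_cong') (auto simp: l_distr)
    also have "\<dots> = L a l \<oplus> L a' l" unfolding L_def using that u by (intro finsum_addf) auto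
    finally show ?thesis .
  qed
  have Lneg: "L (\<lambda>i. \<ominus> a i) l = \<ominus> L a l" if "\<And>i. i < m \<Longrightarrow> a i \<in> carrier A" "l < p" for a l
  proof -
    have "L (\<lambda>i. \<ominus> a i) l = (\<Oplus>i\<in>{..<m}. \<ominus> (a i \<otimes> u i l))"
      unfolding L_def using that u by (intro finsum_cong') (auto simp: l_minus)
    then show ?thesis unfolding L_def using that u by (subst (asm) finsum_minus) auto
  qed
  have Lscale: "L (\<lambda>i. s \<otimes> a i) l = s \<otimes> L a l"
    if "s \<in> carrier A" "\<And>i. i < m \<Longrightarrow> a i \<in> carrier A" "l < p" for s a l
  proof -
    have "L (\<lambda>i. s \<otimes> a i) l = (\<Oplus>i\<in>{..<m}. s \<otimes> (a i \<otimes> u i l))"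
      unfolding L_def using that u by (intro finsum_cong') (auto simp: m_assoc)
    then show ?thesis unfolding L_def using that u by (subst finsum_rdistr) auto
  qed
  have Lzero: "L (\<lambda>_. \<zero>) l = \<zero>" if "l < p" for l
    unfolding L_def using that u by (intro add.finprod_one_eqI) auto
  have Lsum: "L (\<lambda>i. \<Oplus>j\<in>{..<k}. s j \<otimes> a j i) l = (\<Oplus>j\<in>{..<k}. s j \<otimes> L (a j) l)"
    if "\<And>j. j < k \<Longrightarrow> s j \<in> carrier A" "\<And>i j. i < m \<Longrightarrow> j < k \<Longrightarrow> a j i \<in> carrier A" "l < p" for s a l and k :: nat
  proof -
    have "L (\<lambda>i. \<Oplus>j\<in>{..<k}. s j \<otimes> a j i) l = (\<Oplus>i\<in>{..<m}. \<Oplus>j\<in>{..<k}. s j \<otimes> (a j i \<otimes> u i l))"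
      unfolding L_def
    proof (intro finsum_cong')
      fix i assume "i \<in> {..<m}"
      then have i: "i < m" by simp
      have "(\<Oplus>j\<in>{..<k}. s j \<otimes> a j i) \<otimes> u i l = (\<Oplus>j\<in>{..<k}. s j \<otimes> a j i \<otimes> u i l)"
        using that u i by (intro finsum_ldistr) auto
      also have "\<dots> = (\<Oplus>j\<in>{..<k}. s j \<otimes> (a j i \<otimes> u i l))"
        using that u i by (intro finsum_cong') (auto simp: m_assoc)
      finally show "(\<Oplus>j\<in>{..<k}. s j \<otimes> a j i) \<otimes> u i l = (\<Oplus>j\<in>{..<k}. s j \<otimes> (a j i \<otimes> u i l))" .
    qed (use that u in \<open>auto intro!: finsum_closed\<close>)
    also have "\<dots> = (\<Oplus>j\<in>{..<k}. \<Oplus>i\<in>{..<m}. s j \<otimes> (a j i \<otimes> u i l))"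
      using that u by (intro finsum_exchange) auto
    also have "\<dots> = (\<Oplus>j\<in>{..<k}. s j \<otimes> L (a j) l)"
    proof (intro finsum_cong')
      fix j assume "j \<in> {..<k}"
      then show "(\<Oplus>i\<in>{..<m}. s j \<otimes> (a j i \<otimes> u i l)) = s j \<otimes> L (a j) l"
        unfolding L_def using that u by (subst finsum_rdistr) auto
    qed (use that u Lc in auto)
    finally show ?thesis .
  qed
  define vec where "vec q f = (\<lambda>l. if l < q then f l else \<zero>)" for q :: nat and f :: "nat \<Rightarrow> 'a"
  \<comment> \<open>the submodule generated by the rows of \<open>u\<close>\<close>
  define I where "I = {v \<in> carrier (free_module A p). \<exists>a. (\<forall>i<m. a i \<in> carrier A) \<and> (\<forall>l<p. v l = L a l)}"
  have I: "left_submodule A (free_module A p) I"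
    unfolding left_submodule_def
  proof (intro conjI ballI)
    show "\<zero>\<^bsub>free_module A p\<^esub> \<in> I" unfolding I_def using Lzero by (auto intro!: exI[of _ "\<lambda>_. \<zero>"])
  next
    fix v w assume "v \<in> I" "w \<in> I"
    then obtain a a' where a: "\<forall>i<m. a i \<in> carrier A" "\<forall>l<p. v l = L a l" "v \<in> carrier (free_module A p)"
      and a': "\<forall>i<m. a' i \<in> carrier A" "\<forall>l<p. w l = L a' l" "w \<in> carrier (free_module A p)" unfolding I_def by blast
    show "v \<oplus>\<^bsub>free_module A p\<^esub> w \<in> I" unfolding I_def using a a' Ladd[of a a']
      by (auto intro!: exI[of _ "\<lambda>i. a i \<oplus> a' i"])
  next
    fix s v assume s: "s \<in> carrier A" and "v \<in> I"
    then obtain a where a: "\<forall>i<m. a i \<in> carrier A" "\<forall>l<p. v l = L a l" "v \<in> carrier (free_module A p)" unfolding I_def by blast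
    show "s \<odot>\<^bsub>free_module A p\<^esub> v \<in> I" unfolding I_def using a s Lscale[OF s, of a]
      by (auto intro!: exI[of _ "\<lambda>i. s \<otimes> a i"])
  qed (auto simp: I_def)
  obtain k1 f1 where ng1: "null_generators p I k1 f1" using null_generators_exist[OF I] by blast
  note f1 = null_generatorsD(1)[OF ng1] and es1 = null_generatorsD(2)[OF ng1]
  have "\<forall>j. \<exists>a. j < k1 \<longrightarrow> (\<forall>i<m. a i \<in> carrier A) \<and> (\<forall>l<p. f1 j l = L a l)"
    using f1 unfolding I_def by blast
  from choice[OF this]
  obtain a1 where a1: "\<And>i j. j < k1 \<Longrightarrow> i < m \<Longrightarrow> a1 j i \<in> carrier A" "\<And>j l. j < k1 \<Longrightarrow> l < p \<Longrightarrow> f1 j l = L (a1 j) l"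
    by blast
  have null1: "null (\<lambda>n. L (\<lambda>i. \<beta> i n) l)" if l: "l < p" for l
  proof -
    have "(\<Oplus>\<^bsub>B\<^esub>i\<in>{..<m}. cls (\<beta> i) \<otimes>\<^bsub>B\<^esub> \<iota>\<^sub>B (u i l)) = (\<Oplus>\<^bsub>B\<^esub>i\<in>{..<m}. b i \<otimes>\<^bsub>B\<^esub> \<iota>\<^sub>B (u i l))"
      using \<beta> u l by (intro B.finsum_cong') (auto simp: cls_closed cauchy_const)
    then have "cls (\<lambda>n. L (\<lambda>i. \<beta> i n) l) = cls (\<lambda>_. \<zero>)"
      using cls_finsum(2)[of "{..<m}" \<beta> "\<lambda>i. u i l"] \<beta> u l rel[OF l] by (simp add: cls_zero L_def)
    moreover have "cauchy (\<lambda>n. L (\<lambda>i. \<beta> i n) l)"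
      unfolding L_def using cls_finsum(1)[of "{..<m}" \<beta> "\<lambda>i. u i l"] \<beta> u l by simp
    ultimately have "null (\<lambda>n. L (\<lambda>i. \<beta> i n) l \<ominus> \<zero>)" using cls_eq cauchy_const by blast
    then show ?thesis using Lc \<beta>c l by (simp add: diff_zero)
  qed
  have "\<exists>q. (\<forall>n. \<forall>j<k1. q n j \<in> carrier A) \<and> (\<forall>j<k1. null (\<lambda>n. q n j)) \<and>
             (\<forall>n. \<forall>l<p. vec p (L (\<lambda>i. \<beta> i n)) l = (\<Oplus>j\<in>{..<k1}. q n j \<otimes> f1 j l))"
  proof (rule es1)
    show "\<forall>n. vec p (L (\<lambda>i. \<beta> i n)) \<in> I"
    proof
      fix n show "vec p (L (\<lambda>i. \<beta> i n)) \<in> I" unfolding I_def vec_def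
        using Lc \<beta>c by (auto intro!: exI[of _ "\<lambda>i. \<beta> i n"])
    qed
  qed (simp add: vec_def null1)
  then obtain q1 where q1: "\<And>n j. j < k1 \<Longrightarrow> q1 n j \<in> carrier A" "\<And>j. j < k1 \<Longrightarrow> null (\<lambda>n. q1 n j)"
    "\<And>n l. l < p \<Longrightarrow> L (\<lambda>i. \<beta> i n) l = (\<Oplus>j\<in>{..<k1}. q1 n j \<otimes> f1 j l)" by (auto simp: vec_def)
  \<comment> \<open>a null sequence with the same values on the relation as the representatives \<open>\<beta>\<close>\<close>
  define \<sigma>' where "\<sigma>' i n = (\<Oplus>j\<in>{..<k1}. q1 n j \<otimes> a1 j i)" for i n
  have sc: "\<sigma>' i n \<in> carrier A" if "i < m" for i n unfolding \<sigma>'_def using that q1(1) a1(1) by (intro finsum_closed) auto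
  have snull: "null (\<sigma>' i)" if "i < m" for i
    unfolding \<sigma>'_def using that q1 a1 by (intro null_finsum null_mult_right) auto
  define \<tau> where "\<tau> i n = \<beta> i n \<ominus> \<sigma>' i n" for i n
  have tc: "\<tau> i n \<in> carrier A" if "i < m" for i n unfolding \<tau>_def using \<beta>c sc that by simp
  have Lt: "L (\<lambda>i. \<tau> i n) l = \<zero>" if l: "l < p" for n l
  proof -
    have "L (\<lambda>i. \<sigma>' i n) l = (\<Oplus>j\<in>{..<k1}. q1 n j \<otimes> L (a1 j) l)"
      unfolding \<sigma>'_def using q1(1) a1(1) l by (intro Lsum) auto
    also have "\<dots> = (\<Oplus>j\<in>{..<k1}. q1 n j \<otimes> f1 j l)"
      using q1(1) a1 l Lc by (intro finsum_cong') auto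
    finally have *: "L (\<lambda>i. \<sigma>' i n) l = L (\<lambda>i. \<beta> i n) l" using q1(3) l by simp
    have "L (\<lambda>i. \<tau> i n) l = L (\<lambda>i. \<beta> i n) l \<oplus> L (\<lambda>i. \<ominus> \<sigma>' i n) l"
      unfolding \<tau>_def a_minus_def using \<beta>c sc l by (intro Ladd) auto
    also have "\<dots> = L (\<lambda>i. \<beta> i n) l \<ominus> L (\<lambda>i. \<beta> i n) l" using Lneg[of "\<lambda>i. \<sigma>' i n"] sc l * by (simp add: a_minus_def)
    also have "\<dots> = \<zero>" using Lc \<beta>c l by (simp add: minus_eq r_neg)
    finally show ?thesis .
  qed
  have tcauchy: "cauchy (\<tau> i)" if "i < m" for i
    unfolding \<tau>_def using cauchy_diff_null[OF \<beta>(1) snull sc] that by simp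
  have tcls: "b i = cls (\<tau> i)" if i: "i < m" for i
  proof -
    have "\<beta> i n \<ominus> \<tau> i n = \<sigma>' i n" for n
      unfolding \<tau>_def using \<beta>c[OF i] sc[OF i] by (simp add: minus_eq minus_add a_assoc[symmetric] r_neg)
    then show ?thesis using \<beta> i tcauchy[OF i] snull[OF i] cls_eq by simp
  qed
  \<comment> \<open>the relations between the rows of \<open>u\<close>; the sequences \<open>\<tau>\<close> take values in them\<close>
  define S where "S = {v \<in> carrier (free_module A m). \<forall>l<p. L v l = \<zero>}"
  have S: "left_submodule A (free_module A m) S"
    unfolding left_submodule_def
  proof (intro conjI ballI)
    fix v w assume "v \<in> S" "w \<in> S"
    then show "v \<oplus>\<^bsub>free_module A m\<^esub> w \<in> S" unfolding S_def using Ladd[of v w] by simp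
  next
    fix s v assume "s \<in> carrier A" and "v \<in> S"
    then show "s \<odot>\<^bsub>free_module A m\<^esub> v \<in> S" unfolding S_def using Lscale[of s v] by simp
  qed (auto simp: S_def Lzero)
  obtain k f where ng: "null_generators m S k f" using null_generators_exist[OF S] by blast
  note f = null_generatorsD(1)[OF ng] and es2 = null_generatorsD(2)[OF ng]
  have fc: "f j i \<in> carrier A" if "j < k" for j i
    using f[OF that] free_module_coord[of "f j" m i] by (simp add: S_def del: free_module_simps(1))
  \<comment> \<open>The first member is kept, so that the partial sums of \<open>\<delta>\<close> are the sequences \<open>\<tau>\<close>.\<close>
  define \<delta> where "\<delta> n i = (if n = 0 then \<tau> i 0 else \<tau> i n \<ominus> \<tau> i (n - 1))" for n i
  have dc: "\<delta> n i \<in> carrier A" if "i < m" for n i using tc[OF that] by (simp add: \<delta>_def)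
  have Ld: "L (\<delta> n) l = \<zero>" if l: "l < p" for n l
  proof (cases n)
    case 0 then show ?thesis using Lt[OF l] by (simp add: \<delta>_def[abs_def])
  next
    case (Suc n')
    have "L (\<delta> n) l = L (\<lambda>i. \<tau> i n) l \<oplus> L (\<lambda>i. \<ominus> \<tau> i n') l"
      unfolding \<delta>_def a_minus_def Suc using tc l Ladd[of "\<lambda>i. \<tau> i (Suc n')" "\<lambda>i. \<ominus> \<tau> i n'"] by simp
    then show ?thesis using Lneg[of "\<lambda>i. \<tau> i n'"] tc l Lt by simp
  qed
  have Lvec: "L (vec m g) l = L g l" if "l < p" "\<And>i. i < m \<Longrightarrow> g i \<in> carrier A" for g l
    unfolding L_def vec_def using that u by (intro finsum_cong') auto
  have "\<exists>q. (\<forall>n. \<forall>j<k. q n j \<in> carrier A) \<and> (\<forall>j<k. null (\<lambda>n. q n j)) \<and>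
             (\<forall>n. \<forall>i<m. vec m (\<delta> n) i = (\<Oplus>j\<in>{..<k}. q n j \<otimes> f j i))"
  proof (rule es2)
    show "\<forall>n. vec m (\<delta> n) \<in> S"
      using Lvec dc Ld by (auto simp: S_def) (auto simp: vec_def)
    show "\<forall>i<m. null (\<lambda>n. vec m (\<delta> n) i)"
    proof (intro allI impI)
      fix i assume i: "i < m"
      have "null (\<lambda>n. \<delta> (Suc n) i)" using tcauchy[OF i] by (simp add: \<delta>_def cauchy_def)
      then have "null (\<lambda>n. \<delta> n i)" using null_Suc[of "\<lambda>n. \<delta> n i"] by simp
      then show "null (\<lambda>n. vec m (\<delta> n) i)" using i by (simp add: vec_def)
    qed
  qed
  then obtain q where q: "\<And>n j. j < k \<Longrightarrow> q n j \<in> carrier A" "\<And>j. j < k \<Longrightarrow> null (\<lambda>n. q n j)"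
    "\<And>n i. i < m \<Longrightarrow> \<delta> n i = (\<Oplus>j\<in>{..<k}. q n j \<otimes> f j i)" by (auto simp: vec_def)
  define Q where "Q j n = (\<Oplus>t\<in>{..n}. q t j)" for j n
  have Qc: "Q j n \<in> carrier A" if "j < k" for j n unfolding Q_def using q(1) that by (intro finsum_closed) auto
  have QS: "Q j (Suc n) = q (Suc n) j \<oplus> Q j n" if "j < k" for j n
    unfolding Q_def atMost_Suc using q(1) that by (intro finsum_insert) auto
  have Qcauchy: "cauchy (Q j)" if j: "j < k" for j
  proof -
    have "Q j (Suc n) \<ominus> Q j n = q (Suc n) j" for n
      using QS[OF j] Qc[OF j] q(1)[OF j] by (simp add: minus_eq a_assoc r_neg)
    then show ?thesis using null_Suc[of "\<lambda>n. q n j"] q(2)[OF j] Qc[OF j] by (simp add: cauchy_def)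
  qed
  have tQ: "\<tau> i n = (\<Oplus>j\<in>{..<k}. Q j n \<otimes> f j i)" if i: "i < m" for i n
  proof (induction n)
    case 0
    have "Q j 0 = q 0 j" if "j < k" for j unfolding Q_def using q(1) that by simp
    then have "(\<Oplus>j\<in>{..<k}. Q j 0 \<otimes> f j i) = (\<Oplus>j\<in>{..<k}. q 0 j \<otimes> f j i)" using q(1) fc by (intro finsum_cong') auto
    then show ?case using q(3)[OF i, of 0] by (simp add: \<delta>_def)
  next
    case (Suc n)
    have "(\<Oplus>j\<in>{..<k}. Q j (Suc n) \<otimes> f j i) = (\<Oplus>j\<in>{..<k}. q (Suc n) j \<otimes> f j i \<oplus> Q j n \<otimes> f j i)"
      using q(1) Qc fc QS by (intro finsum_cong') (auto simp: l_distr)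
    also have "\<dots> = (\<Oplus>j\<in>{..<k}. q (Suc n) j \<otimes> f j i) \<oplus> (\<Oplus>j\<in>{..<k}. Q j n \<otimes> f j i)"
      using q(1) Qc fc by (intro finsum_addf) auto
    also have "\<dots> = \<delta> (Suc n) i \<oplus> \<tau> i n" using q(3)[OF i] Suc.IH by simp
    also have "\<dots> = \<tau> i (Suc n)" using tc[OF i] by (simp add: \<delta>_def diff_add_cancel)
    finally show ?case by simp
  qed
  show ?thesis
  proof (intro exI conjI allI impI)
    fix j assume j: "j < k" show "cls (Q j) \<in> carrier B" using cls_closed Qcauchy j by blast
  next
    fix j i assume "j < k" "i < m" then show "f j i \<in> carrier A" using fc by blast
  next
    fix j l assume "j < k" "l < p"
    then show "(\<Oplus>i\<in>{..<m}. f j i \<otimes> u i l) = \<zero>" using f[of j] unfolding S_def L_def by blast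
  next
    fix i assume i: "i < m"
    have "b i = cls (\<lambda>n. \<Oplus>j\<in>{..<k}. Q j n \<otimes> f j i)" unfolding tcls[OF i] by (rule arg_cong[of _ _ cls]) (simp add: fun_eq_iff tQ[OF i])
    then show "b i = (\<Oplus>\<^bsub>B\<^esub>j\<in>{..<k}. cls (Q j) \<otimes>\<^bsub>B\<^esub> \<iota>\<^sub>B (f j i))"
      using cls_finsum(2)[of "{..<k}" Q "\<lambda>j. f j i"] Qcauchy fc by simp
  qed
qed

text \<open>
  If \<open>1\<close> is in the left ideal generated by \<open>I\<close> in the completion, then truncating the coefficients
  shows that it is a limit of elements of \<open>I\<close>.
\<close>

lemma faithfulness:
  fixes k :: nat
  assumes I: "I \<subseteq> carrier A" "\<zero> \<in> I" "\<And>u v. u \<in> I \<Longrightarrow> v \<in> I \<Longrightarrow> u \<oplus> v \<in> I"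
      "\<And>a v. a \<in> carrier A \<Longrightarrow> v \<in> I \<Longrightarrow> a \<otimes> v \<in> I"
    and c: "\<And>j. j < k \<Longrightarrow> c j \<in> carrier B" and a: "\<And>j. j < k \<Longrightarrow> a j \<in> I"
    and one: "\<one>\<^bsub>B\<^esub> = (\<Oplus>\<^bsub>B\<^esub>j\<in>{..<k}. c j \<otimes>\<^bsub>B\<^esub> \<iota>\<^sub>B (a j))"
  shows "\<one> \<in> I"
proof -
  obtain \<beta> where \<beta>: "\<And>i. i < k \<Longrightarrow> cauchy (\<beta> i)" "\<And>i. i < k \<Longrightarrow> c i = cls (\<beta> i)"
    using choice[of "\<lambda>i u. i < k \<longrightarrow> cauchy u \<and> c i = cls u"] cls_surj c by blast
  have ac: "a j \<in> carrier A" if "j < k" for j using a[OF that] I(1) by blast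
  have "(\<Oplus>\<^bsub>B\<^esub>i\<in>{..<k}. c i \<otimes>\<^bsub>B\<^esub> \<iota>\<^sub>B (a i)) = (\<Oplus>\<^bsub>B\<^esub>i\<in>{..<k}. cls (\<beta> i) \<otimes>\<^bsub>B\<^esub> \<iota>\<^sub>B (a i))"
    using \<beta> c ac by (intro B.finsum_cong') (auto simp: cls_closed cauchy_const)
  then have "cls (\<lambda>n. \<Oplus>i\<in>{..<k}. \<beta> i n \<otimes> a i) = cls (\<lambda>_. \<one>)"
    using cls_finsum(2)[of "{..<k}" \<beta> a] \<beta> ac one by (simp add: cls_one)
  moreover have "cauchy (\<lambda>n. \<Oplus>i\<in>{..<k}. \<beta> i n \<otimes> a i)" using cls_finsum(1)[of "{..<k}" \<beta> a] \<beta> ac by simp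
  ultimately have n: "null (\<lambda>n. (\<Oplus>i\<in>{..<k}. \<beta> i n \<otimes> a i) \<ominus> \<one>)" using cls_eq cauchy_const by blast
  have "j \<le> k \<Longrightarrow> (\<Oplus>i\<in>{..<j}. \<beta> i n \<otimes> a i) \<in> I" for n j
  proof (induction j)
    case (Suc j)
    have "(\<Oplus>i\<in>{..<Suc j}. \<beta> i n \<otimes> a i) = \<beta> j n \<otimes> a j \<oplus> (\<Oplus>i\<in>{..<j}. \<beta> i n \<otimes> a i)"
      unfolding lessThan_Suc using Suc.prems \<beta>(1) cauchy_closed ac by (intro finsum_insert) auto
    then show ?case using Suc I(3,4) \<beta>(1) cauchy_closed a by simp
  qed (simp add: I(2))
  then show ?thesis using one_not_limit[OF I, of "\<lambda>n. \<Oplus>i\<in>{..<k}. \<beta> i n \<otimes> a i"] n by blast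
qed

end

section \<open>The submultiplicative seminorms\<close>

locale commutator_algebra_with_scalars = commutator_algebra K abs_K A d \<kappa> x
  for K :: "('k, 'z) ring_scheme" and abs_K :: "'k \<Rightarrow> real" and A :: "('k, 'a) module" (structure)
    and d \<kappa> x +
  assumes smult_eq: "c \<in> carrier K \<Longrightarrow> a \<in> carrier A \<Longrightarrow> c \<odot>\<^bsub>A\<^esub> a = \<kappa> c \<otimes> a"
begin

abbreviation \<Q> :: "('a \<Rightarrow> real) set" where
  "\<Q> \<equiv> submultiplicative_seminorms K abs_K A"

lemma seminorm_nonneg: "q \<in> \<Q> \<Longrightarrow> a \<in> carrier A \<Longrightarrow> 0 \<le> q a"
  and seminorm_add: "q \<in> \<Q> \<Longrightarrow> a \<in> carrier A \<Longrightarrow> b \<in> carrier A \<Longrightarrow> q (a \<oplus> b) \<le> max (q a) (q b)"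
  and seminorm_scale: "q \<in> \<Q> \<Longrightarrow> c \<in> carrier K \<Longrightarrow> a \<in> carrier A \<Longrightarrow> q (\<kappa> c \<otimes> a) = abs_K c * q a"
  and seminorm_mult: "q \<in> \<Q> \<Longrightarrow> a \<in> carrier A \<Longrightarrow> b \<in> carrier A \<Longrightarrow> q (a \<otimes> b) \<le> q a * q b"
  using smult_eq by (auto simp: submultiplicative_seminorms_def)

lemma seminorm_zero: "q \<in> \<Q> \<Longrightarrow> q \<zero> = 0"
  using seminorm_scale[of q "\<zero>\<^bsub>K\<^esub>" \<one>] by (simp add: \<kappa>_zero abs_zero)

lemma seminorm_neg: "q \<in> \<Q> \<Longrightarrow> a \<in> carrier A \<Longrightarrow> q (\<ominus> a) = q a"
  using seminorm_scale[of q "\<ominus>\<^bsub>K\<^esub> \<one>\<^bsub>K\<^esub>" a] by (simp add: \<kappa>_neg \<kappa>_one abs_neg_one l_minus)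

lemma seminorm_diff_sym: "q \<in> \<Q> \<Longrightarrow> a \<in> carrier A \<Longrightarrow> b \<in> carrier A \<Longrightarrow> q (a \<ominus> b) = q (b \<ominus> a)"
  using seminorm_neg[of q "a \<ominus> b"] by (simp add: minus_diff)

lemma seminorm_triangle:
  assumes "q \<in> \<Q>" "a \<in> carrier A" "b \<in> carrier A" "c \<in> carrier A" "q (a \<ominus> b) < \<epsilon>" "q (b \<ominus> c) < \<epsilon>"
  shows "q (a \<ominus> c) < \<epsilon>"
proof -
  have "q ((a \<ominus> b) \<oplus> (b \<ominus> c)) \<le> max (q (a \<ominus> b)) (q (b \<ominus> c))" using assms by (intro seminorm_add) auto
  then show ?thesis using assms by (simp add: diff_chain)
qed

text \<open>
  A submultiplicative seminorm is bounded on words by the product of its values on the letters. With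
  \<open>R\<close> not below these values it is dominated by the gauge seminorm, up to the factor \<open>q \<one>\<close>.
\<close>

lemma seminorm_bounded_on_nbhd:
  assumes q: "q \<in> \<Q>"
  shows "\<exists>R0\<ge>1. \<forall>R\<ge>R0. \<forall>\<rho>\<ge>0. \<forall>a\<in>nbhd 1 R \<rho>. q a \<le> q \<one> * \<rho>"
proof -
  define R0 where "R0 = Max (insert 1 ((\<lambda>k. q (x k)) ` {..<d}))"
  have R0: "1 \<le> R0" "\<And>k. k < d \<Longrightarrow> q (x k) \<le> R0" unfolding R0_def by auto
  have "q a \<le> q \<one> * \<rho>" if R: "R \<ge> R0" and \<rho>: "\<rho> \<ge> 0" and a: "a \<in> nbhd 1 R \<rho>" for R \<rho> a
  proof -
    have w: "q (word w) \<le> q \<one> * R ^ wt d 1 w 0" if "w \<in> lists {..<d}" for w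
      using that
    proof (induction w rule: list.induct)
      case (Cons k w)
      have k: "k < d" "w \<in> lists {..<d}" using Cons.prems by auto
      have "q (x k \<otimes> word w) \<le> q (x k) * q (word w)" using k q x_closed by (intro seminorm_mult) auto
      also have "\<dots> \<le> R ^ 2 * (q \<one> * R ^ wt d 1 w 0)"
      proof (intro mult_mono)
        have "R ^ 1 \<le> R ^ 2" using R R0(1) by (intro power_increasing) auto
        then show "q (x k) \<le> R ^ 2" using R0(2)[OF k(1)] R by simp
      qed (use Cons.IH k R R0(1) seminorm_nonneg[OF q] in auto)
      finally show ?case by (simp add: wt_Cons power_add mult_ac power2_eq_square)
    qed (simp add: wt_def)
    show ?thesis using a unfolding nbhd_def
    proof induction
      case zero show ?case using \<rho> seminorm_zero[OF q] seminorm_nonneg[OF q] by simp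
    next
      case (incl s)
      then obtain c w where s: "s = \<kappa> c \<otimes> word w" "c \<in> carrier K" "w \<in> lists {..<d}" "abs_K c * R ^ wt d 1 w 0 \<le> \<rho>" by blast
      have "q s = abs_K c * q (word w)" using s q by (simp add: seminorm_scale)
      also have "\<dots> \<le> abs_K c * (q \<one> * R ^ wt d 1 w 0)" using s w K.nonneg by (intro mult_left_mono) auto
      also have "\<dots> = q \<one> * (abs_K c * R ^ wt d 1 w 0)" by simp
      also have "\<dots> \<le> q \<one> * \<rho>" using s seminorm_nonneg[OF q] by (intro mult_left_mono) auto
      finally show ?case .
    next
      case (add a b)
      then show ?case using seminorm_add[OF q nbhd_closed[unfolded nbhd_def] nbhd_closed[unfolded nbhd_def], OF add.hyps] by simp
    next
      case (neg a)
      then show ?case using seminorm_neg[OF q nbhd_closed[unfolded nbhd_def], OF neg.hyps] by simp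
    qed
  qed
  then show ?thesis using R0(1) by blast
qed

text \<open>
  The Minkowski functional of the sets \<open>nbhd B R\<close>.
\<close>

definition gauge :: "nat \<Rightarrow> real \<Rightarrow> 'a \<Rightarrow> real" where
  "gauge B R a = Inf {\<rho>. 0 \<le> \<rho> \<and> a \<in> nbhd B R \<rho>}"

lemma gauge_le: "0 \<le> \<rho> \<Longrightarrow> a \<in> nbhd B R \<rho> \<Longrightarrow> gauge B R a \<le> \<rho>"
  unfolding gauge_def by (intro cInf_lower) (auto intro: bdd_belowI)

lemma gauge_nonneg: "a \<in> carrier A \<Longrightarrow> 0 \<le> gauge B R a"
  unfolding gauge_def using nbhd_exists[of a B R] by (intro cInf_greatest) (auto intro: less_imp_le)

lemma gauge_lessD:
  assumes "0 \<le> R" "a \<in> carrier A" "gauge B R a < \<epsilon>" shows "a \<in> nbhd B R \<epsilon>"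
proof -
  have "{\<rho>. 0 \<le> \<rho> \<and> a \<in> nbhd B R \<rho>} \<noteq> {}" using nbhd_exists[OF assms(2), of B R] by (auto intro: less_imp_le)
  then obtain \<rho> where "0 \<le> \<rho>" "a \<in> nbhd B R \<rho>" "\<rho> < \<epsilon>"
    using cInf_lessD[OF _ assms(3)[unfolded gauge_def]] by auto
  then show ?thesis using nbhd_mono[of R R \<rho> \<epsilon> B] assms(1) by auto
qed

lemma nbhd_scale:
  assumes c: "c \<in> carrier K" and a: "a \<in> nbhd B R \<rho>" shows "\<kappa> c \<otimes> a \<in> nbhd B R (abs_K c * \<rho>)"
  unfolding nbhd_def
proof (rule add_span_image[OF A.abelian_group_axioms A.abelian_group_axioms, where f = "\<lambda>a. \<kappa> c \<otimes> a"])
  show "a \<in> add_span A {\<kappa> c \<otimes> word w | c w. c \<in> carrier K \<and> w \<in> lists {..<d} \<and> abs_K c * R ^ wt d B w 0 \<le> \<rho>}"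
    using a by (simp add: nbhd_def)
  fix s assume "s \<in> {\<kappa> c \<otimes> word w | c w. c \<in> carrier K \<and> w \<in> lists {..<d} \<and> abs_K c * R ^ wt d B w 0 \<le> \<rho>}"
  then obtain c' w' where s: "s = \<kappa> c' \<otimes> word w'" "c' \<in> carrier K" "w' \<in> lists {..<d}" "abs_K c' * R ^ wt d B w' 0 \<le> \<rho>"
    by blast
  have "abs_K (c \<otimes>\<^bsub>K\<^esub> c') * R ^ wt d B w' 0 \<le> abs_K c * \<rho>"
    using c s K.nonneg by (simp add: K.multiplicative mult.assoc mult_left_mono)
  then have "\<kappa> (c \<otimes>\<^bsub>K\<^esub> c') \<otimes> word w' \<in> nbhd B R (abs_K c * \<rho>)" using c s by (intro word_nbhd) auto
  then show "\<kappa> c \<otimes> s \<in> add_span A {\<kappa> b \<otimes> word w | b w. b \<in> carrier K \<and> w \<in> lists {..<d} \<and> abs_K b * R ^ wt d B w 0 \<le> abs_K c * \<rho>}"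
    unfolding nbhd_def using c s by (simp add: \<kappa>_mult m_assoc)
next
  show "{\<kappa> c \<otimes> word w | c w. c \<in> carrier K \<and> w \<in> lists {..<d} \<and> abs_K c * R ^ wt d B w 0 \<le> \<rho>} \<subseteq> carrier A"
    using A.m_closed word_closed \<kappa>_closed by blast
qed (use c in \<open>simp_all add: r_distr\<close>)

lemma gauge_seminorm:
  assumes R: "0 \<le> R" shows "gauge B R \<in> \<Q>"
  unfolding submultiplicative_seminorms_def
proof (intro CollectI conjI ballI)
  fix a assume "a \<in> carrier A" then show "0 \<le> gauge B R a" by (rule gauge_nonneg)
next
  fix a b assume a: "a \<in> carrier A" and b: "b \<in> carrier A"
  show "gauge B R (a \<oplus> b) \<le> max (gauge B R a) (gauge B R b)"
  proof (rule field_le_epsilon)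
    fix e :: real assume e: "0 < e"
    let ?m = "max (gauge B R a) (gauge B R b) + e"
    have "a \<in> nbhd B R ?m" "b \<in> nbhd B R ?m" using e a b R by (auto intro!: gauge_lessD simp: max_def)
    then show "gauge B R (a \<oplus> b) \<le> ?m"
      using gauge_nonneg[OF a, of B R] e by (intro gauge_le nbhd_add) auto
  qed
next
  fix a b assume a: "a \<in> carrier A" and b: "b \<in> carrier A"
  have le: "gauge B R (a \<otimes> b) \<le> (gauge B R a + e) * (gauge B R b + e)" if e: "0 < e" for e
  proof (rule gauge_le)
    have "a \<in> nbhd B R (gauge B R a + e)" "b \<in> nbhd B R (gauge B R b + e)" using e a b R by (auto intro!: gauge_lessD)
    then show "a \<otimes> b \<in> nbhd B R ((gauge B R a + e) * (gauge B R b + e))"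
      using gauge_nonneg[OF a, of B R] e R by (intro nbhd_mult) auto
  qed (use gauge_nonneg[OF a, of B R] gauge_nonneg[OF b, of B R] e in auto)
  have lim: "((\<lambda>e. (gauge B R a + e) * (gauge B R b + e)) \<longlongrightarrow> (gauge B R a + 0) * (gauge B R b + 0)) (at_right 0)"
    by (intro tendsto_intros)
  have ev: "\<forall>\<^sub>F e in at_right 0. gauge B R (a \<otimes> b) \<le> (gauge B R a + e) * (gauge B R b + e)"
    using le by (auto simp: eventually_at_right_field intro!: exI[of _ 1])
  show "gauge B R (a \<otimes> b) \<le> gauge B R a * gauge B R b"
    using tendsto_lowerbound[OF lim ev] by simp
next
  fix c a assume c: "c \<in> carrier K" and a: "a \<in> carrier A"
  have le: "gauge B R (\<kappa> c \<otimes> a) \<le> abs_K c * gauge B R a" if c: "c \<in> carrier K" and a: "a \<in> carrier A" for c a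
  proof (rule field_le_epsilon)
    fix e :: real assume e: "0 < e"
    let ?e = "e / (abs_K c + 1)"
    have c0: "0 \<le> abs_K c" using K.nonneg[OF c] .
    have e': "0 < ?e" using e c0 by simp
    have "a \<in> nbhd B R (gauge B R a + ?e)" using e' a R by (intro gauge_lessD) auto
    from nbhd_scale[OF c this] have "gauge B R (\<kappa> c \<otimes> a) \<le> abs_K c * (gauge B R a + ?e)"
      using gauge_nonneg[OF a, of B R] e' c0 by (intro gauge_le) auto
    also have "\<dots> \<le> abs_K c * gauge B R a + e"
      using c0 e by (simp add: distrib_left divide_le_eq mult_left_mono algebra_simps)
    finally show "gauge B R (\<kappa> c \<otimes> a) \<le> abs_K c * gauge B R a + e" .
  qed
  have "gauge B R (\<kappa> c \<otimes> a) = abs_K c * gauge B R a"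
  proof (cases "c = \<zero>\<^bsub>K\<^esub>")
    case True
    then show ?thesis using gauge_le[of 0 \<zero> B R] nbhd_zero gauge_nonneg[of \<zero> B R] a by (simp add: \<kappa>_zero abs_zero)
  next
    case False
    have inv: "inv\<^bsub>K\<^esub> c \<in> carrier K" "inv\<^bsub>K\<^esub> c \<otimes>\<^bsub>K\<^esub> c = \<one>\<^bsub>K\<^esub>" using K.field_Units c False by auto
    have "\<kappa> (inv\<^bsub>K\<^esub> c) \<otimes> (\<kappa> c \<otimes> a) = a"
      using inv c a by (simp add: m_assoc[symmetric] \<kappa>_mult[symmetric] \<kappa>_one)
    then have "gauge B R a \<le> abs_K (inv\<^bsub>K\<^esub> c) * gauge B R (\<kappa> c \<otimes> a)"
      using le[OF inv(1), of "\<kappa> c \<otimes> a"] c a by simp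
    then have "abs_K c * gauge B R a \<le> abs_K c * (abs_K (inv\<^bsub>K\<^esub> c) * gauge B R (\<kappa> c \<otimes> a))"
      using K.nonneg[OF c] by (rule mult_left_mono)
    moreover have "abs_K c * abs_K (inv\<^bsub>K\<^esub> c) = 1"
      using K.multiplicative[OF inv(1) c] inv(2) abs_one by (simp add: mult.commute)
    ultimately have "abs_K c * gauge B R a \<le> gauge B R (\<kappa> c \<otimes> a)" by (simp add: mult.assoc[symmetric])
    then show ?thesis using le[OF c a] by simp
  qed
  then show "gauge B R (c \<odot>\<^bsub>A\<^esub> a) = abs_K c * gauge B R a" using smult_eq c a by simp
qed

text \<open>
  So the convergence used in the algebraic part is the one of the Arens--Michael topology.
\<close>

lemma null_iff_seminorms:
  assumes \<gamma>: "\<And>n. \<gamma> n \<in> carrier A"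
  shows "null \<gamma> \<longleftrightarrow> (\<forall>q\<in>\<Q>. \<forall>\<epsilon>>0. \<exists>N. \<forall>n\<ge>N. q (\<gamma> n) < \<epsilon>)"
proof (intro iffI ballI allI impI)
  fix q and \<epsilon> :: real assume n: "null \<gamma>" and q: "q \<in> \<Q>" and e: "0 < \<epsilon>"
  obtain R where R': "R \<ge> 1" "\<forall>R'\<ge>R. \<forall>\<rho>\<ge>0. \<forall>a\<in>nbhd 1 R' \<rho>. q a \<le> q \<one> * \<rho>"
    using seminorm_bounded_on_nbhd[OF q] by (elim exE conjE) rule
  have R: "R \<ge> 1" "\<And>\<rho> a. \<rho> \<ge> 0 \<Longrightarrow> a \<in> nbhd 1 R \<rho> \<Longrightarrow> q a \<le> q \<one> * \<rho>"
    using R'(1) R'(2)[rule_format, OF order.refl] by blast+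
  have q1: "0 \<le> q \<one>" using seminorm_nonneg[OF q] by simp
  let ?\<rho> = "\<epsilon> / (q \<one> + 1)"
  have \<rho>: "0 < ?\<rho>" "q \<one> * ?\<rho> < \<epsilon>" using e q1 by (auto simp: divide_simps algebra_simps)
  have "\<forall>\<^sub>F n in sequentially. \<gamma> n \<in> nbhd 1 R ?\<rho>" using nullD[OF n _ R(1) \<rho>(1)] by simp
  then obtain N where "\<And>n. n \<ge> N \<Longrightarrow> \<gamma> n \<in> nbhd 1 R ?\<rho>" unfolding eventually_sequentially by blast
  then have "q (\<gamma> n) < \<epsilon>" if "n \<ge> N" for n using R(2)[of ?\<rho> "\<gamma> n"] \<rho> that by fastforce
  then show "\<exists>N. \<forall>n\<ge>N. q (\<gamma> n) < \<epsilon>" by blast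
next
  assume s: "\<forall>q\<in>\<Q>. \<forall>\<epsilon>>0. \<exists>N. \<forall>n\<ge>N. q (\<gamma> n) < \<epsilon>"
  show "null \<gamma>" unfolding null_def
  proof (intro allI impI)
    fix B :: nat and R \<epsilon> :: real assume R: "1 \<le> R" and e: "0 < \<epsilon>"
    then obtain N where "\<And>n. n \<ge> N \<Longrightarrow> gauge B R (\<gamma> n) < \<epsilon>" using s gauge_seminorm[of R B] by fastforce
    then have "\<gamma> n \<in> nbhd B R \<epsilon>" if "n \<ge> N" for n using gauge_lessD[of R "\<gamma> n"] \<gamma> R that by simp
    then show "\<forall>\<^sub>F n in sequentially. \<gamma> n \<in> nbhd B R \<epsilon>" unfolding eventually_sequentially by blast
  qed
qed

lemma cauchy_pairs:
  assumes u: "cauchy u" and q: "q \<in> \<Q>" and e: "0 < \<epsilon>"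
  shows "\<exists>N. \<forall>m\<ge>N. \<forall>n\<ge>N. q (u m \<ominus> u n) < \<epsilon>"
proof -
  have uc: "u n \<in> carrier A" for n using cauchy_closed[OF u] .
  have "null (\<lambda>n. u (Suc n) \<ominus> u n)" using u by (simp add: cauchy_def)
  then obtain N where N: "\<And>n. n \<ge> N \<Longrightarrow> q (u (Suc n) \<ominus> u n) < \<epsilon>"
    using null_iff_seminorms[of "\<lambda>n. u (Suc n) \<ominus> u n"] uc q e by fastforce
  have b: "q (u (N + k) \<ominus> u N) < \<epsilon>" for k
  proof (induction k)
    case 0 then show ?case using uc e seminorm_zero[OF q] by (simp add: minus_eq r_neg)
  next
    case (Suc k)
    show ?case using seminorm_triangle[OF q uc uc uc N Suc.IH] by simp
  qed
  have "q (u m \<ominus> u n) < \<epsilon>" if "m \<ge> N" "n \<ge> N" for m n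
    using seminorm_triangle[OF q uc[of m] uc[of N] uc[of n]] b[of "m - N"] b[of "n - N"] that seminorm_diff_sym[OF q uc[of n] uc[of N]] by simp
  then show ?thesis by blast
qed

lemma cauchyI:
  assumes "\<And>n. u n \<in> carrier A" and "\<And>q \<epsilon>. q \<in> \<Q> \<Longrightarrow> 0 < \<epsilon> \<Longrightarrow> \<exists>N. \<forall>m\<ge>N. \<forall>n\<ge>N. q (u m \<ominus> u n) < \<epsilon>"
  shows "cauchy u"
proof -
  have "null (\<lambda>n. u (Suc n) \<ominus> u n)"
  proof (subst null_iff_seminorms, use assms(1) in simp, intro ballI allI impI)
    fix q and \<epsilon> :: real assume "q \<in> \<Q>" "0 < \<epsilon>"
    then obtain N where "\<forall>m\<ge>N. \<forall>n\<ge>N. q (u m \<ominus> u n) < \<epsilon>" using assms(2) by blast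
    then show "\<exists>N. \<forall>n\<ge>N. q (u (Suc n) \<ominus> u n) < \<epsilon>" by (intro exI[of _ N]) simp
  qed
  then show ?thesis using assms(1) by (simp add: cauchy_def)
qed

lemma cauchy_bounded:
  assumes u: "cauchy u" and q: "q \<in> \<Q>"
  shows "\<exists>M>0. \<exists>N. \<forall>n\<ge>N. q (u n) \<le> M"
proof -
  obtain N where N: "\<forall>m\<ge>N. \<forall>n\<ge>N. q (u m \<ominus> u n) < 1" using cauchy_pairs[OF u q, of 1] by auto
  have uc: "u n \<in> carrier A" for n using cauchy_closed[OF u] .
  have "q (u n) \<le> max 1 (q (u N))" if "n \<ge> N" for n
    using seminorm_add[OF q, of "u n \<ominus> u N" "u N"] N that uc diff_add_cancel[OF uc[of n] uc[of N]] by fastforce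
  then show ?thesis by (intro exI[of _ "max 1 (q (u N))"]) auto
qed

end

section \<open>The Arens--Michael envelope by Cauchy sequences\<close>

context commutator_algebra_with_scalars
begin

abbreviation close :: "'a filter \<Rightarrow> 'a filter \<Rightarrow> bool" where
  "close \<equiv> small_difference A \<Q>"

definition carrier_filter :: "'a filter \<Rightarrow> bool" where
  "carrier_filter F \<longleftrightarrow> F \<noteq> bot \<and> F \<le> principal (carrier A)"

abbreviation tail_filter :: "(nat \<Rightarrow> 'a) \<Rightarrow> 'a filter" where
  "tail_filter u \<equiv> filtermap u sequentially"

definition cls :: "(nat \<Rightarrow> 'a) \<Rightarrow> 'a filter set" where
  "cls u = completion_class A \<Q> (tail_filter u)"

lemma close_iff:
  "close F G \<longleftrightarrow> (\<forall>q\<in>\<Q>. \<forall>\<epsilon>>0. \<exists>P P'. eventually P F \<and> eventually P' G \<and> (\<forall>a b. P a \<longrightarrow> P' b \<longrightarrow> q (a \<ominus> b) < \<epsilon>))"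
  unfolding small_difference_def eventually_prod_filter by simp

lemma carrier_filter_eventually: "carrier_filter F \<Longrightarrow> eventually (\<lambda>a. a \<in> carrier A) F"
  by (simp add: carrier_filter_def le_principal)

lemma close_sym:
  assumes "carrier_filter F" "carrier_filter G" "close F G" shows "close G F"
  unfolding close_iff
proof (intro ballI allI impI)
  fix q and \<epsilon> :: real assume q: "q \<in> \<Q>" and e: "0 < \<epsilon>"
  then obtain P P' where P: "eventually P F" "eventually P' G" "\<And>a b. P a \<Longrightarrow> P' b \<Longrightarrow> q (a \<ominus> b) < \<epsilon>"
    using assms(3) unfolding close_iff by blast
  have "eventually (\<lambda>a. P a \<and> a \<in> carrier A) F" "eventually (\<lambda>a. P' a \<and> a \<in> carrier A) G"
    using P carrier_filter_eventually assms by (auto intro: eventually_conj)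
  moreover have "q (b \<ominus> a) < \<epsilon>" if "P' b \<and> b \<in> carrier A" "P a \<and> a \<in> carrier A" for a b
    using P(3)[of a b] seminorm_diff_sym[OF q, of a b] that by simp
  ultimately show "\<exists>P P'. eventually P G \<and> eventually P' F \<and> (\<forall>a b. P a \<longrightarrow> P' b \<longrightarrow> q (a \<ominus> b) < \<epsilon>)" by blast
qed

lemma close_trans:
  assumes "carrier_filter F" "carrier_filter G" "carrier_filter H" "close F G" "close G H" shows "close F H"
  unfolding close_iff
proof (intro ballI allI impI)
  fix q and \<epsilon> :: real assume q: "q \<in> \<Q>" and e: "0 < \<epsilon>"
  obtain P P' where P: "eventually P F" "eventually P' G" "\<And>a b. P a \<Longrightarrow> P' b \<Longrightarrow> q (a \<ominus> b) < \<epsilon>"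
    using assms(4) q e unfolding close_iff by blast
  obtain S S' where S: "eventually S G" "eventually S' H" "\<And>a b. S a \<Longrightarrow> S' b \<Longrightarrow> q (a \<ominus> b) < \<epsilon>"
    using assms(5) q e unfolding close_iff by blast
  have "eventually (\<lambda>b. P' b \<and> S b \<and> b \<in> carrier A) G"
    using P(2) S(1) carrier_filter_eventually[OF assms(2)] by (intro eventually_conj)
  then obtain b where b: "P' b" "S b" "b \<in> carrier A"
    using assms(2) eventually_happens' unfolding carrier_filter_def by blast
  have "eventually (\<lambda>a. P a \<and> a \<in> carrier A) F" "eventually (\<lambda>a. S' a \<and> a \<in> carrier A) H"
    using P(1) S(2) carrier_filter_eventually assms by (auto intro: eventually_conj)
  moreover have "q (a \<ominus> c) < \<epsilon>" if "P a \<and> a \<in> carrier A" "S' c \<and> c \<in> carrier A" for a c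
    using seminorm_triangle[OF q _ b(3), of a c \<epsilon>] P(3)[of a b] S(3)[of b c] b that by simp
  ultimately show "\<exists>P P'. eventually P F \<and> eventually P' H \<and> (\<forall>a b. P a \<longrightarrow> P' b \<longrightarrow> q (a \<ominus> b) < \<epsilon>)" by blast
qed

lemma close_tail_iff:
  "close F (tail_filter u) \<longleftrightarrow> (\<forall>q\<in>\<Q>. \<forall>\<epsilon>>0. \<exists>P N. eventually P F \<and> (\<forall>a n. P a \<longrightarrow> N \<le> n \<longrightarrow> q (a \<ominus> u n) < \<epsilon>))"
proof (intro iffI ballI allI impI)
  fix q and \<epsilon> :: real assume "close F (tail_filter u)" and q: "q \<in> \<Q>" and e: "0 < \<epsilon>"
  then obtain P P' where P: "eventually P F" "eventually P' (tail_filter u)" "\<And>a b. P a \<Longrightarrow> P' b \<Longrightarrow> q (a \<ominus> b) < \<epsilon>"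
    unfolding close_iff by blast
  then obtain N where "\<And>n. N \<le> n \<Longrightarrow> P' (u n)" unfolding eventually_filtermap eventually_sequentially by blast
  then show "\<exists>P N. eventually P F \<and> (\<forall>a n. P a \<longrightarrow> N \<le> n \<longrightarrow> q (a \<ominus> u n) < \<epsilon>)" using P by blast
next
  assume *: "\<forall>q\<in>\<Q>. \<forall>\<epsilon>>0. \<exists>P N. eventually P F \<and> (\<forall>a n. P a \<longrightarrow> N \<le> n \<longrightarrow> q (a \<ominus> u n) < \<epsilon>)"
  show "close F (tail_filter u)" unfolding close_iff
  proof (intro ballI allI impI)
    fix q and \<epsilon> :: real assume q: "q \<in> \<Q>" and e: "0 < \<epsilon>"
    then obtain P N where P: "eventually P F" "\<And>a n. P a \<Longrightarrow> N \<le> n \<Longrightarrow> q (a \<ominus> u n) < \<epsilon>" using * by blast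
    have "eventually (\<lambda>b. \<exists>n\<ge>N. b = u n) (tail_filter u)"
      unfolding eventually_filtermap eventually_sequentially by blast
    then show "\<exists>P P'. eventually P F \<and> eventually P' (tail_filter u) \<and> (\<forall>a b. P a \<longrightarrow> P' b \<longrightarrow> q (a \<ominus> b) < \<epsilon>)"
      using P by blast
  qed
qed

lemma close_tails_iff:
  "close (tail_filter u) (tail_filter v) \<longleftrightarrow> (\<forall>q\<in>\<Q>. \<forall>\<epsilon>>0. \<exists>N. \<forall>m\<ge>N. \<forall>n\<ge>N. q (u m \<ominus> v n) < \<epsilon>)"
proof (intro iffI ballI allI impI)
  fix q and \<epsilon> :: real assume "close (tail_filter u) (tail_filter v)" and q: "q \<in> \<Q>" and e: "0 < \<epsilon>"
  then obtain P N where P: "eventually P (tail_filter u)" "\<And>a n. P a \<Longrightarrow> N \<le> n \<Longrightarrow> q (a \<ominus> v n) < \<epsilon>"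
    unfolding close_tail_iff by blast
  then obtain N' where "\<And>n. N' \<le> n \<Longrightarrow> P (u n)" unfolding eventually_filtermap eventually_sequentially by blast
  then have "\<forall>m\<ge>max N N'. \<forall>n\<ge>max N N'. q (u m \<ominus> v n) < \<epsilon>" using P(2) by simp
  then show "\<exists>N. \<forall>m\<ge>N. \<forall>n\<ge>N. q (u m \<ominus> v n) < \<epsilon>" by blast
next
  assume *: "\<forall>q\<in>\<Q>. \<forall>\<epsilon>>0. \<exists>N. \<forall>m\<ge>N. \<forall>n\<ge>N. q (u m \<ominus> v n) < \<epsilon>"
  show "close (tail_filter u) (tail_filter v)" unfolding close_tail_iff
  proof (intro ballI allI impI)
    fix q and \<epsilon> :: real assume q: "q \<in> \<Q>" and e: "0 < \<epsilon>"
    then obtain N where N: "\<forall>m\<ge>N. \<forall>n\<ge>N. q (u m \<ominus> v n) < \<epsilon>" using * by blast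
    have "eventually (\<lambda>b. \<exists>n\<ge>N. b = u n) (tail_filter u)"
      unfolding eventually_filtermap eventually_sequentially by blast
    then show "\<exists>P N. eventually P (tail_filter u) \<and> (\<forall>a n. P a \<longrightarrow> N \<le> n \<longrightarrow> q (a \<ominus> v n) < \<epsilon>)" using N by blast
  qed
qed

lemma tail_carrier_filter: "(\<And>n. u n \<in> carrier A) \<Longrightarrow> carrier_filter (tail_filter u)"
  by (simp add: carrier_filter_def filtermap_bot_iff le_principal eventually_filtermap)

lemma cauchy_filters_iff: "F \<in> cauchy_filters A \<Q> \<longleftrightarrow> carrier_filter F \<and> close F F"
  by (auto simp: cauchy_filters_def carrier_filter_def)

lemma tail_cauchy: "cauchy u \<Longrightarrow> tail_filter u \<in> cauchy_filters A \<Q>"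
  unfolding cauchy_filters_iff close_tails_iff using tail_carrier_filter cauchy_closed cauchy_pairs by blast

lemma completion_class_eq_cls:
  assumes F: "carrier_filter F" and w: "cauchy w" and c: "close F (tail_filter w)"
  shows "F \<in> cauchy_filters A \<Q>" "completion_class A \<Q> F = cls w"
proof -
  have W: "carrier_filter (tail_filter w)" using tail_carrier_filter cauchy_closed[OF w] by blast
  have c': "close (tail_filter w) F" using close_sym[OF F W c] .
  show "F \<in> cauchy_filters A \<Q>" unfolding cauchy_filters_iff using F close_trans[OF F W F c c'] by blast
  show "completion_class A \<Q> F = cls w"
    unfolding completion_class_def cls_def cauchy_filters_iff using close_trans F W c c' by blast
qed

lemma cls_memD: "cauchy u \<Longrightarrow> F \<in> cls u \<Longrightarrow> carrier_filter F \<and> close F (tail_filter u)"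
  unfolding cls_def completion_class_def cauchy_filters_iff
  using close_sym tail_carrier_filter cauchy_closed by blast

lemma tail_mem_cls: "cauchy u \<Longrightarrow> tail_filter u \<in> cls u"
  using tail_cauchy[of u] by (simp add: cls_def completion_class_def cauchy_filters_iff)

lemma cls_eq_iff:
  assumes u: "cauchy u" and v: "cauchy v"
  shows "cls u = cls v \<longleftrightarrow> null (\<lambda>n. u n \<ominus> v n)"
proof -
  have uc: "u n \<in> carrier A" "v n \<in> carrier A" for n using u v cauchy_closed by auto
  have "cls u = cls v \<longleftrightarrow> close (tail_filter u) (tail_filter v)"
  proof
    assume "cls u = cls v"
    then have "tail_filter u \<in> cls v" using tail_mem_cls[OF u] by simp
    then show "close (tail_filter u) (tail_filter v)" using cls_memD[OF v] by blast
  next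
    assume "close (tail_filter u) (tail_filter v)"
    from completion_class_eq_cls(2)[OF tail_carrier_filter v this] uc show "cls u = cls v" by (simp add: cls_def)
  qed
  also have "\<dots> \<longleftrightarrow> (\<forall>q\<in>\<Q>. \<forall>\<epsilon>>0. \<exists>N. \<forall>n\<ge>N. q (u n \<ominus> v n) < \<epsilon>)"
    unfolding close_tails_iff
  proof (intro iffI ballI allI impI)
    fix q and \<epsilon> :: real assume q: "q \<in> \<Q>" and e: "0 < \<epsilon>"
      and *: "\<forall>q\<in>\<Q>. \<forall>\<epsilon>>0. \<exists>N. \<forall>n\<ge>N. q (u n \<ominus> v n) < \<epsilon>"
    obtain N1 where N1: "\<forall>n\<ge>N1. q (u n \<ominus> v n) < \<epsilon>" using * q e by blast
    obtain N2 where N2: "\<forall>m\<ge>N2. \<forall>n\<ge>N2. q (v m \<ominus> v n) < \<epsilon>" using cauchy_pairs[OF v q e] by blast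
    have "q (u m \<ominus> v n) < \<epsilon>" if "m \<ge> max N1 N2" "n \<ge> max N1 N2" for m n
      by (rule seminorm_triangle[OF q uc(1)[of m] uc(2)[of m] uc(2)[of n]]) (use N1 N2 that in auto)
    then show "\<exists>N. \<forall>m\<ge>N. \<forall>n\<ge>N. q (u m \<ominus> v n) < \<epsilon>" by blast
  qed blast
  also have "\<dots> \<longleftrightarrow> null (\<lambda>n. u n \<ominus> v n)" using null_iff_seminorms[of "\<lambda>n. u n \<ominus> v n"] uc by simp
  finally show ?thesis .
qed

text \<open>
  The topology is defined by countably many seminorms, \<open>gauge 1\<close> at the positive integers. A
  sequence is obtained by picking points in small members of the filter for more and more of these
  seminorms.
\<close>

lemma cauchy_filter_has_sequence:
  assumes "F \<in> cauchy_filters A \<Q>"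
  shows "\<exists>u. cauchy u \<and> completion_class A \<Q> F = cls u"
proof -
  have F: "carrier_filter F" "close F F" using assms by (auto simp: cauchy_filters_iff)
  have "\<exists>P. eventually P F \<and> (\<forall>a b. P a \<longrightarrow> P b \<longrightarrow> gauge 1 (real k + 1) (a \<ominus> b) < 1 / (real j + 1))" for k j :: nat
  proof -
    have "gauge 1 (real k + 1) \<in> \<Q>" by (rule gauge_seminorm) simp
    moreover have "0 < 1 / (real j + 1)" by simp
    ultimately obtain P P' where "eventually P F" "eventually P' F" "\<forall>a b. P a \<longrightarrow> P' b \<longrightarrow> gauge 1 (real k + 1) (a \<ominus> b) < 1 / (real j + 1)"
      using F(2) unfolding close_iff by blast
    then show ?thesis by (intro exI[of _ "\<lambda>a. P a \<and> P' a"]) (auto intro: eventually_conj)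
  qed
  then have "\<forall>k. \<exists>P. \<forall>j. eventually (P j) F \<and> (\<forall>a b. P j a \<longrightarrow> P j b \<longrightarrow> gauge 1 (real k + 1) (a \<ominus> b) < 1 / (real j + 1))"
    by (intro allI choice)
  from choice[OF this] obtain P where P: "\<And>k j. eventually (P k j) F"
    "\<And>k j a b. P k j a \<Longrightarrow> P k j b \<Longrightarrow> gauge 1 (real k + 1) (a \<ominus> b) < 1 / (real j + 1)" by blast
  have "\<exists>a. a \<in> carrier A \<and> (\<forall>k\<in>{..n}. \<forall>j\<in>{..n}. P k j a)" for n :: nat
  proof -
    have "eventually (\<lambda>a. a \<in> carrier A \<and> (\<forall>k\<in>{..n}. \<forall>j\<in>{..n}. P k j a)) F"
      using carrier_filter_eventually[OF F(1)] P(1) by (intro eventually_conj eventually_ball_finite ballI finite_atMost)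
    then show ?thesis using F(1) eventually_happens' unfolding carrier_filter_def by blast
  qed
  then have "\<forall>n. \<exists>a. a \<in> carrier A \<and> (\<forall>k\<in>{..n}. \<forall>j\<in>{..n}. P k j a)" by blast
  from choice[OF this] obtain u where u': "\<forall>n. u n \<in> carrier A \<and> (\<forall>k\<in>{..n}. \<forall>j\<in>{..n}. P k j (u n))"
    by (elim exE) rule
  have u: "\<And>n. u n \<in> carrier A" "\<And>n k j. k \<le> n \<Longrightarrow> j \<le> n \<Longrightarrow> P k j (u n)"
    using u' by simp_all
  have bound: "\<exists>S N. eventually S F \<and> (\<forall>n\<ge>N. S (u n)) \<and> (\<forall>a b. S a \<longrightarrow> S b \<longrightarrow> q (a \<ominus> b) < \<epsilon>)"
    if q: "q \<in> \<Q>" and e: "0 < \<epsilon>" for q \<epsilon>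
  proof -
    obtain R0 where R0: "R0 \<ge> 1" "\<forall>R\<ge>R0. \<forall>\<rho>\<ge>0. \<forall>a\<in>nbhd 1 R \<rho>. q a \<le> q \<one> * \<rho>"
      using seminorm_bounded_on_nbhd[OF q] by (elim exE conjE) rule
    obtain k :: nat where k: "R0 \<le> real k" using real_arch_simple by blast
    obtain j :: nat where j: "q \<one> / \<epsilon> \<le> real j" using real_arch_simple by blast
    have jb: "q \<one> * (1 / (real j + 1)) < \<epsilon>"
    proof -
      have "q \<one> \<le> real j * \<epsilon>" using j e by (simp add: divide_le_eq)
      also have "\<dots> < \<epsilon> * (real j + 1)" using e by (simp add: algebra_simps)
      finally show ?thesis by (simp add: divide_less_eq)
    qed
    have "q (a \<ominus> b) < \<epsilon>" if a: "P k j a \<and> a \<in> carrier A" and b: "P k j b \<and> b \<in> carrier A" for a b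
    proof -
      have "a \<ominus> b \<in> nbhd 1 (real k + 1) (1 / (real j + 1))" using P(2)[of k j a b] a b by (intro gauge_lessD) auto
      moreover have "R0 \<le> real k + 1" "0 \<le> 1 / (real j + 1)" using k by auto
      ultimately have "q (a \<ominus> b) \<le> q \<one> * (1 / (real j + 1))" using R0(2) by blast
      then show ?thesis using jb by simp
    qed
    moreover have "eventually (\<lambda>a. P k j a \<and> a \<in> carrier A) F" using P(1) carrier_filter_eventually[OF F(1)] by (rule eventually_conj)
    moreover have "\<forall>n\<ge>max k j. P k j (u n) \<and> u n \<in> carrier A" using u by simp
    ultimately show ?thesis by blast
  qed
  have cu: "cauchy u"
  proof (rule cauchyI[OF u(1)])
    fix q and \<epsilon> :: real assume "q \<in> \<Q>" "0 < \<epsilon>"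
    from bound[OF this] show "\<exists>N. \<forall>m\<ge>N. \<forall>n\<ge>N. q (u m \<ominus> u n) < \<epsilon>" by blast
  qed
  moreover have "close F (tail_filter u)" unfolding close_tail_iff
  proof (intro ballI allI impI)
    fix q and \<epsilon> :: real assume "q \<in> \<Q>" "0 < \<epsilon>"
    from bound[OF this] show "\<exists>P N. eventually P F \<and> (\<forall>a n. P a \<longrightarrow> N \<le> n \<longrightarrow> q (a \<ominus> u n) < \<epsilon>)" by blast
  qed
  ultimately show ?thesis using completion_class_eq_cls(2)[OF F(1)] by blast
qed

text \<open>
  The operations of the completion are unions over all representatives; continuity along the
  representing sequences makes all contributions to such a union equal.
\<close>

lemma completion_class_of_operation:
  assumes u: "cauchy u" "cauchy v" "cauchy (\<lambda>n. f (u n) (v n))"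
    and f: "\<And>a b. a \<in> carrier A \<Longrightarrow> b \<in> carrier A \<Longrightarrow> f a b \<in> carrier A"
    and cont: "\<And>q \<epsilon>. q \<in> \<Q> \<Longrightarrow> 0 < \<epsilon> \<Longrightarrow> \<exists>\<delta>>0. \<exists>N. \<forall>n\<ge>N. \<forall>a\<in>carrier A. \<forall>b\<in>carrier A.
       q (a \<ominus> u n) < \<delta> \<longrightarrow> q (b \<ominus> v n) < \<delta> \<longrightarrow> q (f a b \<ominus> f (u n) (v n)) < \<epsilon>"
    and F: "F \<in> cls u" and G: "G \<in> cls v"
  shows "completion_class A \<Q> (filtermap (\<lambda>(a, b). f a b) (F \<times>\<^sub>F G)) = cls (\<lambda>n. f (u n) (v n))"
proof (rule completion_class_eq_cls(2)[OF _ u(3)])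
  have F': "carrier_filter F" "close F (tail_filter u)" and G': "carrier_filter G" "close G (tail_filter v)"
    using cls_memD[OF u(1) F] cls_memD[OF u(2) G] by auto
  have "eventually (\<lambda>p. (case p of (a, b) \<Rightarrow> f a b) \<in> carrier A) (F \<times>\<^sub>F G)"
    using carrier_filter_eventually[OF F'(1)] carrier_filter_eventually[OF G'(1)] f
    unfolding eventually_prod_filter by (intro exI[of _ "\<lambda>a. a \<in> carrier A"]) auto
  then show "carrier_filter (filtermap (\<lambda>(a, b). f a b) (F \<times>\<^sub>F G))"
    using F'(1) G'(1) unfolding carrier_filter_def
    by (simp add: filtermap_bot_iff prod_filter_eq_bot le_principal eventually_filtermap)
  show "close (filtermap (\<lambda>(a, b). f a b) (F \<times>\<^sub>F G)) (tail_filter (\<lambda>n. f (u n) (v n)))"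
    unfolding close_tail_iff
  proof (intro ballI allI impI)
    fix q and \<epsilon> :: real assume q: "q \<in> \<Q>" and e: "0 < \<epsilon>"
    obtain \<delta> N where \<delta>: "\<delta> > 0" "\<forall>n\<ge>N. \<forall>a\<in>carrier A. \<forall>b\<in>carrier A.
       q (a \<ominus> u n) < \<delta> \<longrightarrow> q (b \<ominus> v n) < \<delta> \<longrightarrow> q (f a b \<ominus> f (u n) (v n)) < \<epsilon>" using cont[OF q e] by blast
    obtain P N1 where P: "eventually P F" "\<And>a n. P a \<Longrightarrow> N1 \<le> n \<Longrightarrow> q (a \<ominus> u n) < \<delta>"
      using F'(2) q \<delta>(1) unfolding close_tail_iff by blast
    obtain S N2 where S: "eventually S G" "\<And>a n. S a \<Longrightarrow> N2 \<le> n \<Longrightarrow> q (a \<ominus> v n) < \<delta>"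
      using G'(2) q \<delta>(1) unfolding close_tail_iff by blast
    define T where "T c \<longleftrightarrow> (\<exists>a b. P a \<and> S b \<and> a \<in> carrier A \<and> b \<in> carrier A \<and> c = f a b)" for c
    have "eventually (\<lambda>a. P a \<and> a \<in> carrier A) F" "eventually (\<lambda>b. S b \<and> b \<in> carrier A) G"
      using P(1) S(1) carrier_filter_eventually F'(1) G'(1) by (auto intro: eventually_conj)
    then have "eventually T (filtermap (\<lambda>(a, b). f a b) (F \<times>\<^sub>F G))"
      unfolding eventually_filtermap eventually_prod_filter
      by (intro exI[of _ "\<lambda>a. P a \<and> a \<in> carrier A"] exI[of _ "\<lambda>b. S b \<and> b \<in> carrier A"] conjI)
        (auto simp: T_def)
    moreover have "q (c \<ominus> f (u n) (v n)) < \<epsilon>" if c: "T c" and n: "max N (max N1 N2) \<le> n" for c n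
    proof -
      obtain a b where "P a" "S b" "a \<in> carrier A" "b \<in> carrier A" "c = f a b" using c unfolding T_def by blast
      then show ?thesis using \<delta>(2) P(2)[of a n] S(2)[of b n] n by simp
    qed
    ultimately show "\<exists>P N'. eventually P (filtermap (\<lambda>(a, b). f a b) (F \<times>\<^sub>F G)) \<and>
      (\<forall>a n. P a \<longrightarrow> N' \<le> n \<longrightarrow> q (a \<ominus> f (u n) (v n)) < \<epsilon>)" by blast
  qed
qed

abbreviation \<AA> :: "('k, 'a filter set) module" where
  "\<AA> \<equiv> arens_michael K abs_K A"

lemma envelope_add:
  assumes u: "cauchy u" and v: "cauchy v"
  shows "cls u \<oplus>\<^bsub>\<AA>\<^esub> cls v = cls (\<lambda>n. u n \<oplus> v n)"
proof -
  have uc: "u n \<in> carrier A" "v n \<in> carrier A" for n using u v cauchy_closed by auto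
  have "completion_class A \<Q> (filtermap (\<lambda>(a, b). a \<oplus> b) (F \<times>\<^sub>F G)) = cls (\<lambda>n. u n \<oplus> v n)"
    if "F \<in> cls u" "G \<in> cls v" for F G
  proof (rule completion_class_of_operation[OF u v cauchy_add[OF u v] _ _ that])
    fix q and \<epsilon> :: real assume q: "q \<in> \<Q>" and e: "0 < \<epsilon>"
    have "q ((a \<oplus> b) \<ominus> (u n \<oplus> v n)) < \<epsilon>" if "a \<in> carrier A" "b \<in> carrier A" "q (a \<ominus> u n) < \<epsilon>" "q (b \<ominus> v n) < \<epsilon>" for a b n
      using seminorm_add[OF q, of "a \<ominus> u n" "b \<ominus> v n"] uc that by (simp add: add_diff_add)
    then show "\<exists>\<delta>>0. \<exists>N. \<forall>n\<ge>N. \<forall>a\<in>carrier A. \<forall>b\<in>carrier A.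
       q (a \<ominus> u n) < \<delta> \<longrightarrow> q (b \<ominus> v n) < \<delta> \<longrightarrow> q ((a \<oplus> b) \<ominus> (u n \<oplus> v n)) < \<epsilon>" using e by blast
  qed simp
  then have "(\<Union>F\<in>cls u. \<Union>G\<in>cls v. completion_class A \<Q> (filtermap (\<lambda>(a, b). a \<oplus> b) (F \<times>\<^sub>F G))) = cls (\<lambda>n. u n \<oplus> v n)"
    using tail_mem_cls[OF u] tail_mem_cls[OF v] by (auto 0 4)
  then show ?thesis by (simp add: arens_michael_def hausdorff_completion_def)
qed

lemma product_continuous:
  assumes u: "cauchy u" and v: "cauchy v" and q: "q \<in> \<Q>" and e: "0 < \<epsilon>"
  shows "\<exists>\<delta>>0. \<exists>N. \<forall>n\<ge>N. \<forall>a\<in>carrier A. \<forall>b\<in>carrier A.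
       q (a \<ominus> u n) < \<delta> \<longrightarrow> q (b \<ominus> v n) < \<delta> \<longrightarrow> q ((a \<otimes> b) \<ominus> (u n \<otimes> v n)) < \<epsilon>"
proof -
  have uc: "u n \<in> carrier A" "v n \<in> carrier A" for n using u v cauchy_closed by auto
  obtain M1 N1 where M1: "M1 > 0" "\<forall>n\<ge>N1. q (u n) \<le> M1" using cauchy_bounded[OF u q] by blast
  obtain M2 N2 where M2: "M2 > 0" "\<forall>n\<ge>N2. q (v n) \<le> M2" using cauchy_bounded[OF v q] by blast
  define M where "M = M1 + M2 + 1"
  have M: "M \<ge> 1" using M1 M2 by (simp add: M_def)
  define \<delta> where "\<delta> = min 1 (\<epsilon> / (2 * M))"
  have \<delta>: "\<delta> > 0" "\<delta> \<le> 1" "\<delta> * M < \<epsilon>"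
  proof -
    show "\<delta> > 0" "\<delta> \<le> 1" using e M by (auto simp: \<delta>_def)
    have "\<delta> * M \<le> \<epsilon> / (2 * M) * M" using M by (intro mult_right_mono) (auto simp: \<delta>_def)
    also have "\<dots> = \<epsilon> / 2" using M by simp
    finally show "\<delta> * M < \<epsilon>" using e by simp
  qed
  have "q ((a \<otimes> b) \<ominus> (u n \<otimes> v n)) < \<epsilon>" if n: "n \<ge> max N1 N2" and a: "a \<in> carrier A" "q (a \<ominus> u n) < \<delta>"
     and b: "b \<in> carrier A" "q (b \<ominus> v n) < \<delta>" for n a b
  proof -
    have "q b \<le> max (q (b \<ominus> v n)) (q (v n))"
      using seminorm_add[OF q, of "b \<ominus> v n" "v n"] b uc diff_add_cancel[OF b(1) uc(2)] by simp
    moreover have "q (v n) \<le> M2" "q (u n) \<le> M1" using M1 M2 n by simp_all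
    moreover have "q (b \<ominus> v n) < 1" using b \<delta> by simp
    ultimately have qb: "q b \<le> M" and qu: "q (u n) \<le> M" using M1 M2 by (simp_all add: M_def)
    have "q ((a \<ominus> u n) \<otimes> b) \<le> q (a \<ominus> u n) * q b" using a b uc by (intro seminorm_mult[OF q]) auto
    also have "\<dots> \<le> \<delta> * M" using a b uc qb seminorm_nonneg[OF q] \<delta> M by (intro mult_mono) auto
    finally have 1: "q ((a \<ominus> u n) \<otimes> b) < \<epsilon>" using \<delta> by simp
    have "q (u n \<otimes> (b \<ominus> v n)) \<le> q (u n) * q (b \<ominus> v n)" using a b uc by (intro seminorm_mult[OF q]) auto
    also have "\<dots> \<le> M * \<delta>" using a b uc qu seminorm_nonneg[OF q] \<delta> M by (intro mult_mono) auto
    finally have 2: "q (u n \<otimes> (b \<ominus> v n)) < \<epsilon>" using \<delta> by (simp add: mult.commute)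
    have "(a \<ominus> u n) \<otimes> b \<oplus> u n \<otimes> (b \<ominus> v n) = (a \<otimes> b \<ominus> u n \<otimes> b) \<oplus> (u n \<otimes> b \<ominus> u n \<otimes> v n)"
      using a b uc by (simp add: minus_eq l_distr r_distr l_minus r_minus)
    also have "\<dots> = (a \<otimes> b) \<ominus> (u n \<otimes> v n)" using a b uc by (intro diff_chain) auto
    finally show ?thesis using seminorm_add[OF q, of "(a \<ominus> u n) \<otimes> b" "u n \<otimes> (b \<ominus> v n)"] 1 2 a b uc by simp
  qed
  then show ?thesis using \<delta>(1) by blast
qed

lemma cauchy_mult:
  assumes u: "cauchy u" and v: "cauchy v"
  shows "cauchy (\<lambda>n. u n \<otimes> v n)"
proof (rule cauchyI)
  have uc: "u n \<in> carrier A" "v n \<in> carrier A" for n using u v cauchy_closed by auto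
  show "u n \<otimes> v n \<in> carrier A" for n using uc by simp
  fix q and \<epsilon> :: real assume q: "q \<in> \<Q>" and e: "0 < \<epsilon>"
  obtain \<delta> N where \<delta>: "\<delta> > 0" "\<forall>n\<ge>N. \<forall>a\<in>carrier A. \<forall>b\<in>carrier A.
       q (a \<ominus> u n) < \<delta> \<longrightarrow> q (b \<ominus> v n) < \<delta> \<longrightarrow> q ((a \<otimes> b) \<ominus> (u n \<otimes> v n)) < \<epsilon>"
    using product_continuous[OF u v q e] by blast
  obtain N1 where N1: "\<forall>m\<ge>N1. \<forall>n\<ge>N1. q (u m \<ominus> u n) < \<delta>" using cauchy_pairs[OF u q \<delta>(1)] by blast
  obtain N2 where N2: "\<forall>m\<ge>N2. \<forall>n\<ge>N2. q (v m \<ominus> v n) < \<delta>" using cauchy_pairs[OF v q \<delta>(1)] by blast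
  have "\<forall>m\<ge>max N (max N1 N2). \<forall>n\<ge>max N (max N1 N2). q (u m \<otimes> v m \<ominus> u n \<otimes> v n) < \<epsilon>"
    using \<delta>(2) N1 N2 uc by simp
  then show "\<exists>N. \<forall>m\<ge>N. \<forall>n\<ge>N. q (u m \<otimes> v m \<ominus> u n \<otimes> v n) < \<epsilon>" by blast
qed

lemma envelope_mult:
  assumes u: "cauchy u" and v: "cauchy v"
  shows "cls u \<otimes>\<^bsub>\<AA>\<^esub> cls v = cls (\<lambda>n. u n \<otimes> v n)"
proof -
  have "completion_class A \<Q> (filtermap (\<lambda>(a, b). a \<otimes> b) (F \<times>\<^sub>F G)) = cls (\<lambda>n. u n \<otimes> v n)"
    if "F \<in> cls u" "G \<in> cls v" for F G
    by (rule completion_class_of_operation[OF u v cauchy_mult[OF u v] _ product_continuous[OF u v] that]) simp_all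
  then have "(\<Union>F\<in>cls u. \<Union>G\<in>cls v. completion_class A \<Q> (filtermap (\<lambda>(a, b). a \<otimes> b) (F \<times>\<^sub>F G))) = cls (\<lambda>n. u n \<otimes> v n)"
    using tail_mem_cls[OF u] tail_mem_cls[OF v] by (auto 0 4)
  then show ?thesis by (simp add: arens_michael_def hausdorff_completion_def)
qed

lemma envelope_map: "arens_michael_map K abs_K A a = cls (\<lambda>_. a)"
proof -
  have "principal {a} = tail_filter (\<lambda>_. a)"
    by (auto simp: filter_eq_iff eventually_principal eventually_filtermap eventually_sequentially)
  then show ?thesis by (simp add: arens_michael_map_def completion_map_def cls_def)
qed

lemma envelope_one: "\<one>\<^bsub>\<AA>\<^esub> = cls (\<lambda>_. \<one>)" and envelope_zero: "\<zero>\<^bsub>\<AA>\<^esub> = cls (\<lambda>_. \<zero>)"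
  using envelope_map[of \<one>] envelope_map[of \<zero>]
  by (simp_all add: arens_michael_def hausdorff_completion_def arens_michael_map_def)

lemma envelope_carrier: "carrier \<AA> = {cls u | u. cauchy u}"
proof -
  have *: "carrier \<AA> = completion_class A \<Q> ` cauchy_filters A \<Q>" by (simp add: arens_michael_def hausdorff_completion_def)
  show ?thesis unfolding *
  proof (intro equalityI subsetI)
    fix C assume "C \<in> completion_class A \<Q> ` cauchy_filters A \<Q>"
    then obtain F where F: "F \<in> cauchy_filters A \<Q>" "C = completion_class A \<Q> F" by (rule imageE)
    show "C \<in> {cls u | u. cauchy u}" using cauchy_filter_has_sequence[OF F(1)] F(2) by auto
  next
    fix C assume "C \<in> {cls u | u. cauchy u}"
    then obtain u where u: "cauchy u" "C = cls u" by auto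
    show "C \<in> completion_class A \<Q> ` cauchy_filters A \<Q>"
      unfolding u(2) cls_def using tail_cauchy[OF u(1)] by (rule imageI)
  qed
qed

lemma envelope_ring: "ring \<AA>"
proof (rule ringI)
  show "abelian_group \<AA>"
  proof (rule abelian_groupI)
    fix x assume "x \<in> carrier \<AA>"
    then obtain u where u: "cauchy u" "x = cls u" unfolding envelope_carrier by blast
    have uc: "u n \<in> carrier A" for n using u cauchy_closed by auto
    have "cauchy (\<lambda>n. \<zero> \<ominus> u n)"
    proof -
      have "null (\<lambda>n. \<ominus> (u (Suc n) \<ominus> u n))" using u by (intro null_neg) (simp add: cauchy_def)
      then show ?thesis using uc by (simp add: cauchy_def minus_eq minus_add a_comm)
    qed
    moreover have "cls (\<lambda>n. \<zero> \<ominus> u n) \<oplus>\<^bsub>\<AA>\<^esub> x = \<zero>\<^bsub>\<AA>\<^esub>"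
      using envelope_add[OF calculation u(1)] u uc by (simp add: envelope_zero minus_eq l_neg)
    ultimately show "\<exists>y\<in>carrier \<AA>. y \<oplus>\<^bsub>\<AA>\<^esub> x = \<zero>\<^bsub>\<AA>\<^esub>" unfolding envelope_carrier by blast
    show "\<zero>\<^bsub>\<AA>\<^esub> \<oplus>\<^bsub>\<AA>\<^esub> x = x" unfolding envelope_zero u(2) envelope_add[OF cauchy_const[OF zero_closed] u(1)] using uc by simp
  next
    fix x y assume "x \<in> carrier \<AA>" "y \<in> carrier \<AA>"
    then obtain u v where u: "cauchy u" "x = cls u" and v: "cauchy v" "y = cls v" unfolding envelope_carrier by blast
    have uc: "u n \<in> carrier A" "v n \<in> carrier A" for n using u v cauchy_closed by auto
    show "x \<oplus>\<^bsub>\<AA>\<^esub> y \<in> carrier \<AA>" using u v envelope_add cauchy_add unfolding envelope_carrier by blast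
    show "x \<oplus>\<^bsub>\<AA>\<^esub> y = y \<oplus>\<^bsub>\<AA>\<^esub> x" using u v uc by (simp add: envelope_add a_comm)
    fix z assume "z \<in> carrier \<AA>"
    then obtain w where w: "cauchy w" "z = cls w" unfolding envelope_carrier by blast
    then have wc: "w n \<in> carrier A" for n using cauchy_closed by auto
    show "x \<oplus>\<^bsub>\<AA>\<^esub> y \<oplus>\<^bsub>\<AA>\<^esub> z = x \<oplus>\<^bsub>\<AA>\<^esub> (y \<oplus>\<^bsub>\<AA>\<^esub> z)" using u v w uc wc by (simp add: envelope_add cauchy_add a_assoc)
  next
    show "\<zero>\<^bsub>\<AA>\<^esub> \<in> carrier \<AA>" unfolding envelope_carrier envelope_zero using cauchy_const[OF zero_closed] by blast
  qed
  show "Group.monoid \<AA>"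
  proof (rule monoidI)
    show "\<one>\<^bsub>\<AA>\<^esub> \<in> carrier \<AA>" unfolding envelope_carrier envelope_one using cauchy_const[OF one_closed] by blast
  next
    fix x assume "x \<in> carrier \<AA>"
    then obtain u where u: "cauchy u" "x = cls u" unfolding envelope_carrier by blast
    have uc: "u n \<in> carrier A" for n using u cauchy_closed by auto
    show "\<one>\<^bsub>\<AA>\<^esub> \<otimes>\<^bsub>\<AA>\<^esub> x = x" "x \<otimes>\<^bsub>\<AA>\<^esub> \<one>\<^bsub>\<AA>\<^esub> = x"
      unfolding envelope_one u(2) envelope_mult[OF cauchy_const[OF one_closed] u(1)] envelope_mult[OF u(1) cauchy_const[OF one_closed]]
      using uc by simp_all
  next
    fix x y assume "x \<in> carrier \<AA>" "y \<in> carrier \<AA>"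
    then obtain u v where u: "cauchy u" "x = cls u" and v: "cauchy v" "y = cls v" unfolding envelope_carrier by blast
    have uc: "u n \<in> carrier A" "v n \<in> carrier A" for n using u v cauchy_closed by auto
    show "x \<otimes>\<^bsub>\<AA>\<^esub> y \<in> carrier \<AA>" using u v envelope_mult cauchy_mult unfolding envelope_carrier by blast
    fix z assume "z \<in> carrier \<AA>"
    then obtain w where w: "cauchy w" "z = cls w" unfolding envelope_carrier by blast
    then have wc: "w n \<in> carrier A" for n using cauchy_closed by auto
    show "x \<otimes>\<^bsub>\<AA>\<^esub> y \<otimes>\<^bsub>\<AA>\<^esub> z = x \<otimes>\<^bsub>\<AA>\<^esub> (y \<otimes>\<^bsub>\<AA>\<^esub> z)" using u v w uc wc by (simp add: envelope_mult cauchy_mult m_assoc)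
  qed
  fix x y z assume "x \<in> carrier \<AA>" "y \<in> carrier \<AA>" "z \<in> carrier \<AA>"
  then obtain u v w where u: "cauchy u" "x = cls u" and v: "cauchy v" "y = cls v" and w: "cauchy w" "z = cls w"
    unfolding envelope_carrier by blast
  have uc: "u n \<in> carrier A" "v n \<in> carrier A" "w n \<in> carrier A" for n using u v w cauchy_closed by auto
  show "(x \<oplus>\<^bsub>\<AA>\<^esub> y) \<otimes>\<^bsub>\<AA>\<^esub> z = x \<otimes>\<^bsub>\<AA>\<^esub> z \<oplus>\<^bsub>\<AA>\<^esub> y \<otimes>\<^bsub>\<AA>\<^esub> z"
    "z \<otimes>\<^bsub>\<AA>\<^esub> (x \<oplus>\<^bsub>\<AA>\<^esub> y) = z \<otimes>\<^bsub>\<AA>\<^esub> x \<oplus>\<^bsub>\<AA>\<^esub> z \<otimes>\<^bsub>\<AA>\<^esub> y"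
    using u v w uc by (simp_all add: envelope_mult envelope_add cauchy_mult cauchy_add l_distr r_distr)
qed

lemma envelope_completed: "completed_algebra K abs_K A d \<kappa> x \<AA> cls"
  by (intro completed_algebra.intro commutator_algebra_axioms envelope_ring completed_algebra_axioms.intro)
    (auto simp: envelope_carrier cls_eq_iff envelope_add envelope_mult envelope_one envelope_zero)

end

section \<open>Tensor products over a noncommutative ring\<close>

text \<open>
  The elements of free abelian groups form a group type, so quotients can be handled by subtraction
  instead of cosets.
\<close>

definition subgroup_of_frags :: "'s set \<Rightarrow> ('s \<Rightarrow>\<^sub>0 int) set \<Rightarrow> bool" where
  "subgroup_of_frags S T \<longleftrightarrow> T \<subseteq> carrier (free_Abelian_group S) \<and> 0 \<in> T \<and> (\<forall>a\<in>T. \<forall>b\<in>T. a - b \<in> T)"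

lemma subgroup_of_fragsD:
  assumes "subgroup_of_frags S T"
  shows "0 \<in> T" "a \<in> T \<Longrightarrow> b \<in> T \<Longrightarrow> a - b \<in> T" "a \<in> T \<Longrightarrow> - a \<in> T" "a \<in> T \<Longrightarrow> b \<in> T \<Longrightarrow> a + b \<in> T"
    "a \<in> T \<Longrightarrow> Poly_Mapping.keys a \<subseteq> S"
proof -
  show 0: "0 \<in> T" and d: "\<And>a b. a \<in> T \<Longrightarrow> b \<in> T \<Longrightarrow> a - b \<in> T"
    using assms by (auto simp: subgroup_of_frags_def)
  show "Poly_Mapping.keys a \<subseteq> S" if "a \<in> T"
  proof -
    have "a \<in> carrier (free_Abelian_group S)" using assms that unfolding subgroup_of_frags_def by blast
    then show ?thesis by simp
  qed
  show n: "- a \<in> T" if "a \<in> T" for a using d[OF 0 that] by simp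
  show "a + b \<in> T" if "a \<in> T" "b \<in> T" using d[OF that(1) n[OF that(2)]] by simp
qed

lemma frag_coset: "T #>\<^bsub>free_Abelian_group S\<^esub> z = (\<lambda>t. t + z) ` T"
  by (auto simp: r_coset_def)

lemma frag_coset_eq_iff:
  assumes "subgroup_of_frags S T"
  shows "T #>\<^bsub>free_Abelian_group S\<^esub> z = T #>\<^bsub>free_Abelian_group S\<^esub> w \<longleftrightarrow> z - w \<in> T"
proof
  assume "T #>\<^bsub>free_Abelian_group S\<^esub> z = T #>\<^bsub>free_Abelian_group S\<^esub> w"
  moreover have "z \<in> T #>\<^bsub>free_Abelian_group S\<^esub> z"
    using subgroup_of_fragsD(1)[OF assms] unfolding frag_coset by (metis add_0 imageI)
  ultimately obtain t where "t \<in> T" "z = t + w" unfolding frag_coset by blast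
  then show "z - w \<in> T" by simp
next
  assume d: "z - w \<in> T"
  have "t + z \<in> (\<lambda>t. t + w) ` T" if "t \<in> T" for t
    using subgroup_of_fragsD(4)[OF assms that d] by (intro image_eqI[of _ _ "t + (z - w)"]) auto
  moreover have "t + w \<in> (\<lambda>t. t + z) ` T" if "t \<in> T" for t
    using subgroup_of_fragsD(2)[OF assms that d] by (intro image_eqI[of _ _ "t - (z - w)"]) auto
  ultimately show "T #>\<^bsub>free_Abelian_group S\<^esub> z = T #>\<^bsub>free_Abelian_group S\<^esub> w" unfolding frag_coset by blast
qed

lemma frag_coset_trivial:
  assumes "subgroup_of_frags S T"
  shows "T #>\<^bsub>free_Abelian_group S\<^esub> z = T \<longleftrightarrow> z \<in> T"
proof -
  have "T #>\<^bsub>free_Abelian_group S\<^esub> 0 = T" by (simp add: frag_coset)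
  then show ?thesis using frag_coset_eq_iff[OF assms, of z 0] by simp
qed

lemma frag_map_coset:
  assumes T': "subgroup_of_frags S' T'" and T: "subgroup_of_frags S T"
    and add: "\<And>a b. \<phi> (a + b) = \<phi> a + \<phi> b" and null: "\<And>t. t \<in> T' \<Longrightarrow> \<phi> t \<in> T"
  shows "(\<Union>P\<in>T' #>\<^bsub>free_Abelian_group S'\<^esub> z. T #>\<^bsub>free_Abelian_group S\<^esub> \<phi> P) = T #>\<^bsub>free_Abelian_group S\<^esub> \<phi> z"
proof -
  have "T #>\<^bsub>free_Abelian_group S\<^esub> \<phi> (t + z) = T #>\<^bsub>free_Abelian_group S\<^esub> \<phi> z" if "t \<in> T'" for t
    using frag_coset_eq_iff[OF T, of "\<phi> (t + z)" "\<phi> z"] null[OF that] add by simp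
  then show ?thesis unfolding frag_coset[where T = T'] using subgroup_of_fragsD(1)[OF T'] by auto
qed

lemma exact_at_quotients:
  assumes T': "subgroup_of_frags S' T'" and T: "subgroup_of_frags S T" and T'': "subgroup_of_frags S'' T''"
    and \<phi>: "\<And>a b. \<phi> (a + b) = \<phi> a + \<phi> b" "\<And>t. t \<in> T' \<Longrightarrow> \<phi> t \<in> T"
      "\<And>z. z \<in> carrier (free_Abelian_group S') \<Longrightarrow> \<phi> z \<in> carrier (free_Abelian_group S)"
    and \<psi>: "\<And>a b. \<psi> (a - b) = \<psi> a - \<psi> b" "\<And>t. t \<in> T \<Longrightarrow> \<psi> t \<in> T''"
      "\<And>z. z \<in> carrier (free_Abelian_group S) \<Longrightarrow> \<psi> z \<in> carrier (free_Abelian_group S'')"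
  shows "exact_at (free_Abelian_group S' Mod T') (free_Abelian_group S Mod T) (free_Abelian_group S'' Mod T'')
      (\<lambda>C. \<Union>P\<in>C. T #>\<^bsub>free_Abelian_group S\<^esub> \<phi> P) (\<lambda>C. \<Union>P\<in>C. T'' #>\<^bsub>free_Abelian_group S''\<^esub> \<psi> P) \<longleftrightarrow>
    (\<forall>z\<in>carrier (free_Abelian_group S'). \<psi> (\<phi> z) \<in> T'') \<and>
    (\<forall>z\<in>carrier (free_Abelian_group S). \<psi> z \<in> T'' \<longrightarrow> (\<exists>z'\<in>carrier (free_Abelian_group S'). z - \<phi> z' \<in> T))"
    (is "?exact \<longleftrightarrow> ?R")
proof -
  let ?C' = "carrier (free_Abelian_group S')" and ?C = "carrier (free_Abelian_group S)"
  let ?c = "\<lambda>z. T #>\<^bsub>free_Abelian_group S\<^esub> z"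
  have \<psi>add: "\<psi> (a + b) = \<psi> a + \<psi> b" for a b
  proof -
    have "\<psi> a = \<psi> ((a + b) - b)" by simp
    then show ?thesis unfolding \<psi>(1) by simp
  qed
  have im: "(\<lambda>C. \<Union>P\<in>C. ?c (\<phi> P)) ` carrier (free_Abelian_group S' Mod T') = (\<lambda>z. ?c (\<phi> z)) ` ?C'"
    unfolding carrier_FactGroup image_image by (rule image_cong[OF refl]) (rule frag_map_coset[OF T' T \<phi>(1,2)])
  have ker: "kernel (free_Abelian_group S Mod T) (free_Abelian_group S'' Mod T'') (\<lambda>C. \<Union>P\<in>C. T'' #>\<^bsub>free_Abelian_group S''\<^esub> \<psi> P)
      = ?c ` {z \<in> ?C. \<psi> z \<in> T''}"
  proof -
    have "(\<Union>P\<in>?c z. T'' #>\<^bsub>free_Abelian_group S''\<^esub> \<psi> P) = T'' \<longleftrightarrow> \<psi> z \<in> T''" for z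
      using frag_map_coset[where \<phi> = \<psi> and z = z, OF T T'' \<psi>add \<psi>(2)] frag_coset_trivial[OF T''] by simp
    then show ?thesis unfolding kernel_def carrier_FactGroup one_FactGroup by blast
  qed
  have "?exact \<longleftrightarrow> (\<lambda>z. ?c (\<phi> z)) ` ?C' = ?c ` {z \<in> ?C. \<psi> z \<in> T''}"
    unfolding exact_at_def im ker ..
  also have "\<dots> \<longleftrightarrow> ?R"
  proof
    assume eq: "(\<lambda>z. ?c (\<phi> z)) ` ?C' = ?c ` {z \<in> ?C. \<psi> z \<in> T''}"
    show ?R
    proof (intro conjI ballI impI)
      fix z assume "z \<in> ?C'"
      then obtain w where "?c (\<phi> z) = ?c w" and w: "\<psi> w \<in> T''" using eq by blast
      then have "\<phi> z - w \<in> T" using frag_coset_eq_iff[OF T] by blast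
      from \<psi>(2)[OF this] have "\<psi> (\<phi> z) - \<psi> w \<in> T''" by (simp add: \<psi>(1))
      from subgroup_of_fragsD(4)[OF T'' this w] show "\<psi> (\<phi> z) \<in> T''" by simp
    next
      fix z assume "z \<in> ?C" "\<psi> z \<in> T''"
      then obtain z' where "z' \<in> ?C'" "?c z = ?c (\<phi> z')" using eq by blast
      then show "\<exists>z'\<in>?C'. z - \<phi> z' \<in> T" using frag_coset_eq_iff[OF T] by blast
    qed
  next
    assume R: ?R
    have "?c (\<phi> z) \<in> ?c ` {z \<in> ?C. \<psi> z \<in> T''}" if "z \<in> ?C'" for z
      using R \<phi>(3)[OF that] that by blast
    moreover have "?c z \<in> (\<lambda>z. ?c (\<phi> z)) ` ?C'" if z: "z \<in> ?C" "\<psi> z \<in> T''" for z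
    proof -
      obtain z' where "z' \<in> ?C'" "z - \<phi> z' \<in> T" using R z by blast
      then show ?thesis using frag_coset_eq_iff[OF T] by blast
    qed
    ultimately show "(\<lambda>z. ?c (\<phi> z)) ` ?C' = ?c ` {z \<in> ?C. \<psi> z \<in> T''}" by blast
  qed
  finally show ?thesis .
qed

text \<open>
  The tensor product as a group involves only the structure that left and right modules share.
\<close>

locale tensor_pair = M: one_sided_module A M + N: one_sided_module A N
  for A :: "('a, 'y) ring_scheme" and M :: "('a, 'm) module" and N :: "('a, 'n) module"
begin

lemma tensor_relations_closed:
  "({frag_of (x \<oplus>\<^bsub>M\<^esub> x', y) - frag_of (x, y) - frag_of (x', y) | x x' y.
         x \<in> carrier M \<and> x' \<in> carrier M \<and> y \<in> carrier N} \<union>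
      {frag_of (x, y \<oplus>\<^bsub>N\<^esub> y') - frag_of (x, y) - frag_of (x, y') | x y y'.
         x \<in> carrier M \<and> y \<in> carrier N \<and> y' \<in> carrier N} \<union>
      {frag_of (a \<odot>\<^bsub>M\<^esub> x, y) - frag_of (x, a \<odot>\<^bsub>N\<^esub> y) | a x y.
         a \<in> carrier A \<and> x \<in> carrier M \<and> y \<in> carrier N}) \<subseteq> carrier (free_on_pairs M N)" (is "?X \<subseteq> _")
proof
  have d: "u - v \<in> carrier (free_on_pairs M N)" if "u \<in> carrier (free_on_pairs M N)" "v \<in> carrier (free_on_pairs M N)" for u v
    using that keys_diff[of u v] by auto
  fix z assume "z \<in> ?X"
  then show "z \<in> carrier (free_on_pairs M N)"
    by (elim UnE CollectE exE conjE)
       (simp only:, intro d; simp add: M.smult_closed N.smult_closed)+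
qed

lemma tensor_null_subgroup: "subgroup_of_frags (carrier M \<times> carrier N) (tensor_null A M N)"
proof -
  have "subgroup (tensor_null A M N) (free_on_pairs M N)"
    unfolding tensor_null_def by (rule group.generate_is_subgroup[OF group_free_Abelian_group tensor_relations_closed])
  then interpret H: subgroup "tensor_null A M N" "free_on_pairs M N" .
  have "a - b \<in> tensor_null A M N" if "a \<in> tensor_null A M N" "b \<in> tensor_null A M N" for a b
    using H.m_closed[OF that(1) H.m_inv_closed[OF that(2)]] H.subset that by (auto simp: subset_iff)
  then show ?thesis using H.subset H.one_closed by (auto simp: subgroup_of_frags_def)
qed

lemmas tn_zero = subgroup_of_fragsD(1)[OF tensor_null_subgroup]
  and tn_diff = subgroup_of_fragsD(2)[OF tensor_null_subgroup]
  and tn_neg = subgroup_of_fragsD(3)[OF tensor_null_subgroup]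
  and tn_add = subgroup_of_fragsD(4)[OF tensor_null_subgroup]
  and tn_keys = subgroup_of_fragsD(5)[OF tensor_null_subgroup]

lemma tn_left: "x \<in> carrier M \<Longrightarrow> x' \<in> carrier M \<Longrightarrow> y \<in> carrier N \<Longrightarrow>
    frag_of (x \<oplus>\<^bsub>M\<^esub> x', y) - frag_of (x, y) - frag_of (x', y) \<in> tensor_null A M N"
  unfolding tensor_null_def by (rule generate.incl) blast

lemma tn_right: "x \<in> carrier M \<Longrightarrow> y \<in> carrier N \<Longrightarrow> y' \<in> carrier N \<Longrightarrow>
    frag_of (x, y \<oplus>\<^bsub>N\<^esub> y') - frag_of (x, y) - frag_of (x, y') \<in> tensor_null A M N"
  unfolding tensor_null_def by (rule generate.incl) blast

lemma tn_balanced: "a \<in> carrier A \<Longrightarrow> x \<in> carrier M \<Longrightarrow> y \<in> carrier N \<Longrightarrow>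
    frag_of (a \<odot>\<^bsub>M\<^esub> x, y) - frag_of (x, a \<odot>\<^bsub>N\<^esub> y) \<in> tensor_null A M N"
  unfolding tensor_null_def by (rule generate.incl) blast

lemma tensor_null_induct [consumes 1, case_names zero left right balanced add neg]:
  assumes z: "z \<in> tensor_null A M N" and 0: "P 0"
    and l: "\<And>x x' y. x \<in> carrier M \<Longrightarrow> x' \<in> carrier M \<Longrightarrow> y \<in> carrier N \<Longrightarrow>
      P (frag_of (x \<oplus>\<^bsub>M\<^esub> x', y) - frag_of (x, y) - frag_of (x', y))"
    and r: "\<And>x y y'. x \<in> carrier M \<Longrightarrow> y \<in> carrier N \<Longrightarrow> y' \<in> carrier N \<Longrightarrow>
      P (frag_of (x, y \<oplus>\<^bsub>N\<^esub> y') - frag_of (x, y) - frag_of (x, y'))"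
    and b: "\<And>a x y. a \<in> carrier A \<Longrightarrow> x \<in> carrier M \<Longrightarrow> y \<in> carrier N \<Longrightarrow>
      P (frag_of (a \<odot>\<^bsub>M\<^esub> x, y) - frag_of (x, a \<odot>\<^bsub>N\<^esub> y))"
    and add: "\<And>u v. u \<in> tensor_null A M N \<Longrightarrow> v \<in> tensor_null A M N \<Longrightarrow> P u \<Longrightarrow> P v \<Longrightarrow> P (u + v)"
    and neg: "\<And>u. u \<in> tensor_null A M N \<Longrightarrow> P u \<Longrightarrow> P (- u)"
  shows "P z"
  using z unfolding tensor_null_def
proof (induction rule: generate.induct)
  case (inv h)
  have "h \<in> carrier (free_on_pairs M N)" using inv tensor_relations_closed by blast
  moreover have "h \<in> tensor_null A M N" unfolding tensor_null_def using inv by (rule generate.incl)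
  moreover have "P h" using inv by (elim UnE CollectE exE conjE) (simp_all add: l r b)
  ultimately show ?case using neg by simp
next
  case (eng u v)
  then show ?case using add[of u v] by (simp add: tensor_null_def)
qed (use 0 l r b in \<open>auto\<close>)

lemma tn_sum: "(\<And>j. j \<in> J \<Longrightarrow> z j \<in> tensor_null A M N) \<Longrightarrow> sum z J \<in> tensor_null A M N"
  by (induction J rule: infinite_finite_induct) (auto simp: tn_zero tn_add)

lemma tn_zero_left: "y \<in> carrier N \<Longrightarrow> frag_of (\<zero>\<^bsub>M\<^esub>, y) \<in> tensor_null A M N"
  using tn_neg[OF tn_left[of "\<zero>\<^bsub>M\<^esub>" "\<zero>\<^bsub>M\<^esub>" y]] by simp

lemma tn_zero_right: "x \<in> carrier M \<Longrightarrow> frag_of (x, \<zero>\<^bsub>N\<^esub>) \<in> tensor_null A M N"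
  using tn_neg[OF tn_right[of x "\<zero>\<^bsub>N\<^esub>" "\<zero>\<^bsub>N\<^esub>"]] by simp

lemma tn_neg_left: "x \<in> carrier M \<Longrightarrow> y \<in> carrier N \<Longrightarrow> frag_of (x, y) + frag_of (\<ominus>\<^bsub>M\<^esub> x, y) \<in> tensor_null A M N"
  using tn_diff[OF tn_zero_left[of y] tn_left[of x "\<ominus>\<^bsub>M\<^esub> x" y]] by (simp add: M.M.r_neg add.commute)

lemma tn_finsum_left:
  assumes "finite J" "\<And>j. j \<in> J \<Longrightarrow> x j \<in> carrier M" "y \<in> carrier N"
  shows "frag_of (\<Oplus>\<^bsub>M\<^esub>j\<in>J. x j, y) - (\<Sum>j\<in>J. frag_of (x j, y)) \<in> tensor_null A M N"
  using assms(1,2)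
proof (induction J rule: finite_induct)
  case empty then show ?case using tn_zero_left assms(3) by simp
next
  case (insert a J)
  have "frag_of (x a \<oplus>\<^bsub>M\<^esub> (\<Oplus>\<^bsub>M\<^esub>j\<in>J. x j), y) - frag_of (x a, y) - frag_of (\<Oplus>\<^bsub>M\<^esub>j\<in>J. x j, y) \<in> tensor_null A M N"
    using insert.prems assms(3) by (intro tn_left) (auto intro!: M.M.finsum_closed)
  from tn_add[OF this insert.IH] show ?case using insert by (simp add: Pi_iff algebra_simps)
qed

lemma tn_finsum_right:
  assumes "finite J" "\<And>j. j \<in> J \<Longrightarrow> y j \<in> carrier N" "x \<in> carrier M"
  shows "frag_of (x, \<Oplus>\<^bsub>N\<^esub>j\<in>J. y j) - (\<Sum>j\<in>J. frag_of (x, y j)) \<in> tensor_null A M N"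
  using assms(1,2)
proof (induction J rule: finite_induct)
  case empty then show ?case using tn_zero_right assms(3) by simp
next
  case (insert a J)
  have "frag_of (x, y a \<oplus>\<^bsub>N\<^esub> (\<Oplus>\<^bsub>N\<^esub>j\<in>J. y j)) - frag_of (x, y a) - frag_of (x, \<Oplus>\<^bsub>N\<^esub>j\<in>J. y j) \<in> tensor_null A M N"
    using insert.prems assms(3) by (intro tn_right) (auto intro!: N.M.finsum_closed)
  from tn_add[OF this insert.IH] show ?case using insert by (simp add: Pi_iff algebra_simps)
qed

lemma tensor_representative:
  assumes "z \<in> carrier (free_on_pairs M N)"
  shows "\<exists>(m::nat) e y. (\<forall>i<m. e i \<in> carrier M \<and> y i \<in> carrier N) \<and>
    z - (\<Sum>i<m. frag_of (e i, y i)) \<in> tensor_null A M N"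
proof -
  have "Poly_Mapping.keys z \<subseteq> carrier M \<times> carrier N" using assms by simp
  then show ?thesis
  proof (induction z rule: frag_induction)
    case zero
    show ?case using tn_zero by (intro exI[of _ "0::nat"]) simp
  next
    case (one p)
    then show ?case using tn_zero by (intro exI[of _ "1::nat"] exI[of _ "\<lambda>_. fst p"] exI[of _ "\<lambda>_. snd p"]) auto
  next
    case (diff a b)
    then obtain m e y m' e' y' where
      1: "\<forall>i<m. e i \<in> carrier M \<and> y i \<in> carrier N" "a - (\<Sum>i<(m::nat). frag_of (e i, y i)) \<in> tensor_null A M N"
      and 2: "\<forall>i<m'. e' i \<in> carrier M \<and> y' i \<in> carrier N" "b - (\<Sum>i<(m'::nat). frag_of (e' i, y' i)) \<in> tensor_null A M N"
      by blast
    define E where "E i = (if i < m then e i else \<ominus>\<^bsub>M\<^esub> e' (i - m))" for i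
    define Y where "Y i = (if i < m then y i else y' (i - m))" for i
    have split: "(\<Sum>i<m + k. g i) = (\<Sum>i<m. g i) + (\<Sum>i<k. g (m + i))" for k and g :: "nat \<Rightarrow> ('m \<times> 'n \<Rightarrow>\<^sub>0 int)"
      by (induction k) (auto simp: add.assoc)
    have s: "(\<Sum>i<m + m'. frag_of (E i, Y i)) = (\<Sum>i<m. frag_of (e i, y i)) + (\<Sum>i<m'. frag_of (\<ominus>\<^bsub>M\<^esub> e' i, y' i))"
      unfolding split by (simp add: E_def Y_def)
    have "(\<Sum>i<m'. frag_of (e' i, y' i) + frag_of (\<ominus>\<^bsub>M\<^esub> e' i, y' i)) \<in> tensor_null A M N"
      using 2(1) by (intro tn_sum tn_neg_left) auto
    then have n: "(\<Sum>i<m'. frag_of (e' i, y' i)) + (\<Sum>i<m'. frag_of (\<ominus>\<^bsub>M\<^esub> e' i, y' i)) \<in> tensor_null A M N"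
      by (simp add: sum.distrib)
    have "(a - b) - (\<Sum>i<m + m'. frag_of (E i, Y i)) =
       ((a - (\<Sum>i<m. frag_of (e i, y i))) - (b - (\<Sum>i<m'. frag_of (e' i, y' i)))) -
       ((\<Sum>i<m'. frag_of (e' i, y' i)) + (\<Sum>i<m'. frag_of (\<ominus>\<^bsub>M\<^esub> e' i, y' i)))"
      unfolding s by simp
    also have "\<dots> \<in> tensor_null A M N" by (intro tn_diff 1 2 n)
    finally have "(a - b) - (\<Sum>i<m + m'. frag_of (E i, Y i)) \<in> tensor_null A M N" .
    moreover have "\<forall>i<m + m'. E i \<in> carrier M \<and> Y i \<in> carrier N" using 1(1) 2(1) by (auto simp: E_def Y_def)
    ultimately show ?case by blast
  qed
qed

end

text \<open>
  The map induced by \<open>f\<close> and \<open>g\<close> on the free abelian groups of which tensor products are quotients.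
\<close>

definition pair_map :: "('m \<Rightarrow> 'm1) \<Rightarrow> ('n \<Rightarrow> 'n1) \<Rightarrow> ('m \<times> 'n \<Rightarrow>\<^sub>0 int) \<Rightarrow> ('m1 \<times> 'n1 \<Rightarrow>\<^sub>0 int)" where
  "pair_map f g = frag_extend (\<lambda>(x, y). frag_of (f x, g y))"

lemma pair_map_simps [simp]:
  "pair_map f g 0 = 0" "pair_map f g (frag_of (x, y)) = frag_of (f x, g y)"
  "pair_map f g (a + b) = pair_map f g a + pair_map f g b"
  "pair_map f g (a - b) = pair_map f g a - pair_map f g b"
  "pair_map f g (- a) = - pair_map f g a"
  by (simp_all add: pair_map_def frag_extend_add frag_extend_diff frag_extend_minus)

lemma pair_map_sum: "pair_map f g (sum z J) = (\<Sum>j\<in>J. pair_map f g (z j))"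
  by (induction J rule: infinite_finite_induct) auto

lemma pair_map_carrier:
  assumes "f \<in> carrier M \<rightarrow> carrier M'" "g \<in> carrier N \<rightarrow> carrier N'" "z \<in> carrier (free_on_pairs M N)"
  shows "pair_map f g z \<in> carrier (free_on_pairs M' N')"
proof -
  have "Poly_Mapping.keys (pair_map f g z) \<subseteq> (\<Union>p\<in>Poly_Mapping.keys z. Poly_Mapping.keys (case p of (x, y) \<Rightarrow> frag_of (f x, g y)))"
    unfolding pair_map_def by (rule keys_frag_extend)
  also have "\<dots> \<subseteq> carrier M' \<times> carrier N'" using assms by (auto simp: Pi_iff subset_iff split: prod.splits)
  finally show ?thesis by simp
qed

lemma pair_map_null:
  assumes "tensor_pair A M N" "tensor_pair A M' N'" and f: "f \<in> linear_maps A M M'" and g: "g \<in> linear_maps A N N'"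
    and z: "z \<in> tensor_null A M N"
  shows "pair_map f g z \<in> tensor_null A M' N'"
proof -
  interpret S: tensor_pair A M N by fact
  interpret T: tensor_pair A M' N' by fact
  have fc: "x \<in> carrier M \<Longrightarrow> f x \<in> carrier M'" for x using f by (auto simp: linear_maps_def)
  have gc: "x \<in> carrier N \<Longrightarrow> g x \<in> carrier N'" for x using g by (auto simp: linear_maps_def)
  show ?thesis using z
  proof (induction rule: S.tensor_null_induct)
    case (left x x' y)
    then show ?case using T.tn_left[of "f x" "f x'" "g y"] f fc gc by (simp add: linear_maps_def)
  next
    case (right x y y')
    then show ?case using T.tn_right[of "f x" "g y" "g y'"] g fc gc by (simp add: linear_maps_def)
  next
    case (balanced a x y)
    then show ?case using T.tn_balanced[of a "f x" "g y"] f g fc gc by (simp add: linear_maps_def)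
  qed (auto simp: T.tn_zero T.tn_add T.tn_neg)
qed

lemma tensor_exact_iff:
  assumes tp: "tensor_pair A M' N'" "tensor_pair A M N" "tensor_pair A M'' N''"
    and f: "f1 \<in> linear_maps A M' M" "f2 \<in> linear_maps A N' N"
    and g: "g1 \<in> linear_maps A M M''" "g2 \<in> linear_maps A N N''"
  shows "exact_at (tensor_product A M' N') (tensor_product A M N) (tensor_product A M'' N'')
           (tensor_map A M N f1 f2) (tensor_map A M'' N'' g1 g2) \<longleftrightarrow>
    (\<forall>z\<in>carrier (free_on_pairs M' N'). pair_map g1 g2 (pair_map f1 f2 z) \<in> tensor_null A M'' N'') \<and>
    (\<forall>z\<in>carrier (free_on_pairs M N). pair_map g1 g2 z \<in> tensor_null A M'' N'' \<longrightarrow>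
       (\<exists>z'\<in>carrier (free_on_pairs M' N'). z - pair_map f1 f2 z' \<in> tensor_null A M N))"
proof -
  have fc: "f1 \<in> carrier M' \<rightarrow> carrier M" "f2 \<in> carrier N' \<rightarrow> carrier N"
    "g1 \<in> carrier M \<rightarrow> carrier M''" "g2 \<in> carrier N \<rightarrow> carrier N''" using f g by (auto simp: linear_maps_def)
  have tm: "tensor_map A M N f1 f2 = (\<lambda>C. \<Union>P\<in>C. tensor_null A M N #>\<^bsub>free_on_pairs M N\<^esub> pair_map f1 f2 P)"
     "tensor_map A M'' N'' g1 g2 = (\<lambda>C. \<Union>P\<in>C. tensor_null A M'' N'' #>\<^bsub>free_on_pairs M'' N''\<^esub> pair_map g1 g2 P)"
    by (simp_all add: tensor_map_def pair_map_def fun_eq_iff)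
  show ?thesis unfolding tensor_product_def tm
    by (rule exact_at_quotients[OF tensor_pair.tensor_null_subgroup[OF tp(1)] tensor_pair.tensor_null_subgroup[OF tp(2)]
          tensor_pair.tensor_null_subgroup[OF tp(3)]])
      (simp_all only: pair_map_simps pair_map_null[OF tp(1,2) f] pair_map_null[OF tp(2,3) g]
         pair_map_carrier[OF fc(1,2)] pair_map_carrier[OF fc(3,4)])
qed

context abelian_group
begin

lemma neg_zero: "\<ominus> \<zero> = \<zero>"
  using r_neg[of \<zero>] by simp

lemma finsum_lessThan_Suc:
  fixes k :: nat
  assumes "\<And>i. i \<le> k \<Longrightarrow> f i \<in> carrier G"
  shows "(\<Oplus>i\<in>{..<Suc k}. f i) = f k \<oplus> (\<Oplus>i\<in>{..<k}. f i)"
  unfolding lessThan_Suc using assms by (intro finsum_insert) auto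

lemma finsum_lessThan_add:
  fixes m k :: nat
  assumes "\<And>i. i < m + k \<Longrightarrow> f i \<in> carrier G"
  shows "(\<Oplus>i\<in>{..<m + k}. f i) = (\<Oplus>i\<in>{..<m}. f i) \<oplus> (\<Oplus>i\<in>{..<k}. f (m + i))"
  using assms
proof (induction k)
  case 0
  have "(\<Oplus>i\<in>{..<m}. f i) \<in> carrier G" using 0 by (intro finsum_closed) auto
  then show ?case by simp
next
  case (Suc k)
  have c: "(\<Oplus>i\<in>{..<m}. f i) \<in> carrier G" "(\<Oplus>i\<in>{..<k}. f (m + i)) \<in> carrier G"
    using Suc.prems by (auto intro!: finsum_closed)
  have "(\<Oplus>i\<in>{..<m + Suc k}. f i) = f (m + k) \<oplus> (\<Oplus>i\<in>{..<m + k}. f i)"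
    using finsum_lessThan_Suc[of "m + k" f] Suc.prems by simp
  moreover have "(\<Oplus>i\<in>{..<Suc k}. f (m + i)) = f (m + k) \<oplus> (\<Oplus>i\<in>{..<k}. f (m + i))"
    using Suc.prems by (intro finsum_lessThan_Suc) auto
  ultimately show ?case using Suc c by (simp add: a_ac)
qed

lemma finsum_delta:
  assumes "finite S" "s \<in> S" "a \<in> carrier G"
  shows "(\<Oplus>y\<in>S. if y = s then a else \<zero>) = a"
  using finsum_singleton[of s S "\<lambda>_. a"] assms by (simp add: eq_commute cong: if_cong)

end

context one_sided_module
begin

lemma finsum_smult_left:
  assumes "finite S" "\<And>i. i \<in> S \<Longrightarrow> g i \<in> carrier A" "v \<in> carrier M"
  shows "(\<Oplus>\<^bsub>A\<^esub>i\<in>S. g i) \<odot>\<^bsub>M\<^esub> v = (\<Oplus>\<^bsub>M\<^esub>i\<in>S. g i \<odot>\<^bsub>M\<^esub> v)"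
  using additive_map_finsum[of A M "\<lambda>a. a \<odot>\<^bsub>M\<^esub> v" S g] assms A.abelian_group_axioms M.abelian_group_axioms
  by (auto simp: smult_closed smult_add_scalar)

lemma finsum_smult_right:
  assumes "finite S" "\<And>i. i \<in> S \<Longrightarrow> g i \<in> carrier M" "a \<in> carrier A"
  shows "a \<odot>\<^bsub>M\<^esub> (\<Oplus>\<^bsub>M\<^esub>i\<in>S. g i) = (\<Oplus>\<^bsub>M\<^esub>i\<in>S. a \<odot>\<^bsub>M\<^esub> g i)"
  using additive_map_finsum[of M M "\<lambda>v. a \<odot>\<^bsub>M\<^esub> v" S g] assms M.abelian_group_axioms
  by (auto simp: smult_closed smult_add_vector)

lemma finsum_delta_smult:
  assumes "finite S" "S \<subseteq> carrier M" "s \<in> S" "a \<in> carrier A"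
  shows "(\<Oplus>\<^bsub>M\<^esub>y\<in>S. (if y = s then a else \<zero>\<^bsub>A\<^esub>) \<odot>\<^bsub>M\<^esub> y) = a \<odot>\<^bsub>M\<^esub> s"
proof -
  have "(\<Oplus>\<^bsub>M\<^esub>y\<in>S. (if y = s then a else \<zero>\<^bsub>A\<^esub>) \<odot>\<^bsub>M\<^esub> y) = (\<Oplus>\<^bsub>M\<^esub>y\<in>S. if y = s then a \<odot>\<^bsub>M\<^esub> s else \<zero>\<^bsub>M\<^esub>)"
    using assms by (intro M.finsum_cong') (auto simp: smult_closed smult_zero_left subset_iff)
  then show ?thesis using assms by (simp add: M.finsum_delta smult_closed subset_iff)
qed

lemma finsum_diff_smult:
  assumes "finite S" "S \<subseteq> carrier M" "\<And>y. y \<in> S \<Longrightarrow> v y \<in> carrier A" "\<And>y. y \<in> S \<Longrightarrow> w y \<in> carrier A"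
  shows "(\<Oplus>\<^bsub>M\<^esub>y\<in>S. (v y \<ominus>\<^bsub>A\<^esub> w y) \<odot>\<^bsub>M\<^esub> y) = (\<Oplus>\<^bsub>M\<^esub>y\<in>S. v y \<odot>\<^bsub>M\<^esub> y) \<ominus>\<^bsub>M\<^esub> (\<Oplus>\<^bsub>M\<^esub>y\<in>S. w y \<odot>\<^bsub>M\<^esub> y)"
proof -
  have "(\<Oplus>\<^bsub>M\<^esub>y\<in>S. (v y \<ominus>\<^bsub>A\<^esub> w y) \<odot>\<^bsub>M\<^esub> y) = (\<Oplus>\<^bsub>M\<^esub>y\<in>S. v y \<odot>\<^bsub>M\<^esub> y \<oplus>\<^bsub>M\<^esub> (\<ominus>\<^bsub>M\<^esub> (w y \<odot>\<^bsub>M\<^esub> y)))"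
    using assms by (intro M.finsum_cong') (auto simp: smult_diff_left smult_closed subset_iff a_minus_def[of M])
  also have "\<dots> = (\<Oplus>\<^bsub>M\<^esub>y\<in>S. v y \<odot>\<^bsub>M\<^esub> y) \<oplus>\<^bsub>M\<^esub> (\<Oplus>\<^bsub>M\<^esub>y\<in>S. \<ominus>\<^bsub>M\<^esub> (w y \<odot>\<^bsub>M\<^esub> y))"
    using assms by (intro M.finsum_addf) (auto simp: smult_closed subset_iff)
  also have "(\<Oplus>\<^bsub>M\<^esub>y\<in>S. \<ominus>\<^bsub>M\<^esub> (w y \<odot>\<^bsub>M\<^esub> y)) = \<ominus>\<^bsub>M\<^esub> (\<Oplus>\<^bsub>M\<^esub>y\<in>S. w y \<odot>\<^bsub>M\<^esub> y)"
    using assms by (intro M.finsum_minus) (auto simp: smult_closed subset_iff)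
  finally show ?thesis by (simp add: a_minus_def)
qed

end

section \<open>When a tensor vanishes\<close>

text \<open>
  For a left module \<open>N\<close> with the presentation whose generators are all elements of \<open>N\<close>, the tensor
  product \<open>E \<otimes> N\<close> is the quotient of the finitely supported functions from \<open>N\<close> to \<open>E\<close> by these
  functions: the sums of products of elements of \<open>E\<close> with linear relations \<open>v\<close> among elements of
  \<open>N\<close>.
\<close>

inductive_set relation_functions :: "('a, 'y) ring_scheme \<Rightarrow> ('a, 'e) module \<Rightarrow> ('a, 'n) module \<Rightarrow> ('n \<Rightarrow> 'e) set"
  for A :: "('a, 'y) ring_scheme" and E :: "('a, 'e) module" and N :: "('a, 'n) module" where
  zero: "(\<lambda>_. \<zero>\<^bsub>E\<^esub>) \<in> relation_functions A E N"
| step: "\<lbrakk>F \<in> relation_functions A E N; c \<in> carrier E; finite Y; Y \<subseteq> carrier N; \<And>y. y \<in> Y \<Longrightarrow> v y \<in> carrier A;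
    (\<Oplus>\<^bsub>N\<^esub>y\<in>Y. v y \<odot>\<^bsub>N\<^esub> y) = \<zero>\<^bsub>N\<^esub>\<rbrakk> \<Longrightarrow>
    (\<lambda>t. (if t \<in> Y then v t \<odot>\<^bsub>E\<^esub> c else \<zero>\<^bsub>E\<^esub>) \<oplus>\<^bsub>E\<^esub> F t) \<in> relation_functions A E N"

context tensor_pair
begin

lemma relation_functions_closed: "F \<in> relation_functions A M N \<Longrightarrow> F t \<in> carrier M"
  by (induction rule: relation_functions.induct) (auto simp: M.smult_closed)

lemma relation_functions_add:
  assumes "F \<in> relation_functions A M N" "F' \<in> relation_functions A M N"
  shows "(\<lambda>t. F t \<oplus>\<^bsub>M\<^esub> F' t) \<in> relation_functions A M N"
  using assms(1)
proof induction
  case zero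
  then show ?case using assms(2) relation_functions_closed[OF assms(2)] by simp
next
  case (step F c Y v)
  from relation_functions.step[OF step.IH step.hyps(2-6)]
  have "(\<lambda>t. (if t \<in> Y then v t \<odot>\<^bsub>M\<^esub> c else \<zero>\<^bsub>M\<^esub>) \<oplus>\<^bsub>M\<^esub> (F t \<oplus>\<^bsub>M\<^esub> F' t)) \<in> relation_functions A M N" .
  moreover have "(if t \<in> Y then v t \<odot>\<^bsub>M\<^esub> c else \<zero>\<^bsub>M\<^esub>) \<oplus>\<^bsub>M\<^esub> F t \<oplus>\<^bsub>M\<^esub> F' t =
      (if t \<in> Y then v t \<odot>\<^bsub>M\<^esub> c else \<zero>\<^bsub>M\<^esub>) \<oplus>\<^bsub>M\<^esub> (F t \<oplus>\<^bsub>M\<^esub> F' t)" for t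
    using step.hyps relation_functions_closed[OF step.hyps(1)] relation_functions_closed[OF assms(2)]
    by (intro M.M.a_assoc) (auto simp: M.smult_closed)
  ultimately show ?case by simp
qed

lemma relation_functions_neg:
  assumes "F \<in> relation_functions A M N"
  shows "(\<lambda>t. \<ominus>\<^bsub>M\<^esub> F t) \<in> relation_functions A M N"
  using assms
proof induction
  case zero
  show ?case unfolding M.M.neg_zero by (rule relation_functions.zero)
next
  case (step F c Y v)
  from relation_functions.step[OF step.IH _ step.hyps(3-6), of "\<ominus>\<^bsub>M\<^esub> c"] step.hyps(2)
  have "(\<lambda>t. (if t \<in> Y then v t \<odot>\<^bsub>M\<^esub> (\<ominus>\<^bsub>M\<^esub> c) else \<zero>\<^bsub>M\<^esub>) \<oplus>\<^bsub>M\<^esub> (\<ominus>\<^bsub>M\<^esub> F t)) \<in> relation_functions A M N" by simp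
  moreover have "\<ominus>\<^bsub>M\<^esub> ((if t \<in> Y then v t \<odot>\<^bsub>M\<^esub> c else \<zero>\<^bsub>M\<^esub>) \<oplus>\<^bsub>M\<^esub> F t) =
      (if t \<in> Y then v t \<odot>\<^bsub>M\<^esub> (\<ominus>\<^bsub>M\<^esub> c) else \<zero>\<^bsub>M\<^esub>) \<oplus>\<^bsub>M\<^esub> (\<ominus>\<^bsub>M\<^esub> F t)" for t
    using step.hyps relation_functions_closed[OF step.hyps(1)]
    by (auto simp: M.smult_closed M.M.minus_add M.smult_minus_right)
  ultimately show ?case by simp
qed

text \<open>
  A common finite set \<open>Y\<close> carries all relations that are involved; extending them by zero keeps them
  relations.
\<close>

lemma relation_functions_representation:
  assumes "F \<in> relation_functions A M N" "finite Y0" "Y0 \<subseteq> carrier N"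
  shows "\<exists>Y (k::nat) c v. Y0 \<subseteq> Y \<and> finite Y \<and> Y \<subseteq> carrier N \<and> (\<forall>j<k. c j \<in> carrier M) \<and>
    (\<forall>j<k. \<forall>y\<in>Y. v j y \<in> carrier A) \<and> (\<forall>j<k. (\<Oplus>\<^bsub>N\<^esub>y\<in>Y. v j y \<odot>\<^bsub>N\<^esub> y) = \<zero>\<^bsub>N\<^esub>) \<and>
    (\<forall>t\<in>Y. F t = (\<Oplus>\<^bsub>M\<^esub>j\<in>{..<k}. v j t \<odot>\<^bsub>M\<^esub> c j))"
  using assms
proof (induction arbitrary: Y0)
  case zero
  then show ?case by (intro exI[of _ Y0] exI[of _ "0::nat"]) simp
next
  case (step F c Y1 v)
  have "finite (Y0 \<union> Y1)" "Y0 \<union> Y1 \<subseteq> carrier N" using step.hyps(3,4) step.prems by auto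
  from step.IH[OF this] obtain Y and k :: nat and c' v' where
    *: "Y0 \<union> Y1 \<subseteq> Y \<and> finite Y \<and> Y \<subseteq> carrier N \<and> (\<forall>j<k. c' j \<in> carrier M) \<and>
    (\<forall>j<k. \<forall>y\<in>Y. v' j y \<in> carrier A) \<and> (\<forall>j<k. (\<Oplus>\<^bsub>N\<^esub>y\<in>Y. v' j y \<odot>\<^bsub>N\<^esub> y) = \<zero>\<^bsub>N\<^esub>) \<and>
    (\<forall>t\<in>Y. F t = (\<Oplus>\<^bsub>M\<^esub>j\<in>{..<k}. v' j t \<odot>\<^bsub>M\<^esub> c' j))"
    by (elim exE) rule
  then have Y: "Y0 \<union> Y1 \<subseteq> Y" "finite Y" "Y \<subseteq> carrier N" and c': "\<And>j. j < k \<Longrightarrow> c' j \<in> carrier M"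
    and v': "\<And>j y. j < k \<Longrightarrow> y \<in> Y \<Longrightarrow> v' j y \<in> carrier A" "\<And>j. j < k \<Longrightarrow> (\<Oplus>\<^bsub>N\<^esub>y\<in>Y. v' j y \<odot>\<^bsub>N\<^esub> y) = \<zero>\<^bsub>N\<^esub>"
    and F: "\<And>t. t \<in> Y \<Longrightarrow> F t = (\<Oplus>\<^bsub>M\<^esub>j\<in>{..<k}. v' j t \<odot>\<^bsub>M\<^esub> c' j)"
    by simp_all
  define w where "w y = (if y \<in> Y1 then v y else \<zero>\<^bsub>A\<^esub>)" for y
  have w: "w y \<in> carrier A" for y using step.hyps(5) by (simp add: w_def)
  have "(\<Oplus>\<^bsub>N\<^esub>y\<in>Y. w y \<odot>\<^bsub>N\<^esub> y) = (\<Oplus>\<^bsub>N\<^esub>y\<in>Y1. v y \<odot>\<^bsub>N\<^esub> y)"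
    using Y step.hyps(5) by (intro N.M.add.finprod_mono_neutral_cong_right)
      (auto simp: w_def N.smult_zero_left N.smult_closed subset_iff)
  then have w0: "(\<Oplus>\<^bsub>N\<^esub>y\<in>Y. w y \<odot>\<^bsub>N\<^esub> y) = \<zero>\<^bsub>N\<^esub>" using step.hyps(6) by simp
  show ?case
  proof (intro exI[of _ Y] exI[of _ "Suc k"] exI[of _ "c'(k := c)"] exI[of _ "v'(k := w)"] conjI)
    show "\<forall>t\<in>Y. (if t \<in> Y1 then v t \<odot>\<^bsub>M\<^esub> c else \<zero>\<^bsub>M\<^esub>) \<oplus>\<^bsub>M\<^esub> F t =
      (\<Oplus>\<^bsub>M\<^esub>j\<in>{..<Suc k}. (v'(k := w)) j t \<odot>\<^bsub>M\<^esub> (c'(k := c)) j)"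
    proof
      fix t assume t: "t \<in> Y"
      have "(\<Oplus>\<^bsub>M\<^esub>j\<in>{..<Suc k}. (v'(k := w)) j t \<odot>\<^bsub>M\<^esub> (c'(k := c)) j) =
         w t \<odot>\<^bsub>M\<^esub> c \<oplus>\<^bsub>M\<^esub> (\<Oplus>\<^bsub>M\<^esub>j\<in>{..<k}. (v'(k := w)) j t \<odot>\<^bsub>M\<^esub> (c'(k := c)) j)"
        using t v'(1) c' w step.hyps(2) by (subst M.M.finsum_lessThan_Suc) (auto simp: M.smult_closed)
      also have "(\<Oplus>\<^bsub>M\<^esub>j\<in>{..<k}. (v'(k := w)) j t \<odot>\<^bsub>M\<^esub> (c'(k := c)) j) = F t"
        unfolding F[OF t] using t v'(1) c' by (intro M.M.finsum_cong') (auto simp: M.smult_closed)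
      also have "w t \<odot>\<^bsub>M\<^esub> c = (if t \<in> Y1 then v t \<odot>\<^bsub>M\<^esub> c else \<zero>\<^bsub>M\<^esub>)"
        using step.hyps(2) by (simp add: w_def M.smult_zero_left)
      finally show "(if t \<in> Y1 then v t \<odot>\<^bsub>M\<^esub> c else \<zero>\<^bsub>M\<^esub>) \<oplus>\<^bsub>M\<^esub> F t =
        (\<Oplus>\<^bsub>M\<^esub>j\<in>{..<Suc k}. (v'(k := w)) j t \<odot>\<^bsub>M\<^esub> (c'(k := c)) j)" ..
    qed
  qed (use Y c' v' w w0 step.hyps(2) in \<open>auto simp: less_Suc_eq\<close>)
qed

text \<open>
  The component at \<open>t\<close> of the map sending the pair \<open>(x, y)\<close> to the function with value \<open>x\<close> at \<open>y\<close>
  and \<open>\<zero>\<close> elsewhere.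
\<close>

lemma component_map_exists:
  "\<exists>\<Theta>. (\<forall>a\<in>carrier (free_on_pairs M N). \<Theta> a \<in> carrier M) \<and>
     (\<forall>a\<in>carrier (free_on_pairs M N). \<forall>b\<in>carrier (free_on_pairs M N). \<Theta> (a + b) = \<Theta> a \<oplus>\<^bsub>M\<^esub> \<Theta> b) \<and>
     (\<forall>a\<in>carrier (free_on_pairs M N). \<Theta> (- a) = \<ominus>\<^bsub>M\<^esub> \<Theta> a) \<and> \<Theta> 0 = \<zero>\<^bsub>M\<^esub> \<and>
     (\<forall>x\<in>carrier M. \<forall>y\<in>carrier N. \<Theta> (frag_of (x, y)) = (if y = t then x else \<zero>\<^bsub>M\<^esub>))"
proof -
  have "(\<lambda>(x, y). if y = t then x else \<zero>\<^bsub>M\<^esub>) ` (carrier M \<times> carrier N) \<subseteq> carrier (add_monoid M)" by auto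
  from comm_group.free_Abelian_group_universal[OF M.M.a_comm_group this] obtain \<Theta> where
    h: "\<Theta> \<in> hom (free_on_pairs M N) (add_monoid M)"
    and v: "\<And>p. p \<in> carrier M \<times> carrier N \<Longrightarrow> \<Theta> (frag_of p) = (case p of (x, y) \<Rightarrow> if y = t then x else \<zero>\<^bsub>M\<^esub>)" by blast
  interpret H: group_hom "free_on_pairs M N" "add_monoid M" \<Theta>
    using h by (auto simp: group_hom_def group_hom_axioms_def M.M.a_group)
  have "\<Theta> (- a) = \<ominus>\<^bsub>M\<^esub> \<Theta> a" if "a \<in> carrier (free_on_pairs M N)" for a
    using H.hom_inv[OF that] that by (simp add: a_inv_def)
  moreover have "\<Theta> 0 = \<zero>\<^bsub>M\<^esub>" using H.hom_one by simp
  ultimately show ?thesis using H.hom_closed H.hom_mult v by (intro exI[of _ \<Theta>]) auto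
qed

text \<open>
  The defining relations of the tensor product become relation functions: additivity on the left
  becomes \<open>\<zero>\<close>, the two others become one linear relation each, \<open>1 (y + y') - 1 y - 1 y' = 0\<close> and
  \<open>a y - 1 (a y) = 0\<close>.
\<close>

lemma components_of_null:
  assumes "\<And>t a. a \<in> carrier (free_on_pairs M N) \<Longrightarrow> \<Theta> t a \<in> carrier M"
    and "\<And>t a b. a \<in> carrier (free_on_pairs M N) \<Longrightarrow> b \<in> carrier (free_on_pairs M N) \<Longrightarrow> \<Theta> t (a + b) = \<Theta> t a \<oplus>\<^bsub>M\<^esub> \<Theta> t b"
    and "\<And>t a. a \<in> carrier (free_on_pairs M N) \<Longrightarrow> \<Theta> t (- a) = \<ominus>\<^bsub>M\<^esub> \<Theta> t a" "\<And>t. \<Theta> t 0 = \<zero>\<^bsub>M\<^esub>"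
    and v: "\<And>t x y. x \<in> carrier M \<Longrightarrow> y \<in> carrier N \<Longrightarrow> \<Theta> t (frag_of (x, y)) = (if y = t then x else \<zero>\<^bsub>M\<^esub>)"
    and z: "z \<in> tensor_null A M N" and one: "\<And>y. y \<in> carrier N \<Longrightarrow> \<one>\<^bsub>A\<^esub> \<odot>\<^bsub>N\<^esub> y = y"
  shows "(\<lambda>t. \<Theta> t z) \<in> relation_functions A M N"
proof -
  have d: "\<Theta> t (a - b) = \<Theta> t a \<ominus>\<^bsub>M\<^esub> \<Theta> t b"
    if "a \<in> carrier (free_on_pairs M N)" "b \<in> carrier (free_on_pairs M N)" for t a b
    using assms(2)[of a "- b" t] assms(3)[of b t] that by (simp add: a_minus_def)
  have dc: "a - b \<in> carrier (free_on_pairs M N)"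
    if "a \<in> carrier (free_on_pairs M N)" "b \<in> carrier (free_on_pairs M N)" for a b
    using that keys_diff[of a b] by auto
  have fc: "frag_of (x, y) \<in> carrier (free_on_pairs M N)" if "x \<in> carrier M" "y \<in> carrier N" for x y using that by simp
  have nc: "a \<in> tensor_null A M N \<Longrightarrow> a \<in> carrier (free_on_pairs M N)" for a using tn_keys by simp
  have single: "(\<lambda>t. if t \<in> Y then v t \<odot>\<^bsub>M\<^esub> c else \<zero>\<^bsub>M\<^esub>) \<in> relation_functions A M N"
    if "c \<in> carrier M" "finite Y" "Y \<subseteq> carrier N" "\<And>y. y \<in> Y \<Longrightarrow> v y \<in> carrier A" "(\<Oplus>\<^bsub>N\<^esub>y\<in>Y. v y \<odot>\<^bsub>N\<^esub> y) = \<zero>\<^bsub>N\<^esub>" for c Y v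
  proof -
    have "(if t \<in> Y then v t \<odot>\<^bsub>M\<^esub> c else \<zero>\<^bsub>M\<^esub>) \<oplus>\<^bsub>M\<^esub> \<zero>\<^bsub>M\<^esub> = (if t \<in> Y then v t \<odot>\<^bsub>M\<^esub> c else \<zero>\<^bsub>M\<^esub>)" for t
      using that by (simp add: M.smult_closed)
    then show ?thesis using relation_functions.step[OF relation_functions.zero that] by simp
  qed
  show ?thesis using z
  proof (induction rule: tensor_null_induct)
    case zero
    show ?case using assms(4) relation_functions.zero by simp
  next
    case (left x x' y)
    have "\<Theta> t (frag_of (x \<oplus>\<^bsub>M\<^esub> x', y) - frag_of (x, y) - frag_of (x', y)) = \<zero>\<^bsub>M\<^esub>" for t
      using left by (simp add: d dc fc v del: carrier_free_Abelian_group_iff)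
        (simp add: M.M.minus_eq M.M.a_ac M.M.r_neg M.M.r_neg1 M.M.r_neg2)
    then show ?case using relation_functions.zero by simp
  next
    case (right x y y')
    let ?Y = "{y \<oplus>\<^bsub>N\<^esub> y', y, y'}" and ?\<delta> = "\<lambda>s t. if t = s then \<one>\<^bsub>A\<^esub> else \<zero>\<^bsub>A\<^esub>"
    let ?v = "\<lambda>t. ?\<delta> (y \<oplus>\<^bsub>N\<^esub> y') t \<ominus>\<^bsub>A\<^esub> ?\<delta> y t \<ominus>\<^bsub>A\<^esub> ?\<delta> y' t"
    have Y: "?Y \<subseteq> carrier N" using right by auto
    have \<delta>: "(\<Oplus>\<^bsub>N\<^esub>t\<in>?Y. ?\<delta> s t \<odot>\<^bsub>N\<^esub> t) = s" if "s \<in> ?Y" for s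
      using N.finsum_delta_smult[of ?Y s "\<one>\<^bsub>A\<^esub>"] Y that one by auto
    have "(\<Oplus>\<^bsub>N\<^esub>t\<in>?Y. ?v t \<odot>\<^bsub>N\<^esub> t) = (\<Oplus>\<^bsub>N\<^esub>t\<in>?Y. (?\<delta> (y \<oplus>\<^bsub>N\<^esub> y') t \<ominus>\<^bsub>A\<^esub> ?\<delta> y t) \<odot>\<^bsub>N\<^esub> t) \<ominus>\<^bsub>N\<^esub> y'"
      using Y \<delta>[of y'] N.finsum_diff_smult[of ?Y "\<lambda>t. ?\<delta> (y \<oplus>\<^bsub>N\<^esub> y') t \<ominus>\<^bsub>A\<^esub> ?\<delta> y t" "?\<delta> y'"] by simp
    also have "\<dots> = (y \<oplus>\<^bsub>N\<^esub> y') \<ominus>\<^bsub>N\<^esub> y \<ominus>\<^bsub>N\<^esub> y'"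
      using Y \<delta>[of "y \<oplus>\<^bsub>N\<^esub> y'"] \<delta>[of y] N.finsum_diff_smult[of ?Y "?\<delta> (y \<oplus>\<^bsub>N\<^esub> y')" "?\<delta> y"] by simp
    also have "\<dots> = \<zero>\<^bsub>N\<^esub>" using right by (simp add: N.M.minus_eq N.M.a_ac N.M.r_neg N.M.r_neg1 N.M.r_neg2)
    finally have "(\<Oplus>\<^bsub>N\<^esub>t\<in>?Y. ?v t \<odot>\<^bsub>N\<^esub> t) = \<zero>\<^bsub>N\<^esub>" .
    then have "(\<lambda>t. if t \<in> ?Y then ?v t \<odot>\<^bsub>M\<^esub> x else \<zero>\<^bsub>M\<^esub>) \<in> relation_functions A M N"
      using right Y by (intro single) auto
    moreover have "\<Theta> t (frag_of (x, y \<oplus>\<^bsub>N\<^esub> y') - frag_of (x, y) - frag_of (x, y')) = (if t \<in> ?Y then ?v t \<odot>\<^bsub>M\<^esub> x else \<zero>\<^bsub>M\<^esub>)" for t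
    proof -
      have "\<Theta> t (frag_of (x, y \<oplus>\<^bsub>N\<^esub> y') - frag_of (x, y) - frag_of (x, y')) =
        (if y \<oplus>\<^bsub>N\<^esub> y' = t then x else \<zero>\<^bsub>M\<^esub>) \<ominus>\<^bsub>M\<^esub> (if y = t then x else \<zero>\<^bsub>M\<^esub>) \<ominus>\<^bsub>M\<^esub> (if y' = t then x else \<zero>\<^bsub>M\<^esub>)"
        using right by (simp only: d dc fc v N.M.a_closed)
      moreover have "?\<delta> s t \<odot>\<^bsub>M\<^esub> x = (if s = t then x else \<zero>\<^bsub>M\<^esub>)" for s
        using right M.smult_one M.smult_zero_left by simp
      ultimately show ?thesis using right by (simp add: M.smult_diff_left) (auto simp: M.M.minus_eq M.M.neg_zero)
    qed
    ultimately show ?case by simp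
  next
    case (balanced a x y)
    let ?s = "a \<odot>\<^bsub>N\<^esub> y"
    let ?Y = "{y, ?s}" and ?\<delta> = "\<lambda>b s t. if t = s then b else \<zero>\<^bsub>A\<^esub>"
    let ?v = "\<lambda>t. ?\<delta> a y t \<ominus>\<^bsub>A\<^esub> ?\<delta> \<one>\<^bsub>A\<^esub> ?s t"
    have Y: "?Y \<subseteq> carrier N" using balanced N.smult_closed by auto
    have "(\<Oplus>\<^bsub>N\<^esub>t\<in>?Y. ?v t \<odot>\<^bsub>N\<^esub> t) = ?s \<ominus>\<^bsub>N\<^esub> ?s"
      using Y balanced one N.finsum_diff_smult[of ?Y "?\<delta> a y" "?\<delta> \<one>\<^bsub>A\<^esub> ?s"]
        N.finsum_delta_smult[of ?Y y a] N.finsum_delta_smult[of ?Y ?s "\<one>\<^bsub>A\<^esub>"] by simp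
    then have "(\<Oplus>\<^bsub>N\<^esub>t\<in>?Y. ?v t \<odot>\<^bsub>N\<^esub> t) = \<zero>\<^bsub>N\<^esub>" using Y by (simp add: N.M.minus_eq N.M.r_neg)
    then have "(\<lambda>t. if t \<in> ?Y then ?v t \<odot>\<^bsub>M\<^esub> x else \<zero>\<^bsub>M\<^esub>) \<in> relation_functions A M N"
      using balanced Y by (intro single) auto
    moreover have "\<Theta> t (frag_of (a \<odot>\<^bsub>M\<^esub> x, y) - frag_of (x, ?s)) = (if t \<in> ?Y then ?v t \<odot>\<^bsub>M\<^esub> x else \<zero>\<^bsub>M\<^esub>)" for t
    proof -
      have "\<Theta> t (frag_of (a \<odot>\<^bsub>M\<^esub> x, y) - frag_of (x, ?s)) =
        (if y = t then a \<odot>\<^bsub>M\<^esub> x else \<zero>\<^bsub>M\<^esub>) \<ominus>\<^bsub>M\<^esub> (if ?s = t then x else \<zero>\<^bsub>M\<^esub>)"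
        using balanced by (simp only: d dc fc v N.smult_closed M.smult_closed)
      moreover have "?\<delta> b s t \<odot>\<^bsub>M\<^esub> x = (if s = t then b \<odot>\<^bsub>M\<^esub> x else \<zero>\<^bsub>M\<^esub>)" for s b
        using balanced M.smult_zero_left by simp
      ultimately show ?thesis using balanced by (simp add: M.smult_diff_left M.smult_one) (auto simp: M.M.minus_eq M.M.neg_zero)
    qed
    ultimately show ?case by simp
  next
    case (add u v)
    then show ?case using relation_functions_add[OF add.IH] assms(2)[OF nc nc] by simp
  next
    case (neg u)
    then show ?case using relation_functions_neg[OF neg.IH] assms(3)[OF nc] by simp
  qed
qed

end

text \<open>
  The equational criterion for flatness. For a right module, \<open>a \<odot> b\<close> stands for \<open>b \<cdot> a\<close>, so the
  relations have their coefficients on the right and the syzygies \<open>v\<close> multiply the matrix \<open>u\<close> from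
  the left.
\<close>

definition equationally_flat :: "('a, 'y) ring_scheme \<Rightarrow> ('a, 'e) module \<Rightarrow> bool" where
  "equationally_flat A E \<longleftrightarrow> (\<forall>(m::nat) (p::nat) b u. (\<forall>i<m. b i \<in> carrier E) \<and> (\<forall>i<m. \<forall>l<p. u i l \<in> carrier A) \<and>
     (\<forall>l<p. (\<Oplus>\<^bsub>E\<^esub>i\<in>{..<m}. u i l \<odot>\<^bsub>E\<^esub> b i) = \<zero>\<^bsub>E\<^esub>) \<longrightarrow>
     (\<exists>(k::nat) c v. (\<forall>j<k. c j \<in> carrier E) \<and> (\<forall>j<k. \<forall>i<m. v j i \<in> carrier A) \<and>
       (\<forall>j<k. \<forall>l<p. (\<Oplus>\<^bsub>A\<^esub>i\<in>{..<m}. v j i \<otimes>\<^bsub>A\<^esub> u i l) = \<zero>\<^bsub>A\<^esub>) \<and>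
       (\<forall>i<m. b i = (\<Oplus>\<^bsub>E\<^esub>j\<in>{..<k}. v j i \<odot>\<^bsub>E\<^esub> c j))))"

lemma equationally_flatD:
  fixes m p :: nat
  assumes "equationally_flat A E" "\<forall>i<m. b i \<in> carrier E" "\<forall>i<m. \<forall>l<p. u i l \<in> carrier A"
    "\<forall>l<p. (\<Oplus>\<^bsub>E\<^esub>i\<in>{..<m}. u i l \<odot>\<^bsub>E\<^esub> b i) = \<zero>\<^bsub>E\<^esub>"
  shows "\<exists>(k::nat) c v. (\<forall>j<k. c j \<in> carrier E) \<and> (\<forall>j<k. \<forall>i<m. v j i \<in> carrier A) \<and>
       (\<forall>j<k. \<forall>l<p. (\<Oplus>\<^bsub>A\<^esub>i\<in>{..<m}. v j i \<otimes>\<^bsub>A\<^esub> u i l) = \<zero>\<^bsub>A\<^esub>) \<and>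
       (\<forall>i<m. b i = (\<Oplus>\<^bsub>E\<^esub>j\<in>{..<k}. v j i \<odot>\<^bsub>E\<^esub> c j))"
  using assms(1)[unfolded equationally_flat_def, THEN spec, THEN spec, THEN spec, THEN spec, THEN mp, OF conjI, OF assms(2) conjI, OF assms(3,4)] .

text \<open>
  For the unit element of a ring extension this says that proper left ideals generate proper left
  ideals.
\<close>

definition faithful_at :: "('a, 'y) ring_scheme \<Rightarrow> ('a, 'e) module \<Rightarrow> 'e \<Rightarrow> bool" where
  "faithful_at A E e \<longleftrightarrow> e \<in> carrier E \<and>
     (\<forall>I (k::nat) c a. I \<subseteq> carrier A \<and> \<zero>\<^bsub>A\<^esub> \<in> I \<and> (\<forall>u\<in>I. \<forall>v\<in>I. u \<oplus>\<^bsub>A\<^esub> v \<in> I) \<and>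
        (\<forall>r\<in>carrier A. \<forall>v\<in>I. r \<otimes>\<^bsub>A\<^esub> v \<in> I) \<and> (\<forall>j<k. c j \<in> carrier E) \<and> (\<forall>j<k. a j \<in> I) \<and>
        e = (\<Oplus>\<^bsub>E\<^esub>j\<in>{..<k}. a j \<odot>\<^bsub>E\<^esub> c j) \<longrightarrow> \<one>\<^bsub>A\<^esub> \<in> I)"

lemma faithful_atD:
  fixes k :: nat
  assumes f: "faithful_at A E e" and I: "I \<subseteq> carrier A" "\<zero>\<^bsub>A\<^esub> \<in> I" "\<And>u v. u \<in> I \<Longrightarrow> v \<in> I \<Longrightarrow> u \<oplus>\<^bsub>A\<^esub> v \<in> I"
      "\<And>r v. r \<in> carrier A \<Longrightarrow> v \<in> I \<Longrightarrow> r \<otimes>\<^bsub>A\<^esub> v \<in> I" "\<And>j. j < k \<Longrightarrow> c j \<in> carrier E" "\<And>j. j < k \<Longrightarrow> a j \<in> I"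
      "e = (\<Oplus>\<^bsub>E\<^esub>j\<in>{..<k}. a j \<odot>\<^bsub>E\<^esub> c j)"
  shows "\<one>\<^bsub>A\<^esub> \<in> I"
proof -
  have "I \<subseteq> carrier A \<and> \<zero>\<^bsub>A\<^esub> \<in> I \<and> (\<forall>u\<in>I. \<forall>v\<in>I. u \<oplus>\<^bsub>A\<^esub> v \<in> I) \<and>
        (\<forall>r\<in>carrier A. \<forall>v\<in>I. r \<otimes>\<^bsub>A\<^esub> v \<in> I) \<and> (\<forall>j<k. c j \<in> carrier E) \<and> (\<forall>j<k. a j \<in> I) \<and>
        e = (\<Oplus>\<^bsub>E\<^esub>j\<in>{..<k}. a j \<odot>\<^bsub>E\<^esub> c j)" by (intro conjI ballI allI impI I)
  then show ?thesis by (rule f[unfolded faithful_at_def, THEN conjunct2, THEN spec, THEN spec, THEN spec, THEN spec, THEN mp])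
qed

text \<open>
  By \<open>components_of_null\<close> the tensor vanishes because the function it defines is a combination of
  relations among elements of \<open>N\<close>. Comparing components gives linear relations over \<open>A\<close> between the
  \<open>e i\<close> and the coefficients \<open>c\<close> of that combination. Flatness resolves these through syzygies, and
  the syzygies turn the relations in \<open>N\<close> into the required ones for \<open>y\<close>.
\<close>

lemma vanishing_tensors:
  fixes A :: "('a, 'y) ring_scheme" and E :: "('a, 'e) module" and N :: "('a, 'n) module" and m :: nat
  assumes E: "right_module A E" and flat: "equationally_flat A E" and N: "left_module A N"
    and e: "\<And>i. i < m \<Longrightarrow> e i \<in> carrier E" and y: "\<And>i. i < m \<Longrightarrow> y i \<in> carrier N"
    and null: "(\<Sum>i<m. frag_of (e i, y i)) \<in> tensor_null A E N"
  shows "\<exists>(r::nat) d s. (\<forall>j<r. d j \<in> carrier E) \<and> (\<forall>j<r. \<forall>i<m. s j i \<in> carrier A) \<and>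
    (\<forall>i<m. e i = (\<Oplus>\<^bsub>E\<^esub>j\<in>{..<r}. s j i \<odot>\<^bsub>E\<^esub> d j)) \<and>
    (\<forall>j<r. (\<Oplus>\<^bsub>N\<^esub>i\<in>{..<m}. s j i \<odot>\<^bsub>N\<^esub> y i) = \<zero>\<^bsub>N\<^esub>)"
proof -
  interpret E: right_module A E by fact
  interpret N: left_module A N by fact
  interpret T: tensor_pair A E N by (intro tensor_pair.intro E.one_sided_module_axioms N.one_sided_module_axioms)
  let ?F = "carrier (free_on_pairs E N)"
  obtain \<Theta> where \<Theta>: "\<And>t a. a \<in> ?F \<Longrightarrow> \<Theta> t a \<in> carrier E"
    "\<And>t a b. a \<in> ?F \<Longrightarrow> b \<in> ?F \<Longrightarrow> \<Theta> t (a + b) = \<Theta> t a \<oplus>\<^bsub>E\<^esub> \<Theta> t b"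
    "\<And>t a. a \<in> ?F \<Longrightarrow> \<Theta> t (- a) = \<ominus>\<^bsub>E\<^esub> \<Theta> t a" "\<And>t. \<Theta> t 0 = \<zero>\<^bsub>E\<^esub>"
    "\<And>t x y. x \<in> carrier E \<Longrightarrow> y \<in> carrier N \<Longrightarrow> \<Theta> t (frag_of (x, y)) = (if y = t then x else \<zero>\<^bsub>E\<^esub>)"
  proof -
    have "\<forall>t. \<exists>\<Theta>. (\<forall>a\<in>?F. \<Theta> a \<in> carrier E) \<and> (\<forall>a\<in>?F. \<forall>b\<in>?F. \<Theta> (a + b) = \<Theta> a \<oplus>\<^bsub>E\<^esub> \<Theta> b) \<and>
       (\<forall>a\<in>?F. \<Theta> (- a) = \<ominus>\<^bsub>E\<^esub> \<Theta> a) \<and> \<Theta> 0 = \<zero>\<^bsub>E\<^esub> \<and>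
       (\<forall>x\<in>carrier E. \<forall>y\<in>carrier N. \<Theta> (frag_of (x, y)) = (if y = t then x else \<zero>\<^bsub>E\<^esub>))"
      by (rule allI) (rule T.component_map_exists)
    from choice[OF this] obtain \<Theta> where
      *: "\<forall>t. (\<forall>a\<in>?F. \<Theta> t a \<in> carrier E) \<and> (\<forall>a\<in>?F. \<forall>b\<in>?F. \<Theta> t (a + b) = \<Theta> t a \<oplus>\<^bsub>E\<^esub> \<Theta> t b) \<and>
       (\<forall>a\<in>?F. \<Theta> t (- a) = \<ominus>\<^bsub>E\<^esub> \<Theta> t a) \<and> \<Theta> t 0 = \<zero>\<^bsub>E\<^esub> \<and>
       (\<forall>x\<in>carrier E. \<forall>y\<in>carrier N. \<Theta> t (frag_of (x, y)) = (if y = t then x else \<zero>\<^bsub>E\<^esub>))" by (elim exE) rule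
    show ?thesis by (rule that[of \<Theta>]) (use * in \<open>simp_all del: carrier_free_Abelian_group_iff\<close>)
  qed
  have "(\<lambda>t. \<Theta> t (\<Sum>i<m. frag_of (e i, y i))) \<in> relation_functions A E N"
    by (rule T.components_of_null[OF \<Theta> null N.smult_one])
  moreover have "finite (y ` {..<m})" "y ` {..<m} \<subseteq> carrier N" using y by auto
  ultimately have "\<exists>Y (k::nat) c v. y ` {..<m} \<subseteq> Y \<and> finite Y \<and> Y \<subseteq> carrier N \<and> (\<forall>j<k. c j \<in> carrier E) \<and>
    (\<forall>j<k. \<forall>y\<in>Y. v j y \<in> carrier A) \<and> (\<forall>j<k. (\<Oplus>\<^bsub>N\<^esub>y\<in>Y. v j y \<odot>\<^bsub>N\<^esub> y) = \<zero>\<^bsub>N\<^esub>) \<and>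
    (\<forall>t\<in>Y. \<Theta> t (\<Sum>i<m. frag_of (e i, y i)) = (\<Oplus>\<^bsub>E\<^esub>j\<in>{..<k}. v j t \<odot>\<^bsub>E\<^esub> c j))"
    by (rule T.relation_functions_representation)
  then obtain Y and k :: nat and c v where
    *: "y ` {..<m} \<subseteq> Y \<and> finite Y \<and> Y \<subseteq> carrier N \<and> (\<forall>j<k. c j \<in> carrier E) \<and>
    (\<forall>j<k. \<forall>y\<in>Y. v j y \<in> carrier A) \<and> (\<forall>j<k. (\<Oplus>\<^bsub>N\<^esub>y\<in>Y. v j y \<odot>\<^bsub>N\<^esub> y) = \<zero>\<^bsub>N\<^esub>) \<and>
    (\<forall>t\<in>Y. \<Theta> t (\<Sum>i<m. frag_of (e i, y i)) = (\<Oplus>\<^bsub>E\<^esub>j\<in>{..<k}. v j t \<odot>\<^bsub>E\<^esub> c j))"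
    by (elim exE) rule
  then have Y: "y ` {..<m} \<subseteq> Y" "finite Y" "Y \<subseteq> carrier N" and c: "\<And>j. j < k \<Longrightarrow> c j \<in> carrier E"
    and v: "\<And>j y. j < k \<Longrightarrow> y \<in> Y \<Longrightarrow> v j y \<in> carrier A" "\<And>j. j < k \<Longrightarrow> (\<Oplus>\<^bsub>N\<^esub>y\<in>Y. v j y \<odot>\<^bsub>N\<^esub> y) = \<zero>\<^bsub>N\<^esub>"
    and F: "\<And>t. t \<in> Y \<Longrightarrow> \<Theta> t (\<Sum>i<m. frag_of (e i, y i)) = (\<Oplus>\<^bsub>E\<^esub>j\<in>{..<k}. v j t \<odot>\<^bsub>E\<^esub> c j)"
    by simp_all
  have fc: "frag_of (e i, y i) \<in> ?F" if "i < m" for i using e[OF that] y[OF that] by simp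
  let ?\<delta> = "\<lambda>i t. if y i = t then \<one>\<^bsub>A\<^esub> else \<zero>\<^bsub>A\<^esub>"
  have comp: "n \<le> m \<Longrightarrow> \<Theta> t (\<Sum>i<n. frag_of (e i, y i)) = (\<Oplus>\<^bsub>E\<^esub>i\<in>{..<n}. ?\<delta> i t \<odot>\<^bsub>E\<^esub> e i)" for n t
  proof (induction n)
    case 0 then show ?case using \<Theta>(4) by simp
  next
    case (Suc n)
    have s: "(\<Sum>i<n. frag_of (e i, y i)) \<in> ?F" using fc Suc.prems by (intro sum_closed_free_Abelian_group) simp
    have "\<Theta> t (\<Sum>i<Suc n. frag_of (e i, y i)) = \<Theta> t (frag_of (e n, y n) + (\<Sum>i<n. frag_of (e i, y i)))"
      by (simp add: add.commute)
    also have "\<dots> = \<Theta> t (frag_of (e n, y n)) \<oplus>\<^bsub>E\<^esub> \<Theta> t (\<Sum>i<n. frag_of (e i, y i))"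
      using \<Theta>(2)[OF fc s] Suc.prems by simp
    also have "\<Theta> t (frag_of (e n, y n)) = ?\<delta> n t \<odot>\<^bsub>E\<^esub> e n"
      using \<Theta>(5)[of "e n" "y n" t] e y Suc.prems by (simp add: E.smult_one E.smult_zero_left)
    also have "?\<delta> n t \<odot>\<^bsub>E\<^esub> e n \<oplus>\<^bsub>E\<^esub> \<Theta> t (\<Sum>i<n. frag_of (e i, y i)) = (\<Oplus>\<^bsub>E\<^esub>i\<in>{..<Suc n}. ?\<delta> i t \<odot>\<^bsub>E\<^esub> e i)"
      using Suc e by (subst E.M.finsum_lessThan_Suc) (auto simp: E.smult_closed)
    finally show ?case .
  qed
  obtain ys where ys: "set ys = Y" using Y(2) finite_list by blast
  \<comment> \<open>one linear relation between the \<open>e i\<close> and the \<open>c j\<close> for every element of \<open>Y\<close>\<close>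
  define b where "b i = (if i < m then e i else c (i - m))" for i
  define u where "u i l = (if i < m then ?\<delta> i (ys ! l) else \<ominus>\<^bsub>A\<^esub> v (i - m) (ys ! l))" for i l
  have b: "\<forall>i<m + k. b i \<in> carrier E" using e c by (simp add: b_def)
  have yl: "ys ! l \<in> Y" if "l < length ys" for l using ys that by auto
  have u: "\<forall>i<m + k. \<forall>l<length ys. u i l \<in> carrier A" using v(1) yl by (auto simp: u_def)
  have rel: "\<forall>l<length ys. (\<Oplus>\<^bsub>E\<^esub>i\<in>{..<m + k}. u i l \<odot>\<^bsub>E\<^esub> b i) = \<zero>\<^bsub>E\<^esub>"
  proof (intro allI impI)
    fix l assume l: "l < length ys"
    have t: "ys ! l \<in> Y" using yl[OF l] .
    have ic: "(\<Oplus>\<^bsub>E\<^esub>j\<in>{..<k}. v j (ys ! l) \<odot>\<^bsub>E\<^esub> c j) \<in> carrier E"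
      using v(1) t c by (intro E.M.finsum_closed) (auto simp: E.smult_closed)
    have "(\<Oplus>\<^bsub>E\<^esub>i\<in>{..<m + k}. u i l \<odot>\<^bsub>E\<^esub> b i) =
      (\<Oplus>\<^bsub>E\<^esub>i\<in>{..<m}. u i l \<odot>\<^bsub>E\<^esub> b i) \<oplus>\<^bsub>E\<^esub> (\<Oplus>\<^bsub>E\<^esub>j\<in>{..<k}. u (m + j) l \<odot>\<^bsub>E\<^esub> b (m + j))"
      using u b l by (intro E.M.finsum_lessThan_add) (auto simp: E.smult_closed)
    also have "(\<Oplus>\<^bsub>E\<^esub>i\<in>{..<m}. u i l \<odot>\<^bsub>E\<^esub> b i) = (\<Oplus>\<^bsub>E\<^esub>i\<in>{..<m}. ?\<delta> i (ys ! l) \<odot>\<^bsub>E\<^esub> e i)"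
      using e by (intro E.M.finsum_cong') (auto simp: u_def b_def E.smult_closed)
    also have "\<dots> = (\<Oplus>\<^bsub>E\<^esub>j\<in>{..<k}. v j (ys ! l) \<odot>\<^bsub>E\<^esub> c j)" using comp[of m "ys ! l"] F[OF t] by simp
    also have "(\<Oplus>\<^bsub>E\<^esub>j\<in>{..<k}. u (m + j) l \<odot>\<^bsub>E\<^esub> b (m + j)) = (\<Oplus>\<^bsub>E\<^esub>j\<in>{..<k}. \<ominus>\<^bsub>E\<^esub> (v j (ys ! l) \<odot>\<^bsub>E\<^esub> c j))"
      using v(1) t c by (intro E.M.finsum_cong') (auto simp: u_def b_def E.smult_closed E.smult_minus_left)
    also have "\<dots> = \<ominus>\<^bsub>E\<^esub> (\<Oplus>\<^bsub>E\<^esub>j\<in>{..<k}. v j (ys ! l) \<odot>\<^bsub>E\<^esub> c j)"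
      using v(1) t c by (intro E.M.finsum_minus) (auto simp: E.smult_closed)
    finally show "(\<Oplus>\<^bsub>E\<^esub>i\<in>{..<m + k}. u i l \<odot>\<^bsub>E\<^esub> b i) = \<zero>\<^bsub>E\<^esub>" using ic by (simp add: E.M.r_neg)
  qed
  have "\<exists>(r::nat) d s. (\<forall>j<r. d j \<in> carrier E) \<and> (\<forall>j<r. \<forall>i<m + k. s j i \<in> carrier A) \<and>
       (\<forall>j<r. \<forall>l<length ys. (\<Oplus>\<^bsub>A\<^esub>i\<in>{..<m + k}. s j i \<otimes>\<^bsub>A\<^esub> u i l) = \<zero>\<^bsub>A\<^esub>) \<and>
       (\<forall>i<m + k. b i = (\<Oplus>\<^bsub>E\<^esub>j\<in>{..<r}. s j i \<odot>\<^bsub>E\<^esub> d j))"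
    using equationally_flatD[OF flat b u rel] .
  then obtain r :: nat and d s where **: "(\<forall>j<r. d j \<in> carrier E) \<and> (\<forall>j<r. \<forall>i<m + k. s j i \<in> carrier A) \<and>
       (\<forall>j<r. \<forall>l<length ys. (\<Oplus>\<^bsub>A\<^esub>i\<in>{..<m + k}. s j i \<otimes>\<^bsub>A\<^esub> u i l) = \<zero>\<^bsub>A\<^esub>) \<and>
       (\<forall>i<m + k. b i = (\<Oplus>\<^bsub>E\<^esub>j\<in>{..<r}. s j i \<odot>\<^bsub>E\<^esub> d j))" by (elim exE) rule
  then have d: "\<And>j. j < r \<Longrightarrow> d j \<in> carrier E" and s: "\<And>j i. j < r \<Longrightarrow> i < m + k \<Longrightarrow> s j i \<in> carrier A"
    and srel: "\<And>j l. j < r \<Longrightarrow> l < length ys \<Longrightarrow> (\<Oplus>\<^bsub>A\<^esub>i\<in>{..<m + k}. s j i \<otimes>\<^bsub>A\<^esub> u i l) = \<zero>\<^bsub>A\<^esub>"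
    and bd: "\<And>i. i < m + k \<Longrightarrow> b i = (\<Oplus>\<^bsub>E\<^esub>j\<in>{..<r}. s j i \<odot>\<^bsub>E\<^esub> d j)" by simp_all
  have final: "(\<Oplus>\<^bsub>N\<^esub>i\<in>{..<m}. s j i \<odot>\<^bsub>N\<^esub> y i) = \<zero>\<^bsub>N\<^esub>" if j: "j < r" for j
  proof -
    have S: "(\<Oplus>\<^bsub>A\<^esub>i\<in>{..<m}. s j i \<otimes>\<^bsub>A\<^esub> ?\<delta> i t) = (\<Oplus>\<^bsub>A\<^esub>q\<in>{..<k}. s j (m + q) \<otimes>\<^bsub>A\<^esub> v q t)" (is "?a = ?b") if "t \<in> Y" for t
    proof -
      obtain l where l: "l < length ys" "ys ! l = t" using \<open>t \<in> Y\<close> ys by (metis in_set_conv_nth)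
      have ac: "?a \<in> carrier A" "?b \<in> carrier A" using s[OF j] v(1) \<open>t \<in> Y\<close> by (auto intro!: E.A.finsum_closed)
      have "\<zero>\<^bsub>A\<^esub> = (\<Oplus>\<^bsub>A\<^esub>i\<in>{..<m}. s j i \<otimes>\<^bsub>A\<^esub> u i l) \<oplus>\<^bsub>A\<^esub> (\<Oplus>\<^bsub>A\<^esub>q\<in>{..<k}. s j (m + q) \<otimes>\<^bsub>A\<^esub> u (m + q) l)"
        using srel[OF j l(1)] s[OF j] u l by (subst (asm) E.A.finsum_lessThan_add) auto
      also have "(\<Oplus>\<^bsub>A\<^esub>i\<in>{..<m}. s j i \<otimes>\<^bsub>A\<^esub> u i l) = ?a"
        using s[OF j] l by (intro E.A.finsum_cong') (auto simp: u_def)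
      also have "(\<Oplus>\<^bsub>A\<^esub>q\<in>{..<k}. s j (m + q) \<otimes>\<^bsub>A\<^esub> u (m + q) l) = (\<Oplus>\<^bsub>A\<^esub>q\<in>{..<k}. \<ominus>\<^bsub>A\<^esub> (s j (m + q) \<otimes>\<^bsub>A\<^esub> v q t))"
        using s[OF j] l v(1) \<open>t \<in> Y\<close> by (intro E.A.finsum_cong') (auto simp: u_def E.A.r_minus)
      also have "\<dots> = \<ominus>\<^bsub>A\<^esub> ?b" using s[OF j] v(1) \<open>t \<in> Y\<close> by (intro E.A.finsum_minus) auto
      finally show ?thesis using ac E.A.diff_eq_zero[of ?a ?b] by (simp add: a_minus_def)
    qed
    have cl: "s j (m + q) \<odot>\<^bsub>N\<^esub> (v q t \<odot>\<^bsub>N\<^esub> t) \<in> carrier N" if "q < k" "t \<in> Y" for q t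
      using s[OF j, of "m + q"] v(1)[OF that] Y(3) that by (intro N.smult_closed) auto
    have "(\<Oplus>\<^bsub>N\<^esub>i\<in>{..<m}. s j i \<odot>\<^bsub>N\<^esub> y i) = (\<Oplus>\<^bsub>N\<^esub>i\<in>{..<m}. \<Oplus>\<^bsub>N\<^esub>t\<in>Y. (s j i \<otimes>\<^bsub>A\<^esub> ?\<delta> i t) \<odot>\<^bsub>N\<^esub> t)"
    proof (intro N.M.finsum_cong')
      fix i assume i: "i \<in> {..<m}"
      have "(\<Oplus>\<^bsub>N\<^esub>t\<in>Y. (s j i \<otimes>\<^bsub>A\<^esub> ?\<delta> i t) \<odot>\<^bsub>N\<^esub> t) = (\<Oplus>\<^bsub>N\<^esub>t\<in>Y. (if t = y i then s j i else \<zero>\<^bsub>A\<^esub>) \<odot>\<^bsub>N\<^esub> t)"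
        using s[OF j] i Y by (intro N.M.finsum_cong') (auto simp: N.smult_closed subset_iff)
      also have "\<dots> = s j i \<odot>\<^bsub>N\<^esub> y i" using s[OF j] i Y by (intro N.finsum_delta_smult) auto
      finally show "s j i \<odot>\<^bsub>N\<^esub> y i = (\<Oplus>\<^bsub>N\<^esub>t\<in>Y. (s j i \<otimes>\<^bsub>A\<^esub> ?\<delta> i t) \<odot>\<^bsub>N\<^esub> t)" by simp
    qed (use s[OF j] Y in \<open>auto intro!: N.M.finsum_closed N.smult_closed\<close>)
    also have "\<dots> = (\<Oplus>\<^bsub>N\<^esub>t\<in>Y. \<Oplus>\<^bsub>N\<^esub>i\<in>{..<m}. (s j i \<otimes>\<^bsub>A\<^esub> ?\<delta> i t) \<odot>\<^bsub>N\<^esub> t)"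
      using s[OF j] Y by (intro N.M.finsum_exchange) (auto intro!: N.smult_closed)
    also have "\<dots> = (\<Oplus>\<^bsub>N\<^esub>t\<in>Y. \<Oplus>\<^bsub>N\<^esub>q\<in>{..<k}. s j (m + q) \<odot>\<^bsub>N\<^esub> (v q t \<odot>\<^bsub>N\<^esub> t))"
    proof (rule N.M.finsum_cong'[OF refl])
      fix t assume t: "t \<in> Y"
      then have tN: "t \<in> carrier N" using Y by blast
      have "(\<Oplus>\<^bsub>N\<^esub>i\<in>{..<m}. (s j i \<otimes>\<^bsub>A\<^esub> ?\<delta> i t) \<odot>\<^bsub>N\<^esub> t) = (\<Oplus>\<^bsub>A\<^esub>i\<in>{..<m}. s j i \<otimes>\<^bsub>A\<^esub> ?\<delta> i t) \<odot>\<^bsub>N\<^esub> t"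
        using s[OF j] tN by (intro N.finsum_smult_left[symmetric]) auto
      also have "\<dots> = (\<Oplus>\<^bsub>N\<^esub>q\<in>{..<k}. (s j (m + q) \<otimes>\<^bsub>A\<^esub> v q t) \<odot>\<^bsub>N\<^esub> t)"
        unfolding S[OF t] using s[OF j] tN v(1) t by (intro N.finsum_smult_left) auto
      also have "\<dots> = (\<Oplus>\<^bsub>N\<^esub>q\<in>{..<k}. s j (m + q) \<odot>\<^bsub>N\<^esub> (v q t \<odot>\<^bsub>N\<^esub> t))"
        using s[OF j] tN v(1) t by (intro N.M.finsum_cong') (auto simp: N.smult_assoc intro!: N.smult_closed)
      finally show "(\<Oplus>\<^bsub>N\<^esub>i\<in>{..<m}. (s j i \<otimes>\<^bsub>A\<^esub> ?\<delta> i t) \<odot>\<^bsub>N\<^esub> t) = (\<Oplus>\<^bsub>N\<^esub>q\<in>{..<k}. s j (m + q) \<odot>\<^bsub>N\<^esub> (v q t \<odot>\<^bsub>N\<^esub> t))" .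
    qed (use cl in \<open>auto intro!: N.M.finsum_closed\<close>)
    also have "\<dots> = (\<Oplus>\<^bsub>N\<^esub>q\<in>{..<k}. \<Oplus>\<^bsub>N\<^esub>t\<in>Y. s j (m + q) \<odot>\<^bsub>N\<^esub> (v q t \<odot>\<^bsub>N\<^esub> t))"
      using cl Y by (intro N.M.finsum_exchange) auto
    also have "\<dots> = (\<Oplus>\<^bsub>N\<^esub>q\<in>{..<k}. \<zero>\<^bsub>N\<^esub>)"
    proof (rule N.M.finsum_cong'[OF refl])
      fix q assume q: "q \<in> {..<k}"
      have "(\<Oplus>\<^bsub>N\<^esub>t\<in>Y. s j (m + q) \<odot>\<^bsub>N\<^esub> (v q t \<odot>\<^bsub>N\<^esub> t)) = s j (m + q) \<odot>\<^bsub>N\<^esub> (\<Oplus>\<^bsub>N\<^esub>t\<in>Y. v q t \<odot>\<^bsub>N\<^esub> t)"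
        using s[OF j] Y v(1) q N.smult_closed by (intro N.finsum_smult_right[symmetric]) (auto simp: subset_iff)
      then show "(\<Oplus>\<^bsub>N\<^esub>t\<in>Y. s j (m + q) \<odot>\<^bsub>N\<^esub> (v q t \<odot>\<^bsub>N\<^esub> t)) = \<zero>\<^bsub>N\<^esub>"
        using v(2) q s[OF j] N.smult_zero_right by simp
    qed simp
    also have "\<dots> = \<zero>\<^bsub>N\<^esub>" by simp
    finally show ?thesis .
  qed
  have "e i = (\<Oplus>\<^bsub>E\<^esub>j\<in>{..<r}. s j i \<odot>\<^bsub>E\<^esub> d j)" if "i < m" for i using bd[of i] that by (simp add: b_def)
  then show ?thesis using d s final by (intro exI[of _ r] exI[of _ d] exI[of _ s]) auto
qed

section \<open>Faithful flatness from equations\<close>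

lemma linear_map_facts:
  assumes "f \<in> linear_maps A M N"
  shows "x \<in> carrier M \<Longrightarrow> f x \<in> carrier N" "x \<in> carrier M \<Longrightarrow> y \<in> carrier M \<Longrightarrow> f (x \<oplus>\<^bsub>M\<^esub> y) = f x \<oplus>\<^bsub>N\<^esub> f y"
    "a \<in> carrier A \<Longrightarrow> x \<in> carrier M \<Longrightarrow> f (a \<odot>\<^bsub>M\<^esub> x) = a \<odot>\<^bsub>N\<^esub> f x"
  using assms by (auto simp: linear_maps_def)

lemma linear_map_comb:
  assumes "left_module A M" "left_module A N" and f: "f \<in> linear_maps A M N" and "finite S"
    and "\<And>i. i \<in> S \<Longrightarrow> s i \<in> carrier A" "\<And>i. i \<in> S \<Longrightarrow> x i \<in> carrier M"
  shows "f (\<Oplus>\<^bsub>M\<^esub>i\<in>S. s i \<odot>\<^bsub>M\<^esub> x i) = (\<Oplus>\<^bsub>N\<^esub>i\<in>S. s i \<odot>\<^bsub>N\<^esub> f (x i))"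
proof -
  interpret M: left_module A M by fact
  interpret N: left_module A N by fact
  have "f (\<Oplus>\<^bsub>M\<^esub>i\<in>S. s i \<odot>\<^bsub>M\<^esub> x i) = (\<Oplus>\<^bsub>N\<^esub>i\<in>S. f (s i \<odot>\<^bsub>M\<^esub> x i))"
    using assms(4-6) linear_map_facts[OF f] M.M.abelian_group_axioms N.M.abelian_group_axioms
    by (intro additive_map_finsum) (auto simp: M.smult_closed)
  also have "\<dots> = (\<Oplus>\<^bsub>N\<^esub>i\<in>S. s i \<odot>\<^bsub>N\<^esub> f (x i))"
    using assms(4-6) linear_map_facts[OF f] by (intro N.M.finsum_cong') (auto simp: N.smult_closed)
  finally show ?thesis .
qed

lemma id_linear: "id \<in> linear_maps A E E"
  by (simp add: linear_maps_def)

text \<open>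
  For flatness, the equations from \<open>vanishing_tensors\<close> move an element of the kernel of \<open>E \<otimes> g\<close> to a
  sum of \<open>d j \<otimes> w j\<close> with \<open>g (w j) = 0\<close>. For faithfulness, take \<open>n\<close> with \<open>g n = 0\<close>. If \<open>e0 \<otimes> n\<close>
  comes from \<open>E \<otimes> N'\<close>, the same equations express \<open>e0\<close> through the left ideal of all \<open>a\<close> with \<open>a n\<close>
  in the image of \<open>f\<close>, so that this ideal contains \<open>1\<close>.
\<close>

theorem faithfully_flat_rightI:
  assumes E: "right_module A E" and flat: "equationally_flat A E" and faithful: "faithful_at A E e0"
  shows "faithfully_flat_right TYPE('n) A E"
  unfolding faithfully_flat_right_def
proof (intro conjI allI impI E)
  fix N' N N'' :: "('a, 'n) module" and f g
  assume "left_module A N' \<and> left_module A N \<and> left_module A N'' \<and> f \<in> linear_maps A N' N \<and> g \<in> linear_maps A N N''"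
  then have N: "left_module A N'" "left_module A N" "left_module A N''"
    and f: "f \<in> linear_maps A N' N" and g: "g \<in> linear_maps A N N''" by auto
  interpret E: right_module A E by fact
  interpret N': left_module A N' by (rule N)
  interpret N: left_module A N by (rule N)
  interpret N'': left_module A N'' by (rule N)
  interpret T': tensor_pair A E N' by (intro tensor_pair.intro E.one_sided_module_axioms N'.one_sided_module_axioms)
  interpret T: tensor_pair A E N by (intro tensor_pair.intro E.one_sided_module_axioms N.one_sided_module_axioms)
  interpret T'': tensor_pair A E N'' by (intro tensor_pair.intro E.one_sided_module_axioms N''.one_sided_module_axioms)
  note fl = linear_map_facts[OF f] and gl = linear_map_facts[OF g]
  have e0: "e0 \<in> carrier E" using faithful by (simp add: faithful_at_def)
  have ideal: "\<one>\<^bsub>A\<^esub> \<in> I" if "I \<subseteq> carrier A" "\<zero>\<^bsub>A\<^esub> \<in> I" "\<And>u v. u \<in> I \<Longrightarrow> v \<in> I \<Longrightarrow> u \<oplus>\<^bsub>A\<^esub> v \<in> I"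
      "\<And>r v. r \<in> carrier A \<Longrightarrow> v \<in> I \<Longrightarrow> r \<otimes>\<^bsub>A\<^esub> v \<in> I" "\<And>j. j < k \<Longrightarrow> c j \<in> carrier E" "\<And>j. j < k \<Longrightarrow> a j \<in> I"
      "e0 = (\<Oplus>\<^bsub>E\<^esub>j\<in>{..<k}. a j \<odot>\<^bsub>E\<^esub> c j)" for I and k :: nat and c a
    using faithful_atD[OF faithful that] .
  let ?R1 = "\<forall>z\<in>carrier (free_on_pairs E N'). pair_map id g (pair_map id f z) \<in> tensor_null A E N''"
  let ?R2 = "\<forall>z\<in>carrier (free_on_pairs E N). pair_map id g z \<in> tensor_null A E N'' \<longrightarrow>
       (\<exists>z'\<in>carrier (free_on_pairs E N'). z - pair_map id f z' \<in> tensor_null A E N)"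
  have ex: "exact_at (add_monoid N') (add_monoid N) (add_monoid N'') f g \<longleftrightarrow> f ` carrier N' = {n \<in> carrier N. g n = \<zero>\<^bsub>N''\<^esub>}"
    by (simp add: exact_at_def kernel_def)
  have "?R1 \<and> ?R2" if exact: "f ` carrier N' = {n \<in> carrier N. g n = \<zero>\<^bsub>N''\<^esub>}"
  proof (intro conjI ballI impI)
    fix z assume "z \<in> carrier (free_on_pairs E N')"
    then have "Poly_Mapping.keys z \<subseteq> carrier E \<times> carrier N'" by simp
    then show "pair_map id g (pair_map id f z) \<in> tensor_null A E N''"
    proof (induction z rule: frag_induction)
      case (one p)
      obtain x y where p: "p = (x, y)" "x \<in> carrier E" "y \<in> carrier N'" using one by blast
      have "g (f y) = \<zero>\<^bsub>N''\<^esub>" using exact p(3) by blast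
      then show ?case using p T''.tn_zero_right by simp
    qed (auto simp: T''.tn_zero T''.tn_diff)
  next
    fix z assume z: "z \<in> carrier (free_on_pairs E N)" and gz: "pair_map id g z \<in> tensor_null A E N''"
    obtain m :: nat and e n where en: "\<And>i. i < m \<Longrightarrow> e i \<in> carrier E" "\<And>i. i < m \<Longrightarrow> n i \<in> carrier N"
      and zn: "z - (\<Sum>i<m. frag_of (e i, n i)) \<in> tensor_null A E N" using T.tensor_representative[OF z] by blast
    have "pair_map id g (z - (\<Sum>i<m. frag_of (e i, n i))) \<in> tensor_null A E N''"
      by (rule pair_map_null[OF T.tensor_pair_axioms T''.tensor_pair_axioms id_linear g zn])
    from T''.tn_diff[OF gz this] have nl: "(\<Sum>i<m. frag_of (e i, g (n i))) \<in> tensor_null A E N''"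
      by (simp add: pair_map_sum)
    have gn: "\<And>i. i < m \<Longrightarrow> g (n i) \<in> carrier N''" using en(2) gl(1) by blast
    have "\<exists>(r::nat) d s. (\<forall>j<r. d j \<in> carrier E) \<and> (\<forall>j<r. \<forall>i<m. s j i \<in> carrier A) \<and>
      (\<forall>i<m. e i = (\<Oplus>\<^bsub>E\<^esub>j\<in>{..<r}. s j i \<odot>\<^bsub>E\<^esub> d j)) \<and>
      (\<forall>j<r. (\<Oplus>\<^bsub>N''\<^esub>i\<in>{..<m}. s j i \<odot>\<^bsub>N''\<^esub> g (n i)) = \<zero>\<^bsub>N''\<^esub>)"
      using N(3) en(1) gn nl
      by (rule vanishing_tensors[OF E flat])
    then obtain r :: nat and d s where "(\<forall>j<r. d j \<in> carrier E) \<and> (\<forall>j<r. \<forall>i<m. s j i \<in> carrier A) \<and>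
      (\<forall>i<m. e i = (\<Oplus>\<^bsub>E\<^esub>j\<in>{..<r}. s j i \<odot>\<^bsub>E\<^esub> d j)) \<and>
      (\<forall>j<r. (\<Oplus>\<^bsub>N''\<^esub>i\<in>{..<m}. s j i \<odot>\<^bsub>N''\<^esub> g (n i)) = \<zero>\<^bsub>N''\<^esub>)" by (elim exE) rule
    then have d: "\<And>j. j < r \<Longrightarrow> d j \<in> carrier E" and s: "\<And>j i. j < r \<Longrightarrow> i < m \<Longrightarrow> s j i \<in> carrier A"
      and ed: "\<And>i. i < m \<Longrightarrow> e i = (\<Oplus>\<^bsub>E\<^esub>j\<in>{..<r}. s j i \<odot>\<^bsub>E\<^esub> d j)"
      and rel: "\<And>j. j < r \<Longrightarrow> (\<Oplus>\<^bsub>N''\<^esub>i\<in>{..<m}. s j i \<odot>\<^bsub>N''\<^esub> g (n i)) = \<zero>\<^bsub>N''\<^esub>" by simp_all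
    define w where "w j = (\<Oplus>\<^bsub>N\<^esub>i\<in>{..<m}. s j i \<odot>\<^bsub>N\<^esub> n i)" for j
    have wN: "w j \<in> carrier N" if "j < r" for j unfolding w_def using s en that by (auto intro!: N.M.finsum_closed N.smult_closed)
    have "\<exists>x\<in>carrier N'. f x = w j" if "j < r" for j
    proof -
      have "g (w j) = \<zero>\<^bsub>N''\<^esub>" unfolding w_def using linear_map_comb[OF N(2,3) g, of "{..<m}" "s j" n] s en rel that by simp
      then have "w j \<in> f ` carrier N'" using exact wN[OF that] by simp
      then show ?thesis by auto
    qed
    then obtain x where x: "\<And>j. j < r \<Longrightarrow> x j \<in> carrier N'" "\<And>j. j < r \<Longrightarrow> f (x j) = w j" by metis
    have 1: "frag_of (e i, n i) - (\<Sum>j<r. frag_of (d j, s j i \<odot>\<^bsub>N\<^esub> n i)) \<in> tensor_null A E N" if i: "i < m" for i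
    proof -
      have "frag_of (e i, n i) - (\<Sum>j<r. frag_of (s j i \<odot>\<^bsub>E\<^esub> d j, n i)) \<in> tensor_null A E N"
        unfolding ed[OF i] using d s i en by (intro T.tn_finsum_left) (auto intro!: E.smult_closed)
      moreover have "(\<Sum>j<r. frag_of (s j i \<odot>\<^bsub>E\<^esub> d j, n i) - frag_of (d j, s j i \<odot>\<^bsub>N\<^esub> n i)) \<in> tensor_null A E N"
        using d s i en by (intro T.tn_sum T.tn_balanced) auto
      ultimately have "(frag_of (e i, n i) - (\<Sum>j<r. frag_of (s j i \<odot>\<^bsub>E\<^esub> d j, n i))) +
         (\<Sum>j<r. frag_of (s j i \<odot>\<^bsub>E\<^esub> d j, n i) - frag_of (d j, s j i \<odot>\<^bsub>N\<^esub> n i)) \<in> tensor_null A E N" by (rule T.tn_add)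
      then show ?thesis by (simp add: sum_subtractf)
    qed
    have 2: "frag_of (d j, w j) - (\<Sum>i<m. frag_of (d j, s j i \<odot>\<^bsub>N\<^esub> n i)) \<in> tensor_null A E N" if "j < r" for j
      unfolding w_def using d s en that by (intro T.tn_finsum_right) (auto intro!: N.smult_closed)
    let ?z' = "\<Sum>j<r. frag_of (d j, x j)"
    have "(\<Sum>i<m. frag_of (e i, n i) - (\<Sum>j<r. frag_of (d j, s j i \<odot>\<^bsub>N\<^esub> n i))) \<in> tensor_null A E N"
      using 1 by (intro T.tn_sum) simp
    moreover have "(\<Sum>j<r. frag_of (d j, w j) - (\<Sum>i<m. frag_of (d j, s j i \<odot>\<^bsub>N\<^esub> n i))) \<in> tensor_null A E N"
      using 2 by (intro T.tn_sum) simp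
    ultimately have "(\<Sum>i<m. frag_of (e i, n i) - (\<Sum>j<r. frag_of (d j, s j i \<odot>\<^bsub>N\<^esub> n i))) -
      (\<Sum>j<r. frag_of (d j, w j) - (\<Sum>i<m. frag_of (d j, s j i \<odot>\<^bsub>N\<^esub> n i))) \<in> tensor_null A E N" by (rule T.tn_diff)
    moreover have "(\<Sum>i<m. \<Sum>j<r. frag_of (d j, s j i \<odot>\<^bsub>N\<^esub> n i)) = (\<Sum>j<r. \<Sum>i<m. frag_of (d j, s j i \<odot>\<^bsub>N\<^esub> n i))"
      by (rule sum.swap)
    ultimately have "(\<Sum>i<m. frag_of (e i, n i)) - (\<Sum>j<r. frag_of (d j, w j)) \<in> tensor_null A E N"
      by (simp add: sum_subtractf)
    from T.tn_add[OF zn this] have "z - (\<Sum>j<r. frag_of (d j, w j)) \<in> tensor_null A E N" by simp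
    moreover have "pair_map id f ?z' = (\<Sum>j<r. frag_of (d j, w j))" using x(2) by (simp add: pair_map_sum)
    moreover have "?z' \<in> carrier (free_on_pairs E N')" using d x(1) by (intro sum_closed_free_Abelian_group) simp
    ultimately show "\<exists>z'\<in>carrier (free_on_pairs E N'). z - pair_map id f z' \<in> tensor_null A E N" by metis
  qed
  moreover have "f ` carrier N' = {n \<in> carrier N. g n = \<zero>\<^bsub>N''\<^esub>}" if R: "?R1 \<and> ?R2"
  proof (intro equalityI subsetI)
    fix n assume "n \<in> f ` carrier N'"
    then obtain x where x: "x \<in> carrier N'" "n = f x" by blast
    have gn: "g n \<in> carrier N''" using x fl gl by simp
    have "frag_of (e0, x) \<in> carrier (free_on_pairs E N')" using e0 x by simp
    then have nl: "(\<Sum>i<(1::nat). frag_of (e0, g n)) \<in> tensor_null A E N''" using R x by fastforce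
    have "\<exists>(r::nat) d s. (\<forall>j<r. d j \<in> carrier E) \<and> (\<forall>j<r. \<forall>i<(1::nat). s j i \<in> carrier A) \<and>
      (\<forall>i<(1::nat). e0 = (\<Oplus>\<^bsub>E\<^esub>j\<in>{..<r}. s j i \<odot>\<^bsub>E\<^esub> d j)) \<and>
      (\<forall>j<r. (\<Oplus>\<^bsub>N''\<^esub>i\<in>{..<(1::nat)}. s j i \<odot>\<^bsub>N''\<^esub> g n) = \<zero>\<^bsub>N''\<^esub>)"
      using N(3) e0 gn nl
      by (rule vanishing_tensors[OF E flat])
    then obtain r :: nat and d s where "(\<forall>j<r. d j \<in> carrier E) \<and> (\<forall>j<r. \<forall>i<(1::nat). s j i \<in> carrier A) \<and>
      (\<forall>i<(1::nat). e0 = (\<Oplus>\<^bsub>E\<^esub>j\<in>{..<r}. s j i \<odot>\<^bsub>E\<^esub> d j)) \<and>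
      (\<forall>j<r. (\<Oplus>\<^bsub>N''\<^esub>i\<in>{..<(1::nat)}. s j i \<odot>\<^bsub>N''\<^esub> g n) = \<zero>\<^bsub>N''\<^esub>)" by (elim exE) rule
    then have d: "\<And>j. j < r \<Longrightarrow> d j \<in> carrier E" and s: "\<And>j i. j < r \<Longrightarrow> i < (1::nat) \<Longrightarrow> s j i \<in> carrier A"
      and ed: "\<And>i. i < (1::nat) \<Longrightarrow> e0 = (\<Oplus>\<^bsub>E\<^esub>j\<in>{..<r}. s j i \<odot>\<^bsub>E\<^esub> d j)"
      and rel: "\<And>j. j < r \<Longrightarrow> (\<Oplus>\<^bsub>N''\<^esub>i\<in>{..<(1::nat)}. s j i \<odot>\<^bsub>N''\<^esub> g n) = \<zero>\<^bsub>N''\<^esub>" by simp_all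
    have rel0: "s j 0 \<odot>\<^bsub>N''\<^esub> g n = \<zero>\<^bsub>N''\<^esub>" if "j < r" for j
      using rel[OF that] N''.M.finsum_lessThan_Suc[of 0 "\<lambda>i. s j i \<odot>\<^bsub>N''\<^esub> g n"] s[OF that, of 0] gn by (simp add: N''.smult_closed)
    have "\<one>\<^bsub>A\<^esub> \<in> {a \<in> carrier A. a \<odot>\<^bsub>N''\<^esub> g n = \<zero>\<^bsub>N''\<^esub>}"
      by (rule ideal[of _ r d "\<lambda>j. s j 0"])
        (use d s rel0 ed[of 0] gn in \<open>auto simp: N''.smult_zero_left N''.smult_zero_right N''.smult_add_scalar N''.smult_assoc\<close>)
    then show "n \<in> {n \<in> carrier N. g n = \<zero>\<^bsub>N''\<^esub>}" using gn x fl(1) by (simp add: N''.smult_one)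
  next
    fix n assume "n \<in> {n \<in> carrier N. g n = \<zero>\<^bsub>N''\<^esub>}"
    then have n: "n \<in> carrier N" "g n = \<zero>\<^bsub>N''\<^esub>" by auto
    have "frag_of (e0, n) \<in> carrier (free_on_pairs E N)" "pair_map id g (frag_of (e0, n)) \<in> tensor_null A E N''"
      using e0 n T''.tn_zero_right by auto
    then obtain z' where z': "z' \<in> carrier (free_on_pairs E N')" "frag_of (e0, n) - pair_map id f z' \<in> tensor_null A E N"
      using R by blast
    from z'(1) have "- z' \<in> carrier (free_on_pairs E N')" by simp
    from T'.tensor_representative[OF this] obtain m :: nat and e x where
      ex: "\<And>i. i < m \<Longrightarrow> e i \<in> carrier E" "\<And>i. i < m \<Longrightarrow> x i \<in> carrier N'"
      and zn: "- z' - (\<Sum>i<m. frag_of (e i, x i)) \<in> tensor_null A E N'" by blast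
    have "pair_map id f (- z' - (\<Sum>i<m. frag_of (e i, x i))) \<in> tensor_null A E N"
      by (rule pair_map_null[OF T'.tensor_pair_axioms T.tensor_pair_axioms id_linear f zn])
    from T.tn_diff[OF z'(2) this] have "frag_of (e0, n) + (\<Sum>i<m. frag_of (e i, f (x i))) \<in> tensor_null A E N"
      by (simp add: pair_map_sum)
    \<comment> \<open>\<open>e0 \<otimes> n\<close> as the last term of a vanishing tensor whose other terms come from \<open>N'\<close>\<close>
    moreover define e' where "e' i = (if i < m then e i else e0)" for i
    moreover define y where "y i = (if i < m then f (x i) else n)" for i
    ultimately have nl: "(\<Sum>i<Suc m. frag_of (e' i, y i)) \<in> tensor_null A E N" by (simp add: add.commute)
    have ec: "\<And>i. i < Suc m \<Longrightarrow> e' i \<in> carrier E" and yc: "\<And>i. i < Suc m \<Longrightarrow> y i \<in> carrier N"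
      using e0 n ex fl(1) by (auto simp: e'_def y_def)
    have "\<exists>(r::nat) d s. (\<forall>j<r. d j \<in> carrier E) \<and> (\<forall>j<r. \<forall>i<Suc m. s j i \<in> carrier A) \<and>
      (\<forall>i<Suc m. e' i = (\<Oplus>\<^bsub>E\<^esub>j\<in>{..<r}. s j i \<odot>\<^bsub>E\<^esub> d j)) \<and>
      (\<forall>j<r. (\<Oplus>\<^bsub>N\<^esub>i\<in>{..<Suc m}. s j i \<odot>\<^bsub>N\<^esub> y i) = \<zero>\<^bsub>N\<^esub>)"
      using N(2) ec yc nl
      by (rule vanishing_tensors[OF E flat])
    then obtain r :: nat and d s where "(\<forall>j<r. d j \<in> carrier E) \<and> (\<forall>j<r. \<forall>i<Suc m. s j i \<in> carrier A) \<and>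
      (\<forall>i<Suc m. e' i = (\<Oplus>\<^bsub>E\<^esub>j\<in>{..<r}. s j i \<odot>\<^bsub>E\<^esub> d j)) \<and>
      (\<forall>j<r. (\<Oplus>\<^bsub>N\<^esub>i\<in>{..<Suc m}. s j i \<odot>\<^bsub>N\<^esub> y i) = \<zero>\<^bsub>N\<^esub>)" by (elim exE) rule
    then have d: "\<And>j. j < r \<Longrightarrow> d j \<in> carrier E" and s: "\<And>j i. j < r \<Longrightarrow> i < Suc m \<Longrightarrow> s j i \<in> carrier A"
      and ed: "\<And>i. i < Suc m \<Longrightarrow> e' i = (\<Oplus>\<^bsub>E\<^esub>j\<in>{..<r}. s j i \<odot>\<^bsub>E\<^esub> d j)"
      and rel: "\<And>j. j < r \<Longrightarrow> (\<Oplus>\<^bsub>N\<^esub>i\<in>{..<Suc m}. s j i \<odot>\<^bsub>N\<^esub> y i) = \<zero>\<^bsub>N\<^esub>" by simp_all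
    \<comment> \<open>a left ideal that contains the coefficient of \<open>n\<close> in each of the relations\<close>
    define I where "I = {a \<in> carrier A. a \<odot>\<^bsub>N\<^esub> n \<in> f ` carrier N'}"
    have sI: "s j m \<in> I" if j: "j < r" for j
    proof -
      have yc: "y i \<in> carrier N" for i using n ex fl(1) by (simp add: y_def)
      let ?w = "\<Oplus>\<^bsub>N'\<^esub>i\<in>{..<m}. s j i \<odot>\<^bsub>N'\<^esub> x i"
      have w: "?w \<in> carrier N'" using s[OF j] ex by (auto intro!: N'.M.finsum_closed N'.smult_closed)
      have "(\<Oplus>\<^bsub>N\<^esub>i\<in>{..<m}. s j i \<odot>\<^bsub>N\<^esub> y i) = (\<Oplus>\<^bsub>N\<^esub>i\<in>{..<m}. s j i \<odot>\<^bsub>N\<^esub> f (x i))"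
        using s[OF j] ex fl(1) by (intro N.M.finsum_cong') (auto simp: y_def N.smult_closed)
      also have "\<dots> = f ?w" using s[OF j] ex by (intro linear_map_comb[OF N(1,2) f, symmetric]) auto
      finally have "s j m \<odot>\<^bsub>N\<^esub> n \<oplus>\<^bsub>N\<^esub> f ?w = \<zero>\<^bsub>N\<^esub>"
        using rel[OF j] N.M.finsum_lessThan_Suc[of m "\<lambda>i. s j i \<odot>\<^bsub>N\<^esub> y i"] s[OF j] yc by (simp add: N.smult_closed y_def)
      then have "s j m \<odot>\<^bsub>N\<^esub> n = \<ominus>\<^bsub>N\<^esub> f ?w"
        using s[OF j, of m] n fl(1)[OF w] by (intro N.M.minus_equality[symmetric]) (auto simp: N.smult_closed)
      also have "\<dots> = f (\<ominus>\<^bsub>N'\<^esub> ?w)"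
        using additive_map_facts(2)[OF N'.M.abelian_group_axioms N.M.abelian_group_axioms, of f] fl(1,2) w by auto
      finally show ?thesis using s[OF j, of m] w by (simp add: I_def)
    qed
    have "\<one>\<^bsub>A\<^esub> \<in> I"
    proof (rule ideal[of I r d "\<lambda>j. s j m"])
      have "f \<zero>\<^bsub>N'\<^esub> = \<zero>\<^bsub>N\<^esub>"
        using additive_map_facts(1)[OF N'.M.abelian_group_axioms N.M.abelian_group_axioms, of f] fl(1,2) by auto
      then show "\<zero>\<^bsub>A\<^esub> \<in> I" using n unfolding I_def by (simp add: N.smult_zero_left) (metis N'.M.zero_closed imageI)
    next
      fix u v assume "u \<in> I" "v \<in> I"
      then obtain a b where "u \<in> carrier A" "v \<in> carrier A" "a \<in> carrier N'" "b \<in> carrier N'" "u \<odot>\<^bsub>N\<^esub> n = f a" "v \<odot>\<^bsub>N\<^esub> n = f b"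
        unfolding I_def by auto
      then have "(u \<oplus>\<^bsub>A\<^esub> v) \<odot>\<^bsub>N\<^esub> n = f (a \<oplus>\<^bsub>N'\<^esub> b)" "u \<oplus>\<^bsub>A\<^esub> v \<in> carrier A" "a \<oplus>\<^bsub>N'\<^esub> b \<in> carrier N'"
        using n fl(2) by (auto simp: N.smult_add_scalar)
      then show "u \<oplus>\<^bsub>A\<^esub> v \<in> I" unfolding I_def by auto
    next
      fix q v assume q: "q \<in> carrier A" and "v \<in> I"
      then obtain a where "v \<in> carrier A" "a \<in> carrier N'" "v \<odot>\<^bsub>N\<^esub> n = f a" unfolding I_def by auto
      then have "(q \<otimes>\<^bsub>A\<^esub> v) \<odot>\<^bsub>N\<^esub> n = f (q \<odot>\<^bsub>N'\<^esub> a)" "q \<otimes>\<^bsub>A\<^esub> v \<in> carrier A" "q \<odot>\<^bsub>N'\<^esub> a \<in> carrier N'"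
        using n q fl(3) by (auto simp: N.smult_assoc N'.smult_closed)
      then show "q \<otimes>\<^bsub>A\<^esub> v \<in> I" unfolding I_def by auto
    next
      show "e0 = (\<Oplus>\<^bsub>E\<^esub>j\<in>{..<r}. s j m \<odot>\<^bsub>E\<^esub> d j)" using ed[of m] by (simp add: e'_def)
    qed (use d sI in \<open>auto simp: I_def\<close>)
    then show "n \<in> f ` carrier N'" using n unfolding I_def by (simp add: N.smult_one)
  qed
  ultimately show "exact_at (add_monoid N') (add_monoid N) (add_monoid N'') f g \<longleftrightarrow>
     exact_at (tensor_product A E N') (tensor_product A E N) (tensor_product A E N'')
           (tensor_map A E N id f) (tensor_map A E N'' id g)"
    unfolding ex tensor_exact_iff[OF T'.tensor_pair_axioms T.tensor_pair_axioms T''.tensor_pair_axioms id_linear f id_linear g]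
    by blast
qed

section \<open>Passage to the opposite ring\<close>

definition opposite :: "('a, 'y) ring_scheme \<Rightarrow> ('a, 'y) ring_scheme" where
  "opposite A = A\<lparr>monoid.mult := \<lambda>a b. b \<otimes>\<^bsub>A\<^esub> a\<rparr>"

lemma opposite_simps [simp]:
  "carrier (opposite A) = carrier A" "\<one>\<^bsub>opposite A\<^esub> = \<one>\<^bsub>A\<^esub>" "\<zero>\<^bsub>opposite A\<^esub> = \<zero>\<^bsub>A\<^esub>"
  "a \<oplus>\<^bsub>opposite A\<^esub> b = a \<oplus>\<^bsub>A\<^esub> b" "a \<otimes>\<^bsub>opposite A\<^esub> b = b \<otimes>\<^bsub>A\<^esub> a"
  by (simp_all add: opposite_def)

lemma opposite_a_inv [simp]: "a_inv (opposite A) = a_inv A"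
  by (simp add: a_inv_def m_inv_def fun_eq_iff)

lemma opposite_a_minus [simp]: "a \<ominus>\<^bsub>opposite A\<^esub> b = a \<ominus>\<^bsub>A\<^esub> b"
  by (simp add: a_minus_def)

lemma opposite_finsum [simp]: "finsum (opposite A) f S = finsum A f S"
  by (simp add: finsum_def finprod_def opposite_def)

lemma opposite_opposite [simp]: "opposite (opposite A) = A"
  by (simp add: opposite_def)

lemma ring_opposite: "ring A \<Longrightarrow> ring (opposite A)"
proof -
  assume "ring A"
  then interpret A: ring A .
  show ?thesis
  proof (rule ringI)
    show "abelian_group (opposite A)"
      by (rule abelian_groupI) (auto simp: A.a_ac intro: bexI[of _ "\<ominus>\<^bsub>A\<^esub> x" for x] A.l_neg)
    show "Group.monoid (opposite A)"
      by (rule monoidI) (auto simp: A.m_assoc)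
  qed (auto simp: A.l_distr A.r_distr)
qed

lemma one_sided_module_opposite: "one_sided_module A M \<Longrightarrow> one_sided_module (opposite A) M"
  by (simp add: one_sided_module_def one_sided_module_axioms_def ring_opposite)

lemma right_module_opposite: "right_module A M \<Longrightarrow> left_module (opposite A) M"
  by (simp add: right_module_def left_module_def one_sided_module_opposite right_module_axioms_def left_module_axioms_def)

lemma left_module_opposite: "left_module A M \<Longrightarrow> right_module (opposite A) M"
  by (simp add: right_module_def left_module_def one_sided_module_opposite right_module_axioms_def left_module_axioms_def)

lemma linear_maps_opposite: "linear_maps (opposite A) M N = linear_maps A M N"
  by (simp add: linear_maps_def)

definition swap_pairs :: "('m \<times> 'n \<Rightarrow>\<^sub>0 int) \<Rightarrow> ('n \<times> 'm \<Rightarrow>\<^sub>0 int)" where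
  "swap_pairs = frag_extend (\<lambda>(x, y). frag_of (y, x))"

lemma swap_pairs_simps [simp]:
  "swap_pairs 0 = 0" "swap_pairs (frag_of (x, y)) = frag_of (y, x)"
  "swap_pairs (a + b) = swap_pairs a + swap_pairs b" "swap_pairs (a - b) = swap_pairs a - swap_pairs b"
  "swap_pairs (- a) = - swap_pairs a"
  by (simp_all add: swap_pairs_def frag_extend_add frag_extend_diff frag_extend_minus)

lemma swap_swap [simp]: "swap_pairs (swap_pairs z) = z"
proof -
  have "Poly_Mapping.keys z \<subseteq> UNIV" by simp
  then show ?thesis by (induction z rule: frag_induction) auto
qed

lemma swap_pair_map: "swap_pairs (pair_map f g z) = pair_map g f (swap_pairs z)"
proof -
  have "Poly_Mapping.keys z \<subseteq> UNIV" by simp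
  then show ?thesis by (induction z rule: frag_induction) auto
qed

lemma swap_carrier: "z \<in> carrier (free_on_pairs M N) \<Longrightarrow> swap_pairs z \<in> carrier (free_on_pairs N M)"
proof -
  assume "z \<in> carrier (free_on_pairs M N)"
  moreover have "Poly_Mapping.keys (swap_pairs z) \<subseteq> (\<Union>p\<in>Poly_Mapping.keys z. Poly_Mapping.keys (case p of (x, y) \<Rightarrow> frag_of (y, x)))"
    unfolding swap_pairs_def by (rule keys_frag_extend)
  ultimately show ?thesis by (fastforce split: prod.splits)
qed

lemma swap_null_aux:
  assumes "tensor_pair A M N" "z \<in> tensor_null A M N"
  shows "swap_pairs z \<in> tensor_null (opposite A) N M"
proof -
  interpret S: tensor_pair A M N by fact
  interpret T: tensor_pair "opposite A" N M
    using S.M.one_sided_module_axioms S.N.one_sided_module_axioms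
    by (intro tensor_pair.intro one_sided_module_opposite)
  show ?thesis using assms(2)
  proof (induction rule: S.tensor_null_induct)
    case (left x x' y)
    then show ?case using T.tn_right[of y x x'] by simp
  next
    case (right x y y')
    then show ?case using T.tn_left[of y y' x] by simp
  next
    case (balanced a x y)
    then show ?case using T.tn_neg[OF T.tn_balanced[of a y x]] by simp
  qed (auto simp: T.tn_zero T.tn_add T.tn_neg)
qed

lemma swap_null:
  assumes "tensor_pair A M N"
  shows "swap_pairs z \<in> tensor_null (opposite A) N M \<longleftrightarrow> z \<in> tensor_null A M N"
proof
  assume z: "swap_pairs z \<in> tensor_null (opposite A) N M"
  have "tensor_pair (opposite A) N M"
    using assms by (simp add: tensor_pair_def one_sided_module_opposite)
  from swap_null_aux[OF this z] show "z \<in> tensor_null A M N" by simp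
qed (rule swap_null_aux[OF assms])

text \<open>
  Exchanging the factors identifies tensor products over a ring with those over its opposite.
\<close>

lemma tensor_exact_swap:
  fixes A :: "('a, 'y) ring_scheme" and E :: "('a, 'e) module"
    and N' :: "('a, 'n1) module" and N :: "('a, 'n2) module" and N'' :: "('a, 'n3) module"
  assumes tp: "tensor_pair A N' E" "tensor_pair A N E" "tensor_pair A N'' E"
    and f: "f \<in> linear_maps A N' N" and g: "g \<in> linear_maps A N N''"
  shows "exact_at (tensor_product A N' E) (tensor_product A N E) (tensor_product A N'' E)
           (tensor_map A N E f id) (tensor_map A N'' E g id) \<longleftrightarrow>
    exact_at (tensor_product (opposite A) E N') (tensor_product (opposite A) E N) (tensor_product (opposite A) E N'')
           (tensor_map (opposite A) E N id f) (tensor_map (opposite A) E N'' id g)" (is "?L \<longleftrightarrow> ?R")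
proof -
  have tp': "tensor_pair (opposite A) E N'" "tensor_pair (opposite A) E N" "tensor_pair (opposite A) E N''"
    using tp by (auto simp: tensor_pair_def one_sided_module_opposite)
  have L: "?L \<longleftrightarrow> (\<forall>z\<in>carrier (free_on_pairs N' E). pair_map g id (pair_map f id z) \<in> tensor_null A N'' E) \<and>
    (\<forall>z\<in>carrier (free_on_pairs N E). pair_map g id z \<in> tensor_null A N'' E \<longrightarrow>
       (\<exists>z'\<in>carrier (free_on_pairs N' E). z - pair_map f id z' \<in> tensor_null A N E))"
    by (rule tensor_exact_iff[OF tp f id_linear g id_linear])
  have R: "?R \<longleftrightarrow> (\<forall>z\<in>carrier (free_on_pairs E N'). pair_map id g (pair_map id f z) \<in> tensor_null (opposite A) E N'') \<and>
    (\<forall>z\<in>carrier (free_on_pairs E N). pair_map id g z \<in> tensor_null (opposite A) E N'' \<longrightarrow>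
       (\<exists>z'\<in>carrier (free_on_pairs E N'). z - pair_map id f z' \<in> tensor_null (opposite A) E N))"
    using f g by (intro tensor_exact_iff[OF tp']) (auto simp: linear_maps_opposite id_linear)
  have im: "carrier (free_on_pairs E M) = swap_pairs ` carrier (free_on_pairs M E)" for M :: "('a, 'p) module"
  proof (intro equalityI subsetI)
    fix z assume "z \<in> carrier (free_on_pairs E M)"
    from swap_carrier[OF this] show "z \<in> swap_pairs ` carrier (free_on_pairs M E)"
      by (rule rev_image_eqI) simp
  next
    fix z assume "z \<in> swap_pairs ` carrier (free_on_pairs M E)"
    then obtain w where "w \<in> carrier (free_on_pairs M E)" "z = swap_pairs w" by (rule imageE)
    then show "z \<in> carrier (free_on_pairs E M)" using swap_carrier[of w M E] by (simp only:)
  qed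
  have 1: "pair_map id h (swap_pairs z) = swap_pairs (pair_map h id z)" for h :: "'p \<Rightarrow> 'q" and z :: "'p \<times> 'e \<Rightarrow>\<^sub>0 int"
    by (simp add: swap_pair_map)
  have 2: "swap_pairs z - swap_pairs w = swap_pairs (z - w)" for z w :: "'p \<times> 'e \<Rightarrow>\<^sub>0 int" by simp
  show ?thesis unfolding L R im ball_simps bex_simps 1 2 swap_null[OF tp(2)] swap_null[OF tp(3)] ..
qed

theorem faithfully_flat_leftI:
  assumes E: "left_module A E" and flat: "equationally_flat (opposite A) E" and faithful: "faithful_at (opposite A) E e0"
  shows "faithfully_flat_left TYPE('n) A E"
  unfolding faithfully_flat_left_def
proof (intro conjI allI impI E)
  fix N' N N'' :: "('a, 'n) module" and f g
  assume *: "right_module A N' \<and> right_module A N \<and> right_module A N'' \<and> f \<in> linear_maps A N' N \<and> g \<in> linear_maps A N N''"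
  have ff: "faithfully_flat_right TYPE('n) (opposite A) E"
    by (rule faithfully_flat_rightI[OF left_module_opposite[OF E] flat faithful])
  have o: "one_sided_module A E" "one_sided_module A N'" "one_sided_module A N" "one_sided_module A N''"
    using E * by (auto simp: left_module_def right_module_def)
  have "exact_at (add_monoid N') (add_monoid N) (add_monoid N'') f g \<longleftrightarrow>
     exact_at (tensor_product (opposite A) E N') (tensor_product (opposite A) E N) (tensor_product (opposite A) E N'')
           (tensor_map (opposite A) E N id f) (tensor_map (opposite A) E N'' id g)"
    using ff * unfolding faithfully_flat_right_def by (simp add: right_module_opposite linear_maps_opposite)
  also have "\<dots> \<longleftrightarrow> exact_at (tensor_product A N' E) (tensor_product A N E) (tensor_product A N'' E)
           (tensor_map A N E f id) (tensor_map A N'' E g id)"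
    using * by (intro tensor_exact_swap[symmetric] tensor_pair.intro o) auto
  finally show "exact_at (add_monoid N') (add_monoid N) (add_monoid N'') f g \<longleftrightarrow>
     exact_at (tensor_product A N' E) (tensor_product A N E) (tensor_product A N'' E)
           (tensor_map A N E f id) (tensor_map A N'' E g id)" .
qed

section \<open>Faithful flatness of the envelope\<close>

lemma with_smult_simps [simp]:
  "carrier (with_smult B s) = carrier B" "\<zero>\<^bsub>with_smult B s\<^esub> = \<zero>\<^bsub>B\<^esub>" "\<one>\<^bsub>with_smult B s\<^esub> = \<one>\<^bsub>B\<^esub>"
  "a \<oplus>\<^bsub>with_smult B s\<^esub> b = a \<oplus>\<^bsub>B\<^esub> b" "a \<otimes>\<^bsub>with_smult B s\<^esub> b = a \<otimes>\<^bsub>B\<^esub> b" "c \<odot>\<^bsub>with_smult B s\<^esub> a = s c a"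
  by (simp_all add: with_smult_def)

lemma with_smult_finsum [simp]: "finsum (with_smult B s) f S = finsum B f S"
  by (simp add: finsum_def finprod_def with_smult_def)

lemma with_smult_abelian_group: "abelian_group B \<Longrightarrow> abelian_group (with_smult B s)"
proof -
  assume "abelian_group B"
  then interpret B: abelian_group B .
  show ?thesis
    by (rule abelian_groupI) (auto simp: B.a_ac intro: bexI[of _ "\<ominus>\<^bsub>B\<^esub> x" for x] B.l_neg)
qed

text \<open>
  The group structure of the module comes from a record \<open>C\<close> whose multiplication may differ from
  that of \<open>B\<close>: this serves the envelope as well as its opposite, with the same module.
\<close>

lemma (in completed_algebra) completion_flat:
  assumes "\<And>a b. a \<in> carrier A \<Longrightarrow> b \<in> carrier B \<Longrightarrow> s a b = b \<otimes>\<^bsub>B\<^esub> \<iota>\<^sub>B a"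
    and C: "carrier C = carrier B" "\<zero>\<^bsub>C\<^esub> = \<zero>\<^bsub>B\<^esub>" "\<And>f S. finsum C f (S :: nat set) = finsum B f S"
  shows "equationally_flat A (with_smult C s)"
proof -
  have conv: "(\<Oplus>\<^bsub>B\<^esub>i\<in>{..<m}. s (u i) (b i)) = (\<Oplus>\<^bsub>B\<^esub>i\<in>{..<m}. b i \<otimes>\<^bsub>B\<^esub> \<iota>\<^sub>B (u i))"
    if "\<And>i. i < m \<Longrightarrow> b i \<in> carrier B" "\<And>i. i < m \<Longrightarrow> u i \<in> carrier A" for m :: nat and b u
    using that assms(1) by (intro B.finsum_cong') (auto simp: cls_closed cauchy_const)
  show ?thesis
    unfolding equationally_flat_def with_smult_simps with_smult_finsum C
  proof (intro allI impI; elim conjE)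
    fix m p :: nat and b u
    assume b: "\<forall>i<m. b i \<in> carrier B" and u: "\<forall>i<m. \<forall>l<p. u i l \<in> carrier A"
      and rel: "\<forall>l<p. (\<Oplus>\<^bsub>B\<^esub>i\<in>{..<m}. s (u i l) (b i)) = \<zero>\<^bsub>B\<^esub>"
    have "\<exists>(k::nat) c v. (\<forall>j<k. c j \<in> carrier B) \<and> (\<forall>j<k. \<forall>i<m. v j i \<in> carrier A) \<and>
      (\<forall>j<k. \<forall>l<p. (\<Oplus>i\<in>{..<m}. v j i \<otimes> u i l) = \<zero>) \<and>
      (\<forall>i<m. b i = (\<Oplus>\<^bsub>B\<^esub>j\<in>{..<k}. c j \<otimes>\<^bsub>B\<^esub> \<iota>\<^sub>B (v j i)))"
    proof (rule equational_flatness)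
      fix l assume l: "l < p"
      show "(\<Oplus>\<^bsub>B\<^esub>i\<in>{..<m}. b i \<otimes>\<^bsub>B\<^esub> \<iota>\<^sub>B (u i l)) = \<zero>\<^bsub>B\<^esub>" using conv[of m b "\<lambda>i. u i l"] b u rel l by simp
    qed (use b u in auto)
    then obtain k :: nat and c v where *: "(\<forall>j<k. c j \<in> carrier B) \<and> (\<forall>j<k. \<forall>i<m. v j i \<in> carrier A) \<and>
      (\<forall>j<k. \<forall>l<p. (\<Oplus>i\<in>{..<m}. v j i \<otimes> u i l) = \<zero>) \<and>
      (\<forall>i<m. b i = (\<Oplus>\<^bsub>B\<^esub>j\<in>{..<k}. c j \<otimes>\<^bsub>B\<^esub> \<iota>\<^sub>B (v j i)))" by (elim exE) rule
    show "\<exists>(k::nat) c v. (\<forall>j<k. c j \<in> carrier B) \<and> (\<forall>j<k. \<forall>i<m. v j i \<in> carrier A) \<and>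
      (\<forall>j<k. \<forall>l<p. (\<Oplus>i\<in>{..<m}. v j i \<otimes> u i l) = \<zero>) \<and>
      (\<forall>i<m. b i = (\<Oplus>\<^bsub>B\<^esub>j\<in>{..<k}. s (v j i) (c j)))"
    proof (intro exI conjI)
      show "\<forall>i<m. b i = (\<Oplus>\<^bsub>B\<^esub>j\<in>{..<k}. s (v j i) (c j))"
      proof (intro allI impI)
        fix i assume i: "i < m"
        show "b i = (\<Oplus>\<^bsub>B\<^esub>j\<in>{..<k}. s (v j i) (c j))" using conv[of k c "\<lambda>j. v j i"] * i by simp
      qed
    qed (use * in blast)+
  qed
qed

lemma (in completed_algebra) completion_faithful:
  assumes "\<And>a b. a \<in> carrier A \<Longrightarrow> b \<in> carrier B \<Longrightarrow> s a b = b \<otimes>\<^bsub>B\<^esub> \<iota>\<^sub>B a"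
    and C: "carrier C = carrier B" "\<And>f S. finsum C f (S :: nat set) = finsum B f S"
  shows "faithful_at A (with_smult C s) \<one>\<^bsub>B\<^esub>"
  unfolding faithful_at_def with_smult_simps with_smult_finsum C
proof (intro conjI allI impI; (elim conjE)?)
  fix I and k :: nat and c a
  assume I: "I \<subseteq> carrier A" "\<zero> \<in> I" "\<forall>u\<in>I. \<forall>v\<in>I. u \<oplus> v \<in> I" "\<forall>r\<in>carrier A. \<forall>v\<in>I. r \<otimes> v \<in> I"
    and c: "\<forall>j<k. c j \<in> carrier B" and a: "\<forall>j<k. a j \<in> I" and one: "\<one>\<^bsub>B\<^esub> = (\<Oplus>\<^bsub>B\<^esub>j\<in>{..<k}. s (a j) (c j))"
  have "(\<Oplus>\<^bsub>B\<^esub>j\<in>{..<k}. s (a j) (c j)) = (\<Oplus>\<^bsub>B\<^esub>j\<in>{..<k}. c j \<otimes>\<^bsub>B\<^esub> \<iota>\<^sub>B (a j))"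
    using c a I(1) assms(1) by (intro B.finsum_cong') (auto simp: cls_closed cauchy_const subset_iff)
  then show "\<one> \<in> I" using I c a one by (intro faithfulness[of I k c a]) auto
qed simp

lemma add_span_opposite: "add_span (opposite A) S = add_span A S"
proof -
  have "a \<in> add_span A S" if "a \<in> add_span (opposite A) S" for a
    using that by induction (auto intro: add_span.intros)
  moreover have "a \<in> add_span (opposite A) S" if "a \<in> add_span A S" for a
    using that
  proof induction
    case zero show ?case using add_span.zero[of "opposite A" S] by simp
  next
    case (add a b) then show ?case using add_span.add[of a "opposite A" S b] by simp
  next
    case (neg a) then show ?case using add_span.neg[of a "opposite A" S] by simp
  qed (auto intro: add_span.incl)
  ultimately show ?thesis by blast
qed

context commutator_algebra
begin

lemma opposite_word: "w \<in> lists {..<d} \<Longrightarrow> foldr (\<lambda>k a. x k \<otimes>\<^bsub>opposite A\<^esub> a) w \<one>\<^bsub>opposite A\<^esub> = word (rev w)"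
proof (induction w rule: list.induct)
  case (Cons k w)
  then have "k < d" "w \<in> lists {..<d}" "rev w \<in> lists {..<d}" by auto
  then show ?case using Cons.IH word_append[of "rev w" "[k]"] by (simp add: x_closed)
qed simp

lemma opposite_scaled_words:
  "{\<kappa> c \<otimes>\<^bsub>opposite A\<^esub> foldr (\<lambda>k a. x k \<otimes>\<^bsub>opposite A\<^esub> a) w \<one>\<^bsub>opposite A\<^esub> | c w. c \<in> carrier K \<and> w \<in> lists {..<d} \<and> Q c (mset w)} =
    {\<kappa> c \<otimes> word w | c w. c \<in> carrier K \<and> w \<in> lists {..<d} \<and> Q c (mset w)}" (is "?L = ?R")
proof -
  have e: "\<kappa> c \<otimes>\<^bsub>opposite A\<^esub> foldr (\<lambda>k a. x k \<otimes>\<^bsub>opposite A\<^esub> a) w \<one>\<^bsub>opposite A\<^esub> = \<kappa> c \<otimes> word (rev w)"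
    if "c \<in> carrier K" "w \<in> lists {..<d}" for c w
  proof -
    have "rev w \<in> lists {..<d}" using that(2) by auto
    then show ?thesis unfolding opposite_word[OF that(2)] using \<kappa>_central[OF that(1), of "word (rev w)"] by simp
  qed
  show ?thesis
  proof (intro equalityI subsetI)
    fix a assume "a \<in> ?L"
    then obtain c w where c: "c \<in> carrier K" "w \<in> lists {..<d}" "Q c (mset w)"
      "a = \<kappa> c \<otimes>\<^bsub>opposite A\<^esub> foldr (\<lambda>k a. x k \<otimes>\<^bsub>opposite A\<^esub> a) w \<one>\<^bsub>opposite A\<^esub>" by blast
    then have "a = \<kappa> c \<otimes> word (rev w)" "rev w \<in> lists {..<d}" "mset (rev w) = mset w" using e by auto
    then show "a \<in> ?R" using c by (intro CollectI exI[of _ c] exI[of _ "rev w"]) simp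
  next
    fix a assume "a \<in> ?R"
    then obtain c w where c: "c \<in> carrier K" "w \<in> lists {..<d}" "Q c (mset w)" "a = \<kappa> c \<otimes> word w" by blast
    have r: "rev w \<in> lists {..<d}" "mset (rev w) = mset w" using c by auto
    show "a \<in> ?L" using e[OF c(1) r(1)] c r by (intro CollectI exI[of _ c] exI[of _ "rev w"]) simp
  qed
qed

text \<open>
  Words are reversed, which changes neither weights nor spans.
\<close>

lemma opposite_commutator_algebra: "commutator_algebra K abs_K (opposite A) d \<kappa> x"
proof -
  have hom: "\<kappa> \<in> ring_hom K (opposite A)"
  proof (rule ring_hom_memI)
    fix a b assume "a \<in> carrier K" "b \<in> carrier K"
    then show "\<kappa> (a \<otimes>\<^bsub>K\<^esub> b) = \<kappa> a \<otimes>\<^bsub>opposite A\<^esub> \<kappa> b" using \<kappa>_central[of a "\<kappa> b"] by (simp add: \<kappa>_mult)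
  qed (simp_all add: \<kappa>_add \<kappa>_one)
  have sc: "{\<kappa> c \<otimes>\<^bsub>opposite A\<^esub> x k | c k. c \<in> carrier K \<and> k < d} = {\<kappa> c \<otimes> x k | c k. c \<in> carrier K \<and> k < d}"
  proof -
    have "\<kappa> c \<otimes>\<^bsub>opposite A\<^esub> x k = \<kappa> c \<otimes> x k" if "c \<in> carrier K" "k < d" for c k
      using \<kappa>_central[OF that(1) x_closed[OF that(2)]] by simp
    then show ?thesis by (intro Collect_cong ex_cong1) metis
  qed
  have com: "x i \<otimes>\<^bsub>opposite A\<^esub> x j \<ominus>\<^bsub>opposite A\<^esub> x j \<otimes>\<^bsub>opposite A\<^esub> x i \<in>
      add_span (opposite A) {\<kappa> c \<otimes>\<^bsub>opposite A\<^esub> x k | c k. c \<in> carrier K \<and> k < d}" if "i < d" "j < d" for i j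
    unfolding add_span_opposite sc using commutator[OF that(2,1)] by simp
  have sp: "carrier (opposite A) \<subseteq> add_span (opposite A) {\<kappa> c \<otimes>\<^bsub>opposite A\<^esub> foldr (\<lambda>k a. x k \<otimes>\<^bsub>opposite A\<^esub> a) w \<one>\<^bsub>opposite A\<^esub> | c w.
      c \<in> carrier K \<and> w \<in> lists {..<d}}"
    using spanning opposite_scaled_words[of "\<lambda>_ _. True"]
    by (simp only: add_span_opposite opposite_simps(1) word_def simp_thms)
  show ?thesis
    by (intro commutator_algebra.intro commutator_algebra_axioms.intro K.nonarch_absolute_value_axioms ring_opposite A.ring_axioms hom com sp)
      (use \<kappa>_central x_closed in simp_all)
qed

lemma opposite_null: "commutator_algebra.null K abs_K (opposite A) d \<kappa> x = null"
proof -
  interpret op: commutator_algebra K abs_K "opposite A" d \<kappa> x by (rule opposite_commutator_algebra)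
  have wt: "wt d B w 0 = wt d B (SOME w'. mset w' = mset w) 0" for B w
    by (rule wt_cong) (metis (mono_tags) someI_ex)
  have "op.nbhd B R \<rho> = nbhd B R \<rho>" for B R \<rho>
    unfolding op.nbhd_def nbhd_def op.word_def add_span_opposite
    using opposite_scaled_words[of "\<lambda>c m. abs_K c * R ^ wt d B (SOME w'. mset w' = m) 0 \<le> \<rho>"]
    by (simp only: wt[symmetric])
  then show ?thesis unfolding op.null_def[abs_def] null_def[abs_def] by simp
qed

lemma opposite_cauchy: "commutator_algebra.cauchy K abs_K (opposite A) d \<kappa> x = cauchy"
proof -
  interpret op: commutator_algebra K abs_K "opposite A" d \<kappa> x by (rule opposite_commutator_algebra)
  show ?thesis unfolding op.cauchy_def[abs_def] cauchy_def[abs_def] opposite_null by simp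
qed

end

lemma (in completed_algebra) opposite_completed:
  "completed_algebra K abs_K (opposite A) d \<kappa> x (opposite B) cls"
proof -
  interpret op: commutator_algebra K abs_K "opposite A" d \<kappa> x by (rule opposite_commutator_algebra)
  show ?thesis
    by (intro completed_algebra.intro opposite_commutator_algebra ring_opposite B.ring_axioms completed_algebra_axioms.intro)
      (auto simp: opposite_cauchy opposite_null cls_closed cls_eq cls_add cls_mult cls_zero cls_one intro: cls_surj)
qed

context commutator_algebra_with_scalars
begin

theorem envelope_faithfully_flat:
  "faithfully_flat_hom TYPE('n) A (arens_michael K abs_K A) (arens_michael_map K abs_K A)"
  unfolding faithfully_flat_hom_def
proof (intro conjI)
  interpret E: completed_algebra K abs_K A d \<kappa> x \<AA> cls by (rule envelope_completed)
  let ?h = "arens_michael_map K abs_K A"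
  have hc: "?h a \<in> carrier \<AA>" if "a \<in> carrier A" for a
    unfolding envelope_map using E.cls_closed cauchy_const[OF that] .
  have hom: "?h \<in> ring_hom A \<AA>"
    by (rule ring_hom_memI)
      (simp_all add: hc, simp_all add: envelope_map envelope_mult envelope_add envelope_one cauchy_const)
  then show "ring_hom_ring A \<AA> ?h"
    by (intro ring_hom_ring.intro ring_hom_ring_axioms.intro A.ring_axioms envelope_ring)
  note h = ring_hom_mult[OF hom] ring_hom_add[OF hom] ring_hom_one[OF hom]
  have "right_module A (with_smult \<AA> (\<lambda>a x. x \<otimes>\<^bsub>\<AA>\<^esub> ?h a))"
    unfolding right_module_def right_module_axioms_def one_sided_module_def one_sided_module_axioms_def
    by (simp add: A.ring_axioms with_smult_abelian_group E.B.abelian_group_axioms hc h E.B.r_distr E.B.l_distr E.B.m_assoc)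
  moreover have "equationally_flat A (with_smult \<AA> (\<lambda>a x. x \<otimes>\<^bsub>\<AA>\<^esub> ?h a))"
    by (rule E.completion_flat) (simp_all add: envelope_map)
  moreover have "faithful_at A (with_smult \<AA> (\<lambda>a x. x \<otimes>\<^bsub>\<AA>\<^esub> ?h a)) \<one>\<^bsub>\<AA>\<^esub>"
    by (rule E.completion_faithful) (simp_all add: envelope_map)
  ultimately show "faithfully_flat_right TYPE('n) A (with_smult \<AA> (\<lambda>a x. x \<otimes>\<^bsub>\<AA>\<^esub> ?h a))"
    by (rule faithfully_flat_rightI)
  interpret op: completed_algebra K abs_K "opposite A" d \<kappa> x "opposite \<AA>" cls by (rule E.opposite_completed)
  have "left_module A (with_smult \<AA> (\<lambda>a x. ?h a \<otimes>\<^bsub>\<AA>\<^esub> x))"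
    unfolding left_module_def left_module_axioms_def one_sided_module_def one_sided_module_axioms_def
    by (simp add: A.ring_axioms with_smult_abelian_group E.B.abelian_group_axioms hc h E.B.r_distr E.B.l_distr E.B.m_assoc)
  moreover have "equationally_flat (opposite A) (with_smult \<AA> (\<lambda>a x. ?h a \<otimes>\<^bsub>\<AA>\<^esub> x))"
    by (rule op.completion_flat) (simp_all add: envelope_map)
  moreover have "faithful_at (opposite A) (with_smult \<AA> (\<lambda>a x. ?h a \<otimes>\<^bsub>\<AA>\<^esub> x)) \<one>\<^bsub>opposite \<AA>\<^esub>"
    by (rule op.completion_faithful) (simp_all add: envelope_map)
  ultimately show "faithfully_flat_left TYPE('n) A (with_smult \<AA> (\<lambda>a x. ?h a \<otimes>\<^bsub>\<AA>\<^esub> x))"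
    by (rule faithfully_flat_leftI)
qed

end

section \<open>Free algebras and quotient algebras\<close>

text \<open>
  An algebra over a field, with its scalars given by a central ring homomorphism. In this form the
  structure passes to quotients along the quotient map.
\<close>

locale scalar_algebra = K: field K + A: ring A
  for K :: "('k, 'z) ring_scheme" and A :: "('k, 'a) module" (structure) and \<kappa> +
  assumes scalars_hom: "\<kappa> \<in> ring_hom K A"
    and scalars_central: "\<lbrakk>c \<in> carrier K; a \<in> carrier A\<rbrakk> \<Longrightarrow> \<kappa> c \<otimes> a = a \<otimes> \<kappa> c"
    and smult_by_scalar: "\<lbrakk>c \<in> carrier K; a \<in> carrier A\<rbrakk> \<Longrightarrow> c \<odot>\<^bsub>A\<^esub> a = \<kappa> c \<otimes> a"
begin

lemma scalars_closed [simp]: "c \<in> carrier K \<Longrightarrow> \<kappa> c \<in> carrier A"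
  using ring_hom_closed[OF scalars_hom] .

lemma quotient_scalar_algebra:
  assumes "ideal I A"
  shows "scalar_algebra K (quotient_algebra A I) (\<lambda>c. I +> \<kappa> c)"
    and "(+>) I \<in> ring_hom A (quotient_algebra A I)"
    and "carrier (quotient_algebra A I) = (+>) I ` carrier A"
proof -
  interpret I: ideal I A by fact
  interpret Q: ring "A Quot I" by (rule I.quotient_is_ring)
  have cQ: "carrier (A Quot I) = (+>) I ` carrier A"
    by (auto simp: FactRing_def A_RCOSETS_def')
  show cq: "carrier (quotient_algebra A I) = (+>) I ` carrier A"
    unfolding quotient_algebra_def with_smult_def using cQ by simp
  have ringq: "ring (quotient_algebra A I)"
  proof -
    have "abelian_group (quotient_algebra A I)"
      by (rule abelian_groupI) (auto simp: quotient_algebra_def with_smult_def Q.a_ac intro: bexI[of _ "\<ominus>\<^bsub>A Quot I\<^esub> x" for x] Q.l_neg)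
    moreover have "Group.monoid (quotient_algebra A I)"
      by (rule monoidI) (auto simp: quotient_algebra_def with_smult_def Q.m_assoc)
    ultimately show ?thesis
      by (rule ringI) (auto simp: quotient_algebra_def with_smult_def Q.l_distr Q.r_distr)
  qed
  have hom: "(+>) I \<in> ring_hom A (A Quot I)" by (rule I.rcos_ring_hom)
  show homq: "(+>) I \<in> ring_hom A (quotient_algebra A I)"
    using hom unfolding ring_hom_def quotient_algebra_def with_smult_def by simp
  have "(\<Union>x\<in>I +> a. I +> (c \<odot>\<^bsub>A\<^esub> x)) = I +> (c \<odot>\<^bsub>A\<^esub> a)" if c: "c \<in> carrier K" and a: "a \<in> carrier A" for c a
  proof -
    have "I +> (c \<odot>\<^bsub>A\<^esub> x) = I +> (c \<odot>\<^bsub>A\<^esub> a)" if x: "x \<in> I +> a" for x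
    proof -
      have xc: "x \<in> carrier A" using x a A.a_r_coset_subset_G[OF I.a_subset a] by blast
      have "I +> x = I +> a" using A.a_repr_independence[OF x a I.is_additive_subgroup[THEN additive_subgroup.a_subgroup]] by simp
      then have "(I +> \<kappa> c) \<otimes>\<^bsub>A Quot I\<^esub> (I +> x) = (I +> \<kappa> c) \<otimes>\<^bsub>A Quot I\<^esub> (I +> a)" by simp
      then show ?thesis using ring_hom_mult[OF hom, of "\<kappa> c"] a xc c by (simp add: smult_by_scalar)
    qed
    moreover have "a \<in> I +> a" using I.a_rcos_self[OF a] .
    ultimately show ?thesis by blast
  qed
  then have sq: "c \<odot>\<^bsub>quotient_algebra A I\<^esub> (I +> a) = I +> (\<kappa> c \<otimes> a)" if "c \<in> carrier K" "a \<in> carrier A" for c a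
    using that unfolding quotient_algebra_def with_smult_def by (simp add: smult_by_scalar)
  have mq: "(I +> a) \<otimes>\<^bsub>quotient_algebra A I\<^esub> (I +> b) = I +> (a \<otimes> b)" if "a \<in> carrier A" "b \<in> carrier A" for a b
    using ring_hom_mult[OF homq that] by simp
  show "scalar_algebra K (quotient_algebra A I) (\<lambda>c. I +> \<kappa> c)"
  proof (intro scalar_algebra.intro scalar_algebra_axioms.intro ringq K.field_axioms)
    show "(\<lambda>c. I +> \<kappa> c) \<in> ring_hom K (quotient_algebra A I)"
      using ring_hom_trans[OF scalars_hom homq] by (simp add: o_def)
  qed (auto simp: cq sq mq scalars_central)
qed

end

context ring
begin

text \<open>
  The product of the free algebra, for arbitrary functions on words. Separating the first letter in
  \<open>convolution_Cons\<close> allows induction on words.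
\<close>

definition convolution :: "('s list \<Rightarrow> 'a) \<Rightarrow> ('s list \<Rightarrow> 'a) \<Rightarrow> 's list \<Rightarrow> 'a" where
  "convolution f g = (\<lambda>w. \<Oplus>i\<in>{..length w}. f (take i w) \<otimes> g (drop i w))"

lemma convolution_closed:
  "f \<in> UNIV \<rightarrow> carrier R \<Longrightarrow> g \<in> UNIV \<rightarrow> carrier R \<Longrightarrow> convolution f g w \<in> carrier R"
  unfolding convolution_def by (intro finsum_closed) (auto simp: Pi_iff)

lemma convolution_Nil: "f \<in> UNIV \<rightarrow> carrier R \<Longrightarrow> g \<in> UNIV \<rightarrow> carrier R \<Longrightarrow> convolution f g [] = f [] \<otimes> g []"
  unfolding convolution_def by (simp add: Pi_iff)

lemma convolution_Cons:
  assumes "f \<in> UNIV \<rightarrow> carrier R" "g \<in> UNIV \<rightarrow> carrier R"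
  shows "convolution f g (a # w) = f [] \<otimes> g (a # w) \<oplus> convolution (\<lambda>u. f (a # u)) g w"
proof -
  have "(\<Oplus>i\<in>{..Suc (length w)}. f (take i (a # w)) \<otimes> g (drop i (a # w))) =
    (\<Oplus>i\<in>{..length w}. f (take (Suc i) (a # w)) \<otimes> g (drop (Suc i) (a # w))) \<oplus> f (take 0 (a # w)) \<otimes> g (drop 0 (a # w))"
    using assms by (intro finsum_Suc2) (auto simp: Pi_iff)
  moreover have "(\<Oplus>i\<in>{..length w}. f (a # take i w) \<otimes> g (drop i w)) \<in> carrier R"
    using assms by (intro finsum_closed) (auto simp: Pi_iff)
  ultimately show ?thesis using assms unfolding convolution_def by (simp add: Pi_iff a_comm del: finsum_Suc)
qed

lemma convolution_add_left:
  assumes "f \<in> UNIV \<rightarrow> carrier R" "f' \<in> UNIV \<rightarrow> carrier R" "g \<in> UNIV \<rightarrow> carrier R"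
  shows "convolution (\<lambda>u. f u \<oplus> f' u) g w = convolution f g w \<oplus> convolution f' g w"
  unfolding convolution_def using assms
  by (subst finsum_addf[symmetric]) (auto simp: Pi_iff l_distr intro!: finsum_cong')

lemma convolution_add_right:
  assumes "f \<in> UNIV \<rightarrow> carrier R" "g \<in> UNIV \<rightarrow> carrier R" "g' \<in> UNIV \<rightarrow> carrier R"
  shows "convolution f (\<lambda>u. g u \<oplus> g' u) w = convolution f g w \<oplus> convolution f g' w"
  unfolding convolution_def using assms
  by (subst finsum_addf[symmetric]) (auto simp: Pi_iff r_distr intro!: finsum_cong')

lemma convolution_scale_left:
  assumes "f \<in> UNIV \<rightarrow> carrier R" "g \<in> UNIV \<rightarrow> carrier R" "c \<in> carrier R"
  shows "convolution (\<lambda>u. c \<otimes> f u) g w = c \<otimes> convolution f g w"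
  unfolding convolution_def using assms
  by (subst finsum_rdistr) (auto simp: Pi_iff m_assoc intro!: finsum_cong')

lemma convolution_assoc:
  assumes "f \<in> UNIV \<rightarrow> carrier R" "g \<in> UNIV \<rightarrow> carrier R" "h \<in> UNIV \<rightarrow> carrier R"
  shows "convolution (convolution f g) h w = convolution f (convolution g h) w"
  using assms(1)
proof (induction w arbitrary: f)
  case Nil
  have c: "convolution f g \<in> UNIV \<rightarrow> carrier R" "convolution g h \<in> UNIV \<rightarrow> carrier R"
    using Nil.prems assms by (auto intro!: convolution_closed)
  have "f [] \<in> carrier R" "g [] \<in> carrier R" "h [] \<in> carrier R" using Nil.prems assms by auto
  then show ?case using Nil.prems assms c by (simp add: convolution_Nil m_assoc)
next
  case (Cons a w)
  let ?f = "\<lambda>u. f (a # u)" and ?g = "\<lambda>u. g (a # u)"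
  have fc: "?f \<in> UNIV \<rightarrow> carrier R" "?g \<in> UNIV \<rightarrow> carrier R" "f [] \<in> carrier R" "(\<lambda>u. f [] \<otimes> ?g u) \<in> UNIV \<rightarrow> carrier R"
    using Cons.prems assms by (auto simp: Pi_iff)
  have c: "convolution f g \<in> UNIV \<rightarrow> carrier R" "convolution g h \<in> UNIV \<rightarrow> carrier R" "convolution ?f g \<in> UNIV \<rightarrow> carrier R"
    using Cons.prems assms fc by (auto intro!: convolution_closed)
  have cl: "f [] \<in> carrier R" "g [] \<in> carrier R" "h (a # w) \<in> carrier R" "convolution ?g h w \<in> carrier R"
    "convolution ?f (convolution g h) w \<in> carrier R"
    using assms Cons.prems fc c by (auto intro!: convolution_closed)
  have "convolution (convolution f g) h (a # w) =
      (f [] \<otimes> g []) \<otimes> h (a # w) \<oplus> convolution (\<lambda>u. convolution f g (a # u)) h w"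
    using Cons.prems assms c by (simp add: convolution_Cons convolution_Nil)
  also have "(\<lambda>u. convolution f g (a # u)) = (\<lambda>u. f [] \<otimes> ?g u \<oplus> convolution ?f g u)"
    using Cons.prems assms by (simp add: convolution_Cons)
  also have "convolution \<dots> h w = f [] \<otimes> convolution ?g h w \<oplus> convolution ?f (convolution g h) w"
    using convolution_add_left[OF fc(4) c(3) assms(3)] convolution_scale_left[OF fc(2) assms(3) fc(3)] Cons.IH[OF fc(1)] by simp
  also have "(f [] \<otimes> g []) \<otimes> h (a # w) \<oplus> (f [] \<otimes> convolution ?g h w \<oplus> convolution ?f (convolution g h) w) =
      f [] \<otimes> (g [] \<otimes> h (a # w) \<oplus> convolution ?g h w) \<oplus> convolution ?f (convolution g h) w"
    using cl by (simp add: r_distr m_assoc a_assoc)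
  also have "g [] \<otimes> h (a # w) \<oplus> convolution ?g h w = convolution g h (a # w)"
    using assms by (simp add: convolution_Cons)
  also have "f [] \<otimes> convolution g h (a # w) \<oplus> convolution ?f (convolution g h) w = convolution f (convolution g h) (a # w)"
    using Cons.prems c(2) by (simp add: convolution_Cons)
  finally show ?case .
qed

lemma convolution_zero_left: "g \<in> UNIV \<rightarrow> carrier R \<Longrightarrow> convolution (\<lambda>u. \<zero>) g w = \<zero>"
proof -
  assume g: "g \<in> UNIV \<rightarrow> carrier R"
  have "(\<Oplus>i\<in>{..length w}. \<zero> \<otimes> g (drop i w)) = (\<Oplus>i\<in>{..length w}. \<zero>)"
    using g by (intro finsum_cong') (auto simp: Pi_iff)
  then show ?thesis by (simp add: convolution_def)
qed

lemma convolution_scalar_left: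
  assumes "c \<in> carrier R" "g \<in> UNIV \<rightarrow> carrier R"
  shows "convolution (\<lambda>u. if u = [] then c else \<zero>) g w = c \<otimes> g w"
proof (cases w)
  case Nil then show ?thesis using assms by (simp add: convolution_Nil Pi_iff)
next
  case (Cons a v)
  then show ?thesis using assms convolution_zero_left[OF assms(2)] by (simp add: convolution_Cons Pi_iff)
qed

lemma convolution_scalar_right:
  assumes "c \<in> carrier R" "f \<in> UNIV \<rightarrow> carrier R"
  shows "convolution f (\<lambda>u. if u = [] then c else \<zero>) w = f w \<otimes> c"
  using assms(2)
proof (induction w arbitrary: f)
  case Nil then show ?case using assms(1) by (simp add: convolution_Nil Pi_iff)
next
  case (Cons a w)
  then show ?case using assms(1) Cons.IH[of "\<lambda>u. f (a # u)"] by (simp add: convolution_Cons Pi_iff)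
qed

lemma convolution_generator_left:
  assumes "g \<in> UNIV \<rightarrow> carrier R"
  shows "convolution (free_generator R s) g w = (case w of [] \<Rightarrow> \<zero> | a # v \<Rightarrow> if a = s then g v else \<zero>)"
proof (cases w)
  case Nil then show ?thesis using assms by (simp add: convolution_Nil free_generator_def Pi_iff)
next
  case (Cons a v)
  have "(\<lambda>u. free_generator R s (a # u)) = (if a = s then (\<lambda>u. if u = [] then \<one> else \<zero>) else (\<lambda>u. \<zero>))"
    by (auto simp: free_generator_def fun_eq_iff)
  then have "convolution (\<lambda>u. free_generator R s (a # u)) g v = (if a = s then g v else \<zero>)"
    using assms convolution_scalar_left[of \<one> g v] convolution_zero_left[OF assms] by (simp add: Pi_iff)
  then show ?thesis using Cons assms by (simp add: convolution_Cons free_generator_def Pi_iff)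
qed

lemma convolution_support:
  assumes "f \<in> UNIV \<rightarrow> carrier R" "g \<in> UNIV \<rightarrow> carrier R"
  shows "{w. convolution f g w \<noteq> \<zero>} \<subseteq> (\<lambda>(u, v). u @ v) ` ({w. f w \<noteq> \<zero>} \<times> {w. g w \<noteq> \<zero>})"
proof
  fix w assume "w \<in> {w. convolution f g w \<noteq> \<zero>}"
  then have "\<not> (\<forall>i. f (take i w) \<otimes> g (drop i w) = \<zero>)" proof (intro notI)
    assume "\<forall>i. f (take i w) \<otimes> g (drop i w) = \<zero>"
    then have "convolution f g w = (\<Oplus>i\<in>{..length w}. \<zero>)" by (simp add: convolution_def)
    then show False using \<open>w \<in> _\<close> by simp
  qed
  then obtain i where "f (take i w) \<otimes> g (drop i w) \<noteq> \<zero>" by blast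
  then have "f (take i w) \<noteq> \<zero>" "g (drop i w) \<noteq> \<zero>" using assms by (auto simp: Pi_iff)
  then show "w \<in> (\<lambda>(u, v). u @ v) ` ({w. f w \<noteq> \<zero>} \<times> {w. g w \<noteq> \<zero>})"
    by (intro image_eqI[of _ _ "(take i w, drop i w)"]) auto
qed

end

definition free_scalar :: "('k, 'z) ring_scheme \<Rightarrow> 'k \<Rightarrow> 's list \<Rightarrow> 'k" where
  "free_scalar K c = (\<lambda>w. if w = [] then c else \<zero>\<^bsub>K\<^esub>)"

context field
begin

lemma free_algebra_simps:
  "\<zero>\<^bsub>free_algebra R S\<^esub> = (\<lambda>w. \<zero>)" "\<one>\<^bsub>free_algebra R S\<^esub> = free_scalar R \<one>"
  "f \<oplus>\<^bsub>free_algebra R S\<^esub> g = (\<lambda>w. f w \<oplus> g w)" "f \<otimes>\<^bsub>free_algebra R S\<^esub> g = convolution f g"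
  "c \<odot>\<^bsub>free_algebra R S\<^esub> f = (\<lambda>w. c \<otimes> f w)"
  by (simp_all add: free_algebra_def convolution_def free_scalar_def fun_eq_iff)

lemma free_algebra_carrier: "f \<in> carrier (free_algebra R S) \<longleftrightarrow>
    f \<in> UNIV \<rightarrow> carrier R \<and> finite {w. f w \<noteq> \<zero>} \<and> {w. f w \<noteq> \<zero>} \<subseteq> lists S"
  by (simp add: free_algebra_def)

lemma free_algebra_subsupport:
  assumes "g \<in> UNIV \<rightarrow> carrier R" "{w. g w \<noteq> \<zero>} \<subseteq> T" "finite T" "T \<subseteq> lists S"
  shows "g \<in> carrier (free_algebra R S)"
  unfolding free_algebra_carrier using assms finite_subset by blast

lemma free_scalar_closed: "c \<in> carrier R \<Longrightarrow> free_scalar R c \<in> carrier (free_algebra R S)"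
  by (rule free_algebra_subsupport[of _ "{[]}"]) (auto simp: free_scalar_def)

lemma free_generator_closed: "s \<in> S \<Longrightarrow> free_generator R s \<in> carrier (free_algebra R S)"
  by (rule free_algebra_subsupport[of _ "{[s]}"]) (auto simp: free_generator_def)

lemma free_algebra_ring: "ring (free_algebra R S)"
proof -
  note fc = free_algebra_carrier
  have add: "(\<lambda>w. f w \<oplus> g w) \<in> carrier (free_algebra R S)"
    if "f \<in> carrier (free_algebra R S)" "g \<in> carrier (free_algebra R S)" for f g
    using that by (intro free_algebra_subsupport[of _ "{w. f w \<noteq> \<zero>} \<union> {w. g w \<noteq> \<zero>}"]) (auto simp: fc Pi_iff)
  have neg: "(\<lambda>w. \<ominus> f w) \<in> carrier (free_algebra R S)" if "f \<in> carrier (free_algebra R S)" for f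
    using that by (intro free_algebra_subsupport[of _ "{w. f w \<noteq> \<zero>}"]) (auto simp: fc Pi_iff)
  have mult: "convolution f g \<in> carrier (free_algebra R S)"
    if "f \<in> carrier (free_algebra R S)" "g \<in> carrier (free_algebra R S)" for f g
  proof (rule free_algebra_subsupport[of _ "(\<lambda>(u, v). u @ v) ` ({w. f w \<noteq> \<zero>} \<times> {w. g w \<noteq> \<zero>})"])
    show "convolution f g \<in> UNIV \<rightarrow> carrier R" using that by (auto simp: fc intro: convolution_closed)
    show "{w. convolution f g w \<noteq> \<zero>} \<subseteq> (\<lambda>(u, v). u @ v) ` ({w. f w \<noteq> \<zero>} \<times> {w. g w \<noteq> \<zero>})"
      using that by (intro convolution_support) (auto simp: fc)
    show "finite ((\<lambda>(u, v). u @ v) ` ({w. f w \<noteq> \<zero>} \<times> {w. g w \<noteq> \<zero>}))" using that by (auto simp: fc)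
    show "(\<lambda>(u, v). u @ v) ` ({w. f w \<noteq> \<zero>} \<times> {w. g w \<noteq> \<zero>}) \<subseteq> lists S" using that by (fastforce simp: fc)
  qed
  show ?thesis
  proof (intro ringI abelian_groupI monoidI, goal_cases)
    case (3 f g h) then show ?case by (auto simp: free_algebra_simps fc Pi_iff a_assoc)
  next
    case (4 f g) then show ?case by (auto simp: free_algebra_simps fc Pi_iff a_comm)
  next
    case (6 f) then show ?case
      by (intro bexI[OF _ neg[OF 6]]) (auto simp: free_algebra_simps fc Pi_iff l_neg)
  next
    case (9 f g h) then show ?case by (auto simp: free_algebra_simps fc fun_eq_iff intro: convolution_assoc)
  next
    case (10 f) then show ?case
      using convolution_scalar_left[of \<one> f] by (auto simp: free_algebra_simps fc fun_eq_iff free_scalar_def Pi_iff)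
  next
    case (11 f) then show ?case
      using convolution_scalar_right[of \<one> f] by (auto simp: free_algebra_simps fc fun_eq_iff free_scalar_def Pi_iff)
  next
    case (12 f g h) then show ?case by (auto simp: free_algebra_simps fc fun_eq_iff intro: convolution_add_left)
  next
    case (13 f g h) then show ?case by (auto simp: free_algebra_simps fc fun_eq_iff intro: convolution_add_right)
  qed (auto simp: free_algebra_simps add mult free_scalar_closed, auto simp: fc Pi_iff)
qed

lemma free_scalar_algebra:
  fixes S :: "'s set"
  shows "scalar_algebra R (free_algebra R S) (free_scalar R)"
proof (intro scalar_algebra.intro scalar_algebra_axioms.intro free_algebra_ring field_axioms)
  show "free_scalar R \<in> ring_hom R (free_algebra R S)"
  proof (rule ring_hom_memI)
    fix a b assume ab: "a \<in> carrier R" "b \<in> carrier R"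
    then have "(free_scalar R b :: 's list \<Rightarrow> 'a) \<in> UNIV \<rightarrow> carrier R" by (auto simp: free_scalar_def)
    from convolution_scalar_left[OF ab(1) this]
    have "convolution (free_scalar R a) (free_scalar R b :: 's list \<Rightarrow> 'a) = (\<lambda>w. a \<otimes> free_scalar R b w)"
      by (simp add: free_scalar_def[of R a] fun_eq_iff)
    then show "free_scalar R (a \<otimes> b) = free_scalar R a \<otimes>\<^bsub>free_algebra R S\<^esub> free_scalar R b"
      using ab by (auto simp: free_algebra_simps fun_eq_iff free_scalar_def)
  qed (simp add: free_scalar_closed, auto simp: free_algebra_simps free_scalar_def fun_eq_iff)
next
  fix c f assume c: "c \<in> carrier R" and f: "f \<in> carrier (free_algebra R S)"
  then have f': "f \<in> UNIV \<rightarrow> carrier R" by (simp add: free_algebra_carrier)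
  have l: "convolution (free_scalar R c) f = (\<lambda>w. c \<otimes> f w)" and r: "convolution f (free_scalar R c) = (\<lambda>w. f w \<otimes> c)"
    unfolding free_scalar_def using convolution_scalar_left[OF c f'] convolution_scalar_right[OF c f'] by auto
  show "free_scalar R c \<otimes>\<^bsub>free_algebra R S\<^esub> f = f \<otimes>\<^bsub>free_algebra R S\<^esub> free_scalar R c"
    unfolding free_algebra_simps l r using c f' m_comm by (auto simp: fun_eq_iff Pi_iff)
  show "c \<odot>\<^bsub>free_algebra R S\<^esub> f = free_scalar R c \<otimes>\<^bsub>free_algebra R S\<^esub> f"
    unfolding free_algebra_simps l ..
qed

lemma free_word:
  "foldr (\<lambda>s f. free_generator R s \<otimes>\<^bsub>free_algebra R S\<^esub> f) w \<one>\<^bsub>free_algebra R S\<^esub> = (\<lambda>v. if v = w then \<one> else \<zero>)"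
proof (induction w)
  case Nil then show ?case by (simp add: free_algebra_simps free_scalar_def)
next
  case (Cons s w)
  have "convolution (free_generator R s) (\<lambda>v. if v = w then \<one> else \<zero>) = (\<lambda>v. if v = s # w then \<one> else \<zero>)"
    by (auto simp: fun_eq_iff convolution_generator_left Pi_iff split: list.splits)
  then show ?case using Cons by (simp add: free_algebra_simps)
qed

lemma free_algebra_spanned:
  assumes "f \<in> carrier (free_algebra R S)"
  shows "f \<in> add_span (free_algebra R S)
    {free_scalar R c \<otimes>\<^bsub>free_algebra R S\<^esub> foldr (\<lambda>s f. free_generator R s \<otimes>\<^bsub>free_algebra R S\<^esub> f) w \<one>\<^bsub>free_algebra R S\<^esub> | c w.
       c \<in> carrier R \<and> w \<in> lists S}" (is "f \<in> add_span _ ?W")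
proof -
  have "f \<in> add_span (free_algebra R S) ?W"
    if "finite T" "T \<subseteq> lists S" "f \<in> UNIV \<rightarrow> carrier R" "{w. f w \<noteq> \<zero>} \<subseteq> T" for T f
    using that
  proof (induction T arbitrary: f rule: finite_induct)
    case empty
    then have "f = \<zero>\<^bsub>free_algebra R S\<^esub>" by (auto simp: free_algebra_simps fun_eq_iff)
    then show ?case by (simp add: add_span.zero)
  next
    case (insert w T)
    define h where "h = (\<lambda>v. if v = w then \<one> else \<zero>)"
    have hc: "h \<in> UNIV \<rightarrow> carrier R" by (auto simp: h_def)
    have fw: "f w \<in> carrier R" using insert.prems by auto
    have 1: "f(w := \<zero>) \<in> add_span (free_algebra R S) ?W"
      using insert.prems by (intro insert.IH) auto
    have 2: "free_scalar R (f w) \<otimes>\<^bsub>free_algebra R S\<^esub> h \<in> ?W"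
      using fw insert.prems unfolding h_def free_word[of S w, symmetric] by blast
    have "free_scalar R (f w) \<otimes>\<^bsub>free_algebra R S\<^esub> h \<oplus>\<^bsub>free_algebra R S\<^esub> f(w := \<zero>) \<in> add_span (free_algebra R S) ?W"
      by (rule add_span.add[OF add_span.incl[OF 2] 1])
    also have "free_scalar R (f w) \<otimes>\<^bsub>free_algebra R S\<^esub> h \<oplus>\<^bsub>free_algebra R S\<^esub> f(w := \<zero>) = f"
      using convolution_scalar_left[OF fw hc] insert.prems(2) fw
      by (auto simp: free_algebra_simps free_scalar_def fun_eq_iff h_def Pi_iff)
    finally show ?case .
  qed
  from this[of "{w. f w \<noteq> \<zero>}" f] show ?thesis using assms unfolding free_algebra_carrier by blast
qed

end

section \<open>Extension of scalars\<close>

locale tensor_base_change = lie_algebra R L + fraction_field R K \<iota>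
  for R :: "('r, 'y) ring_scheme" (structure) and K :: "('k, 'z) ring_scheme" (structure) and \<iota>
    and L :: "('r, 'g) module" (structure)
begin

abbreviation K' :: "('r, 'k) module" where "K' \<equiv> scalars_module K \<iota>"

lemma embed_closed: "r \<in> carrier R \<Longrightarrow> \<iota> r \<in> carrier K"
  using ring_hom_closed[OF embed_hom] .

lemma scalars_tensor_pair: "tensor_pair R L K'"
proof -
  have "abelian_group K'"
    by (rule abelian_groupI) (auto simp: K.a_ac intro: bexI[of _ "\<ominus>\<^bsub>K\<^esub> x" for x] K.l_neg)
  then show ?thesis
    unfolding tensor_pair_def one_sided_module_def one_sided_module_axioms_def
    using embed_hom
    by (simp add: R.ring_axioms M.abelian_group_axioms smult_l_distr smult_r_distr embed_closed K.l_distr K.r_distr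
        ring_hom_add ring_hom_one)
qed

sublocale T: tensor_pair R L K' by (rule scalars_tensor_pair)

abbreviation cl :: "('g \<times> 'k \<Rightarrow>\<^sub>0 int) \<Rightarrow> ('g \<times> 'k \<Rightarrow>\<^sub>0 int) set" where
  "cl P \<equiv> tensor_null R L K' #>\<^bsub>free_on_pairs L K'\<^esub> P"

abbreviation V :: "('k, ('g \<times> 'k \<Rightarrow>\<^sub>0 int) set) module" where
  "V \<equiv> base_change R K \<iota> L"

lemma base_change_carrier: "carrier V = cl ` carrier (free_on_pairs L K')"
  by (simp add: base_change_def Let_def tensor_product_def carrier_FactGroup)

lemma cl_closed: "P \<in> carrier (free_on_pairs L K') \<Longrightarrow> cl P \<in> carrier V"
  unfolding base_change_carrier by (rule imageI)

lemma base_change_add: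
  assumes "P \<in> carrier (free_on_pairs L K')" "Q \<in> carrier (free_on_pairs L K')"
  shows "cl P \<oplus>\<^bsub>V\<^esub> cl Q = cl (P + Q)"
proof -
  have "cl P \<oplus>\<^bsub>V\<^esub> cl Q = cl P <#>\<^bsub>free_on_pairs L K'\<^esub> cl Q"
    by (simp add: base_change_def Let_def tensor_product_def FactGroup_def)
  also have "\<dots> = cl (P + Q)"
  proof -
    have "p + q \<in> cl (P + Q)" if p: "p \<in> cl P" and q: "q \<in> cl Q" for p q
    proof -
      obtain s where "s \<in> tensor_null R L K'" "p = s + P" using p unfolding frag_coset by (rule imageE)
      moreover obtain t where "t \<in> tensor_null R L K'" "q = t + Q" using q unfolding frag_coset by (rule imageE)
      ultimately show ?thesis unfolding frag_coset using T.tn_add[of s t]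
        by (intro image_eqI[of _ _ "s + t"]) (simp_all add: algebra_simps)
    qed
    moreover have "\<exists>p\<in>cl P. \<exists>q\<in>cl Q. z = p + q" if z: "z \<in> cl (P + Q)" for z
    proof -
      obtain s where s: "s \<in> tensor_null R L K'" "z = s + (P + Q)" using z unfolding frag_coset by (rule imageE)
      have "s + P \<in> cl P" unfolding frag_coset using s(1) by (rule imageI)
      moreover have "Q \<in> cl Q" unfolding frag_coset using T.tn_zero by (intro image_eqI[of _ _ 0]) simp_all
      ultimately show ?thesis using s(2) by (intro bexI[of _ "s + P"] bexI[of _ Q]) (simp_all add: add.assoc)
    qed
    ultimately show ?thesis unfolding set_mult_def mult_free_Abelian_group by blast
  qed
  finally show ?thesis .
qed

lemma base_change_smult:
  assumes c: "c \<in> carrier K" and P: "P \<in> carrier (free_on_pairs L K')"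
  shows "c \<odot>\<^bsub>V\<^esub> cl P = cl (pair_map id (\<lambda>a. c \<otimes>\<^bsub>K\<^esub> a) P)"
proof -
  have f: "id \<in> linear_maps R L L" "(\<lambda>a. c \<otimes>\<^bsub>K\<^esub> a) \<in> linear_maps R K' K'"
    using c by (auto simp: linear_maps_def K.r_distr K.m_lcomm embed_closed)
  have "c \<odot>\<^bsub>V\<^esub> cl P = (\<Union>Q\<in>cl P. cl (pair_map id (\<lambda>a. c \<otimes>\<^bsub>K\<^esub> a) Q))"
    by (simp add: base_change_def Let_def tensor_map_def pair_map_def)
  also have "\<dots> = cl (pair_map id (\<lambda>a. c \<otimes>\<^bsub>K\<^esub> a) P)"
    by (rule frag_map_coset[OF T.tensor_null_subgroup T.tensor_null_subgroup])
      (simp_all add: pair_map_null[OF scalars_tensor_pair scalars_tensor_pair f])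
  finally show ?thesis .
qed

lemma base_change_smult_pure:
  "c \<in> carrier K \<Longrightarrow> l \<in> carrier L \<Longrightarrow> a \<in> carrier K \<Longrightarrow> c \<odot>\<^bsub>V\<^esub> cl (frag_of (l, a)) = cl (frag_of (l, c \<otimes>\<^bsub>K\<^esub> a))"
  using base_change_smult[of c "frag_of (l, a)"] by simp

text \<open>
  The bracket of the extended Lie algebra on representatives.
\<close>

definition bracket_frag :: "('g \<times> 'k \<Rightarrow>\<^sub>0 int) \<Rightarrow> ('g \<times> 'k \<Rightarrow>\<^sub>0 int) \<Rightarrow> ('g \<times> 'k \<Rightarrow>\<^sub>0 int)" where
  "bracket_frag P Q = frag_extend (\<lambda>(x, a). frag_extend (\<lambda>(y, b). frag_of (x \<otimes>\<^bsub>L\<^esub> y, a \<otimes>\<^bsub>K\<^esub> b)) Q) P"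

lemma bracket_frag_add_left: "bracket_frag (P + P') Q = bracket_frag P Q + bracket_frag P' Q"
  and bracket_frag_diff_left: "bracket_frag (P - P') Q = bracket_frag P Q - bracket_frag P' Q"
  and bracket_frag_zero_left: "bracket_frag 0 Q = 0"
  by (simp_all add: bracket_frag_def frag_extend_add frag_extend_diff)

lemma bracket_frag_pure_left: "bracket_frag (frag_of (x, a)) Q = pair_map (\<lambda>y. x \<otimes>\<^bsub>L\<^esub> y) (\<lambda>b. a \<otimes>\<^bsub>K\<^esub> b) Q"
  by (simp add: bracket_frag_def pair_map_def)

lemma bracket_frag_diff_right: "bracket_frag P (Q - Q') = bracket_frag P Q - bracket_frag P Q'"
proof -
  have "Poly_Mapping.keys P \<subseteq> UNIV" by simp
  then show ?thesis
  proof (induction P rule: frag_induction)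
    case (one p) then show ?case by (cases p) (simp add: bracket_frag_pure_left)
  qed (simp_all add: bracket_frag_zero_left bracket_frag_diff_left)
qed

lemma bracket_frag_zero_right: "bracket_frag P 0 = 0"
  using bracket_frag_diff_right[of P 0 0] by simp

lemma bracket_frag_add_right: "bracket_frag P (Q + Q') = bracket_frag P Q + bracket_frag P Q'"
  using bracket_frag_diff_right[of P "Q + Q'" Q'] by simp

lemma bracket_frag_pure_right: "bracket_frag P (frag_of (y, b)) = pair_map (\<lambda>x. x \<otimes>\<^bsub>L\<^esub> y) (\<lambda>a. a \<otimes>\<^bsub>K\<^esub> b) P"
  by (simp add: bracket_frag_def pair_map_def)

lemma bracket_maps:
  assumes "x \<in> carrier L" "a \<in> carrier K"
  shows "(\<lambda>y. x \<otimes>\<^bsub>L\<^esub> y) \<in> linear_maps R L L" "(\<lambda>y. y \<otimes>\<^bsub>L\<^esub> x) \<in> linear_maps R L L"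
    "(\<lambda>b. a \<otimes>\<^bsub>K\<^esub> b) \<in> linear_maps R K' K'" "(\<lambda>b. b \<otimes>\<^bsub>K\<^esub> a) \<in> linear_maps R K' K'"
  using assms
  by (auto simp: linear_maps_def bracket_closed bracket_add_left bracket_add_right bracket_smult_left bracket_smult_right
      K.r_distr K.l_distr K.m_lcomm K.m_assoc embed_closed)

lemma bracket_frag_closed:
  assumes P: "P \<in> carrier (free_on_pairs L K')" and Q: "Q \<in> carrier (free_on_pairs L K')"
  shows "bracket_frag P Q \<in> carrier (free_on_pairs L K')"
proof -
  have "Poly_Mapping.keys P \<subseteq> carrier L \<times> carrier K" using P by simp
  then show ?thesis
  proof (induction P rule: frag_induction)
    case (one p)
    obtain x a where p: "p = (x, a)" by (cases p)
    then have "(\<lambda>y. x \<otimes>\<^bsub>L\<^esub> y) \<in> carrier L \<rightarrow> carrier L" "(\<lambda>b. a \<otimes>\<^bsub>K\<^esub> b) \<in> carrier K' \<rightarrow> carrier K'"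
      using one bracket_closed by auto
    from pair_map_carrier[OF this Q] show ?case by (simp only: p bracket_frag_pure_left)
  next
    case (diff a b)
    then show ?case
      using keys_diff[of "bracket_frag a Q" "bracket_frag b Q"] by (auto simp: bracket_frag_diff_left)
  qed (simp add: bracket_frag_zero_left)
qed

lemma bracket_frag_null_right:
  assumes P: "P \<in> carrier (free_on_pairs L K')" and Q: "Q \<in> tensor_null R L K'"
  shows "bracket_frag P Q \<in> tensor_null R L K'"
proof -
  have "Poly_Mapping.keys P \<subseteq> carrier L \<times> carrier K" using P by simp
  then show ?thesis
  proof (induction P rule: frag_induction)
    case (one p)
    then obtain x a where p: "p = (x, a)" "x \<in> carrier L" "a \<in> carrier K" by auto
    from pair_map_null[OF scalars_tensor_pair scalars_tensor_pair bracket_maps(1)[OF p(2,3)] bracket_maps(3)[OF p(2,3)] Q]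
    show ?case unfolding p(1) bracket_frag_pure_left .
  qed (simp_all add: bracket_frag_zero_left bracket_frag_diff_left T.tn_zero T.tn_diff)
qed

lemma bracket_frag_null_left:
  assumes P: "P \<in> tensor_null R L K'" and Q: "Q \<in> carrier (free_on_pairs L K')"
  shows "bracket_frag P Q \<in> tensor_null R L K'"
proof -
  have "Poly_Mapping.keys Q \<subseteq> carrier L \<times> carrier K" using Q by simp
  then show ?thesis
  proof (induction Q rule: frag_induction)
    case (one p)
    then obtain x a where p: "p = (x, a)" "x \<in> carrier L" "a \<in> carrier K" by auto
    from pair_map_null[OF scalars_tensor_pair scalars_tensor_pair bracket_maps(2)[OF p(2,3)] bracket_maps(4)[OF p(2,3)] P]
    show ?case unfolding p(1) bracket_frag_pure_right .
  qed (simp_all add: bracket_frag_zero_right bracket_frag_diff_right T.tn_zero T.tn_diff)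
qed

lemma base_change_bracket:
  assumes P: "P \<in> carrier (free_on_pairs L K')" and Q: "Q \<in> carrier (free_on_pairs L K')"
  shows "cl P \<otimes>\<^bsub>V\<^esub> cl Q = cl (bracket_frag P Q)"
proof -
  have "cl P \<otimes>\<^bsub>V\<^esub> cl Q = (\<Union>P'\<in>cl P. \<Union>Q'\<in>cl Q. cl (bracket_frag P' Q'))"
    by (simp add: base_change_def Let_def bracket_frag_def)
  also have "\<dots> = (\<Union>P'\<in>cl P. cl (bracket_frag P' Q))"
  proof (rule SUP_cong[OF refl])
    fix P' assume "P' \<in> cl P"
    then obtain t where "t \<in> tensor_null R L K'" "P' = t + P" unfolding frag_coset by blast
    then have "P' \<in> carrier (free_on_pairs L K')"
      using P T.tn_keys[of t] keys_add[of t P] by auto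
    from bracket_frag_null_right[OF this] show "(\<Union>Q'\<in>cl Q. cl (bracket_frag P' Q')) = cl (bracket_frag P' Q)"
      by (intro frag_map_coset[OF T.tensor_null_subgroup T.tensor_null_subgroup]) (simp_all add: bracket_frag_add_right)
  qed
  also have "\<dots> = cl (bracket_frag P Q)"
    by (rule frag_map_coset[where \<phi> = "\<lambda>P. bracket_frag P Q", OF T.tensor_null_subgroup T.tensor_null_subgroup])
      (simp_all add: bracket_frag_add_left bracket_frag_null_left[OF _ Q])
  finally show ?thesis .
qed

lemma base_change_bracket_closed: "u \<in> carrier V \<Longrightarrow> v \<in> carrier V \<Longrightarrow> u \<otimes>\<^bsub>V\<^esub> v \<in> carrier V"
  unfolding base_change_carrier by (elim imageE) (simp only: base_change_bracket, intro imageI bracket_frag_closed)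

lemma base_change_add_closed: "u \<in> carrier V \<Longrightarrow> v \<in> carrier V \<Longrightarrow> u \<oplus>\<^bsub>V\<^esub> v \<in> carrier V"
  unfolding base_change_carrier
proof (elim imageE)
  fix P Q assume "u = cl P" "v = cl Q" and PQ: "P \<in> carrier (free_on_pairs L K')" "Q \<in> carrier (free_on_pairs L K')"
  moreover have "P + Q \<in> carrier (free_on_pairs L K')" using PQ keys_add[of P Q] by auto
  ultimately show "u \<oplus>\<^bsub>V\<^esub> v \<in> cl ` carrier (free_on_pairs L K')" by (simp only: base_change_add imageI)
qed

lemma base_change_smult_closed: "c \<in> carrier K \<Longrightarrow> v \<in> carrier V \<Longrightarrow> c \<odot>\<^bsub>V\<^esub> v \<in> carrier V"
  unfolding base_change_carrier
proof (elim imageE)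
  fix P assume c: "c \<in> carrier K" and "v = cl P" and P: "P \<in> carrier (free_on_pairs L K')"
  moreover have "pair_map id (\<lambda>a. c \<otimes>\<^bsub>K\<^esub> a) P \<in> carrier (free_on_pairs L K')"
    using c by (intro pair_map_carrier[OF _ _ P]) auto
  ultimately show "c \<odot>\<^bsub>V\<^esub> v \<in> cl ` carrier (free_on_pairs L K')" by (simp only: base_change_smult imageI)
qed

text \<open>
  The extended module is spanned over \<open>K\<close> by the elements \<open>b \<otimes> 1\<close>, with \<open>b\<close> from a generating set of
  \<open>L\<close>. It is stated for a linear image, where negatives and scalars are those of an algebra.
\<close>

lemma linear_image_spanned:
  fixes A :: "('a, 'w) ring_scheme"
  assumes A: "ring A" and \<kappa>: "\<kappa> \<in> ring_hom K A"
    and t: "t \<in> carrier V \<rightarrow> carrier A"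
    and t_add: "\<And>u v. u \<in> carrier V \<Longrightarrow> v \<in> carrier V \<Longrightarrow> t (u \<oplus>\<^bsub>V\<^esub> v) = t u \<oplus>\<^bsub>A\<^esub> t v"
    and t_smult: "\<And>c v. c \<in> carrier K \<Longrightarrow> v \<in> carrier V \<Longrightarrow> t (c \<odot>\<^bsub>V\<^esub> v) = \<kappa> c \<otimes>\<^bsub>A\<^esub> t v"
    and B: "finite B" "B \<subseteq> carrier L" and gen: "\<And>l. l \<in> carrier L \<Longrightarrow> \<exists>r\<in>B \<rightarrow> carrier R. l = (\<Oplus>\<^bsub>L\<^esub>b\<in>B. r b \<odot>\<^bsub>L\<^esub> b)"
    and v: "v \<in> carrier V"
  shows "t v \<in> add_span A {\<kappa> c \<otimes>\<^bsub>A\<^esub> t (cl (frag_of (b, \<one>\<^bsub>K\<^esub>))) | c b. c \<in> carrier K \<and> b \<in> B}" (is "_ \<in> add_span A ?X")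
proof -
  interpret A: ring A by fact
  have \<kappa>c: "\<kappa> c \<in> carrier A" if "c \<in> carrier K" for c using ring_hom_closed[OF \<kappa> that] .
  let ?F = "carrier (free_on_pairs L K')"
  have tc: "t (cl P) \<in> carrier A" if "P \<in> ?F" for P using t cl_closed[OF that] by blast
  have t_plus: "t (cl (P + Q)) = t (cl P) \<oplus>\<^bsub>A\<^esub> t (cl Q)" if "P \<in> ?F" "Q \<in> ?F" for P Q
    using t_add[OF cl_closed cl_closed, OF that] base_change_add[OF that] by simp
  have t_zero: "t (cl 0) = \<zero>\<^bsub>A\<^esub>"
    using t_plus[of 0 0] tc[of 0] by (metis A.add.l_cancel_one add.right_neutral carrier_free_Abelian_group_iff keys_zero empty_subsetI)
  have t_diff: "t (cl (P - Q)) = t (cl P) \<ominus>\<^bsub>A\<^esub> t (cl Q)" if "P \<in> ?F" "Q \<in> ?F" for P Q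
  proof -
    have d: "P - Q \<in> ?F" using that keys_diff[of P Q] by auto
    from t_plus[OF d that(2)] have "t (cl P) = t (cl (P - Q)) \<oplus>\<^bsub>A\<^esub> t (cl Q)" by simp
    then show ?thesis using tc[OF d] tc[OF that(2)] by (simp add: A.minus_eq A.a_assoc A.r_neg)
  qed
  have pure: "frag_of (l, a) \<in> ?F" if "l \<in> carrier L" "a \<in> carrier K" for l a using that by simp
  have cl_eq: "cl P = cl Q" if "P - Q \<in> tensor_null R L K'" for P Q
    using frag_coset_eq_iff[OF T.tensor_null_subgroup] that by blast
  have scale: "t (cl (frag_of (l, c \<otimes>\<^bsub>K\<^esub> a))) = \<kappa> c \<otimes>\<^bsub>A\<^esub> t (cl (frag_of (l, a)))"
    if "c \<in> carrier K" "l \<in> carrier L" "a \<in> carrier K" for c l a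
    using t_smult[OF that(1) cl_closed[OF pure[OF that(2,3)]]] base_change_smult_pure[OF that] by simp
  have span_scale: "\<kappa> c \<otimes>\<^bsub>A\<^esub> a \<in> add_span A ?X" if c: "c \<in> carrier K" and a: "a \<in> add_span A ?X" for c a
  proof (rule add_span_image[where f = "\<lambda>a. \<kappa> c \<otimes>\<^bsub>A\<^esub> a" and S = ?X and M = A])
    fix s assume "s \<in> ?X"
    then obtain e b where e: "e \<in> carrier K" "b \<in> B" "s = \<kappa> e \<otimes>\<^bsub>A\<^esub> t (cl (frag_of (b, \<one>\<^bsub>K\<^esub>)))" by blast
    then have "\<kappa> c \<otimes>\<^bsub>A\<^esub> s = \<kappa> (c \<otimes>\<^bsub>K\<^esub> e) \<otimes>\<^bsub>A\<^esub> t (cl (frag_of (b, \<one>\<^bsub>K\<^esub>)))"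
      using c B tc[OF pure[of b "\<one>\<^bsub>K\<^esub>"]] by (simp add: ring_hom_mult[OF \<kappa>] A.m_assoc \<kappa>c subset_iff)
    then show "\<kappa> c \<otimes>\<^bsub>A\<^esub> s \<in> add_span A ?X" using c e by (intro add_span.incl CollectI exI[of _ "c \<otimes>\<^bsub>K\<^esub> e"] exI[of _ b]) simp
  next
    have "\<kappa> c \<otimes>\<^bsub>A\<^esub> t (cl (frag_of (b, \<one>\<^bsub>K\<^esub>))) \<in> carrier A" if "c \<in> carrier K" "b \<in> B" for c b
      using that B tc[OF pure[of b "\<one>\<^bsub>K\<^esub>"]] \<kappa>c by auto
    then show "?X \<subseteq> carrier A" by blast
  qed (use c a \<kappa>c in \<open>auto simp: A.r_distr A.abelian_group_axioms\<close>)
  have unit: "t (cl (frag_of (\<Oplus>\<^bsub>L\<^esub>b\<in>S. r b \<odot>\<^bsub>L\<^esub> b, \<one>\<^bsub>K\<^esub>))) \<in> add_span A ?X" if "S \<subseteq> B" "r \<in> B \<rightarrow> carrier R" for S r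
    using finite_subset[OF that(1) B(1)] that
  proof (induction S rule: finite_induct)
    case empty
    have "cl (frag_of (\<zero>\<^bsub>L\<^esub>, \<one>\<^bsub>K\<^esub>)) = cl 0" using T.tn_zero_left[of "\<one>\<^bsub>K\<^esub>"] by (intro cl_eq) simp
    then show ?case by (simp only: M.finsum_empty t_zero add_span.zero)
  next
    case (insert b S)
    have b: "b \<in> B" "b \<in> carrier L" "r b \<in> carrier R" using insert.prems B by auto
    let ?s = "\<Oplus>\<^bsub>L\<^esub>b\<in>S. r b \<odot>\<^bsub>L\<^esub> b"
    have S: "(\<lambda>b. r b \<odot>\<^bsub>L\<^esub> b) \<in> S \<rightarrow> carrier L" using insert.prems B by auto
    then have s: "?s \<in> carrier L" by (rule M.finsum_closed)
    have rb: "r b \<odot>\<^bsub>L\<^esub> b \<in> carrier L" using b by simp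
    have ins: "(\<Oplus>\<^bsub>L\<^esub>b\<in>insert b S. r b \<odot>\<^bsub>L\<^esub> b) = r b \<odot>\<^bsub>L\<^esub> b \<oplus>\<^bsub>L\<^esub> ?s"
      using insert.hyps S rb by (intro M.finsum_insert)
    have "cl (frag_of (r b \<odot>\<^bsub>L\<^esub> b \<oplus>\<^bsub>L\<^esub> ?s, \<one>\<^bsub>K\<^esub>)) = cl (frag_of (r b \<odot>\<^bsub>L\<^esub> b, \<one>\<^bsub>K\<^esub>) + frag_of (?s, \<one>\<^bsub>K\<^esub>))"
      using T.tn_left[OF rb s, of "\<one>\<^bsub>K\<^esub>"] by (intro cl_eq) (simp add: diff_diff_add)
    then have "t (cl (frag_of (\<Oplus>\<^bsub>L\<^esub>b\<in>insert b S. r b \<odot>\<^bsub>L\<^esub> b, \<one>\<^bsub>K\<^esub>))) =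
        t (cl (frag_of (r b \<odot>\<^bsub>L\<^esub> b, \<one>\<^bsub>K\<^esub>))) \<oplus>\<^bsub>A\<^esub> t (cl (frag_of (?s, \<one>\<^bsub>K\<^esub>)))"
      using t_plus[OF pure[OF rb K.one_closed] pure[OF s K.one_closed]] by (simp only: ins)
    also have "cl (frag_of (r b \<odot>\<^bsub>L\<^esub> b, \<one>\<^bsub>K\<^esub>)) = cl (frag_of (b, \<iota> (r b) \<otimes>\<^bsub>K\<^esub> \<one>\<^bsub>K\<^esub>))"
      using T.tn_balanced[OF b(3,2), of "\<one>\<^bsub>K\<^esub>"] by (intro cl_eq) simp
    also have "t \<dots> = \<kappa> (\<iota> (r b)) \<otimes>\<^bsub>A\<^esub> t (cl (frag_of (b, \<one>\<^bsub>K\<^esub>)))"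
      using b by (intro scale) (auto simp: embed_closed)
    finally have eq: "t (cl (frag_of (\<Oplus>\<^bsub>L\<^esub>b\<in>insert b S. r b \<odot>\<^bsub>L\<^esub> b, \<one>\<^bsub>K\<^esub>))) =
      \<kappa> (\<iota> (r b)) \<otimes>\<^bsub>A\<^esub> t (cl (frag_of (b, \<one>\<^bsub>K\<^esub>))) \<oplus>\<^bsub>A\<^esub> t (cl (frag_of (?s, \<one>\<^bsub>K\<^esub>)))" .
    have 1: "\<kappa> (\<iota> (r b)) \<otimes>\<^bsub>A\<^esub> t (cl (frag_of (b, \<one>\<^bsub>K\<^esub>))) \<in> ?X" using b embed_closed by blast
    have 2: "t (cl (frag_of (?s, \<one>\<^bsub>K\<^esub>))) \<in> add_span A ?X" by (rule insert.IH) (use insert.prems in auto)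
    show ?case unfolding eq by (rule add_span.add[OF add_span.incl[OF 1] 2])
  qed
  obtain P where P: "P \<in> ?F" "v = cl P" using v unfolding base_change_carrier by blast
  have "Poly_Mapping.keys P \<subseteq> carrier L \<times> carrier K" using P by simp
  then have "P \<in> ?F \<and> t (cl P) \<in> add_span A ?X"
  proof (induction P rule: frag_induction)
    case zero then show ?case unfolding t_zero using add_span.zero by simp
  next
    case (one p)
    then obtain l a where p: "p = (l, a)" "l \<in> carrier L" "a \<in> carrier K" by auto
    obtain r where r: "r \<in> B \<rightarrow> carrier R" "l = (\<Oplus>\<^bsub>L\<^esub>b\<in>B. r b \<odot>\<^bsub>L\<^esub> b)" using gen[OF p(2)] by blast
    have "t (cl (frag_of (l, a))) = \<kappa> a \<otimes>\<^bsub>A\<^esub> t (cl (frag_of (l, \<one>\<^bsub>K\<^esub>)))"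
      using scale[of a l "\<one>\<^bsub>K\<^esub>"] p by simp
    moreover have "t (cl (frag_of (l, \<one>\<^bsub>K\<^esub>))) \<in> add_span A ?X" unfolding r(2) by (rule unit[OF subset_refl r(1)])
    ultimately show ?case using span_scale[OF p(3)] pure[OF p(2,3)] by (simp only: p(1))
  next
    case (diff a b)
    have "a - b \<in> ?F" using diff.IH keys_diff[of a b] by auto
    then show ?case using diff.IH t_diff[of a b] by (simp only: add_span_diff)
  qed
  then show ?thesis using P by simp
qed

end

section \<open>The universal enveloping algebra\<close>

text \<open>
  Generators that are themselves combinations of the \<open>x k\<close> can be expanded in words, since the
  scalars are central.
\<close>

lemma (in scalar_algebra) spanned_by_words:
  assumes x: "\<And>k. k < d \<Longrightarrow> x k \<in> carrier A"
    and t: "\<And>s. s \<in> S \<Longrightarrow> t s \<in> add_span A {\<kappa> c \<otimes> x k | c k. c \<in> carrier K \<and> k < d}"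
    and span: "carrier A \<subseteq> add_span A {\<kappa> c \<otimes> foldr (\<lambda>s a. t s \<otimes> a) w \<one> | c w. c \<in> carrier K \<and> w \<in> lists S}"
  shows "carrier A \<subseteq> add_span A {\<kappa> c \<otimes> foldr (\<lambda>k a. x k \<otimes> a) w \<one> | c w. c \<in> carrier K \<and> w \<in> lists {..<(d :: nat)}}"
    (is "_ \<subseteq> add_span A ?W")
proof -
  let ?word = "\<lambda>w. foldr (\<lambda>k a. x k \<otimes> a) w \<one>"
  have word: "?word w \<in> carrier A" if "w \<in> lists {..<d}" for w
    using that by (induction w) (auto simp: x)
  have WC: "?W \<subseteq> carrier A"
  proof
    fix a assume "a \<in> ?W"
    then obtain c w where "c \<in> carrier K" "w \<in> lists {..<d}" "a = \<kappa> c \<otimes> ?word w" by blast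
    then show "a \<in> carrier A" using word[of w] by simp
  qed
  have XC: "{\<kappa> c \<otimes> x k | c k. c \<in> carrier K \<and> k < d} \<subseteq> carrier A" using x by auto
  have scale: "\<kappa> c \<otimes> a \<in> add_span A ?W" if c: "c \<in> carrier K" and a: "a \<in> add_span A ?W" for c a
  proof (rule add_span_image[where f = "\<lambda>a. \<kappa> c \<otimes> a" and S = ?W and M = A])
    fix s assume "s \<in> ?W"
    then obtain e w where e: "e \<in> carrier K" "w \<in> lists {..<d}" "s = \<kappa> e \<otimes> ?word w" by blast
    have "\<kappa> c \<otimes> s = \<kappa> (c \<otimes>\<^bsub>K\<^esub> e) \<otimes> ?word w"
      using c e word[OF e(2)] by (simp add: ring_hom_mult[OF scalars_hom] A.m_assoc)
    then show "\<kappa> c \<otimes> s \<in> add_span A ?W" using c e by (intro add_span.incl CollectI exI[of _ "c \<otimes>\<^bsub>K\<^esub> e"] exI[of _ w]) simp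
  qed (use c a WC in \<open>auto simp: A.r_distr A.abelian_group_axioms\<close>)
  have mult: "b \<otimes> a \<in> add_span A ?W"
    if b: "b \<in> add_span A {\<kappa> c \<otimes> x k | c k. c \<in> carrier K \<and> k < d}" and a: "a \<in> add_span A ?W" for a b
  proof -
    have ac: "a \<in> carrier A" using A.add_span_closed[OF WC a] .
    have gen: "x k \<otimes> a \<in> add_span A ?W" if k: "k < d" for k
    proof (rule add_span_image[where f = "\<lambda>a. x k \<otimes> a" and S = ?W and M = A])
      fix s assume "s \<in> ?W"
      then obtain e w where e: "e \<in> carrier K" "w \<in> lists {..<d}" "s = \<kappa> e \<otimes> ?word w" by blast
      have "x k \<otimes> (\<kappa> e \<otimes> ?word w) = (x k \<otimes> \<kappa> e) \<otimes> ?word w"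
        using e(1) x[OF k] word[OF e(2)] by (simp only: A.m_assoc scalars_closed)
      also have "x k \<otimes> \<kappa> e = \<kappa> e \<otimes> x k" using scalars_central[OF e(1) x[OF k]] ..
      finally have "x k \<otimes> s = \<kappa> e \<otimes> ?word (k # w)"
        using e x[OF k] word[OF e(2)] by (simp add: A.m_assoc)
      moreover have "k # w \<in> lists {..<d}" using k e(2) by simp
      ultimately show "x k \<otimes> s \<in> add_span A ?W" using e(1) by (intro add_span.incl) blast
    qed (use x[OF k] a WC in \<open>auto simp: A.r_distr A.abelian_group_axioms\<close>)
    show ?thesis
    proof (rule add_span_image[where f = "\<lambda>b. b \<otimes> a" and S = "{\<kappa> c \<otimes> x k | c k. c \<in> carrier K \<and> k < d}" and M = A])
      fix s assume "s \<in> {\<kappa> c \<otimes> x k | c k. c \<in> carrier K \<and> k < d}"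
      then obtain c k where ck: "c \<in> carrier K" "k < d" "s = \<kappa> c \<otimes> x k" by blast
      then have "s \<otimes> a = \<kappa> c \<otimes> (x k \<otimes> a)" using x ac by (simp add: A.m_assoc)
      then show "s \<otimes> a \<in> add_span A ?W" using scale[OF ck(1) gen[OF ck(2)]] by simp
    qed (use b ac XC in \<open>auto simp: A.l_distr A.abelian_group_axioms\<close>)
  qed
  have "\<kappa> \<one>\<^bsub>K\<^esub> = \<one>" by (rule ring_hom_one[OF scalars_hom])
  then have "\<one> = \<kappa> \<one>\<^bsub>K\<^esub> \<otimes> ?word []" by (simp only: foldr.simps id_apply A.l_one A.one_closed)
  moreover have "[] \<in> lists {..<d}" by simp
  ultimately have "\<one> \<in> ?W" using K.one_closed by blast
  then have one: "\<one> \<in> add_span A ?W" by (rule add_span.incl)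
  have "foldr (\<lambda>s a. t s \<otimes> a) w \<one> \<in> add_span A ?W" if "w \<in> lists S" for w
    using that
  proof (induction w rule: list.induct)
    case Nil show ?case using one by simp
  next
    case (Cons s w)
    then show ?case using mult[OF t[of s]] by simp
  qed
  then have "{\<kappa> c \<otimes> foldr (\<lambda>s a. t s \<otimes> a) w \<one> | c w. c \<in> carrier K \<and> w \<in> lists S} \<subseteq> add_span A ?W"
    using scale by blast
  then show ?thesis using span add_span_subset by blast
qed

lemma ring_hom_words:
  fixes A :: "('a, 'y) ring_scheme" and B :: "('b, 'z) ring_scheme"
  assumes h: "h \<in> ring_hom A B" and A: "ring A" and B: "ring B" and onto: "carrier B \<subseteq> h ` carrier A"
    and \<kappa>: "\<kappa> \<in> carrier K \<rightarrow> carrier A" and t: "t \<in> S \<rightarrow> carrier A"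
    and span: "carrier A \<subseteq> add_span A {\<kappa> c \<otimes>\<^bsub>A\<^esub> foldr (\<lambda>s a. t s \<otimes>\<^bsub>A\<^esub> a) w \<one>\<^bsub>A\<^esub> | c w. c \<in> carrier K \<and> w \<in> lists S}"
  shows "carrier B \<subseteq> add_span B {h (\<kappa> c) \<otimes>\<^bsub>B\<^esub> foldr (\<lambda>s a. h (t s) \<otimes>\<^bsub>B\<^esub> a) w \<one>\<^bsub>B\<^esub> | c w. c \<in> carrier K \<and> w \<in> lists S}"
    (is "_ \<subseteq> add_span B ?W")
proof
  interpret A: ring A by fact
  interpret B: ring B by fact
  fix b assume "b \<in> carrier B"
  then obtain a where a: "a \<in> carrier A" "b = h a" using onto by blast
  have word: "foldr (\<lambda>s a. t s \<otimes>\<^bsub>A\<^esub> a) w \<one>\<^bsub>A\<^esub> \<in> carrier A \<and>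
      h (foldr (\<lambda>s a. t s \<otimes>\<^bsub>A\<^esub> a) w \<one>\<^bsub>A\<^esub>) = foldr (\<lambda>s a. h (t s) \<otimes>\<^bsub>B\<^esub> a) w \<one>\<^bsub>B\<^esub>" if "w \<in> lists S" for w
    using that
  proof (induction w rule: list.induct)
    case Nil show ?case by (simp add: ring_hom_one[OF h])
  next
    case (Cons s w)
    then have ts: "t s \<in> carrier A" using t by auto
    show ?case using Cons ring_hom_mult[OF h ts, of "foldr (\<lambda>s a. t s \<otimes>\<^bsub>A\<^esub> a) w \<one>\<^bsub>A\<^esub>"] ts by simp
  qed
  show "b \<in> add_span B ?W" unfolding a(2)
  proof (rule add_span_image[where M = A and f = h])
    show "a \<in> add_span A {\<kappa> c \<otimes>\<^bsub>A\<^esub> foldr (\<lambda>s a. t s \<otimes>\<^bsub>A\<^esub> a) w \<one>\<^bsub>A\<^esub> | c w. c \<in> carrier K \<and> w \<in> lists S}"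
      using span a(1) by blast
    show "{\<kappa> c \<otimes>\<^bsub>A\<^esub> foldr (\<lambda>s a. t s \<otimes>\<^bsub>A\<^esub> a) w \<one>\<^bsub>A\<^esub> | c w. c \<in> carrier K \<and> w \<in> lists S} \<subseteq> carrier A"
    proof
      fix z assume "z \<in> {\<kappa> c \<otimes>\<^bsub>A\<^esub> foldr (\<lambda>s a. t s \<otimes>\<^bsub>A\<^esub> a) w \<one>\<^bsub>A\<^esub> | c w. c \<in> carrier K \<and> w \<in> lists S}"
      then obtain c w where "c \<in> carrier K" "w \<in> lists S" "z = \<kappa> c \<otimes>\<^bsub>A\<^esub> foldr (\<lambda>s a. t s \<otimes>\<^bsub>A\<^esub> a) w \<one>\<^bsub>A\<^esub>" by blast
      then show "z \<in> carrier A" using \<kappa> word[of w] by auto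
    qed
    fix z assume "z \<in> {\<kappa> c \<otimes>\<^bsub>A\<^esub> foldr (\<lambda>s a. t s \<otimes>\<^bsub>A\<^esub> a) w \<one>\<^bsub>A\<^esub> | c w. c \<in> carrier K \<and> w \<in> lists S}"
    then obtain c w where cw: "c \<in> carrier K" "w \<in> lists S" "z = \<kappa> c \<otimes>\<^bsub>A\<^esub> foldr (\<lambda>s a. t s \<otimes>\<^bsub>A\<^esub> a) w \<one>\<^bsub>A\<^esub>" by blast
    have "\<kappa> c \<in> carrier A" using \<kappa> cw(1) by blast
    then have "h z = h (\<kappa> c) \<otimes>\<^bsub>B\<^esub> foldr (\<lambda>s a. h (t s) \<otimes>\<^bsub>B\<^esub> a) w \<one>\<^bsub>B\<^esub>"
      unfolding cw(3) using word[OF cw(2)] by (simp add: ring_hom_mult[OF h])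
    then show "h z \<in> add_span B ?W" using cw by (intro add_span.incl) blast
  qed (use A.abelian_group_axioms B.abelian_group_axioms ring_hom_closed[OF h] ring_hom_add[OF h] in auto)
qed

text \<open>
  The canonical map \<open>t\<close> is linear by the relations of the tensor algebra and takes brackets to
  commutators by those of the enveloping algebra. The words span the free algebra, which maps onto
  the enveloping algebra.
\<close>

lemma universal_enveloping_algebra_presentation:
  fixes K :: "('k, 'z) ring_scheme" and L :: "('k, 'v) module"
  assumes K: "field K"
    and L: "\<And>u v. u \<in> carrier L \<Longrightarrow> v \<in> carrier L \<Longrightarrow> u \<oplus>\<^bsub>L\<^esub> v \<in> carrier L"
      "\<And>c v. c \<in> carrier K \<Longrightarrow> v \<in> carrier L \<Longrightarrow> c \<odot>\<^bsub>L\<^esub> v \<in> carrier L"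
      "\<And>u v. u \<in> carrier L \<Longrightarrow> v \<in> carrier L \<Longrightarrow> u \<otimes>\<^bsub>L\<^esub> v \<in> carrier L"
  defines "U \<equiv> universal_enveloping_algebra K L"
  obtains \<kappa> t where "scalar_algebra K U \<kappa>" "t \<in> carrier L \<rightarrow> carrier U"
    "\<And>u v. u \<in> carrier L \<Longrightarrow> v \<in> carrier L \<Longrightarrow> t (u \<oplus>\<^bsub>L\<^esub> v) = t u \<oplus>\<^bsub>U\<^esub> t v"
    "\<And>c v. c \<in> carrier K \<Longrightarrow> v \<in> carrier L \<Longrightarrow> t (c \<odot>\<^bsub>L\<^esub> v) = \<kappa> c \<otimes>\<^bsub>U\<^esub> t v"
    "\<And>u v. u \<in> carrier L \<Longrightarrow> v \<in> carrier L \<Longrightarrow> t (u \<otimes>\<^bsub>L\<^esub> v) = t u \<otimes>\<^bsub>U\<^esub> t v \<ominus>\<^bsub>U\<^esub> t v \<otimes>\<^bsub>U\<^esub> t u"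
    "carrier U \<subseteq> add_span U {\<kappa> c \<otimes>\<^bsub>U\<^esub> foldr (\<lambda>v a. t v \<otimes>\<^bsub>U\<^esub> a) w \<one>\<^bsub>U\<^esub> | c w. c \<in> carrier K \<and> w \<in> lists (carrier L)}"
proof -
  interpret K: field K by fact
  define F where "F = free_algebra K (carrier L)"
  interpret F: scalar_algebra K F "free_scalar K" unfolding F_def by (rule K.free_scalar_algebra)
  have g: "free_generator K v \<in> carrier F" if "v \<in> carrier L" for v
    unfolding F_def by (rule K.free_generator_closed[OF that])
  define I where "I = tensor_algebra_ideal K L"
  let ?add = "{free_generator K (x \<oplus>\<^bsub>L\<^esub> y) \<ominus>\<^bsub>F\<^esub> (free_generator K x \<oplus>\<^bsub>F\<^esub> free_generator K y) | x y.
           x \<in> carrier L \<and> y \<in> carrier L}"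
  let ?smult = "{free_generator K (c \<odot>\<^bsub>L\<^esub> x) \<ominus>\<^bsub>F\<^esub> c \<odot>\<^bsub>F\<^esub> free_generator K x | c x.
           c \<in> carrier K \<and> x \<in> carrier L}"
  have I_eq: "I = Idl\<^bsub>F\<^esub> (?add \<union> ?smult)" by (simp add: I_def tensor_algebra_ideal_def Let_def F_def)
  have rel: "?add \<union> ?smult \<subseteq> carrier F"
    using g L(1,2) F.smult_by_scalar by fastforce
  have I: "ideal I F" unfolding I_eq by (rule F.A.genideal_ideal[OF rel])
  have mem: "?add \<union> ?smult \<subseteq> I" unfolding I_eq by (rule F.A.genideal_self[OF rel])
  define T where "T = tensor_algebra K L"
  have T_eq: "T = quotient_algebra F I" by (simp add: T_def tensor_algebra_def F_def I_def)
  note q = F.quotient_scalar_algebra[OF I, folded T_eq]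
  interpret T: scalar_algebra K T "\<lambda>c. I +>\<^bsub>F\<^esub> free_scalar K c" by (rule q(1))
  let ?t = "\<lambda>v. I +>\<^bsub>F\<^esub> free_generator K v"
  have tc: "?t v \<in> carrier T" if "v \<in> carrier L" for v using ring_hom_closed[OF q(2) g[OF that]] .
  have t_add: "?t (u \<oplus>\<^bsub>L\<^esub> v) = ?t u \<oplus>\<^bsub>T\<^esub> ?t v" if "u \<in> carrier L" "v \<in> carrier L" for u v
  proof -
    have "free_generator K (u \<oplus>\<^bsub>L\<^esub> v) \<ominus>\<^bsub>F\<^esub> (free_generator K u \<oplus>\<^bsub>F\<^esub> free_generator K v) \<in> I" using mem that by blast
    then have "?t (u \<oplus>\<^bsub>L\<^esub> v) = I +>\<^bsub>F\<^esub> (free_generator K u \<oplus>\<^bsub>F\<^esub> free_generator K v)"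
      using that L(1) g by (subst F.A.quotient_eq_iff_same_a_r_cos[OF I, symmetric]) auto
    then show ?thesis using ring_hom_add[OF q(2) g[OF that(1)] g[OF that(2)]] by simp
  qed
  have t_smult: "?t (c \<odot>\<^bsub>L\<^esub> v) = (I +>\<^bsub>F\<^esub> free_scalar K c) \<otimes>\<^bsub>T\<^esub> ?t v" if "c \<in> carrier K" "v \<in> carrier L" for c v
  proof -
    have "free_generator K (c \<odot>\<^bsub>L\<^esub> v) \<ominus>\<^bsub>F\<^esub> c \<odot>\<^bsub>F\<^esub> free_generator K v \<in> I" using mem that by blast
    then have "?t (c \<odot>\<^bsub>L\<^esub> v) = I +>\<^bsub>F\<^esub> (free_scalar K c \<otimes>\<^bsub>F\<^esub> free_generator K v)"
      using that L(2) g by (subst F.A.quotient_eq_iff_same_a_r_cos[OF I, symmetric]) (auto simp: F.smult_by_scalar)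
    then show ?thesis using ring_hom_mult[OF q(2) F.scalars_closed[OF that(1)] g[OF that(2)]] by simp
  qed
  let ?com = "{(?t x \<otimes>\<^bsub>T\<^esub> ?t y \<ominus>\<^bsub>T\<^esub> ?t y \<otimes>\<^bsub>T\<^esub> ?t x) \<ominus>\<^bsub>T\<^esub> ?t (x \<otimes>\<^bsub>L\<^esub> y) | x y. x \<in> carrier L \<and> y \<in> carrier L}"
  define J where "J = Idl\<^bsub>T\<^esub> ?com"
  have relJ: "?com \<subseteq> carrier T" using tc L(3) by fastforce
  have J: "ideal J T" unfolding J_def by (rule T.A.genideal_ideal[OF relJ])
  have memJ: "?com \<subseteq> J" unfolding J_def by (rule T.A.genideal_self[OF relJ])
  have U_eq: "U = quotient_algebra T J"
    by (simp add: U_def universal_enveloping_algebra_def Let_def T_def J_def tensor_generator_def[abs_def] F_def I_def)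
  note p = T.quotient_scalar_algebra[OF J, folded U_eq]
  interpret U: scalar_algebra K U "\<lambda>c. J +>\<^bsub>T\<^esub> (I +>\<^bsub>F\<^esub> free_scalar K c)" by (rule p(1))
  have pm: "J +>\<^bsub>T\<^esub> (a \<otimes>\<^bsub>T\<^esub> b) = (J +>\<^bsub>T\<^esub> a) \<otimes>\<^bsub>U\<^esub> (J +>\<^bsub>T\<^esub> b)" if "a \<in> carrier T" "b \<in> carrier T" for a b
    using ring_hom_mult[OF p(2) that] .
  show ?thesis
  proof (rule that[of "\<lambda>c. J +>\<^bsub>T\<^esub> (I +>\<^bsub>F\<^esub> free_scalar K c)" "\<lambda>v. J +>\<^bsub>T\<^esub> ?t v"])
    show "scalar_algebra K U (\<lambda>c. J +>\<^bsub>T\<^esub> (I +>\<^bsub>F\<^esub> free_scalar K c))" by (rule p(1))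
    show "(\<lambda>v. J +>\<^bsub>T\<^esub> ?t v) \<in> carrier L \<rightarrow> carrier U" using tc ring_hom_closed[OF p(2)] by blast
    show "J +>\<^bsub>T\<^esub> ?t (u \<oplus>\<^bsub>L\<^esub> v) = (J +>\<^bsub>T\<^esub> ?t u) \<oplus>\<^bsub>U\<^esub> (J +>\<^bsub>T\<^esub> ?t v)" if "u \<in> carrier L" "v \<in> carrier L" for u v
      unfolding t_add[OF that] using ring_hom_add[OF p(2)] tc that by blast
    show "J +>\<^bsub>T\<^esub> ?t (c \<odot>\<^bsub>L\<^esub> v) = (J +>\<^bsub>T\<^esub> (I +>\<^bsub>F\<^esub> free_scalar K c)) \<otimes>\<^bsub>U\<^esub> (J +>\<^bsub>T\<^esub> ?t v)"
      if "c \<in> carrier K" "v \<in> carrier L" for c v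
      unfolding t_smult[OF that] by (rule pm[OF T.scalars_closed[OF that(1)] tc[OF that(2)]])
    show "J +>\<^bsub>T\<^esub> ?t (u \<otimes>\<^bsub>L\<^esub> v) = (J +>\<^bsub>T\<^esub> ?t u) \<otimes>\<^bsub>U\<^esub> (J +>\<^bsub>T\<^esub> ?t v) \<ominus>\<^bsub>U\<^esub> (J +>\<^bsub>T\<^esub> ?t v) \<otimes>\<^bsub>U\<^esub> (J +>\<^bsub>T\<^esub> ?t u)"
      if u: "u \<in> carrier L" and v: "v \<in> carrier L" for u v
    proof -
      let ?c = "?t u \<otimes>\<^bsub>T\<^esub> ?t v \<ominus>\<^bsub>T\<^esub> ?t v \<otimes>\<^bsub>T\<^esub> ?t u"
      have "?c \<ominus>\<^bsub>T\<^esub> ?t (u \<otimes>\<^bsub>L\<^esub> v) \<in> J" using memJ u v by blast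
      then have "J +>\<^bsub>T\<^esub> ?c = J +>\<^bsub>T\<^esub> ?t (u \<otimes>\<^bsub>L\<^esub> v)"
        using tc u v L(3) by (subst T.A.quotient_eq_iff_same_a_r_cos[OF J, symmetric]) auto
      moreover have "J +>\<^bsub>T\<^esub> ?c = (J +>\<^bsub>T\<^esub> (?t u \<otimes>\<^bsub>T\<^esub> ?t v)) \<ominus>\<^bsub>U\<^esub> (J +>\<^bsub>T\<^esub> (?t v \<otimes>\<^bsub>T\<^esub> ?t u))"
        by (rule additive_map_facts(3)[OF T.A.abelian_group_axioms U.A.abelian_group_axioms])
          (use ring_hom_closed[OF p(2)] ring_hom_add[OF p(2)] tc u v in auto)
      ultimately show ?thesis using tc u v by (simp add: pm)
    qed
    have hom: "(\<lambda>f. J +>\<^bsub>T\<^esub> (I +>\<^bsub>F\<^esub> f)) \<in> ring_hom F U"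
      using ring_hom_trans[OF q(2) p(2)] by (simp add: o_def)
    show "carrier U \<subseteq> add_span U {(J +>\<^bsub>T\<^esub> (I +>\<^bsub>F\<^esub> free_scalar K c)) \<otimes>\<^bsub>U\<^esub> foldr (\<lambda>v a. (J +>\<^bsub>T\<^esub> ?t v) \<otimes>\<^bsub>U\<^esub> a) w \<one>\<^bsub>U\<^esub> | c w.
        c \<in> carrier K \<and> w \<in> lists (carrier L)}"
    proof (rule ring_hom_words[OF hom F.A.ring_axioms U.A.ring_axioms])
      show "carrier U \<subseteq> (\<lambda>f. J +>\<^bsub>T\<^esub> (I +>\<^bsub>F\<^esub> f)) ` carrier F" unfolding p(3) q(3) by blast
      show "carrier F \<subseteq> add_span F {free_scalar K c \<otimes>\<^bsub>F\<^esub> foldr (\<lambda>s a. free_generator K s \<otimes>\<^bsub>F\<^esub> a) w \<one>\<^bsub>F\<^esub> | c w.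
          c \<in> carrier K \<and> w \<in> lists (carrier L)}"
        unfolding F_def using K.free_algebra_spanned by blast
    qed (use g in auto)
  qed
qed

lemma (in tensor_base_change) universal_enveloping_algebra_generators:
  assumes abs: "nonarch_absolute_value K abs_K" and free: "finite_free R L"
  shows "\<exists>d \<kappa> x. commutator_algebra_with_scalars K abs_K (universal_enveloping_algebra K V) d \<kappa> x"
proof -
  let ?U = "universal_enveloping_algebra K V"
  obtain \<kappa> t where U: "scalar_algebra K ?U \<kappa>" and t: "t \<in> carrier V \<rightarrow> carrier ?U"
    "\<And>u v. u \<in> carrier V \<Longrightarrow> v \<in> carrier V \<Longrightarrow> t (u \<oplus>\<^bsub>V\<^esub> v) = t u \<oplus>\<^bsub>?U\<^esub> t v"
    "\<And>c v. c \<in> carrier K \<Longrightarrow> v \<in> carrier V \<Longrightarrow> t (c \<odot>\<^bsub>V\<^esub> v) = \<kappa> c \<otimes>\<^bsub>?U\<^esub> t v"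
    and bracket: "\<And>u v. u \<in> carrier V \<Longrightarrow> v \<in> carrier V \<Longrightarrow> t (u \<otimes>\<^bsub>V\<^esub> v) = t u \<otimes>\<^bsub>?U\<^esub> t v \<ominus>\<^bsub>?U\<^esub> t v \<otimes>\<^bsub>?U\<^esub> t u"
    and span: "carrier ?U \<subseteq> add_span ?U {\<kappa> c \<otimes>\<^bsub>?U\<^esub> foldr (\<lambda>v a. t v \<otimes>\<^bsub>?U\<^esub> a) w \<one>\<^bsub>?U\<^esub> | c w.
      c \<in> carrier K \<and> w \<in> lists (carrier V)}"
    by (rule universal_enveloping_algebra_presentation[OF K.field_axioms, of V])
      (erule (1) base_change_add_closed base_change_smult_closed base_change_bracket_closed | rule that; simp)+
  interpret U: scalar_algebra K ?U \<kappa> by fact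
  obtain B where basis: "finite B \<and> B \<subseteq> carrier L \<and>
      (\<forall>l\<in>carrier L. \<exists>!c. c \<in> B \<rightarrow>\<^sub>E carrier R \<and> l = (\<Oplus>\<^bsub>L\<^esub>b\<in>B. c b \<odot>\<^bsub>L\<^esub> b))"
    using free unfolding finite_free_def by (elim exE)
  then have B: "finite B" "B \<subseteq> carrier L" by simp_all
  have gen: "\<exists>r\<in>B \<rightarrow> carrier R. l = (\<Oplus>\<^bsub>L\<^esub>b\<in>B. r b \<odot>\<^bsub>L\<^esub> b)" if "l \<in> carrier L" for l
  proof -
    have "\<exists>!c. c \<in> B \<rightarrow>\<^sub>E carrier R \<and> l = (\<Oplus>\<^bsub>L\<^esub>b\<in>B. c b \<odot>\<^bsub>L\<^esub> b)" using basis that by simp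
    then obtain c where "c \<in> B \<rightarrow>\<^sub>E carrier R" "l = (\<Oplus>\<^bsub>L\<^esub>b\<in>B. c b \<odot>\<^bsub>L\<^esub> b)" by (elim ex1E conjE)
    then show ?thesis by (intro bexI[of _ c]) (simp_all add: PiE_def)
  qed
  obtain b :: "nat \<Rightarrow> 'g" where b: "bij_betw b {..<card B} B"
    using ex_bij_betw_nat_finite[OF B(1)] by (auto simp: atLeast0LessThan)
  let ?d = "card B" and ?v = "\<lambda>k. cl (frag_of (b k, \<one>\<^bsub>K\<^esub>))"
  have v: "?v k \<in> carrier V" if "k < ?d" for k
    using B(2) bij_betwE[OF b] that by (intro cl_closed) auto
  have tx: "t (?v k) \<in> carrier ?U" if "k < ?d" for k using t(1) v[OF that] by blast
  have tspan: "t u \<in> add_span ?U {\<kappa> c \<otimes>\<^bsub>?U\<^esub> t (?v k) | c k. c \<in> carrier K \<and> k < ?d}" if u: "u \<in> carrier V" for u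
  proof -
    have "{\<kappa> c \<otimes>\<^bsub>?U\<^esub> t (cl (frag_of (e, \<one>\<^bsub>K\<^esub>))) | c e. c \<in> carrier K \<and> e \<in> B} \<subseteq>
        {\<kappa> c \<otimes>\<^bsub>?U\<^esub> t (?v k) | c k. c \<in> carrier K \<and> k < ?d}"
    proof
      fix a assume "a \<in> {\<kappa> c \<otimes>\<^bsub>?U\<^esub> t (cl (frag_of (e, \<one>\<^bsub>K\<^esub>))) | c e. c \<in> carrier K \<and> e \<in> B}"
      then obtain c e where a: "a = \<kappa> c \<otimes>\<^bsub>?U\<^esub> t (cl (frag_of (e, \<one>\<^bsub>K\<^esub>)))" "c \<in> carrier K" "e \<in> B" by blast
      have "e \<in> b ` {..<?d}" using a(3) bij_betw_imp_surj_on[OF b] by simp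
      then obtain k where "e = b k" "k < ?d" by auto
      then show "a \<in> {\<kappa> c \<otimes>\<^bsub>?U\<^esub> t (?v k) | c k. c \<in> carrier K \<and> k < ?d}" using a by blast
    qed
    moreover have "t u \<in> add_span ?U {\<kappa> c \<otimes>\<^bsub>?U\<^esub> t (cl (frag_of (e, \<one>\<^bsub>K\<^esub>))) | c e. c \<in> carrier K \<and> e \<in> B}"
      by (rule linear_image_spanned[OF U.A.ring_axioms U.scalars_hom t B gen u])
    ultimately show ?thesis using add_span_mono by blast
  qed
  have "commutator_algebra_with_scalars K abs_K ?U ?d \<kappa> (\<lambda>k. t (?v k))"
  proof (intro commutator_algebra_with_scalars.intro commutator_algebra.intro commutator_algebra_axioms.intro
      commutator_algebra_with_scalars_axioms.intro abs U.A.ring_axioms U.scalars_hom)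
    fix i j assume ij: "i < ?d" "j < ?d"
    show "t (?v i) \<otimes>\<^bsub>?U\<^esub> t (?v j) \<ominus>\<^bsub>?U\<^esub> t (?v j) \<otimes>\<^bsub>?U\<^esub> t (?v i) \<in>
        add_span ?U {\<kappa> c \<otimes>\<^bsub>?U\<^esub> t (?v k) | c k. c \<in> carrier K \<and> k < ?d}"
      using tspan[OF base_change_bracket_closed[OF v[OF ij(1)] v[OF ij(2)]]] bracket[OF v[OF ij(1)] v[OF ij(2)]] by simp
  next
    show "carrier ?U \<subseteq> add_span ?U {\<kappa> c \<otimes>\<^bsub>?U\<^esub> foldr (\<lambda>k a. t (?v k) \<otimes>\<^bsub>?U\<^esub> a) w \<one>\<^bsub>?U\<^esub> | c w.
        c \<in> carrier K \<and> w \<in> lists {..<?d}}"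
      by (rule U.spanned_by_words[OF tx tspan span])
  qed (use tx U.scalars_central U.smult_by_scalar in auto)
  then show ?thesis by blast
qed

theorem theorem3p13:
  fixes R :: "'r ring" and K :: "'k ring" and \<iota> :: "'r \<Rightarrow> 'k" and abs_K :: "'k \<Rightarrow> real"
    and \<gg> :: "('r, 'g) module"
  assumes "complete_discrete_valuation_ring R"
    and "valued_fraction_field R K \<iota> abs_K"
    and "lie_algebra R \<gg>"
    and "finite_free R \<gg>"
  shows "faithfully_flat_hom TYPE('n)
           (universal_enveloping_algebra K (base_change R K \<iota> \<gg>))
           (arens_michael K abs_K (universal_enveloping_algebra K (base_change R K \<iota> \<gg>)))
           (arens_michael_map K abs_K (universal_enveloping_algebra K (base_change R K \<iota> \<gg>)))"
proof -
  interpret K: valued_fraction_field R K \<iota> abs_K by fact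
  interpret V: tensor_base_change R K \<iota> \<gg>
    using assms(3) K.fraction_field_axioms by (simp add: tensor_base_change_def)
  obtain d \<kappa> x where
    "commutator_algebra_with_scalars K abs_K (universal_enveloping_algebra K (base_change R K \<iota> \<gg>)) d \<kappa> x"
    using V.universal_enveloping_algebra_generators[OF K.nonarch_absolute_value_axioms assms(4)] by blast
  then show ?thesis by (rule commutator_algebra_with_scalars.envelope_faithfully_flat)
qed

end
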